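(* There exists a codimension two entire graph $M_0=\{(p,f(p)):p\in\mathbb{R}^2\}\subset\mathbb{R}^4$, with $f:\mathbb{R}^2\to\mathbb{R}^2$ smooth, which has flat normal bundle, bounded slope, bounded geometry, and the uniformly area decreasing property. The corresponding smooth graphical mean curvature flow $(M_t)_{t\ge0}$ starting from $M_0$ exists uniquely for all time and preserves all of these properties except the flatness of the normal bundle. More precisely, the normal bundle of $M_t$ is not flat for all sufficiently small $t>0$.
   Context: For an immersion $F:M^m\to\mathbb{R}^n$ with induced metric $g$, the normal connection is $\nabla^\perp_X\nu=(D_X\nu)^\perp$, where $D$ is the Euclidean connection. Its curvature is $R^\perp(X,Y)\nu=\nabla^\perp_X\nabla^\perp_Y\nu-\nabla^\perp_Y\nabla^\perp_X\nu-\nabla^\perp_{[X,Y]}\nu$. The normal bundle is flat if $R^\perp\equiv0$. The second fundamental form is $A(X,Y)=(D_XY)^\perp$ and the mean curvature vector is $H=\mathrm{tr}_gA$. A mean curvature flow is a smooth family of immersions $F_t=F(\cdot,t)$ with $\frac{dF}{dt}=H$. It is graphical if each $M_t=F_t(M)$ is the graph of a smooth map $f_t:\mathbb{R}^2\to\mathbb{R}^2$ (an entire graph). For the graph of $f:\mathbb{R}^2\to\mathbb{R}^2$: - The slope function is $v=\sqrt{\det(I+{}^t(df)\,df)}$. The graph has bounded slope if $\sup_{\mathbb{R}^2} v<\infty$. - The graph has bounded geometry if $\sup|\nabla^\ell A|<\infty$ for every integer $\ell\ge0$. - Let $\lambda,\mu\ge0$ be the singular values of $df$ at a point and set $\mathsf{p}=\dfrac{1-\lambda^2\mu^2}{(1+\lambda^2)(1+\mu^2)}$.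 The graph is uniformly area decreasing if there is $\varepsilon>0$ with $\mathsf{p}\ge\varepsilon$ everywhere. *)

theory Defs
  imports "HOL-Analysis.Analysis"
begin

text \<open>
  Smoothness on a set \<open>S\<close> uses derivatives relative to \<open>S\<close>, so that it includes smoothness up to the
  boundary. It is only used for sets on which such derivatives are unique: the whole space, and
  \<open>I \<times> UNIV\<close> with \<open>I\<close> a nondegenerate interval of times.
\<close>

primrec Ck_on :: "nat \<Rightarrow> 'a::euclidean_space set \<Rightarrow> ('a \<Rightarrow> 'b::real_normed_vector) \<Rightarrow> bool" where
  "Ck_on 0 S f \<longleftrightarrow> continuous_on S f"
| "Ck_on (Suc k) S f \<longleftrightarrow> f differentiable_on S \<and>
     (\<forall>b\<in>Basis. Ck_on k S (\<lambda>x. frechet_derivative f (at x within S) b))"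

definition smooth_on :: "'a::euclidean_space set \<Rightarrow> ('a \<Rightarrow> 'b::real_normed_vector) \<Rightarrow> bool" where
  "smooth_on S f \<longleftrightarrow> (\<forall>k. Ck_on k S f)"


section \<open>Immersions of \<open>\<real>\<^sup>m\<close> into a Euclidean space\<close>

text \<open>
  Tangent vector fields of the parameter manifold \<open>M = \<real>\<^sup>m\<close> are functions of type
  \<open>real^'m \<Rightarrow> real^'m\<close>; fields along \<open>F\<close> are functions of type \<open>real^'m \<Rightarrow> 'b\<close>.
\<close>

definition immersion :: "(real^'m \<Rightarrow> 'b::euclidean_space) \<Rightarrow> bool" where
  "immersion F \<longleftrightarrow> smooth_on UNIV F \<and> (\<forall>p. inj (frechet_derivative F (at p)))"

definition induced_metric :: "(real^'m \<Rightarrow> 'b::euclidean_space) \<Rightarrow> real^'m \<Rightarrow> real^'m^'m" where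
  "induced_metric F p = (\<chi> i j. frechet_derivative F (at p) (axis i 1) \<bullet>
                                frechet_derivative F (at p) (axis j 1))"

definition tangent_space :: "(real^'m \<Rightarrow> 'b::euclidean_space) \<Rightarrow> real^'m \<Rightarrow> 'b set" where
  "tangent_space F p = range (frechet_derivative F (at p))"

definition normal_space :: "(real^'m \<Rightarrow> 'b::euclidean_space) \<Rightarrow> real^'m \<Rightarrow> 'b set" where
  "normal_space F p = orthogonal_comp (tangent_space F p)"

definition normal_part :: "(real^'m \<Rightarrow> 'b::euclidean_space) \<Rightarrow> real^'m \<Rightarrow> 'b \<Rightarrow> 'b" where
  "normal_part F p w = (THE z. z \<in> normal_space F p \<and> w - z \<in> tangent_space F p)"

definition euclidean_connection ::
    "(real^'m \<Rightarrow> real^'m) \<Rightarrow> (real^'m \<Rightarrow> 'b::euclidean_space) \<Rightarrow> real^'m \<Rightarrow> 'b" where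
  "euclidean_connection X V p = frechet_derivative V (at p) (X p)"

definition pushforward ::
    "(real^'m \<Rightarrow> 'b::euclidean_space) \<Rightarrow> (real^'m \<Rightarrow> real^'m) \<Rightarrow> real^'m \<Rightarrow> 'b" where
  "pushforward F X p = frechet_derivative F (at p) (X p)"

definition second_fundamental_form ::
    "(real^'m \<Rightarrow> 'b::euclidean_space) \<Rightarrow> (real^'m \<Rightarrow> real^'m) \<Rightarrow> (real^'m \<Rightarrow> real^'m) \<Rightarrow>
     real^'m \<Rightarrow> 'b" where
  "second_fundamental_form F X Y p =
     normal_part F p (euclidean_connection X (pushforward F Y) p)"

definition mean_curvature :: "(real^'m \<Rightarrow> 'b::euclidean_space) \<Rightarrow> real^'m \<Rightarrow> 'b" where
  "mean_curvature F p =
     (\<Sum>i\<in>UNIV. \<Sum>j\<in>UNIV. (matrix_inv (induced_metric F p) $ i $ j) *\<^sub>R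
        second_fundamental_form F (\<lambda>_. axis i 1) (\<lambda>_. axis j 1) p)"


section \<open>Normal connection and normal curvature\<close>

definition normal_connection ::
    "(real^'m \<Rightarrow> 'b::euclidean_space) \<Rightarrow> (real^'m \<Rightarrow> real^'m) \<Rightarrow> (real^'m \<Rightarrow> 'b) \<Rightarrow>
     real^'m \<Rightarrow> 'b" where
  "normal_connection F X \<nu> p = normal_part F p (euclidean_connection X \<nu> p)"

definition lie_bracket ::
    "(real^'m \<Rightarrow> real^'m) \<Rightarrow> (real^'m \<Rightarrow> real^'m) \<Rightarrow> real^'m \<Rightarrow> real^'m" where
  "lie_bracket X Y p = euclidean_connection X Y p - euclidean_connection Y X p"

definition normal_curvature ::
    "(real^'m \<Rightarrow> 'b::euclidean_space) \<Rightarrow> (real^'m \<Rightarrow> real^'m) \<Rightarrow> (real^'m \<Rightarrow> real^'m) \<Rightarrow>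
     (real^'m \<Rightarrow> 'b) \<Rightarrow> real^'m \<Rightarrow> 'b" where
  "normal_curvature F X Y \<nu> p =
     normal_connection F X (normal_connection F Y \<nu>) p
     - normal_connection F Y (normal_connection F X \<nu>) p
     - normal_connection F (lie_bracket X Y) \<nu> p"

definition flat_normal_bundle :: "(real^'m \<Rightarrow> 'b::euclidean_space) \<Rightarrow> bool" where
  "flat_normal_bundle F \<longleftrightarrow>
     (\<forall>X Y \<nu>. smooth_on UNIV X \<longrightarrow> smooth_on UNIV Y \<longrightarrow>
        smooth_on UNIV \<nu> \<longrightarrow> (\<forall>p. \<nu> p \<in> normal_space F p) \<longrightarrow>
        (\<forall>p. normal_curvature F X Y \<nu> p = 0))"


section \<open>Covariant derivatives of the second fundamental form\<close>

text \<open>The Levi-Civita connection of the induced metric, by the Gauss formula.\<close>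

definition levi_civita ::
    "(real^'m \<Rightarrow> 'b::euclidean_space) \<Rightarrow> (real^'m \<Rightarrow> real^'m) \<Rightarrow> (real^'m \<Rightarrow> real^'m) \<Rightarrow>
     real^'m \<Rightarrow> real^'m" where
  "levi_civita F X Y p =
     (THE w. frechet_derivative F (at p) w =
        euclidean_connection X (pushforward F Y) p - second_fundamental_form F X Y p)"

text \<open>
  A normal-bundle valued covariant \<open>k\<close>-tensor is a function of a list of \<open>k\<close> vector fields. Its
  covariant derivative takes the direction of differentiation as the additional first argument:
  \<open>(\<nabla>T)(X, X\<^sub>1, \<dots>, X\<^sub>k) = \<nabla>\<^sup>\<bottom>\<^sub>X (T(X\<^sub>1, \<dots>, X\<^sub>k)) - (\<Sum>i. T(X\<^sub>1, \<dots>, \<nabla>\<^sub>X X\<^sub>i, \<dots>, X\<^sub>k))\<close>.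
\<close>

definition covariant_derivative ::
    "(real^'m \<Rightarrow> 'b::euclidean_space) \<Rightarrow>
     ((real^'m \<Rightarrow> real^'m) list \<Rightarrow> real^'m \<Rightarrow> 'b) \<Rightarrow>
     ((real^'m \<Rightarrow> real^'m) list \<Rightarrow> real^'m \<Rightarrow> 'b)" where
  "covariant_derivative F T Xs p =
     (let X = hd Xs; Ys = tl Xs in
        normal_connection F X (T Ys) p
        - (\<Sum>i<length Ys. T (Ys[i := levi_civita F X (Ys ! i)]) p))"

definition nabla_A ::
    "(real^'m \<Rightarrow> 'b::euclidean_space) \<Rightarrow> nat \<Rightarrow>
     ((real^'m \<Rightarrow> real^'m) list \<Rightarrow> real^'m \<Rightarrow> 'b)" where
  "nabla_A F l = (covariant_derivative F ^^ l)
     (\<lambda>Xs. second_fundamental_form F (Xs ! 0) (Xs ! 1))"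

text \<open>
  Norm of a \<open>k\<close>-tensor with respect to the induced metric: the square root of
  \<open>g\<^sup>i\<^sup>1\<^sup>j\<^sup>1 \<dots> g\<^sup>i\<^sup>k\<^sup>j\<^sup>k \<langle>T(\<partial>\<^sub>i\<^sub>1, \<dots>, \<partial>\<^sub>i\<^sub>k), T(\<partial>\<^sub>j\<^sub>1, \<dots>, \<partial>\<^sub>j\<^sub>k)\<rangle>\<close>.
\<close>

definition tensor_norm ::
    "(real^'m \<Rightarrow> 'b::euclidean_space) \<Rightarrow> nat \<Rightarrow>
     ((real^'m \<Rightarrow> real^'m) list \<Rightarrow> real^'m \<Rightarrow> 'b) \<Rightarrow> real^'m \<Rightarrow> real" where
  "tensor_norm F k T p =
     sqrt (\<Sum>I\<in>{I :: 'm list. length I = k}. \<Sum>J\<in>{J :: 'm list. length J = k}.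
        (\<Prod>r<k. matrix_inv (induced_metric F p) $ (I ! r) $ (J ! r)) *
        (T (map (\<lambda>i _. axis i 1) I) p \<bullet> T (map (\<lambda>j _. axis j 1) J) p))"

definition bounded_geometry :: "(real^'m \<Rightarrow> 'b::euclidean_space) \<Rightarrow> bool" where
  "bounded_geometry F \<longleftrightarrow> (\<forall>l. bdd_above (range (tensor_norm F (l + 2) (nabla_A F l))))"


section \<open>Entire graphs\<close>

text \<open>
  \<open>\<real>\<^sup>4\<close> is rendered as \<open>(real^2) \<times> (real^2)\<close>, whose inner product is the standard one.
\<close>

definition graph_immersion :: "(real^2 \<Rightarrow> real^2) \<Rightarrow> real^2 \<Rightarrow> (real^2) \<times> (real^2)" where
  "graph_immersion f p = (p, f p)"

definition entire_graph :: "(real^2 \<Rightarrow> real^2) \<Rightarrow> ((real^2) \<times> (real^2)) set" where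
  "entire_graph f = {(p, f p) | p. True}"

definition differential_matrix :: "(real^2 \<Rightarrow> real^2) \<Rightarrow> real^2 \<Rightarrow> real^2^2" where
  "differential_matrix f p = matrix (frechet_derivative f (at p))"

definition slope :: "(real^2 \<Rightarrow> real^2) \<Rightarrow> real^2 \<Rightarrow> real" where
  "slope f p =
     sqrt (det (mat 1 + transpose (differential_matrix f p) ** differential_matrix f p))"

definition bounded_slope :: "(real^2 \<Rightarrow> real^2) \<Rightarrow> bool" where
  "bounded_slope f \<longleftrightarrow> bdd_above (range (slope f))"

text \<open>
  Singular values: \<open>a\<^sup>2\<close> and \<open>b\<^sup>2\<close> are the eigenvalues of \<open>\<^sup>tM M\<close>, counted with multiplicity, i.e. the
  roots of its characteristic polynomial.
\<close>

definition singular_values :: "real^2^2 \<Rightarrow> real \<Rightarrow> real \<Rightarrow> bool" where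
  "singular_values M a b \<longleftrightarrow> 0 \<le> a \<and> 0 \<le> b \<and>
     (\<forall>x. det (x *\<^sub>R mat 1 - transpose M ** M) = (x - a\<^sup>2) * (x - b\<^sup>2))"

definition uniformly_area_decreasing :: "(real^2 \<Rightarrow> real^2) \<Rightarrow> bool" where
  "uniformly_area_decreasing f \<longleftrightarrow>
     (\<exists>\<epsilon>>0. \<forall>p. \<exists>a b. singular_values (differential_matrix f p) a b \<and>
        (1 - a\<^sup>2 * b\<^sup>2) / ((1 + a\<^sup>2) * (1 + b\<^sup>2)) \<ge> \<epsilon>)"


section \<open>Graphical mean curvature flow\<close>

definition mean_curvature_flow ::
    "real set \<Rightarrow> (real \<Rightarrow> real^'m \<Rightarrow> 'b::euclidean_space) \<Rightarrow> bool" where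
  "mean_curvature_flow I F \<longleftrightarrow>
     smooth_on (I \<times> UNIV) (\<lambda>(t, p). F t p) \<and>
     (\<forall>t\<in>I. immersion (F t)) \<and>
     (\<forall>t\<in>I. \<forall>p. ((\<lambda>s. F s p) has_vector_derivative mean_curvature (F t) p) (at t within I))"

definition graphical_mean_curvature_flow ::
    "real set \<Rightarrow> (real \<Rightarrow> real^2 \<Rightarrow> (real^2) \<times> (real^2)) \<Rightarrow> bool" where
  "graphical_mean_curvature_flow I F \<longleftrightarrow> mean_curvature_flow I F \<and>
     (\<forall>t\<in>I. \<exists>h. smooth_on UNIV h \<and> range (F t) = entire_graph h)"

end

theory Submission
  imports Defs
begin

text \<open>
  The example is a helicoidal graph \<open>f (x, y) = u x *\<^sub>R (cos y, sin y)\<close>. In the natural orthonormal normal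
  frame the connection form is \<open>W\<^sup>-\<^sup>1\<^sup>/\<^sup>2 dy\<close> with \<open>W = (1 + u'\<^sup>2) (1 + u\<^sup>2)\<close>, so that the normal bundle is flat iff
  \<open>W\<close> is constant. The initial profile solves \<open>W = 1 + eps\<^sup>2\<close> with a small nonzero amplitude \<open>eps\<close>; it is
  periodic, and periodicity bounds the geometry.

  Helicoidal symmetry reduces mean curvature flow to \<open>u\<^sub>t = u\<^sub>x\<^sub>x / (1 + u\<^sub>x\<^sup>2) - u / (1 + u\<^sup>2)\<close>. For small data
  a contraction on weighted Fourier coefficients gives a global solution, small together with \<open>u\<^sub>x\<close>. At \<open>t = 0\<close> the
  derivative \<open>W\<^sub>t\<close> takes different values at a zero and at a maximum of the profile, so \<open>W\<close> is not constant
  for small \<open>t > 0\<close>.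

  For uniqueness among all graphical flows, the maximum principle is applied to a function of the vertical
  distance \<open>w\<close> to the symmetric solution, namely \<open>sqrt (1 + \<bar>w\<bar>\<^sup>2) - 1\<close> with exponential weight in time and a
  barrier at infinity. No slope bound on the competing flow is needed: the Hessian of \<open>sqrt (1 + \<bar>w\<bar>\<^sup>2)\<close>
  controls the squared relative slope of the two graphs, which absorbs the difference between the two
  traces of the second derivative of the symmetric solution.
\<close>

section \<open>Smooth functions\<close>

text \<open>Helicoidal graphs are invariant under the screw motions that translate y and rotate the
  values, so all scalar geometric quantities depend on x alone. Constancy of \<open>W\<close> is a
  first-order equation for the initial profile, solved by inverting an elliptic integral. The
  variable \<phi> with dx/d\<phi> = sqrt (1 + eps^2 sin^2 \<phi>) turns the solution into eps sin
  \<phi>, a single Fourier mode, at the price of explicit trigonometric coefficients in the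
  equation. The equation is quasilinear: its nonlinearity contains the second space derivative, so
  the heat semigroup must give back two derivatives without loss. In a weighted supremum over modes
  and times this maximal regularity is elementary, since each mode obeys a scalar linear equation
  whose solution operator, multiplied by the eigenvalue, has norm at most 1. For uniqueness, a
  competing flow is a family of parametrized surfaces, each an entire graph, with no control at
  infinity. The maximum is therefore sought over base points of the graphs instead of parameters,
  and joint continuity of the graph functions in time and space has to be derived from that of the
  parametrizations.\<close>

definition approachable :: "'a::euclidean_space set \<Rightarrow> bool" where
  "approachable S \<longleftrightarrow> (\<forall>x\<in>S. \<forall>i\<in>Basis. \<forall>e>0. \<exists>d. 0 < \<bar>d\<bar> \<and> \<bar>d\<bar> < e \<and> x + d *\<^sub>R i \<in> S)"

lemma approachable_UNIV [simp]: "approachable UNIV"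
  unfolding approachable_def
proof (intro ballI allI impI)
  fix e :: real assume "e > 0"
  then have "0 < \<bar>e/2\<bar> \<and> \<bar>e/2\<bar> < e" by auto
  then show "\<exists>d. 0 < \<bar>d\<bar> \<and> \<bar>d\<bar> < e \<and> x + d *\<^sub>R i \<in> UNIV" for x i :: 'a by blast
qed

lemma approachable_Times_UNIV:
  assumes "approachable I" shows "approachable (I \<times> UNIV)"
  unfolding approachable_def
proof (intro ballI allI impI)
  fix z :: "'a \<times> 'b" and i :: "'a \<times> 'b" and e :: real
  assume z: "z \<in> I \<times> UNIV" and i: "i \<in> Basis" and e: "e > 0"
  consider u where "u \<in> Basis" "i = (u, 0)" | u where "u \<in> Basis" "i = (0, u)"
    using i unfolding Basis_prod_def by auto
  then show "\<exists>d. 0 < \<bar>d\<bar> \<and> \<bar>d\<bar> < e \<and> z + d *\<^sub>R i \<in> I \<times> UNIV"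
  proof cases
    case 1
    have "fst z \<in> I" using z by (simp add: mem_Times_iff)
    then obtain d where "0 < \<bar>d\<bar>" "\<bar>d\<bar> < e" "fst z + d *\<^sub>R u \<in> I"
      using assms 1(1) e unfolding approachable_def by blast
    then show ?thesis by (intro exI[of _ d]) (simp add: mem_Times_iff 1(2))
  next
    case 2
    have "fst z \<in> I" using z by (simp add: mem_Times_iff)
    then show ?thesis using e by (intro exI[of _ "e/2"]) (simp add: mem_Times_iff 2(2))
  qed
qed

lemma approachable_atLeast [simp]: "approachable {0::real..}"
  unfolding approachable_def
proof (intro ballI allI impI)
  fix x i e :: real assume "x \<in> {0..}" "i \<in> Basis" "e > 0"
  then show "\<exists>d. 0 < \<bar>d\<bar> \<and> \<bar>d\<bar> < e \<and> x + d *\<^sub>R i \<in> {0..}"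
    by (intro exI[of _ "e/2"]) auto
qed

text \<open>If every point of \<open>S\<close> can be approached inside \<open>S\<close> along each
  axis, a derivative relative to \<open>S\<close> is unique, so the choice behind
  \<open>frechet_derivative\<close> returns the derivative at hand.\<close>

lemma frechet_derivative_within_eq:
  assumes "approachable S" "x \<in> S" "(f has_derivative D) (at x within S)"
  shows "frechet_derivative f (at x within S) = D"
proof -
  have "(f has_derivative frechet_derivative f (at x within S)) (at x within S)"
    using assms(3) differentiableI frechet_derivative_works by blast
  then show ?thesis
    using assms by (intro frechet_derivative_unique_within[of f _ x S])
      (auto simp: approachable_def)
qed

lemma frechet_derivative_within_cong:
  assumes "\<And>x. x \<in> S \<Longrightarrow> f x = g x" "x \<in> S"
  shows "frechet_derivative f (at x within S) = frechet_derivative g (at x within S)"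
proof -
  have "(f has_derivative D) (at x within S) \<longleftrightarrow> (g has_derivative D) (at x within S)" for D
    using assms has_derivative_transform[of x S f g D] has_derivative_transform[of x S g f D]
    by auto
  then show ?thesis unfolding frechet_derivative_def by simp
qed

lemma Ck_on_cong:
  assumes "\<And>x. x \<in> S \<Longrightarrow> f x = g x" "Ck_on k S f"
  shows "Ck_on k S g"
  using assms
proof (induction k arbitrary: f g)
  case 0
  then show ?case using continuous_on_cong[of S S f g] by simp
next
  case (Suc k)
  have "g differentiable_on S"
    using Suc.prems differentiable_transform_within[of f _ S 1 g]
    by (auto simp: differentiable_on_def)
  moreover have "Ck_on k S (\<lambda>x. frechet_derivative g (at x within S) b)" if "b \<in> Basis" for b
  proof (rule Suc.IH[of "\<lambda>x. frechet_derivative f (at x within S) b"])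
    show "frechet_derivative f (at x within S) b = frechet_derivative g (at x within S) b"
      if "x \<in> S" for x
      using frechet_derivative_within_cong[of S f g x] Suc.prems(1) that by simp
    show "Ck_on k S (\<lambda>x. frechet_derivative f (at x within S) b)"
      using Suc.prems \<open>b \<in> Basis\<close> by simp
  qed
  ultimately show ?case by simp
qed

lemma smooth_on_cong:
  assumes "\<And>x. x \<in> S \<Longrightarrow> f x = g x" "smooth_on S f"
  shows "smooth_on S g"
  using assms Ck_on_cong unfolding smooth_on_def by metis

text \<open>Smoothness is proved by exhibiting a class of functions that is closed under taking partial
  derivatives.\<close>

lemma smooth_on_closed_class:
  fixes C :: "('a::euclidean_space \<Rightarrow> 'b::real_normed_vector) set"
  assumes S: "approachable S"
    and C: "\<And>f. f \<in> C \<Longrightarrow> \<exists>D. (\<forall>x\<in>S. (f has_derivative D x) (at x within S)) \<and>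
               (\<forall>b\<in>Basis. \<exists>g\<in>C. \<forall>x\<in>S. g x = D x b)"
    and f: "f \<in> C"
  shows "smooth_on S f"
proof -
  have "Ck_on k S f" if "f \<in> C" for k f
    using that
  proof (induction k arbitrary: f)
    case 0
    then obtain D where "\<forall>x\<in>S. (f has_derivative D x) (at x within S)" using C by blast
    then show ?case by (auto intro: has_derivative_continuous_on)
  next
    case (Suc k)
    then obtain D where D: "\<forall>x\<in>S. (f has_derivative D x) (at x within S)"
      "\<forall>b\<in>Basis. \<exists>g\<in>C. \<forall>x\<in>S. g x = D x b" using C by blast
    have "f differentiable_on S" using D by (auto simp: differentiable_on_def differentiable_def)
    moreover have "Ck_on k S (\<lambda>x. frechet_derivative f (at x within S) b)" if b: "b \<in> Basis" for b
    proof -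
      obtain g where g: "g \<in> C" "\<forall>x\<in>S. g x = D x b" using D b by blast
      have "g x = frechet_derivative f (at x within S) b" if "x \<in> S" for x
        using frechet_derivative_within_eq[OF S that, of f "D x"] D(1) g(2) that by simp
      then show ?thesis by (rule Ck_on_cong[OF _ Suc.IH[OF g(1)]])
    qed
    ultimately show ?case by simp
  qed
  then show ?thesis using f by (simp add: smooth_on_def)
qed

lemma closed_class_witness:
  assumes "\<And>x. x \<in> S \<Longrightarrow> (f has_derivative D x) (at x within S)"
    "\<And>b. b \<in> Basis \<Longrightarrow> (\<lambda>x. D x b) \<in> C"
  shows "\<exists>D. (\<forall>x\<in>S. (f has_derivative D x) (at x within S)) \<and> (\<forall>b\<in>Basis. (\<lambda>x. D x b) \<in> C)"
    and "\<exists>D. (\<forall>x\<in>S. (f has_derivative D x) (at x within S)) \<and>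
      (\<forall>b\<in>Basis. \<exists>g\<in>C. \<forall>x\<in>S. g x = D x b)"
proof -
  show 1: "\<exists>D. (\<forall>x\<in>S. (f has_derivative D x) (at x within S)) \<and> (\<forall>b\<in>Basis. (\<lambda>x. D x b) \<in> C)"
    using assms by (intro exI[of _ D]) simp
  have "\<exists>g\<in>C. \<forall>x\<in>S. g x = D x b" if "b \<in> Basis" for b
    by (rule bexI[OF _ assms(2)[OF that]]) simp
  then show "\<exists>D. (\<forall>x\<in>S. (f has_derivative D x) (at x within S)) \<and>
      (\<forall>b\<in>Basis. \<exists>g\<in>C. \<forall>x\<in>S. g x = D x b)"
    using assms(1) by (intro exI[of _ D] conjI ballI)
qed

lemma smooth_on_has_derivative:
  assumes "smooth_on S f" "x \<in> S"
  shows "(f has_derivative frechet_derivative f (at x within S)) (at x within S)"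
proof -
  have "Ck_on (Suc 0) S f" using assms by (simp only: smooth_on_def)
  then show ?thesis
    using assms by (auto simp: differentiable_on_def simp flip: frechet_derivative_works)
qed

lemma smooth_on_frechet_Basis:
  assumes "smooth_on S f" "b \<in> Basis"
  shows "smooth_on S (\<lambda>x. frechet_derivative f (at x within S) b)"
proof -
  have "Ck_on (Suc k) S f" for k using assms by (simp only: smooth_on_def)
  then show ?thesis using assms by (auto simp: smooth_on_def)
qed

lemma smooth_on_imp_continuous_on: "smooth_on S f \<Longrightarrow> continuous_on S f"
  using Ck_on.simps(1) smooth_on_def by blast

lemma smooth_on_const:
  assumes "approachable S" shows "smooth_on S (\<lambda>_. c)"
proof (rule smooth_on_closed_class[OF assms, where C="range (\<lambda>c _. c)"])
  fix f :: "'a \<Rightarrow> 'b" assume "f \<in> range (\<lambda>c _. c)"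
  then obtain c where f: "f = (\<lambda>_. c)" by blast
  have "(\<lambda>_. 0) \<in> range (\<lambda>(c::'b) (_::'a). c)" by blast
  then show "\<exists>D. (\<forall>x\<in>S. (f has_derivative D x) (at x within S)) \<and>
      (\<forall>b\<in>Basis. \<exists>g\<in>range (\<lambda>c _. c). \<forall>x\<in>S. g x = D x b)"
    unfolding f by (intro exI[of _ "\<lambda>_ _. 0"] conjI ballI bexI[of _ "\<lambda>_. 0"]) simp_all
qed blast

lemma smooth_on_linear_image:
  assumes S: "approachable S" and L: "bounded_linear L" and f: "smooth_on S f"
  shows "smooth_on S (\<lambda>x. L (f x))"
proof (rule smooth_on_closed_class[OF S, where C="{\<lambda>x. L (f x) | f. smooth_on S f}"])
  fix h assume "h \<in> {\<lambda>x. L (f x) | f. smooth_on S f}"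
  then obtain f where f: "h = (\<lambda>x. L (f x))" "smooth_on S f" by auto
  define D where "D x v = L (frechet_derivative f (at x within S) v)" for x v
  have "(h has_derivative D x) (at x within S)" if "x \<in> S" for x
    unfolding f(1) D_def
    using bounded_linear.has_derivative[OF L smooth_on_has_derivative[OF f(2) that]] by blast
  moreover have "(\<lambda>x. D x b) \<in> {\<lambda>x. L (f x) | f. smooth_on S f}" if "b \<in> Basis" for b
    unfolding D_def
    by (intro CollectI exI[of _ "\<lambda>x. frechet_derivative f (at x within S) b"] conjI refl
        smooth_on_frechet_Basis[OF f(2) that])
  ultimately show "\<exists>D. (\<forall>x\<in>S. (h has_derivative D x) (at x within S)) \<and>
      (\<forall>b\<in>Basis. \<exists>g\<in>{\<lambda>x. L (f x) | f. smooth_on S f}. \<forall>x\<in>S. g x = D x b)"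
    by (intro closed_class_witness(2)[where D=D])
qed (use f in blast)

lemma smooth_on_componentwise:
  fixes f :: "'a::euclidean_space \<Rightarrow> 'b::euclidean_space"
  assumes S: "approachable S" and f: "\<And>i. i \<in> Basis \<Longrightarrow> smooth_on S (\<lambda>x. f x \<bullet> i)"
  shows "smooth_on S f"
proof (rule smooth_on_closed_class[OF S, where C="{f. \<forall>i\<in>Basis. smooth_on S (\<lambda>x. f x \<bullet> i)}"])
  fix h :: "'a \<Rightarrow> 'b" assume "h \<in> {f. \<forall>i\<in>Basis. smooth_on S (\<lambda>x. f x \<bullet> i)}"
  then have h: "\<And>i. i \<in> Basis \<Longrightarrow> smooth_on S (\<lambda>x. h x \<bullet> i)" by auto
  define D where "D x v = (\<Sum>i\<in>Basis. frechet_derivative (\<lambda>x. h x \<bullet> i) (at x within S) v *\<^sub>R i)"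
    for x v
  have i: "D x v \<bullet> i = frechet_derivative (\<lambda>x. h x \<bullet> i) (at x within S) v" if "i \<in> Basis" for x v i
    unfolding D_def using that by (simp add: inner_sum_left inner_Basis if_distrib sum.delta cong: if_cong)
  have "(h has_derivative D x) (at x within S)" if "x \<in> S" for x
    using smooth_on_has_derivative[OF h that]
    by (subst has_derivative_componentwise_within) (simp add: i)
  moreover have "(\<lambda>x. D x b) \<in> {f. \<forall>i\<in>Basis. smooth_on S (\<lambda>x. f x \<bullet> i)}"
    if "b \<in> Basis" for b
    using smooth_on_frechet_Basis[OF h that] by (simp add: i)
  ultimately show "\<exists>D. (\<forall>x\<in>S. (h has_derivative D x) (at x within S)) \<and>
      (\<forall>b\<in>Basis. \<exists>g\<in>{f. \<forall>i\<in>Basis. smooth_on S (\<lambda>x. f x \<bullet> i)}. \<forall>x\<in>S. g x = D x b)"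
    by (intro closed_class_witness(2)[where D=D])
qed (use f in auto)

section \<open>Closure of smoothness under arithmetic and composition\<close>

inductive_set smooth_closure :: "'a::euclidean_space set \<Rightarrow> ('a \<Rightarrow> real) set"
  for S :: "'a set" where
  base: "smooth_on S f \<Longrightarrow> f \<in> smooth_closure S"
| add: "f \<in> smooth_closure S \<Longrightarrow> g \<in> smooth_closure S \<Longrightarrow> (\<lambda>x. f x + g x) \<in> smooth_closure S"
| mult: "f \<in> smooth_closure S \<Longrightarrow> g \<in> smooth_closure S \<Longrightarrow> (\<lambda>x. f x * g x) \<in> smooth_closure S"
| comp: "f \<in> smooth_closure S \<Longrightarrow> smooth_on UNIV h \<Longrightarrow> (\<lambda>x. h (f x :: real)) \<in> smooth_closure S"
| inv: "f \<in> smooth_closure S \<Longrightarrow> (\<And>x. x \<in> S \<Longrightarrow> f x \<noteq> 0) \<Longrightarrow> (\<lambda>x. inverse (f x)) \<in> smooth_closure S"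
| sqrt: "f \<in> smooth_closure S \<Longrightarrow> (\<And>x. x \<in> S \<Longrightarrow> f x > 0) \<Longrightarrow> (\<lambda>x. sqrt (f x)) \<in> smooth_closure S"
| comp2: "f \<in> smooth_closure S \<Longrightarrow> g \<in> smooth_closure S \<Longrightarrow> smooth_on (J \<times> UNIV) h \<Longrightarrow>
    (\<And>x. x \<in> S \<Longrightarrow> f x \<in> J) \<Longrightarrow> (\<lambda>x. h (f x :: real, g x :: real)) \<in> smooth_closure S"

text \<open>The Leibniz and chain rules lead from one product or composite to sums of products of
  others, so no single operation yields a class closed under partial derivatives; the inductive
  closure under all of them does. The rule \<open>comp2\<close> admits an outer function that is
  smooth only up to the boundary of J x R, with derivatives relative to that set, as is needed for
  functions of time and space.\<close>

lemma smooth_closure_smooth: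
  assumes S: "approachable S" and "f \<in> smooth_closure S"
  shows "smooth_on S f"
proof (rule smooth_on_closed_class[OF S _ assms(2)])
  fix f assume "f \<in> smooth_closure S"
  then have "\<exists>D. (\<forall>x\<in>S. (f has_derivative D x) (at x within S)) \<and>
     (\<forall>b\<in>Basis. (\<lambda>x. D x b) \<in> smooth_closure S)"
  proof induction
    case (base f)
    then show ?case
      by (intro exI[of _ "\<lambda>x. frechet_derivative f (at x within S)"] conjI ballI
          smooth_on_has_derivative smooth_on_frechet_Basis smooth_closure.base)
  next
    case (add f g)
    then obtain D E where DE: "\<forall>x\<in>S. (f has_derivative D x) (at x within S)"
      "\<forall>x\<in>S. (g has_derivative E x) (at x within S)"
      "\<forall>b\<in>Basis. (\<lambda>x. D x b) \<in> smooth_closure S" "\<forall>b\<in>Basis. (\<lambda>x. E x b) \<in> smooth_closure S"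
      by blast
    then show ?case
      by (intro exI[of _ "\<lambda>x v. D x v + E x v"])
        (auto intro!: has_derivative_add smooth_closure.add)
  next
    case (mult f g)
    then obtain D E where DE: "\<forall>x\<in>S. (f has_derivative D x) (at x within S)"
      "\<forall>x\<in>S. (g has_derivative E x) (at x within S)"
      "\<forall>b\<in>Basis. (\<lambda>x. D x b) \<in> smooth_closure S" "\<forall>b\<in>Basis. (\<lambda>x. E x b) \<in> smooth_closure S"
      by blast
    then show ?case using mult.hyps
      by (intro exI[of _ "\<lambda>x v. f x * E x v + D x v * g x"])
        (auto intro!: has_derivative_mult smooth_closure.add smooth_closure.mult)
  next
    case (comp f h)
    then obtain D where D: "\<forall>x\<in>S. (f has_derivative D x) (at x within S)"
      "\<forall>b\<in>Basis. (\<lambda>x. D x b) \<in> smooth_closure S" by blast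
    define h' where "h' r = frechet_derivative h (at r) 1" for r
    have h: "(h has_derivative frechet_derivative h (at r)) (at r)" for r
      using smooth_on_has_derivative[OF comp.hyps(2)] by simp
    have lin: "frechet_derivative h (at r) v = v * h' r" for r v
      using linear.scaleR[OF has_derivative_linear[OF h], of r v 1] by (simp add: h'_def)
    have h's: "smooth_on UNIV h'"
      using smooth_on_frechet_Basis[OF comp.hyps(2), of 1] by (simp add: h'_def[abs_def])
    have "((\<lambda>x. h (f x)) has_derivative (\<lambda>v. frechet_derivative h (at (f x)) (D x v))) (at x within S)"
      if "x \<in> S" for x
      by (rule has_derivative_compose[OF bspec[OF D(1) that] h])
    moreover have "(\<lambda>x. frechet_derivative h (at (f x)) (D x b)) \<in> smooth_closure S"
      if "b \<in> Basis" for b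
      unfolding lin
      by (rule smooth_closure.mult[OF bspec[OF D(2) that] smooth_closure.comp[OF comp.hyps(1) h's]])
    ultimately show ?case
      by (intro closed_class_witness(1)[where D="\<lambda>x v. frechet_derivative h (at (f x)) (D x v)"])
  next
    case (inv f)
    then obtain D where D: "\<forall>x\<in>S. (f has_derivative D x) (at x within S)"
      "\<forall>b\<in>Basis. (\<lambda>x. D x b) \<in> smooth_closure S" by blast
    have "(\<lambda>x. -1 * (inverse (f x) * D x b * inverse (f x))) \<in> smooth_closure S" if "b \<in> Basis" for b
      by (rule smooth_closure.mult[OF smooth_closure.base[OF smooth_on_const[OF S]]
            smooth_closure.mult[OF smooth_closure.mult[OF smooth_closure.inv[OF inv.hyps]
              bspec[OF D(2) that]] smooth_closure.inv[OF inv.hyps]]])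
    moreover have "((\<lambda>x. inverse (f x)) has_derivative
        (\<lambda>v. -1 * (inverse (f x) * D x v * inverse (f x)))) (at x within S)" if "x \<in> S" for x
      using Deriv.has_derivative_inverse[OF inv.hyps(2)[OF that] bspec[OF D(1) that]]
      by (rule has_derivative_eq_rhs) auto
    ultimately show ?case
      by (intro closed_class_witness(1)[where D="\<lambda>x v. -1 * (inverse (f x) * D x v * inverse (f x))"])
  next
    case (sqrt f)
    then obtain D where D: "\<forall>x\<in>S. (f has_derivative D x) (at x within S)"
      "\<forall>b\<in>Basis. (\<lambda>x. D x b) \<in> smooth_closure S" by blast
    have "(\<lambda>x. (1/2) * (inverse (sqrt (f x)) * D x b)) \<in> smooth_closure S" if "b \<in> Basis" for b
    proof -
      have "sqrt (f x) \<noteq> 0" if "x \<in> S" for x using sqrt.hyps(2)[OF that] by simp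
      then have "(\<lambda>x. inverse (sqrt (f x))) \<in> smooth_closure S"
        by (intro smooth_closure.inv smooth_closure.sqrt sqrt.hyps)
      then show ?thesis
        by (rule smooth_closure.mult[OF smooth_closure.base[OF smooth_on_const[OF S]]
            smooth_closure.mult[OF _ bspec[OF D(2) that]]])
    qed
    moreover have "((\<lambda>x. sqrt (f x)) has_derivative (\<lambda>v. (1/2) * (inverse (sqrt (f x)) * D x v)))
        (at x within S)" if "x \<in> S" for x
    proof -
      have "((\<lambda>x. sqrt (f x)) has_derivative (\<lambda>v. D x v * (inverse (sqrt (f x)) / 2))) (at x within S)"
        using has_derivative_real_sqrt[OF sqrt.hyps(2)[OF that] bspec[OF D(1) that]]
        by (rule has_derivative_eq_rhs) (auto simp: field_simps)
      then show ?thesis by (rule has_derivative_eq_rhs) auto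
    qed
    ultimately show ?case
      by (intro closed_class_witness(1)[where D="\<lambda>x v. (1/2) * (inverse (sqrt (f x)) * D x v)"])
  next
    case (comp2 f g J h)
    then obtain D E where DE: "\<forall>x\<in>S. (f has_derivative D x) (at x within S)"
      "\<forall>x\<in>S. (g has_derivative E x) (at x within S)"
      "\<forall>b\<in>Basis. (\<lambda>x. D x b) \<in> smooth_closure S" "\<forall>b\<in>Basis. (\<lambda>x. E x b) \<in> smooth_closure S"
      by blast
    define H where "H z = frechet_derivative h (at z within J \<times> UNIV)" for z
    define h1 where "h1 z = H z (1, 0)" for z
    define h2 where "h2 z = H z (0, 1)" for z
    have h: "(h has_derivative H z) (at z within J \<times> UNIV)" if "z \<in> J \<times> UNIV" for z
      using smooth_on_has_derivative[OF comp2.hyps(3)] that by (simp add: H_def)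
    have lin: "H z v = fst v * h1 z + snd v * h2 z" if "z \<in> J \<times> UNIV" for z v
    proof -
      have l: "linear (H z)" using has_derivative_linear[OF h[OF that]] .
      have "H z (fst v *\<^sub>R (1, 0) + snd v *\<^sub>R (0, 1)) = fst v *\<^sub>R h1 z + snd v *\<^sub>R h2 z"
        by (simp only: linear_add[OF l] linear_scale[OF l] h1_def h2_def)
      then show ?thesis by simp
    qed
    have h12: "smooth_on (J \<times> UNIV) h1" "smooth_on (J \<times> UNIV) h2"
      using smooth_on_frechet_Basis[OF comp2.hyps(3), of "(1,0)"]
        smooth_on_frechet_Basis[OF comp2.hyps(3), of "(0,1)"]
      by (auto simp: h1_def[abs_def] h2_def[abs_def] H_def Basis_prod_def)
    define DD where "DD x v = D x v * h1 (f x, g x) + E x v * h2 (f x, g x)" for x v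
    have "((\<lambda>x. h (f x, g x)) has_derivative DD x) (at x within S)" if x: "x \<in> S" for x
    proof -
      have 1: "((\<lambda>x. (f x, g x)) has_derivative (\<lambda>v. (D x v, E x v))) (at x within S)"
        using DE x by (auto intro!: has_derivative_Pair)
      have "((\<lambda>x. h (f x, g x)) has_derivative (\<lambda>v. H (f x, g x) (D x v, E x v))) (at x within S)"
        using comp2.hyps(4) x
        by (intro has_derivative_in_compose2[where t="J \<times> UNIV" and s=S and g=h, OF h _ _ 1]) auto
      then show ?thesis using comp2.hyps(4)[OF x]
        by (simp add: lin DD_def[abs_def])
    qed
    moreover have "(\<lambda>x. DD x b) \<in> smooth_closure S" if "b \<in> Basis" for b
      unfolding DD_def
      by (rule smooth_closure.add[OF
          smooth_closure.mult[OF bspec[OF DE(3) that]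
            smooth_closure.comp2[OF comp2.hyps(1,2) h12(1) comp2.hyps(4)]]
          smooth_closure.mult[OF bspec[OF DE(4) that]
            smooth_closure.comp2[OF comp2.hyps(1,2) h12(2) comp2.hyps(4)]]])
    ultimately show ?case by (intro closed_class_witness(1)[where D=DD])
  qed
  then obtain D where "\<forall>x\<in>S. (f has_derivative D x) (at x within S)"
    "\<forall>b\<in>Basis. (\<lambda>x. D x b) \<in> smooth_closure S" by (elim exE conjE)
  then show "\<exists>D. (\<forall>x\<in>S. (f has_derivative D x) (at x within S)) \<and>
      (\<forall>b\<in>Basis. \<exists>g\<in>smooth_closure S. \<forall>x\<in>S. g x = D x b)"
    by (intro closed_class_witness(2)[where D=D]) simp_all
qed

context
  fixes S :: "'a::euclidean_space set"
  assumes S: "approachable S"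
begin

lemmas smooth_closure_smooth' = smooth_closure_smooth[OF S]

lemma smooth_on_add_real:
  fixes f g :: "'a \<Rightarrow> real"
  assumes "smooth_on S f" "smooth_on S g" shows "smooth_on S (\<lambda>x. f x + g x)"
  by (rule smooth_closure_smooth'[OF smooth_closure.add[OF smooth_closure.base[OF assms(1)]
        smooth_closure.base[OF assms(2)]]])

lemma smooth_on_mult:
  fixes f g :: "'a \<Rightarrow> real"
  assumes "smooth_on S f" "smooth_on S g" shows "smooth_on S (\<lambda>x. f x * g x)"
  by (rule smooth_closure_smooth'[OF smooth_closure.mult[OF smooth_closure.base[OF assms(1)]
        smooth_closure.base[OF assms(2)]]])

lemma smooth_on_inverse:
  fixes f :: "'a \<Rightarrow> real"
  assumes "smooth_on S f" "\<And>x. x \<in> S \<Longrightarrow> f x \<noteq> 0" shows "smooth_on S (\<lambda>x. inverse (f x))"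
  by (rule smooth_closure_smooth'[OF smooth_closure.inv[OF smooth_closure.base[OF assms(1)] assms(2)]])

lemma smooth_on_sqrt:
  fixes f :: "'a \<Rightarrow> real"
  assumes "smooth_on S f" "\<And>x. x \<in> S \<Longrightarrow> f x > 0" shows "smooth_on S (\<lambda>x. sqrt (f x))"
  by (rule smooth_closure_smooth'[OF smooth_closure.sqrt[OF smooth_closure.base[OF assms(1)] assms(2)]])

lemma smooth_on_compose:
  fixes f :: "'a \<Rightarrow> real" and h :: "real \<Rightarrow> real"
  assumes "smooth_on UNIV h" "smooth_on S f" shows "smooth_on S (\<lambda>x. h (f x))"
  by (rule smooth_closure_smooth'[OF smooth_closure.comp[OF smooth_closure.base[OF assms(2)] assms(1)]])

lemma smooth_on_compose2:
  fixes f g :: "'a \<Rightarrow> real" and h :: "real \<times> real \<Rightarrow> real"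
  assumes "smooth_on (J \<times> UNIV) h" "smooth_on S f" "smooth_on S g" "\<And>x. x \<in> S \<Longrightarrow> f x \<in> J"
  shows "smooth_on S (\<lambda>x. h (f x, g x))"
  by (rule smooth_closure_smooth'[OF smooth_closure.comp2[OF smooth_closure.base[OF assms(2)]
        smooth_closure.base[OF assms(3)] assms(1,4)]])

lemma smooth_on_bounded_linear:
  assumes L: "bounded_linear L" shows "smooth_on S L"
proof (rule smooth_on_closed_class[OF S, where C="{\<lambda>x. a *\<^sub>R L x + c | a c. True}"])
  fix f assume "f \<in> {\<lambda>x. a *\<^sub>R L x + c | a c. True}"
  then obtain a c where f: "f = (\<lambda>x. a *\<^sub>R L x + c)" by (elim CollectE exE conjE)
  have "(f has_derivative (\<lambda>v. a *\<^sub>R L v)) (at x within S)" for x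
    unfolding f by (auto intro!: derivative_eq_intros bounded_linear_imp_has_derivative[OF L])
  moreover have "(\<lambda>x. a *\<^sub>R L b) \<in> {\<lambda>x. a *\<^sub>R L x + c | a c. True}" for b
    by (intro CollectI exI[of _ 0] exI[of _ "a *\<^sub>R L b"]) simp
  ultimately show "\<exists>D. (\<forall>x\<in>S. (f has_derivative D x) (at x within S)) \<and>
      (\<forall>b\<in>Basis. \<exists>g\<in>{\<lambda>x. a *\<^sub>R L x + c | a c. True}. \<forall>x\<in>S. g x = D x b)"
    by (intro closed_class_witness(2)[where D="\<lambda>x v. a *\<^sub>R L v"])
next
  show "L \<in> {\<lambda>x. a *\<^sub>R L x + c | a c. True}"
    by (intro CollectI exI[of _ 1] exI[of _ 0]) simp
qed

lemma smooth_on_inner_left: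
  fixes f :: "'a \<Rightarrow> 'b::euclidean_space"
  assumes "smooth_on S f" shows "smooth_on S (\<lambda>x. f x \<bullet> c)"
  using smooth_on_linear_image[OF S _ assms, of "\<lambda>y. y \<bullet> c"] bounded_linear_inner_left by auto

lemma smooth_on_sum_real:
  fixes f :: "'i \<Rightarrow> 'a \<Rightarrow> real"
  assumes "\<And>i. i \<in> I \<Longrightarrow> smooth_on S (f i)" shows "smooth_on S (\<lambda>x. \<Sum>i\<in>I. f i x)"
  using assms
proof (induction I rule: infinite_finite_induct)
  case (insert i I)
  then show ?case using smooth_on_add_real[of "f i" "\<lambda>x. \<Sum>i\<in>I. f i x"] by simp
qed (auto simp: smooth_on_const[OF S])

lemma smooth_on_add:
  fixes f g :: "'a \<Rightarrow> 'b::euclidean_space"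
  assumes "smooth_on S f" "smooth_on S g" shows "smooth_on S (\<lambda>x. f x + g x)"
  by (rule smooth_on_componentwise[OF S])
    (use assms in \<open>auto simp: inner_add_left intro!: smooth_on_add_real smooth_on_inner_left\<close>)

lemma smooth_on_scaleR:
  fixes f :: "'a \<Rightarrow> real" and g :: "'a \<Rightarrow> 'b::euclidean_space"
  assumes "smooth_on S f" "smooth_on S g" shows "smooth_on S (\<lambda>x. f x *\<^sub>R g x)"
  by (rule smooth_on_componentwise[OF S]) (use assms in \<open>auto intro!: smooth_on_mult smooth_on_inner_left\<close>)

lemma smooth_on_uminus:
  fixes f :: "'a \<Rightarrow> 'b::euclidean_space"
  assumes "smooth_on S f" shows "smooth_on S (\<lambda>x. - f x)"
  using smooth_on_linear_image[OF S bounded_linear_minus[OF bounded_linear_ident] assms] .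

lemma smooth_on_diff:
  fixes f g :: "'a \<Rightarrow> 'b::euclidean_space"
  assumes "smooth_on S f" "smooth_on S g" shows "smooth_on S (\<lambda>x. f x - g x)"
  using smooth_on_add[OF assms(1) smooth_on_uminus[OF assms(2)]] by simp

lemma smooth_on_sum:
  fixes f :: "'i \<Rightarrow> 'a \<Rightarrow> 'b::euclidean_space"
  assumes "\<And>i. i \<in> I \<Longrightarrow> smooth_on S (f i)" shows "smooth_on S (\<lambda>x. \<Sum>i\<in>I. f i x)"
  by (rule smooth_on_componentwise[OF S])
    (use assms in \<open>auto simp: inner_sum_left intro!: smooth_on_sum_real smooth_on_inner_left\<close>)

lemma smooth_on_inner:
  fixes f g :: "'a \<Rightarrow> 'b::euclidean_space"
  assumes "smooth_on S f" "smooth_on S g" shows "smooth_on S (\<lambda>x. f x \<bullet> g x)"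
proof -
  have "smooth_on S (\<lambda>x. \<Sum>b\<in>Basis. (f x \<bullet> b) * (g x \<bullet> b))"
    by (intro smooth_on_sum_real smooth_on_mult smooth_on_inner_left assms)
  then show ?thesis by (rule smooth_on_cong[rotated]) (rule euclidean_inner[symmetric])
qed

lemma smooth_on_divide:
  fixes f g :: "'a \<Rightarrow> real"
  assumes "smooth_on S f" "smooth_on S g" "\<And>x. x \<in> S \<Longrightarrow> g x \<noteq> 0"
  shows "smooth_on S (\<lambda>x. f x / g x)"
  unfolding divide_inverse using assms by (intro smooth_on_mult smooth_on_inverse) auto

lemma smooth_on_power:
  fixes f :: "'a \<Rightarrow> real"
  assumes "smooth_on S f" shows "smooth_on S (\<lambda>x. f x ^ n)"
  by (induction n) (auto intro!: smooth_on_mult assms smooth_on_const[OF S])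

lemma smooth_on_Pair:
  fixes f :: "'a \<Rightarrow> 'b::euclidean_space" and g :: "'a \<Rightarrow> 'c::euclidean_space"
  assumes "smooth_on S f" "smooth_on S g"
  shows "smooth_on S (\<lambda>x. (f x, g x))"
proof (rule smooth_on_componentwise[OF S])
  fix i :: "'b \<times> 'c" assume "i \<in> Basis"
  then consider u where "i = (u, 0)" | u where "i = (0, u)" unfolding Basis_prod_def by auto
  then show "smooth_on S (\<lambda>x. (f x, g x) \<bullet> i)"
    by cases (simp_all add: smooth_on_inner_left assms)
qed

lemma smooth_on_derivative_along:
  fixes f :: "'a \<Rightarrow> 'b::euclidean_space" and X :: "'a \<Rightarrow> 'a"
  assumes f: "smooth_on S f" and X: "smooth_on S X"
  shows "smooth_on S (\<lambda>x. frechet_derivative f (at x within S) (X x))"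
proof -
  have "smooth_on S (\<lambda>x. \<Sum>b\<in>Basis. (X x \<bullet> b) *\<^sub>R frechet_derivative f (at x within S) b)"
    by (rule smooth_on_sum, rule smooth_on_scaleR, rule smooth_on_inner_left[OF X],
        erule smooth_on_frechet_Basis[OF f])
  then show ?thesis
  proof (rule smooth_on_cong[rotated])
    fix x assume "x \<in> S"
    then have l: "linear (frechet_derivative f (at x within S))"
      using smooth_on_has_derivative[OF f] has_derivative_linear by blast
    have "frechet_derivative f (at x within S) (X x) =
        frechet_derivative f (at x within S) (\<Sum>b\<in>Basis. (X x \<bullet> b) *\<^sub>R b)"
      by (simp only: euclidean_representation)
    also have "\<dots> = (\<Sum>b\<in>Basis. (X x \<bullet> b) *\<^sub>R frechet_derivative f (at x within S) b)"
      by (simp only: linear_sum[OF l] linear_scale[OF l])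
    finally show "(\<Sum>b\<in>Basis. (X x \<bullet> b) *\<^sub>R frechet_derivative f (at x within S) b) =
        frechet_derivative f (at x within S) (X x)" ..
  qed
qed

end

text \<open>The two-dimensional span of sine and cosine is closed under differentiation.\<close>

lemma smooth_on_sin_cos: "smooth_on UNIV (\<lambda>x::real. a * sin x + b * cos x)"
proof (rule smooth_on_closed_class[where C="{\<lambda>x::real. a * sin x + b * cos x | a b. True}"])
  fix f assume "f \<in> {\<lambda>x::real. a * sin x + b * cos x | a b. True}"
  then obtain a b where f: "f = (\<lambda>x. a * sin x + b * cos x)" by (elim CollectE exE conjE)
  have "(f has_derivative (\<lambda>v. v * (a * cos x - b * sin x))) (at x)" for x
    unfolding f by (auto intro!: derivative_eq_intros simp: algebra_simps)
  moreover have "(\<lambda>x. v * (a * cos x - b * sin x)) \<in> {\<lambda>x::real. a * sin x + b * cos x | a b. True}" for v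
    by (intro CollectI exI[of _ "v * a"] exI[of _ "- (v * b)"]) (simp add: algebra_simps)
  ultimately show "\<exists>D. (\<forall>x\<in>UNIV. (f has_derivative D x) (at x)) \<and>
      (\<forall>b\<in>Basis. \<exists>g\<in>{\<lambda>x::real. a * sin x + b * cos x | a b. True}. \<forall>x\<in>UNIV. g x = D x b)"
    by (intro closed_class_witness(2)[where D="\<lambda>x v. v * (a * cos x - b * sin x)"])
next
  show "(\<lambda>x::real. a * sin x + b * cos x) \<in> {\<lambda>x::real. a * sin x + b * cos x | a b. True}"
    by (intro CollectI exI[of _ a] exI[of _ b]) simp
qed simp

lemma smooth_on_sin: "smooth_on UNIV (sin :: real \<Rightarrow> real)"
  using smooth_on_sin_cos[of 1 0] by simp

lemma smooth_on_cos: "smooth_on UNIV (cos :: real \<Rightarrow> real)"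
  using smooth_on_sin_cos[of 0 1] by simp

lemma smooth_on_ident: "approachable S \<Longrightarrow> smooth_on S (\<lambda>x. x)"
  by (rule smooth_on_bounded_linear[OF _ bounded_linear_ident])

section \<open>Absolutely convergent Fourier series depending on time\<close>

lemma at_within_atLeast_eq:
  fixes x :: real
  assumes "0 \<le> x" shows "at x within {0..} = at x within {0..x+1}"
  using assms by (intro at_within_nhd[of x "{..<x+1}"]) auto

lemma integral_has_vector_derivative_atLeast:
  fixes f :: "real \<Rightarrow> 'b::banach"
  assumes "continuous_on {0..} f" "0 \<le> x"
  shows "((\<lambda>t. integral {0..t} f) has_vector_derivative f x) (at x within {0..})"
  unfolding at_within_atLeast_eq[OF assms(2)]
  using assms by (intro integral_has_vector_derivative continuous_on_subset[OF assms(1)]) auto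

lemma continuous_on_infsum:
  fixes f :: "'i \<Rightarrow> 'a::topological_space \<Rightarrow> 'c::banach"
  assumes "\<And>k. continuous_on A (f k)" "\<And>k x. x \<in> A \<Longrightarrow> norm (f k x) \<le> M k" "M summable_on UNIV"
  shows "continuous_on A (\<lambda>x. \<Sum>\<^sub>\<infinity>k. f k x)"
proof (rule uniform_limit_theorem)
  show "uniform_limit A (\<lambda>X y. \<Sum>x\<in>X. f x y) (\<lambda>y. \<Sum>\<^sub>\<infinity>x. f x y) (finite_subsets_at_top UNIV)"
    using assms by (intro Weierstrass_m_test_general[where M=M]) auto
  show "\<forall>\<^sub>F X in finite_subsets_at_top UNIV. continuous_on A (\<lambda>y. \<Sum>x\<in>X. f x y)"
    by (intro always_eventually allI continuous_on_sum assms(1))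
qed simp

lemma infsum_eq_suminf_int:
  fixes f :: "int \<Rightarrow> 'c::banach"
  assumes "M summable_on UNIV" "\<And>k. norm (f k) \<le> M k"
  shows "(\<lambda>j. f (int_decode j)) sums (\<Sum>\<^sub>\<infinity>k. f k)"
proof -
  have "f summable_on UNIV"
    using Infinite_Sum.abs_summable_on_comparison_test'[OF assms(1), of f] assms(2) abs_summable_summable by auto
  then have "(f has_sum (\<Sum>\<^sub>\<infinity>k. f k)) UNIV" by simp
  then have "((\<lambda>j. f (int_decode j)) has_sum (\<Sum>\<^sub>\<infinity>k. f k)) UNIV"
    using has_sum_reindex_bij_betw[OF bij_int_decode, of f] by simp
  then show ?thesis by (rule has_sum_imp_sums)
qed

text \<open>The enumeration \<open>int_decode\<close> turns the sum over the integers into an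
  ordinary series, which may be differentiated term by term because its derivatives converge
  uniformly. One majorant \<open>M\<close> serves values and derivatives alike.\<close>

lemma has_vector_derivative_infsum:
  fixes f f' :: "int \<Rightarrow> real \<Rightarrow> 'c::banach"
  assumes S: "convex S" and x: "x \<in> S"
    and d: "\<And>n x. x \<in> S \<Longrightarrow> (f n has_vector_derivative f' n x) (at x within S)"
    and b: "\<And>n x. x \<in> S \<Longrightarrow> norm (f n x) \<le> M n" "\<And>n x. x \<in> S \<Longrightarrow> norm (f' n x) \<le> M n"
    and M: "M summable_on UNIV"
  shows "((\<lambda>x. \<Sum>\<^sub>\<infinity>n. f n x) has_vector_derivative (\<Sum>\<^sub>\<infinity>n. f' n x)) (at x within S)"
proof -
  define g' where "g' x = (\<Sum>\<^sub>\<infinity>n. f' n x)" for x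
  have M': "summable (\<lambda>j. M (int_decode j))"
  proof -
    have "(M has_sum (\<Sum>\<^sub>\<infinity>k. M k)) UNIV" using M by simp
    then have "((\<lambda>j. M (int_decode j)) has_sum (\<Sum>\<^sub>\<infinity>k. M k)) UNIV"
      using has_sum_reindex_bij_betw[OF bij_int_decode, of M] by simp
    then show ?thesis by (intro sums_summable has_sum_imp_sums)
  qed
  have sf: "(\<lambda>j. f (int_decode j) x) sums (\<Sum>\<^sub>\<infinity>n. f n x)" if "x \<in> S" for x
    using infsum_eq_suminf_int[OF M, of "\<lambda>n. f n x"] b that by simp
  have sf': "(\<lambda>j. f' (int_decode j) x) sums g' x" if "x \<in> S" for x
    using infsum_eq_suminf_int[OF M, of "\<lambda>n. f' n x"] b that by (simp add: g'_def)
  have ul: "uniform_limit S (\<lambda>n x. \<Sum>i<n. f' (int_decode i) x) (\<lambda>x. \<Sum>i. f' (int_decode i) x) sequentially"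
    using b M' by (intro Weierstrass_m_test) auto
  have "\<exists>g. \<forall>x\<in>S. (\<lambda>j. f (int_decode j) x) sums g x \<and>
      (g has_derivative (\<lambda>h. h *\<^sub>R g' x)) (at x within S)"
  proof (rule has_derivative_series[OF S, where f'="\<lambda>j x h. h *\<^sub>R f' (int_decode j) x"])
    show "(f (int_decode n) has_derivative (\<lambda>h. h *\<^sub>R f' (int_decode n) x)) (at x within S)"
      if "x \<in> S" for n x using d[OF that] by (simp add: has_vector_derivative_def)
    show "x \<in> S" by fact
    show "(\<lambda>n. f (int_decode n) x) sums (\<Sum>\<^sub>\<infinity>n. f n x)" using sf x by simp
    fix e :: real assume "e > 0"
    then have "\<forall>\<^sub>F n in sequentially. \<forall>x\<in>S. dist (\<Sum>i<n. f' (int_decode i) x) (\<Sum>i. f' (int_decode i) x) < e"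
      using uniform_limitD[OF ul] by simp
    then show "\<forall>\<^sub>F n in sequentially. \<forall>x\<in>S. \<forall>h.
        norm ((\<Sum>i<n. h *\<^sub>R f' (int_decode i) x) - h *\<^sub>R g' x) \<le> e * norm h"
    proof eventually_elim
      case (elim n)
      show ?case
      proof (intro ballI allI)
        fix x h assume xS: "x \<in> S"
        then have "norm ((\<Sum>i<n. f' (int_decode i) x) - g' x) \<le> e"
          using elim sums_unique[OF sf'] by (auto simp: dist_norm intro: less_imp_le)
        then have "\<bar>h\<bar> * norm ((\<Sum>i<n. f' (int_decode i) x) - g' x) \<le> \<bar>h\<bar> * e"
          by (intro mult_left_mono) auto
        then show "norm ((\<Sum>i<n. h *\<^sub>R f' (int_decode i) x) - h *\<^sub>R g' x) \<le> e * norm h"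
          by (simp add: scaleR_sum_right[symmetric] scaleR_diff_right[symmetric] mult.commute)
      qed
    qed
  qed
  then obtain g where g: "\<And>x. x \<in> S \<Longrightarrow> (\<lambda>j. f (int_decode j) x) sums g x"
    "\<And>x. x \<in> S \<Longrightarrow> (g has_derivative (\<lambda>h. h *\<^sub>R g' x)) (at x within S)" by blast
  have "(\<Sum>\<^sub>\<infinity>n. f n x) = g x" if "x \<in> S" for x
    using sums_unique2[OF sf[OF that] g(1)[OF that]] .
  then have "((\<lambda>x. \<Sum>\<^sub>\<infinity>n. f n x) has_derivative (\<lambda>h. h *\<^sub>R g' x)) (at x within S)"
    using has_derivative_transform[OF x _ g(2)[OF x]] by simp
  then show ?thesis by (simp add: has_vector_derivative_def g'_def)
qed

text \<open>The polynomial factor makes the weighted supremum norm submultiplicative under convolution; the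
  exponential factor makes all series that occur termwise differentiable.\<close>

definition wt :: "int \<Rightarrow> real" where "wt n = 20 * (1 + (of_int n)\<^sup>2) * exp \<bar>of_int n\<bar>"

section \<open>Weights and their summability\<close>

definition invsq :: "int \<Rightarrow> real" where "invsq k = 1 / (1 + (of_int k)\<^sup>2)"

lemma one_plus_sq_pos: "0 < 1 + (x::real)\<^sup>2"
  by (simp add: add_pos_nonneg)

lemma wt_ge: "20 * (1 + (real_of_int n)\<^sup>2) \<le> wt n"
  unfolding wt_def using mult_left_mono[of 1 "exp \<bar>of_int n\<bar>" "20 * (1 + (real_of_int n)\<^sup>2)"] by simp

lemma wt_pos: "0 < wt n"
  unfolding wt_def by (intro mult_pos_pos one_plus_sq_pos) auto

lemma wt_minus [simp]: "wt (- n) = wt n" by (simp add: wt_def)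

lemma invsq_nonneg: "0 \<le> invsq k" by (simp add: invsq_def)

lemma inverse_wt_le: "1 / wt n \<le> invsq n / 20"
  using wt_ge[of n] wt_pos[of n] one_plus_sq_pos[of "of_int n"]
  by (simp add: invsq_def field_simps)

text \<open>The two terms at distance x from 0 are dominated by a telescoping difference: 2 / (1 +
  x^2) \<le> 2 / (x^2 - 1/4) = 2 / (x - 1/2) - 2 / (x + 1/2). The constant 5 is the one for which
  the inductive bound is an equality at N = 0.\<close>

lemma sum_invsq_le: assumes "finite F" shows "sum invsq F \<le> 5"
proof -
  have S: "(\<Sum>k\<in>{-int N..int N}. invsq k) \<le> 5 - 2 / (real N + 1/2)" for N
  proof (induction N)
    case 0
    show ?case by (simp add: invsq_def)
  next
    case (Suc N)
    define x where "x = real N + 1"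
    have x: "x \<ge> 1" by (simp add: x_def)
    have "{-int (Suc N)..int (Suc N)} = insert (-int (Suc N)) (insert (int (Suc N)) {-int N..int N})"
      by auto
    then have "(\<Sum>k\<in>{-int (Suc N)..int (Suc N)}. invsq k) =
        invsq (-int (Suc N)) + (invsq (int (Suc N)) + (\<Sum>k\<in>{-int N..int N}. invsq k))" by simp
    also have "invsq (-int (Suc N)) = 1 / (1 + x\<^sup>2)" by (simp add: invsq_def x_def power2_eq_square algebra_simps)
    also have "invsq (int (Suc N)) = 1 / (1 + x\<^sup>2)" by (simp add: invsq_def x_def add.commute)
    also have "1 / (1 + x\<^sup>2) + (1 / (1 + x\<^sup>2) + (\<Sum>k\<in>{-int N..int N}. invsq k))
        \<le> 2 / (1 + x\<^sup>2) + (5 - 2 / (x - 1/2))"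
    proof -
      have "x - 1/2 = real N + 1/2" by (simp add: x_def)
      then show ?thesis using Suc by (simp only:)
    qed
    also have "2 / (1 + x\<^sup>2) \<le> 2 / (x\<^sup>2 - 1/4)"
    proof (rule divide_left_mono)
      have "1 \<le> x\<^sup>2" using x by simp
      then show "0 < (1 + x\<^sup>2) * (x\<^sup>2 - 1/4)" by (intro mult_pos_pos) auto
    qed auto
    also have "2 / (x\<^sup>2 - 1/4) = 2 / (x - 1/2) - 2 / (x + 1/2)"
    proof -
      have "x\<^sup>2 - 1/4 = (x - 1/2) * (x + 1/2)" by (simp add: power2_eq_square algebra_simps)
      moreover have "2 / (x - 1/2) - 2 / (x + 1/2) = (2 * (x + 1/2) - 2 * (x - 1/2)) / ((x - 1/2) * (x + 1/2))"
        using x by (intro diff_frac_eq) auto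
      moreover have "2 * (x + 1/2) - 2 * (x - 1/2) = 2" by (simp add: algebra_simps)
      ultimately show ?thesis by (simp only:)
    qed
    finally show ?case by (simp add: x_def)
  qed
  have "\<exists>N. F \<subseteq> {-int N..int N}" using assms
  proof induction
    case (insert k F)
    then obtain N where "F \<subseteq> {-int N..int N}" by blast
    then have "insert k F \<subseteq> {-int (max N (nat \<bar>k\<bar>))..int (max N (nat \<bar>k\<bar>))}"
    proof (intro subsetI)
      fix x assume "x \<in> insert k F"
      then have "\<bar>x\<bar> \<le> int (max N (nat \<bar>k\<bar>))"
        using subsetD[OF \<open>F \<subseteq> {-int N..int N}\<close>, of x] by (auto simp: of_nat_max)
      then show "x \<in> {-int (max N (nat \<bar>k\<bar>))..int (max N (nat \<bar>k\<bar>))}" by auto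
    qed
    then show ?case by blast
  qed simp
  then obtain N where "F \<subseteq> {-int N..int N}" ..
  then have "sum invsq F \<le> (\<Sum>k\<in>{-int N..int N}. invsq k)"
    by (intro sum_mono2) (auto simp: invsq_nonneg)
  also have "\<dots> \<le> 5 - 2 / (real N + 1/2)" by (rule S)
  also have "\<dots> \<le> 5" by simp
  finally show ?thesis .
qed

lemma invsq_summable: "invsq summable_on UNIV"
  by (rule nonneg_bdd_above_summable_on) (auto simp: invsq_nonneg intro!: bdd_aboveI2[where M=5] sum_invsq_le)

lemma infsum_invsq_le: "infsum invsq UNIV \<le> 5"
  by (rule infsum_le_finite_sums[OF invsq_summable sum_invsq_le])

lemma bij_diff_int: "bij_betw (\<lambda>k. n - k) (UNIV::int set) UNIV"
  by (rule bij_betwI[where g="\<lambda>k. n - k"]) auto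

lemma invsq_shift_summable: "(\<lambda>k. invsq (n - k)) summable_on UNIV"
  using summable_on_reindex_bij_betw[OF bij_diff_int, of invsq n] invsq_summable by simp

lemma infsum_invsq_shift: "(\<Sum>\<^sub>\<infinity>k. invsq (n - k)) = infsum invsq UNIV"
  by (rule infsum_reindex_bij_betw[OF bij_diff_int])

text \<open>The exponentials are submultiplicative, and 1 + (x + y)^2 \<le> 2 (1 + x^2) + 2 (1 +
  y^2). Of the factor 20 in the weight, 2 pays for this inequality and 10 for the sum over k of
  \<open>invsq k + invsq (n - k)\<close>, which is at most 5 + 5; thus convolution has norm at most
  1.\<close>

lemma wt_conv: "1 / (wt k * wt (n - k)) \<le> (invsq k + invsq (n - k)) / 10 / wt n"
proof -
  define x where "x = real_of_int k"
  define y where "y = real_of_int (n - k)"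
  have n: "real_of_int n = x + y" by (simp add: x_def y_def)
  define K where "K = 1 + x\<^sup>2"
  define L where "L = 1 + y\<^sup>2"
  have KL: "K > 0" "L > 0" unfolding K_def L_def by (rule one_plus_sq_pos)+
  have "0 \<le> (x - y)\<^sup>2" by simp
  then have N: "1 + (x + y)\<^sup>2 \<le> 2 * (K + L)"
    unfolding K_def L_def by (simp add: power2_eq_square algebra_simps)
  have E: "exp \<bar>x + y\<bar> \<le> exp \<bar>x\<bar> * exp \<bar>y\<bar>"
    unfolding exp_add[symmetric] by simp
  have "wt n = 20 * ((1 + (x + y)\<^sup>2) * exp \<bar>x + y\<bar>)" by (simp add: wt_def n)
  also have "\<dots> \<le> 20 * (2 * (K + L) * (exp \<bar>x\<bar> * exp \<bar>y\<bar>))"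
    using N E KL by (intro mult_left_mono mult_mono) auto
  also have "\<dots> = (1/K + 1/L) / 10 * (20 * K * exp \<bar>x\<bar> * (20 * L * exp \<bar>y\<bar>))"
    using KL by (simp add: field_simps)
  also have "\<dots> = (invsq k + invsq (n - k)) / 10 * (wt k * wt (n - k))"
    by (simp add: K_def L_def invsq_def wt_def x_def y_def)
  finally show ?thesis
    using wt_pos[of n] wt_pos[of k] wt_pos[of "n - k"] by (simp add: field_simps)
qed

text \<open>From (1 + x/k)^k \<le> exp x one gets x^k \<le> k^k exp x, so the exponential in the
  weight pays for any number of space derivatives.\<close>

lemma abs_power_le_wt: "\<exists>C\<ge>0. \<forall>n. \<bar>real_of_int n\<bar> ^ k / wt n \<le> C * invsq n"
proof -
  have "\<bar>real_of_int n\<bar> ^ k \<le> real (k ^ k) * exp \<bar>real_of_int n\<bar>" for n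
  proof (cases "k = 0")
    case False
    define x where "x = \<bar>real_of_int n\<bar>"
    have "(x / real k) ^ k \<le> (1 + x / real k) ^ k"
      by (intro power_mono) (auto simp: x_def)
    also have "\<dots> \<le> exp x"
      using exp_ge_one_plus_x_over_n_power_n[of k x] False by (simp add: x_def)
    finally show ?thesis using False by (simp add: power_divide x_def field_simps)
  qed simp
  then have "\<bar>real_of_int n\<bar> ^ k / wt n \<le> real (k ^ k) * invsq n" for n
  proof -
    have "\<bar>real_of_int n\<bar> ^ k / wt n \<le> real (k ^ k) * exp \<bar>real_of_int n\<bar> / wt n"
      using wt_pos[of n] \<open>\<And>n. _ \<le> real (k ^ k) * exp \<bar>real_of_int n\<bar>\<close>
      by (intro divide_right_mono) (auto intro: less_imp_le)
    also have "\<dots> = real (k ^ k) * (invsq n / 20)"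
      by (simp add: wt_def invsq_def)
    also have "\<dots> \<le> real (k ^ k) * invsq n"
      using invsq_nonneg[of n] by (intro mult_left_mono) auto
    finally show ?thesis .
  qed
  then show ?thesis by (intro exI[of _ "real (k ^ k)"]) simp
qed

text \<open>An element is stored as its family of weighted Fourier coefficients, so that the uniform norm of
  bounded continuous functions is the weighted norm.\<close>

type_synonym wiener = "(int \<times> real) \<Rightarrow>\<^sub>C complex"

definition coef :: "wiener \<Rightarrow> int \<Rightarrow> real \<Rightarrow> complex" where
  "coef y n t = apply_bcontfun y (n, t) / of_real (wt n)"

definition mkW :: "(int \<Rightarrow> real \<Rightarrow> complex) \<Rightarrow> wiener" where
  "mkW f = Bcontfun (\<lambda>(n, t). of_real (wt n) * f n t)"

lemma coef_le: "cmod (coef y n t) \<le> norm y / wt n"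
  unfolding coef_def using norm_bounded[of y "(n, t)"] wt_pos[of n]
  by (simp add: norm_divide divide_right_mono)

lemma coef_add [simp]: "coef (a + b) n t = coef a n t + coef b n t"
  by (simp add: coef_def add_divide_distrib)
lemma coef_diff [simp]: "coef (a - b) n t = coef a n t - coef b n t"
  by (simp add: coef_def diff_divide_distrib)
lemma coef_uminus [simp]: "coef (- a) n t = - coef a n t"
  by (simp add: coef_def)
lemma coef_scaleR [simp]: "coef (c *\<^sub>R a) n t = c *\<^sub>R coef a n t"
  by (simp add: coef_def scaleR_conv_of_real)

lemma coef_continuous: "continuous_on A (coef y n)"
  unfolding coef_def using wt_pos[of n]
  by (intro continuous_intros continuous_on_compose2[OF continuous_on_apply_bcontfun[of UNIV y]]) auto

lemma coef_eqI: "(\<And>n t. coef a n t = coef b n t) \<Longrightarrow> a = b"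
proof (rule bcontfun_eqI)
  fix x assume "\<And>n t. coef a n t = coef b n t"
  then have "coef a (fst x) (snd x) = coef b (fst x) (snd x)" .
  then show "apply_bcontfun a x = apply_bcontfun b x"
    using wt_pos[of "fst x"] by (simp add: coef_def)
qed

text \<open>The integers are discrete, so the slices {n} x R are open and continuity on the product
  is continuity in time for each fixed mode.\<close>

lemma mkW:
  assumes c: "\<And>n. continuous_on UNIV (f n)" and b: "\<And>n t. cmod (f n t) \<le> M / wt n"
  shows "coef (mkW f) n t = f n t" "norm (mkW f) \<le> M"
proof -
  define h where "h = (\<lambda>(n, t). of_real (wt n) * f n t)"
  have "continuous_on (\<Union>n. {n} \<times> UNIV) h"
  proof (rule continuous_on_open_Union)
    show "open s" if "s \<in> range (\<lambda>n::int. {n} \<times> (UNIV::real set))" for s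
      using that by (auto intro!: open_Times open_discrete)
    show "continuous_on s h" if s: "s \<in> range (\<lambda>n::int. {n} \<times> (UNIV::real set))" for s
    proof -
      obtain n where n: "s = {n} \<times> UNIV" using s by blast
      have "continuous_on s (\<lambda>x. of_real (wt n) * f n (snd x))"
        by (intro continuous_intros continuous_on_compose2[OF c]) auto
      then show ?thesis
        by (rule continuous_on_eq) (auto simp: n h_def)
    qed
  qed
  moreover have "(\<Union>n::int. {n} \<times> (UNIV::real set)) = UNIV" by auto
  ultimately have "continuous_on UNIV h" by simp
  moreover have hb: "norm (h x) \<le> M" for x
    using b[of "fst x" "snd x"] wt_pos[of "fst x"]
    by (simp add: h_def split_beta norm_mult field_simps)
  ultimately have "h \<in> bcontfun" by (rule bcontfun_normI)
  then have ap: "apply_bcontfun (mkW f) = h" by (simp add: mkW_def h_def Bcontfun_inverse)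
  show "coef (mkW f) n t = f n t" using wt_pos[of n] by (simp add: coef_def ap h_def)
  show "norm (mkW f) \<le> M" by (rule norm_bound) (simp add: ap hb)
qed

section \<open>Convolution, Fourier multipliers and the heat semigroup\<close>

definition pr :: "wiener \<Rightarrow> wiener \<Rightarrow> wiener" where
  "pr a b = mkW (\<lambda>n t. \<Sum>\<^sub>\<infinity>k. coef a k t * coef b (n - k) t)"

lemma pr_term_le:
  "cmod (coef a k t * coef b (n - k) t) \<le> norm a * norm b / wt n * ((invsq k + invsq (n - k)) / 10)"
proof -
  have "cmod (coef a k t * coef b (n - k) t) \<le> (norm a / wt k) * (norm b / wt (n - k))"
    unfolding norm_mult by (intro mult_mono coef_le) (use wt_pos[of k] in \<open>auto intro: less_imp_le\<close>)
  also have "\<dots> = norm a * norm b * (1 / (wt k * wt (n - k)))" by simp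
  also have "\<dots> \<le> norm a * norm b * ((invsq k + invsq (n - k)) / 10 / wt n)"
    by (intro mult_left_mono wt_conv) auto
  finally show ?thesis by (simp add: field_simps)
qed

lemma pr_majorant_summable: "(\<lambda>k. c * ((invsq k + invsq (n - k)) / 10)) summable_on UNIV"
proof -
  have "(\<lambda>k. (c/10) * (invsq k + invsq (n - k))) summable_on UNIV"
    by (intro summable_on_cmult_right summable_on_add invsq_summable invsq_shift_summable)
  then show ?thesis by (simp add: field_simps)
qed

lemma pr_abs_summable: "(\<lambda>k. cmod (coef a k t * coef b (n - k) t)) summable_on UNIV"
  by (rule Infinite_Sum.abs_summable_on_comparison_test'[OF pr_majorant_summable]) (rule pr_term_le)

lemma pr_summable: "(\<lambda>k. coef a k t * coef b (n - k) t) summable_on UNIV"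
  by (rule abs_summable_summable[OF pr_abs_summable])

lemma coef_pr: "coef (pr a b) n t = (\<Sum>\<^sub>\<infinity>k. coef a k t * coef b (n - k) t)"
  and norm_pr: "norm (pr a b) \<le> norm a * norm b"
proof -
  have c: "continuous_on UNIV (\<lambda>t. \<Sum>\<^sub>\<infinity>k. coef a k t * coef b (n - k) t)" for n
    by (rule continuous_on_infsum[OF _ _ pr_majorant_summable])
      (intro continuous_intros coef_continuous, rule pr_term_le)
  have b: "cmod (\<Sum>\<^sub>\<infinity>k. coef a k t * coef b (n - k) t) \<le> norm a * norm b / wt n" for n t
  proof -
    have "cmod (\<Sum>\<^sub>\<infinity>k. coef a k t * coef b (n - k) t) \<le>
       (\<Sum>\<^sub>\<infinity>k. norm a * norm b / wt n * ((invsq k + invsq (n - k)) / 10))"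
      by (rule norm_infsum_le[OF has_sum_infsum[OF pr_summable]
            has_sum_infsum[OF pr_majorant_summable] pr_term_le])
    also have "\<dots> = (\<Sum>\<^sub>\<infinity>k. norm a * norm b / wt n / 10 * (invsq k + invsq (n - k)))"
      by (simp add: field_simps)
    also have "\<dots> = norm a * norm b / wt n / 10 * (infsum invsq UNIV + infsum invsq UNIV)"
      by (subst infsum_cmult_right', subst infsum_add[OF invsq_summable invsq_shift_summable])
        (simp add: infsum_invsq_shift)
    also have "\<dots> \<le> norm a * norm b / wt n / 10 * 10"
      using infsum_invsq_le wt_pos[of n] by (intro mult_left_mono) auto
    finally show ?thesis by simp
  qed
  show "coef (pr a b) n t = (\<Sum>\<^sub>\<infinity>k. coef a k t * coef b (n - k) t)"
    "norm (pr a b) \<le> norm a * norm b"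
    unfolding pr_def using mkW[OF c b] by auto
qed

lemma pr_diff: "pr a b - pr a' b' = pr (a - a') b + pr a' (b - b')"
proof (rule coef_eqI)
  fix n t
  have "coef (pr (a - a') b) n t + coef (pr a' (b - b')) n t =
      (\<Sum>\<^sub>\<infinity>k. coef (a - a') k t * coef b (n - k) t + coef a' k t * coef (b - b') (n - k) t)"
    unfolding coef_pr by (rule infsum_add[symmetric]; rule pr_summable)
  also have "\<dots> = (\<Sum>\<^sub>\<infinity>k. coef a k t * coef b (n - k) t + - (coef a' k t * coef b' (n - k) t))"
    by (simp add: algebra_simps)
  also have "\<dots> = coef (pr a b) n t - coef (pr a' b') n t"
    unfolding coef_pr
    by (subst infsum_add) (auto simp: infsum_uminus summable_on_uminus intro: pr_summable)
  finally show "coef (pr a b - pr a' b') n t = coef (pr (a - a') b + pr a' (b - b')) n t" by simp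
qed

definition mult_op :: "(int \<Rightarrow> complex) \<Rightarrow> wiener \<Rightarrow> wiener" where
  "mult_op h y = mkW (\<lambda>n t. h n * coef y n t)"

lemma mult_op:
  assumes "\<And>n. cmod (h n) \<le> 1"
  shows "coef (mult_op h y) n t = h n * coef y n t" "norm (mult_op h y) \<le> norm y"
proof -
  have "cmod (h n * coef y n t) \<le> norm y / wt n" for n t
    unfolding norm_mult using mult_mono[OF assms[of n] coef_le[of y n t]] by simp
  then show "coef (mult_op h y) n t = h n * coef y n t" "norm (mult_op h y) \<le> norm y"
    unfolding mult_op_def
    by (auto intro!: mkW continuous_intros coef_continuous)
qed

lemma mult_op_diff:
  assumes "\<And>n. cmod (h n) \<le> 1"
  shows "mult_op h a - mult_op h b = mult_op h (a - b)"
  by (rule coef_eqI) (simp add: mult_op[OF assms] algebra_simps)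

text \<open>The value is frozen for negative times because coefficients are bounded continuous functions on
  the whole line. The factor \<open>l\<close> makes the operator bounded by 1 in the supremum norm.\<close>

definition duhamel :: "real \<Rightarrow> (real \<Rightarrow> complex) \<Rightarrow> real \<Rightarrow> complex" where
  "duhamel l f t = of_real (l * exp (- l * max 0 t)) * integral {0..max 0 t} (\<lambda>s. of_real (exp (l * s)) * f s)"

lemma duhamel_derivative:
  assumes f: "continuous_on UNIV f" and t: "t \<ge> 0"
  shows "(duhamel l f has_vector_derivative (of_real l * (f t - duhamel l f t))) (at t within {0..})"
proof -
  define g where "g = (\<lambda>s. of_real (exp (l * s)) * f s)"
  have g: "continuous_on UNIV g" unfolding g_def by (intro continuous_intros f)
  have "((\<lambda>t. integral {0..t} g) has_vector_derivative g t) (at t within {0..})"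
    by (rule integral_has_vector_derivative_atLeast[OF continuous_on_subset[OF g] t]) simp
  moreover have "((\<lambda>t. of_real (l * exp (- l * t)) :: complex) has_vector_derivative
      of_real (- l * (l * exp (- l * t)))) (at t within {0..})"
  proof -
    have "((\<lambda>t. l * exp (- l * t)) has_real_derivative (- l * (l * exp (- l * t)))) (at t within {0..})"
      by (auto intro!: derivative_eq_intros)
    then show ?thesis by (rule has_vector_derivative_of_real)
  qed
  ultimately have "((\<lambda>t. of_real (l * exp (- l * t)) * integral {0..t} g) has_vector_derivative
      of_real (l * exp (- l * t)) * g t + of_real (- l * (l * exp (- l * t))) * integral {0..t} g)
      (at t within {0..})"
    by (rule has_vector_derivative_mult[rotated])
  moreover have "of_real (l * exp (- l * t)) * g t = of_real l * f t"
    by (simp add: g_def exp_minus of_real_mult[symmetric] del: of_real_mult)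
  moreover have "of_real (- l * (l * exp (- l * t))) * integral {0..t} g = - of_real l * duhamel l f t"
    using t by (simp add: duhamel_def g_def max_def)
  ultimately have "((\<lambda>t. of_real (l * exp (- l * t)) * integral {0..t} g) has_vector_derivative
      of_real l * f t + - of_real l * duhamel l f t) (at t within {0..})"
    by (simp only:)
  then have "((\<lambda>t. of_real (l * exp (- l * t)) * integral {0..t} g) has_vector_derivative
      of_real l * (f t - duhamel l f t)) (at t within {0..})"
    by (rule has_vector_derivative_eq_rhs) (simp add: algebra_simps)
  then show ?thesis
    by (rule has_vector_derivative_transform[rotated 2]) (use t in \<open>auto simp: duhamel_def g_def max_def\<close>)
qed

lemma duhamel_0: "duhamel l f 0 = 0" by (simp add: duhamel_def)

lemma duhamel_max: "duhamel l f t = duhamel l f (max 0 t)" by (simp add: duhamel_def)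

lemma duhamel_continuous:
  assumes "continuous_on UNIV f" shows "continuous_on UNIV (duhamel l f)"
proof -
  have "continuous_on {0..} (duhamel l f)"
    unfolding continuous_on_eq_continuous_within
    using duhamel_derivative[OF assms] has_vector_derivative_continuous by (metis atLeast_iff)
  then have "continuous_on UNIV (\<lambda>t. duhamel l f (max 0 t))"
    by (rule continuous_on_compose2) (auto intro!: continuous_intros)
  then show ?thesis using duhamel_max[of l f] by simp
qed

text \<open>The integral of l exp (- l (T - s)) over [0, T] equals 1 - exp (- l T), which is below 1
  uniformly in l. This uniformity is what allows l to run through all eigenvalues.\<close>

lemma duhamel_le:
  assumes f: "continuous_on UNIV f" and B: "\<And>t. cmod (f t) \<le> B" and l: "l > 0"
  shows "cmod (duhamel l f t) \<le> B"
proof -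
  define T where "T = max 0 t"
  have T: "T \<ge> 0" by (simp add: T_def)
  have "B \<ge> 0" using B[of 0] norm_ge_zero order_trans by blast
  have I: "((\<lambda>s. B * exp (l * s)) has_integral (B * exp (l * T) / l - B * exp (l * 0) / l)) {0..T}"
    using T l by (intro fundamental_theorem_of_calculus)
      (auto intro!: derivative_eq_intros simp: has_real_derivative_iff_has_vector_derivative[symmetric])
  have "cmod (integral {0..T} (\<lambda>s. of_real (exp (l * s)) * f s)) \<le> integral {0..T} (\<lambda>s. B * exp (l * s))"
  proof (rule integral_norm_bound_integral)
    show "(\<lambda>s. of_real (exp (l * s)) * f s) integrable_on {0..T}"
      by (intro integrable_continuous_interval continuous_intros continuous_on_subset[OF f]) auto
    show "(\<lambda>s. B * exp (l * s)) integrable_on {0..T}" using I by blast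
    show "cmod (of_real (exp (l * s)) * f s) \<le> B * exp (l * s)" for s
      using B[of s] by (simp add: norm_mult mult.commute mult_right_mono)
  qed
  also have "\<dots> = B * exp (l * T) / l - B / l" unfolding integral_unique[OF I] by simp
  finally have "cmod (duhamel l f t) \<le> l * exp (- l * T) * (B * exp (l * T) / l - B / l)"
    unfolding duhamel_def T_def[symmetric] norm_mult using l by (simp add: mult_left_mono norm_mult)
  also have "\<dots> = B - B * exp (- l * T)"
    using l by (simp add: field_simps exp_minus)
  also have "\<dots> \<le> B" using \<open>B \<ge> 0\<close> by simp
  finally show ?thesis .
qed

lemma duhamel_diff:
  assumes f: "continuous_on UNIV f" and g: "continuous_on UNIV g"
  shows "duhamel l f t - duhamel l g t = duhamel l (\<lambda>s. f s - g s) t"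
proof -
  have *: "(\<lambda>s. of_real (exp (l * s)) * h s) integrable_on {0..max 0 t}"
    if "continuous_on UNIV h" for h :: "real \<Rightarrow> complex"
    by (intro integrable_continuous_interval continuous_intros continuous_on_subset[OF that]) auto
  show ?thesis unfolding duhamel_def
    by (simp add: right_diff_distrib Henstock_Kurzweil_Integration.integral_diff[OF *[OF f] *[OF g]])
qed

lemma duhamel_cnj: "duhamel l (\<lambda>s. cnj (f s)) t = cnj (duhamel l f t)"
  by (simp add: duhamel_def Henstock_Kurzweil_Integration.integral_cnj)

definition lam :: "int \<Rightarrow> real" where "lam n = 1 + (of_int n)\<^sup>2"

lemma lam_pos: "lam n > 0" and lam_ge_1: "lam n \<ge> 1" by (simp_all add: lam_def add_pos_nonneg)

text \<open>On the level of functions this is 1 - \<partial>^2 applied to the solution w of w_t =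
  w'' - w + y with zero initial value; \<open>lam n\<close> is the symbol of 1 - \<partial>^2. That
  the norm is at most 1 is maximal regularity in this space: a nonlinearity of second order is
  inverted without losing derivatives.\<close>

definition opK :: "wiener \<Rightarrow> wiener" where
  "opK y = mkW (\<lambda>n. duhamel (lam n) (coef y n))"

lemma coef_opK: "coef (opK y) n t = duhamel (lam n) (coef y n) t"
  and norm_opK: "norm (opK y) \<le> norm y"
  unfolding opK_def
  by (auto intro!: mkW duhamel_continuous coef_continuous duhamel_le coef_le lam_pos)

lemma opK_diff: "opK a - opK b = opK (a - b)"
proof (rule coef_eqI)
  fix n t
  have "coef (a - b) n = (\<lambda>s. coef a n s - coef b n s)" by (rule ext) simp
  then show "coef (opK a - opK b) n t = coef (opK (a - b)) n t"
    by (simp add: coef_opK duhamel_diff coef_continuous)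
qed

text \<open>That is, the function with these Fourier coefficients is real-valued.\<close>

definition sym :: "wiener \<Rightarrow> bool" where
  "sym y \<longleftrightarrow> (\<forall>n t. coef y (- n) t = cnj (coef y n t))"

lemma sym_add: "sym a \<Longrightarrow> sym b \<Longrightarrow> sym (a + b)"
  and sym_diff: "sym a \<Longrightarrow> sym b \<Longrightarrow> sym (a - b)"
  and sym_uminus: "sym a \<Longrightarrow> sym (- a)"
  and sym_scaleR: "sym a \<Longrightarrow> sym (c *\<^sub>R a)"
  by (simp_all add: sym_def)

lemma sym_pr: assumes "sym a" "sym b" shows "sym (pr a b)"
  unfolding sym_def
proof (intro allI)
  fix n t
  have "coef (pr a b) (- n) t = (\<Sum>\<^sub>\<infinity>k. coef a (- k) t * coef b (- n - (- k)) t)"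
    unfolding coef_pr
    by (rule infsum_reindex_bij_betw[symmetric, of uminus UNIV UNIV "\<lambda>k. coef a k t * coef b (- n - k) t"])
      (rule bij_betwI[where g=uminus]; simp)
  also have "\<dots> = (\<Sum>\<^sub>\<infinity>k. cnj (coef a k t * coef b (n - k) t))"
  proof (rule infsum_cong)
    fix k
    have "coef b (- (n - k)) t = cnj (coef b (n - k) t)" using assms(2) by (simp only: sym_def)
    then show "coef a (- k) t * coef b (- n - (- k)) t = cnj (coef a k t * coef b (n - k) t)"
      using assms(1) by (simp add: sym_def)
  qed
  also have "\<dots> = cnj (coef (pr a b) n t)" unfolding coef_pr by (rule infsum_cnj)
  finally show "coef (pr a b) (- n) t = cnj (coef (pr a b) n t)" .
qed

lemma sym_mult_op:
  assumes "\<And>n. cmod (h n) \<le> 1" "\<And>n. h (- n) = cnj (h n)" "sym a"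
  shows "sym (mult_op h a)"
  using assms(2,3) by (simp add: sym_def mult_op(1)[OF assms(1)])

lemma sym_opK: assumes "sym a" shows "sym (opK a)"
proof -
  have "coef a (- n) = (\<lambda>t. cnj (coef a n t))" for n using assms by (auto simp: sym_def)
  then show ?thesis by (simp add: sym_def coef_opK duhamel_cnj) (simp add: lam_def)
qed

lemma bounded_linear_coef: "bounded_linear (\<lambda>y. coef y n t)"
  by (rule bounded_linear_intro[where K="1 / wt n"]) (use coef_le in auto)

lemma closed_sym: "closed {y. sym y}"
proof -
  have "continuous_on UNIV (\<lambda>y. coef y n t)" for n t
    using bounded_linear_coef linear_continuous_on by blast
  then show ?thesis unfolding sym_def
    by (intro closed_Collect_all closed_Collect_eq continuous_intros) auto
qed

section \<open>The profile equation\<close>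

text \<open>The unknown of the fixed point equation is \<open>z = (1 - \<partial>\<^sup>2) u\<close>; \<open>u\<close>, \<open>u'\<close> and \<open>u''\<close> are recovered by the
  multipliers \<open>coefR 0\<close>, \<open>coefR 1\<close> and \<open>coefR 2\<close>, all of which are bounded by 1.\<close>

definition coefR :: "nat \<Rightarrow> int \<Rightarrow> complex" where
  "coefR j n = (\<i> * of_int n) ^ j / of_real (lam n)"

lemma coefR_le: assumes "j \<le> 2" shows "cmod (coefR j n) \<le> 1"
proof -
  define x where "x = \<bar>real_of_int n\<bar>"
  have "x ^ j \<le> 1 + x\<^sup>2"
  proof -
    have "0 \<le> (x - 1)\<^sup>2" "x \<ge> 0" by (simp_all add: x_def)
    moreover have "(x - 1)\<^sup>2 = x\<^sup>2 - 2 * x + 1" by (simp add: power2_diff)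
    ultimately have "x \<le> 1 + x\<^sup>2" by linarith
    moreover have "x ^ 0 \<le> 1 + x\<^sup>2" by simp
    moreover have "x ^ 2 \<le> 1 + x\<^sup>2" by simp
    moreover have "j \<in> {0, 1, 2}" using assms by auto
    ultimately show ?thesis by (auto simp only: insert_iff power_one_right empty_iff)
  qed
  moreover have "cmod (coefR j n) = x ^ j / lam n"
    using lam_pos[of n] by (simp add: coefR_def norm_divide norm_mult norm_power x_def)
  ultimately show ?thesis
    using lam_pos[of n] by (simp add: lam_def x_def)
qed

lemma coefR_sym: "coefR j (- n) = cnj (coefR j n)"
  by (simp add: coefR_def lam_def)

definition opR :: "nat \<Rightarrow> wiener \<Rightarrow> wiener" where "opR j = mult_op (coefR j)"

lemma opR: assumes "j \<le> 2"
  shows coef_opR: "coef (opR j y) n t = coefR j n * coef y n t"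
    and norm_opR: "norm (opR j y) \<le> norm y"
    and opR_diff: "opR j a - opR j b = opR j (a - b)"
    and sym_opR: "sym y \<Longrightarrow> sym (opR j y)"
  unfolding opR_def
  using mult_op[of "coefR j"] mult_op_diff[of "coefR j"] sym_mult_op[of "coefR j"] coefR_le[OF assms] coefR_sym
  by auto

definition trig :: "(int \<Rightarrow> complex) \<Rightarrow> wiener" where
  "trig c = mkW (\<lambda>n t. c n)"

lemma trig:
  assumes "\<And>n. cmod (c n) * wt n \<le> M"
  shows "coef (trig c) n t = c n" "norm (trig c) \<le> M"
  unfolding trig_def using assms wt_pos
  by (auto intro!: mkW simp: field_simps)

text \<open>The coefficients of \<open>sin\<^sup>2 x\<close> and of \<open>sin (2 x)\<close>.\<close>

definition c_s2 :: "int \<Rightarrow> complex" where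
  "c_s2 n = (if n = 0 then 1/2 else if \<bar>n\<bar> = 2 then -1/4 else 0)"
definition c_sg :: "int \<Rightarrow> complex" where
  "c_sg n = (if n = 2 then - \<i>/2 else if n = -2 then \<i>/2 else 0)"

lemma exp_1_le_3: "exp (1::real) \<le> 3" using exp_le by simp
lemma exp_2_le_9: "exp (2::real) \<le> 9"
proof -
  have "exp (2::real) = exp 1 * exp 1" by (simp flip: exp_add)
  also have "\<dots> \<le> 3 * 3" by (intro mult_mono exp_1_le_3) auto
  finally show ?thesis by simp
qed

lemma wt_0: "wt 0 = 20" and wt_1: "wt 1 \<le> 120" and wt_2: "wt 2 \<le> 900"
  using exp_1_le_3 exp_2_le_9 by (auto simp: wt_def)

lemma wt_abs: "\<bar>n\<bar> = k \<Longrightarrow> wt n = wt k"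
  by (auto simp: wt_def)

definition s2W :: wiener where "s2W = trig c_s2"
definition sgW :: wiener where "sgW = trig c_sg"

text \<open>The constants come from the modes 2 and -2, where the weight is at most 900: 225 = 900 /
  4 and 450 = 900 / 2.\<close>

lemma s2W: "coef s2W n t = c_s2 n" "norm s2W \<le> 225"
  and sgW: "coef sgW n t = c_sg n" "norm sgW \<le> 450"
proof -
  have "cmod (c_s2 n) * wt n \<le> 225" for n
    using wt_0 wt_2 wt_abs[of n 2] by (auto simp: c_s2_def norm_divide)
  then show "coef s2W n t = c_s2 n" "norm s2W \<le> 225" unfolding s2W_def by (auto intro: trig)
  have "cmod (c_sg n) * wt n \<le> 450" for n
    using wt_2 wt_abs[of n 2] by (auto simp: c_sg_def norm_divide norm_mult)
  then show "coef sgW n t = c_sg n" "norm sgW \<le> 450" unfolding sgW_def by (auto intro: trig)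
qed

lemma sym_s2W: "sym s2W" and sym_sgW: "sym sgW"
  by (auto simp: sym_def s2W sgW c_s2_def c_sg_def)

text \<open>With the bound 120 for \<open>wt 1\<close> this amplitude gives norm at most 12/1000 for
  the linear evolution \<open>Z0\<close>, which leaves room in the ball of radius 4/100 for the
  nonlinear part.\<close>

definition eps :: real where "eps = 1 / 10000"

text \<open>The linear evolution of \<open>(1 - \<partial>\<^sup>2) (eps * sin)\<close>.\<close>

definition Z0 :: wiener where
  "Z0 = mkW (\<lambda>n t. of_real (2 * eps * exp (- 2 * max 0 t)) *
     (if n = 1 then - \<i>/2 else if n = -1 then \<i>/2 else 0))"

lemma Z0: "coef Z0 n t = of_real (2 * eps * exp (- 2 * max 0 t)) *
     (if n = 1 then - \<i>/2 else if n = -1 then \<i>/2 else 0)" "norm Z0 \<le> 12 / 1000"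
proof -
  have "cmod (of_real (2 * eps * exp (- 2 * max 0 t)) *
     (if n = 1 then - \<i>/2 else if n = -1 then \<i>/2 else 0)) \<le> (12/1000) / wt n" for n t
  proof (cases "\<bar>n\<bar> = 1")
    case True
    have "eps * exp (- 2 * max 0 t) \<le> eps * 1" by (intro mult_left_mono) (auto simp: eps_def)
    moreover have "eps \<le> (12/1000) / wt n"
      using wt_1 wt_abs[OF True] wt_pos[of 1] by (simp add: eps_def field_simps)
    ultimately have "eps * exp (- 2 * max 0 t) \<le> (12/1000) / wt n" by linarith
    moreover have "n = 1 \<or> n = -1" using True by auto
    ultimately show ?thesis by (auto simp: norm_mult norm_divide eps_def)
  next
    case False
    then have "n \<noteq> 1" "n \<noteq> -1" by auto
    then show ?thesis using wt_pos[of n] by (simp add: less_imp_le)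
  qed
  note b = this
  have a: "continuous_on UNIV (\<lambda>t. of_real (2 * eps * exp (- 2 * max 0 t)) *
     (if n = 1 then - \<i>/2 else if n = -1 then \<i>/2 else (0::complex)))" for n :: int
    by (intro continuous_intros)
  show "coef Z0 n t = of_real (2 * eps * exp (- 2 * max 0 t)) *
     (if n = 1 then - \<i>/2 else if n = -1 then \<i>/2 else 0)"
    unfolding Z0_def by (rule mkW(1)[OF a b])
  show "norm Z0 \<le> 12 / 1000" unfolding Z0_def by (rule mkW(2)[OF a b])
qed

lemma sym_Z0: "sym Z0" by (auto simp: sym_def Z0)

section \<open>The contraction\<close>

type_synonym state = "wiener \<times> wiener \<times> wiener \<times> wiener"

definition radius :: real where "radius = 4/100"

text \<open>\<open>L\<close> is a Lipschitz constant and \<open>B\<close> a bound on the ball. They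
  are propagated together because the Lipschitz constant of a product involves the bounds of its
  factors; the rules below turn all estimates for the fixed point map into arithmetic with explicit
  rationals.\<close>

definition lipb :: "(state \<Rightarrow> wiener) \<Rightarrow> real \<Rightarrow> real \<Rightarrow> bool" where
  "lipb f L B \<longleftrightarrow> 0 \<le> L \<and> 0 \<le> B \<and> (\<forall>y. norm y \<le> radius \<longrightarrow> norm (f y) \<le> B) \<and>
    (\<forall>y y'. norm y \<le> radius \<longrightarrow> norm y' \<le> radius \<longrightarrow> norm (f y - f y') \<le> L * norm (y - y'))"

lemma lipbD:
  assumes "lipb f L B"
  shows "0 \<le> L" "0 \<le> B" "norm y \<le> radius \<Longrightarrow> norm (f y) \<le> B"
    "norm y \<le> radius \<Longrightarrow> norm y' \<le> radius \<Longrightarrow> norm (f y - f y') \<le> L * norm (y - y')"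
  using assms unfolding lipb_def by blast+

lemma lipb_add: assumes "lipb f L B" "lipb g L' B'" shows "lipb (\<lambda>y. f y + g y) (L + L') (B + B')"
  unfolding lipb_def
proof (intro conjI allI impI)
  fix y y' :: state assume y: "norm y \<le> radius" "norm y' \<le> radius"
  have "norm ((f y + g y) - (f y' + g y')) \<le> norm (f y - f y') + norm (g y - g y')"
    by (metis add_diff_add norm_triangle_ineq)
  then show "norm ((f y + g y) - (f y' + g y')) \<le> (L + L') * norm (y - y')"
    using assms y unfolding lipb_def distrib_right by (meson add_mono order_trans)
next
  fix y :: state assume y: "norm y \<le> radius"
  show "norm (f y + g y) \<le> B + B'"
    using assms y unfolding lipb_def by (meson add_mono norm_triangle_ineq order_trans)
qed (use assms in \<open>auto simp: lipb_def\<close>)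

lemma lipb_uminus: assumes "lipb f L B" shows "lipb (\<lambda>y. - f y) L B"
  using assms unfolding lipb_def by (simp add: norm_minus_commute)

lemma lipb_op:
  assumes "\<And>y. norm (K y) \<le> norm y" "\<And>a b. K a - K b = K (a - b)" "lipb f L B"
  shows "lipb (\<lambda>y. K (f y)) L B"
  using assms(3) unfolding lipb_def assms(2) by (meson assms(1) order_trans)

lemma lipb_scaleR: assumes "lipb f L B" "0 \<le> c" shows "lipb (\<lambda>y. c *\<^sub>R f y) (c * L) (c * B)"
  using assms unfolding lipb_def
  by (simp add: scaleR_diff_right[symmetric] mult_left_mono mult.assoc)

lemma lipb_const: "norm w \<le> B \<Longrightarrow> lipb (\<lambda>_. w) 0 B"
  unfolding lipb_def by (auto intro: order_trans[OF norm_ge_zero])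

lemma lipb_pr: assumes "lipb f L B" "lipb g L' B'"
  shows "lipb (\<lambda>y. pr (f y) (g y)) (L * B' + B * L') (B * B')"
  unfolding lipb_def
proof (intro conjI allI impI)
  fix y :: state assume y: "norm y \<le> radius"
  show "norm (pr (f y) (g y)) \<le> B * B'"
    by (rule order_trans[OF norm_pr])
      (intro mult_mono lipbD(3)[OF assms(1) y] lipbD(3)[OF assms(2) y] lipbD(2)[OF assms(1)] norm_ge_zero)
next
  fix y y' :: state assume y: "norm y \<le> radius" "norm y' \<le> radius"
  have "norm (pr (f y) (g y) - pr (f y') (g y')) \<le>
      norm (f y - f y') * norm (g y) + norm (f y') * norm (g y - g y')"
    unfolding pr_diff by (rule order_trans[OF norm_triangle_ineq]) (intro add_mono norm_pr)
  also have "\<dots> \<le> (L * norm (y - y')) * B' + B * (L' * norm (y - y'))"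
    by (intro add_mono mult_mono lipbD(3,4)[OF assms(1)] lipbD(3,4)[OF assms(2)] y norm_ge_zero
        mult_nonneg_nonneg lipbD(1,2)[OF assms(1)])
  finally show "norm (pr (f y) (g y) - pr (f y') (g y')) \<le> (L * B' + B * L') * norm (y - y')"
    by (simp add: algebra_simps)
qed (use assms in \<open>auto simp: lipb_def\<close>)

lemma lipb_mono: "lipb f L B \<Longrightarrow> L \<le> L' \<Longrightarrow> B \<le> B' \<Longrightarrow> lipb f L' B'"
  unfolding lipb_def by (meson mult_right_mono norm_ge_zero order_trans)

definition sz :: "state \<Rightarrow> wiener" where "sz y = fst y"
definition sa :: "state \<Rightarrow> wiener" where "sa y = fst (snd y)"
definition sb :: "state \<Rightarrow> wiener" where "sb y = fst (snd (snd y))"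
definition sp :: "state \<Rightarrow> wiener" where "sp y = snd (snd (snd y))"

lemma norm_components:
  "norm (sz y) \<le> norm y" "norm (sa y) \<le> norm y" "norm (sb y) \<le> norm y" "norm (sp y) \<le> norm y"
proof -
  obtain a b c d where y: "y = (a, b, c, d)" by (rule prod_cases4)
  have 1: "norm a \<le> norm y" "norm (b, c, d) \<le> norm y"
    unfolding y by (rule norm_fst_le, rule norm_snd_le)
  have 2: "norm b \<le> norm (b, c, d)" "norm (c, d) \<le> norm (b, c, d)"
    by (rule norm_fst_le, rule norm_snd_le)
  have 3: "norm c \<le> norm (c, d)" "norm d \<le> norm (c, d)"
    by (rule norm_fst_le, rule norm_snd_le)
  show "norm (sz y) \<le> norm y" "norm (sa y) \<le> norm y" "norm (sb y) \<le> norm y" "norm (sp y) \<le> norm y"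
    using 1 2 3 by (simp_all add: sz_def sa_def sb_def sp_def y)
qed

lemma lipb_components: "lipb sz 1 radius" "lipb sa 1 radius" "lipb sb 1 radius" "lipb sp 1 radius"
proof -
  have *: "lipb f 1 radius"
    if f: "\<And>y. norm (f y) \<le> norm y" "\<And>y y'. f y - f y' = f (y - y')" for f
    unfolding lipb_def f(2)
  proof (intro conjI allI impI)
    show "norm (f y) \<le> radius" if "norm y \<le> radius" for y
      using f(1)[of y] that by (rule order_trans)
    show "norm (f (y - y')) \<le> 1 * norm (y - y')" for y y'
      unfolding mult_1_left by (rule f(1))
  qed (simp_all add: radius_def)
  show "lipb sz 1 radius" "lipb sa 1 radius" "lipb sb 1 radius" "lipb sp 1 radius"
    by (rule *[OF norm_components(1)], simp add: sz_def, rule *[OF norm_components(2)], simp add: sa_def,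
      rule *[OF norm_components(3)], simp add: sb_def, rule *[OF norm_components(4)], simp add: sp_def)
qed

text \<open>With \<open>m = eps\<^sup>2\<close> the equation for \<open>u\<close> is \<open>u\<^sub>t = u'' - u + N\<close>, where
  \<open>N = u'' a - (m / 2) sin (2 x) u' (1 + p) (1 + a) - u b\<close>. The quotients are treated as further unknowns:
  \<open>1 + p = 1 / (1 + m sin\<^sup>2 x)\<close>, \<open>1 + a = 1 / (1 + m sin\<^sup>2 x + u'\<^sup>2)\<close> and \<open>1 + b = 1 / (1 + u\<^sup>2)\<close> turn into
  the polynomial fixed point equations below.\<close>

definition fA :: "state \<Rightarrow> wiener" where
  "fA y = (eps\<^sup>2) *\<^sub>R s2W + pr (opR 1 (sz y)) (opR 1 (sz y))"
definition fB :: "state \<Rightarrow> wiener" where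
  "fB y = pr (opR 0 (sz y)) (opR 0 (sz y))"
definition fG :: "state \<Rightarrow> wiener" where
  "fG y = pr sgW (opR 1 (sz y)) + pr (pr sgW (opR 1 (sz y))) (sp y)"
definition fN :: "state \<Rightarrow> wiener" where
  "fN y = pr (opR 2 (sz y)) (sa y) + - ((eps\<^sup>2 / 2) *\<^sub>R (fG y + pr (fG y) (sa y))) + - pr (opR 0 (sz y)) (sb y)"

definition stepz :: "state \<Rightarrow> wiener" where "stepz y = Z0 + opK (fN y)"
definition stepa :: "state \<Rightarrow> wiener" where "stepa y = - (fA y + pr (fA y) (sa y))"
definition stepb :: "state \<Rightarrow> wiener" where "stepb y = - (fB y + pr (fB y) (sb y))"
definition stepp :: "state \<Rightarrow> wiener" where
  "stepp y = - ((eps\<^sup>2) *\<^sub>R s2W + pr ((eps\<^sup>2) *\<^sub>R s2W) (sp y))"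

definition step :: "state \<Rightarrow> state" where "step y = (stepz y, stepa y, stepb y, stepp y)"

lemma lipb_opR: "j \<le> 2 \<Longrightarrow> lipb f L B \<Longrightarrow> lipb (\<lambda>y. opR j (f y)) L B"
  by (rule lipb_op) (auto intro: norm_opR opR_diff)

lemma lipb_opR_sz: "lipb (\<lambda>y. opR 0 (sz y)) 1 radius" "lipb (\<lambda>y. opR 1 (sz y)) 1 radius"
  "lipb (\<lambda>y. opR 2 (sz y)) 1 radius"
  by (intro lipb_opR lipb_components; simp)+

lemma lipb_e2s2: "lipb (\<lambda>y. eps\<^sup>2 *\<^sub>R s2W) 0 (225 * eps\<^sup>2)"
  using lipb_scaleR[OF lipb_const[OF s2W(2)], of "eps\<^sup>2"] by (simp add: mult.commute)

lemma lipb_fA: "lipb fA (81/1000) (17/10000)"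
  unfolding fA_def[abs_def]
  by (rule lipb_mono[OF lipb_add[OF lipb_e2s2 lipb_pr[OF lipb_opR_sz(2) lipb_opR_sz(2)]]])
    (simp_all add: radius_def eps_def power2_eq_square)

lemma lipb_fB: "lipb fB (81/1000) (17/10000)"
  unfolding fB_def[abs_def]
  by (rule lipb_mono[OF lipb_pr[OF lipb_opR_sz(1) lipb_opR_sz(1)]])
    (simp_all add: radius_def)

lemma lipb_fG: "lipb fG 600 25"
  unfolding fG_def[abs_def]
  by (rule lipb_mono[OF lipb_add[OF lipb_pr[OF lipb_const[OF sgW(2)] lipb_opR_sz(2)]
        lipb_pr[OF lipb_pr[OF lipb_const[OF sgW(2)] lipb_opR_sz(2)] lipb_components(4)]]])
    (simp_all add: radius_def)

lemma lipb_fN: "lipb fN (17/100) (34/10000)"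
  unfolding fN_def[abs_def]
  by (rule lipb_mono[OF lipb_add[OF lipb_add[OF lipb_pr[OF lipb_opR_sz(3) lipb_components(2)]
     lipb_uminus[OF lipb_scaleR[OF lipb_add[OF lipb_fG lipb_pr[OF lipb_fG lipb_components(2)]]]]]
     lipb_uminus[OF lipb_pr[OF lipb_opR_sz(1) lipb_components(3)]]]])
    (simp_all add: radius_def eps_def power2_eq_square)

lemma lipb_stepz: "lipb stepz (17/100) (16/1000)"
  unfolding stepz_def[abs_def]
  by (rule lipb_mono[OF lipb_add[OF lipb_const[OF Z0(2)] lipb_op[OF norm_opK opK_diff lipb_fN]]]) simp_all

lemma lipb_stepa: "lipb stepa (9/100) (2/1000)"
  unfolding stepa_def[abs_def]
  by (rule lipb_mono[OF lipb_uminus[OF lipb_add[OF lipb_fA lipb_pr[OF lipb_fA lipb_components(2)]]]])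
   (simp_all add: radius_def)

lemma lipb_stepb: "lipb stepb (9/100) (2/1000)"
  unfolding stepb_def[abs_def]
  by (rule lipb_mono[OF lipb_uminus[OF lipb_add[OF lipb_fB lipb_pr[OF lipb_fB lipb_components(3)]]]])
   (simp_all add: radius_def)

lemma lipb_stepp: "lipb stepp (1/100) (1/1000)"
  unfolding stepp_def[abs_def]
  by (rule lipb_mono[OF lipb_uminus[OF lipb_add[OF lipb_e2s2 lipb_pr[OF lipb_e2s2 lipb_components(4)]]]])
   (simp_all add: radius_def eps_def power2_eq_square)

lemma norm_tuple4_le: "norm (a, b, c, d) \<le> norm a + norm b + norm c + norm (d :: 'd::real_normed_vector)"
proof -
  have "norm (a, b, c, d) \<le> norm a + norm (b, c, d)" by (rule norm_Pair_le)
  also have "norm (b, c, d) \<le> norm b + norm (c, d)" by (rule norm_Pair_le)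
  also have "norm (c, d) \<le> norm c + norm d" by (rule norm_Pair_le)
  finally show ?thesis by simp
qed

definition symst :: "state \<Rightarrow> bool" where
  "symst y \<longleftrightarrow> sym (sz y) \<and> sym (sa y) \<and> sym (sb y) \<and> sym (sp y)"

lemma symst_step: assumes "symst y" shows "symst (step y)"
proof -
  have s: "sym (sz y)" "sym (sa y)" "sym (sb y)" "sym (sp y)" using assms by (auto simp: symst_def)
  have "sym (fA y)" "sym (fB y)" "sym (fG y)"
    unfolding fA_def fB_def fG_def
    by (intro sym_add sym_pr sym_scaleR sym_opR s sym_s2W sym_sgW; simp)+
  then have "sym (stepz y)" "sym (stepa y)" "sym (stepb y)" "sym (stepp y)"
    unfolding stepz_def stepa_def stepb_def stepp_def fN_def
    by (intro sym_add sym_opK sym_Z0 sym_pr sym_uminus sym_scaleR sym_opR s sym_s2W sym_sgW; simp)+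
  then show ?thesis by (simp add: symst_def step_def sz_def sa_def sb_def sp_def)
qed

text \<open>The library proves completeness only for functions on a metric space, which \<open>int\<close> is not.\<close>

lemma wiener_Cauchy_convergent:
  fixes f :: "nat \<Rightarrow> wiener"
  assumes "Cauchy f" shows "\<exists>l. f \<longlonglongrightarrow> l"
proof -
  have "\<exists>N. \<forall>m n x. N \<le> m \<and> N \<le> n \<longrightarrow> dist (f m x) (f n x) < e" if "e > 0" for e
    using assms that dist_bounded unfolding Cauchy_def by (metis le_less_trans)
  then obtain g where g: "uniform_limit UNIV (\<lambda>n. apply_bcontfun (f n)) g sequentially"
    using uniformly_convergent_eq_cauchy[of "\<lambda>_. True" "\<lambda>n. apply_bcontfun (f n)"]
    unfolding uniform_limit_sequentially_iff by auto
  obtain l where "f \<longlonglongrightarrow> l" using uniform_limit_bcontfunE[OF g sequentially_bot] by metis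
  then show ?thesis ..
qed

text \<open>The bounds of the four components add up to 21/1000, below the radius 40/1000, and their
  Lipschitz constants to 36/100, below 1/2. The symmetry of the coefficients is made part of the
  closed set on which the contraction acts, so that the fixed point represents real-valued
  functions.\<close>

lemma step_fixpoint: "\<exists>y. norm y \<le> radius \<and> symst y \<and> step y = y"
proof -
  define D where "D = {y. norm y \<le> radius \<and> symst y}"
  define Sy where "Sy = {y. sym y}"
  have cS: "closed Sy" unfolding Sy_def by (rule closed_sym)
  have "continuous_on UNIV sz" "continuous_on UNIV sa" "continuous_on UNIV sb" "continuous_on UNIV sp"
    unfolding sz_def[abs_def] sa_def[abs_def] sb_def[abs_def] sp_def[abs_def]
    by (intro continuous_intros)+
  then have "closed (sz -` Sy)" "closed (sa -` Sy)" "closed (sb -` Sy)" "closed (sp -` Sy)"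
    using closed_vimage[OF cS] by blast+
  then have "closed (sz -` Sy \<inter> (sa -` Sy \<inter> (sb -` Sy \<inter> (sp -` Sy \<inter> cball 0 radius))))"
    by (intro closed_Int closed_cball)
  moreover have "D = sz -` Sy \<inter> (sa -` Sy \<inter> (sb -` Sy \<inter> (sp -` Sy \<inter> cball 0 radius)))"
    by (rule set_eqI) (simp add: D_def symst_def Sy_def conj_comms)
  ultimately have "closed D" by (simp only:)
  have c: "complete D"
  proof (rule completeI)
    fix f :: "nat \<Rightarrow> state" assume f: "\<forall>n. f n \<in> D" "Cauchy f"
    \<comment> \<open>Completeness of the product is obtained from that of each factor: every
      component map is linear and does not increase the norm.\<close>
    have lim: "\<exists>l. (\<lambda>n. g (f n)) \<longlonglongrightarrow> l"
      if g: "\<And>a b. norm (g a - g b) \<le> norm (a - b)" for g :: "state \<Rightarrow> wiener"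
    proof (rule wiener_Cauchy_convergent)
      show "Cauchy (\<lambda>n. g (f n))"
      proof (rule metric_CauchyI)
        fix e :: real assume "e > 0"
        then obtain M where "\<And>m n. m \<ge> M \<Longrightarrow> n \<ge> M \<Longrightarrow> dist (f m) (f n) < e"
          using f(2) unfolding Cauchy_def by blast
        moreover have "dist (g a) (g b) \<le> dist a b" for a b unfolding dist_norm by (rule g)
        ultimately have "\<And>m n. m \<ge> M \<Longrightarrow> n \<ge> M \<Longrightarrow> dist (g (f m)) (g (f n)) < e"
          using le_less_trans by blast
        then show "\<exists>M. \<forall>m\<ge>M. \<forall>n\<ge>M. dist (g (f m)) (g (f n)) < e" by blast
      qed
    qed
    have d: "sz a - sz b = sz (a - b)" "sa a - sa b = sa (a - b)" "sb a - sb b = sb (a - b)"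
      "sp a - sp b = sp (a - b)" for a b by (simp_all add: sz_def sa_def sb_def sp_def)
    have n: "norm (sz a - sz b) \<le> norm (a - b)" "norm (sa a - sa b) \<le> norm (a - b)"
      "norm (sb a - sb b) \<le> norm (a - b)" "norm (sp a - sp b) \<le> norm (a - b)" for a b
      unfolding d by (rule norm_components)+
    obtain l1 where l1: "(\<lambda>n. sz (f n)) \<longlonglongrightarrow> l1" using lim[OF n(1)] ..
    obtain l2 where l2: "(\<lambda>n. sa (f n)) \<longlonglongrightarrow> l2" using lim[OF n(2)] ..
    obtain l3 where l3: "(\<lambda>n. sb (f n)) \<longlonglongrightarrow> l3" using lim[OF n(3)] ..
    obtain l4 where l4: "(\<lambda>n. sp (f n)) \<longlonglongrightarrow> l4" using lim[OF n(4)] ..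
    from l1 l2 l3 l4 have "(\<lambda>n. (sz (f n), sa (f n), sb (f n), sp (f n))) \<longlonglongrightarrow> (l1, l2, l3, l4)"
      by (intro tendsto_Pair)
    moreover have "(\<lambda>n. (sz (f n), sa (f n), sb (f n), sp (f n))) = f"
      by (rule ext) (simp add: sz_def sa_def sb_def sp_def)
    ultimately have l: "f \<longlonglongrightarrow> (l1, l2, l3, l4)" by (simp only:)
    then have "(l1, l2, l3, l4) \<in> D"
      using closed_sequentially[OF \<open>closed D\<close>] f(1) by blast
    then show "\<exists>l\<in>D. f \<longlonglongrightarrow> l" using l by blast
  qed
  have "sym 0" by (simp add: sym_def coef_def)
  then have "0 \<in> D" by (simp add: D_def symst_def radius_def sz_def sa_def sb_def sp_def)
  then have ne: "D \<noteq> {}" by blast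
  have self: "step ` D \<subseteq> D"
  proof
    fix x assume "x \<in> step ` D"
    then obtain y where y: "x = step y" "norm y \<le> radius" "symst y" unfolding D_def by blast
    have "norm x \<le> norm (stepz y) + norm (stepa y) + norm (stepb y) + norm (stepp y)"
      unfolding y(1) step_def by (rule norm_tuple4_le)
    also have "\<dots> \<le> 16/1000 + 2/1000 + 2/1000 + 1/1000"
      by (intro add_mono lipbD(3)[OF lipb_stepz y(2)] lipbD(3)[OF lipb_stepa y(2)]
          lipbD(3)[OF lipb_stepb y(2)] lipbD(3)[OF lipb_stepp y(2)])
    also have "\<dots> \<le> radius" by (simp add: radius_def)
    finally have "norm x \<le> radius" .
    then show "x \<in> D" using symst_step[OF y(3)] y(1) by (simp only: D_def mem_Collect_eq simp_thms)
  qed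
  have lip: "dist (step y) (step y') \<le> (1/2) * dist y y'" if "y \<in> D" "y' \<in> D" for y y'
  proof -
    have n: "norm y \<le> radius" "norm y' \<le> radius" using that by (simp_all only: D_def mem_Collect_eq)
    have "step y - step y' = (stepz y - stepz y', stepa y - stepa y', stepb y - stepb y', stepp y - stepp y')"
      by (simp only: step_def diff_Pair)
    then have "norm (step y - step y') \<le> norm (stepz y - stepz y') + norm (stepa y - stepa y')
        + norm (stepb y - stepb y') + norm (stepp y - stepp y')"
      using norm_tuple4_le by (simp only:)
    also have "\<dots> \<le> (17/100) * norm (y - y') + (9/100) * norm (y - y') + (9/100) * norm (y - y')
        + (1/100) * norm (y - y')"
      by (intro add_mono lipbD(4)[OF lipb_stepz n] lipbD(4)[OF lipb_stepa n]
          lipbD(4)[OF lipb_stepb n] lipbD(4)[OF lipb_stepp n])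
    also have "\<dots> \<le> (1/2) * norm (y - y')" using norm_ge_zero[of "y - y'"] by linarith
    finally show ?thesis by (simp only: dist_norm)
  qed
  have "\<exists>!y\<in>D. step y = y"
    by (rule Banach_fix[OF c ne _ _ self lip]) auto
  then obtain y where "y \<in> D" "step y = y" by blast
  then show ?thesis unfolding D_def by blast
qed

section \<open>Fourier series with given coefficients\<close>

definition fser :: "nat \<Rightarrow> wiener \<Rightarrow> real \<Rightarrow> real \<Rightarrow> complex" where
  "fser k y t x = (\<Sum>\<^sub>\<infinity>n. (\<i> * of_int n) ^ k * coef y n t * cis (of_int n * x))"

text \<open>The constant depends only on the order \<open>k\<close> of differentiation. The
  resulting majorant is independent of time and space, so every space derivative of the series
  converges uniformly.\<close>

lemma fser_term_le:
  "\<exists>C. C \<ge> 0 \<and> (\<forall>y n t x. cmod ((\<i> * of_int n) ^ k * coef y n t * cis (of_int n * x)) \<le> C * norm y * invsq n)"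
proof -
  obtain C where C: "C \<ge> 0" "\<And>n. \<bar>real_of_int n\<bar> ^ k / wt n \<le> C * invsq n"
    using abs_power_le_wt[of k] by blast
  have "cmod ((\<i> * of_int n) ^ k * coef y n t * cis (of_int n * x)) \<le> C * norm y * invsq n" for y n t x
  proof -
    have "cmod ((\<i> * of_int n) ^ k * coef y n t * cis (of_int n * x)) = \<bar>real_of_int n\<bar> ^ k * cmod (coef y n t)"
      by (simp add: norm_mult norm_power)
    also have "\<dots> \<le> \<bar>real_of_int n\<bar> ^ k * (norm y / wt n)"
      by (intro mult_left_mono coef_le) auto
    also have "\<dots> = norm y * (\<bar>real_of_int n\<bar> ^ k / wt n)" by simp
    also have "\<dots> \<le> norm y * (C * invsq n)" by (intro mult_left_mono C) auto
    finally show ?thesis by (simp add: mult_ac)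
  qed
  with C(1) show ?thesis by (intro exI[of _ C]) simp
qed

lemma invsq_majorant: "(\<lambda>n. c * invsq n) summable_on UNIV"
  by (intro summable_on_cmult_right invsq_summable)

lemma fser_summable: "(\<lambda>n. (\<i> * of_int n) ^ k * coef y n t * cis (of_int n * x)) summable_on UNIV"
proof -
  obtain C where C0: "C \<ge> 0 \<and> (\<forall>y n t x. cmod ((\<i> * of_int n) ^ k * coef y n t * cis (of_int n * x)) \<le> C * norm y * invsq n)"
    using fser_term_le[of k] ..
  note C = conjunct1[OF C0] conjunct2[OF C0, rule_format]
  show ?thesis
    by (rule abs_summable_summable[OF Infinite_Sum.abs_summable_on_comparison_test'[OF invsq_majorant C(2)]])
qed

lemma fser_continuous: "continuous_on UNIV (\<lambda>z. fser k y (fst z) (snd z))"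
proof -
  obtain C where C0: "C \<ge> 0 \<and> (\<forall>y n t x. cmod ((\<i> * of_int n) ^ k * coef y n t * cis (of_int n * x)) \<le> C * norm y * invsq n)"
    using fser_term_le[of k] ..
  note C = conjunct1[OF C0] conjunct2[OF C0, rule_format]
  show ?thesis unfolding fser_def
  proof (rule continuous_on_infsum[OF _ C(2) invsq_majorant])
    fix n
    have "continuous_on UNIV (\<lambda>z::real \<times> real. coef y n (fst z))"
      by (rule continuous_on_compose2[OF coef_continuous[of UNIV]]) (auto intro: continuous_intros)
    moreover have "continuous_on UNIV (\<lambda>z::real \<times> real. cis (of_int n * snd z))"
      unfolding cis_conv_exp by (intro continuous_intros)
    ultimately show "continuous_on UNIV (\<lambda>z. (\<i> * of_int n) ^ k * coef y n (fst z) * cis (of_int n * snd z))"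
      by (intro continuous_on_mult continuous_on_const)
  qed
qed

lemma fser_derivative:
  "((\<lambda>x. fser k y t x) has_vector_derivative fser (Suc k) y t x) (at x)"
proof -
  obtain C where C0: "C \<ge> 0 \<and> (\<forall>y n t x. cmod ((\<i> * of_int n) ^ k * coef y n t * cis (of_int n * x)) \<le> C * norm y * invsq n)"
    using fser_term_le[of k] ..
  note C = conjunct1[OF C0] conjunct2[OF C0, rule_format]
  obtain C' where C'0: "C' \<ge> 0 \<and> (\<forall>y n t x. cmod ((\<i> * of_int n) ^ Suc k * coef y n t * cis (of_int n * x)) \<le> C' * norm y * invsq n)"
    using fser_term_le[of "Suc k"] ..
  note C' = conjunct1[OF C'0] conjunct2[OF C'0, rule_format]
  have m: "C * norm y * invsq n \<le> (C + C') * norm y * invsq n" "C' * norm y * invsq n \<le> (C + C') * norm y * invsq n" for n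
    using C(1) C'(1) invsq_nonneg[of n] by (auto intro!: mult_right_mono)
  show ?thesis unfolding fser_def
  proof (rule has_vector_derivative_infsum[OF convex_UNIV UNIV_I _ _ _ invsq_majorant])
    show "((\<lambda>x. (\<i> * of_int n) ^ k * coef y n t * cis (of_int n * x)) has_vector_derivative
        (\<i> * of_int n) ^ Suc k * coef y n t * cis (of_int n * x)) (at x)" for n x
    proof -
      have "((\<lambda>x. exp (of_real x * (\<i> * of_int n))) has_vector_derivative
          (exp (of_real x * (\<i> * of_int n)) * (\<i> * of_int n))) (at x)"
        by (rule has_vector_derivative_eq_rhs, rule has_vector_derivative_real_field,
            auto intro!: derivative_eq_intros)
      then have "((\<lambda>x. cis (of_int n * x)) has_vector_derivative (\<i> * of_int n) * cis (of_int n * x)) (at x)"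
        by (simp add: cis_conv_exp mult_ac)
      then have "((\<lambda>x. ((\<i> * of_int n) ^ k * coef y n t) * cis (of_int n * x)) has_vector_derivative
          ((\<i> * of_int n) ^ k * coef y n t) * ((\<i> * of_int n) * cis (of_int n * x))) (at x)"
        by (rule has_vector_derivative_mult_right)
      then show ?thesis by (simp add: mult_ac)
    qed
    show "cmod ((\<i> * of_int n) ^ k * coef y n t * cis (of_int n * x)) \<le> (C + C') * norm y * invsq n" for n x
      by (rule order_trans[OF C(2) m(1)])
    show "cmod ((\<i> * of_int n) ^ Suc k * coef y n t * cis (of_int n * x)) \<le> (C + C') * norm y * invsq n" for n x
      by (rule order_trans[OF C'(2) m(2)])
  qed
qed

text \<open>It suffices to differentiate each mode, since the modes of the derivative are again
  those of an element \<open>v\<close> of the weighted space and are dominated by the same multiple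
  of \<open>invsq\<close>.\<close>

lemma fser_time_derivative:
  assumes "\<And>n t. t \<ge> 0 \<Longrightarrow> (coef u n has_vector_derivative coef v n t) (at t within {0..})" "t \<ge> 0"
  shows "((\<lambda>t. fser k u t x) has_vector_derivative fser k v t x) (at t within {0..})"
proof -
  obtain C where C0: "C \<ge> 0 \<and> (\<forall>y n t x. cmod ((\<i> * of_int n) ^ k * coef y n t * cis (of_int n * x)) \<le> C * norm y * invsq n)"
    using fser_term_le[of k] ..
  note C = conjunct1[OF C0] conjunct2[OF C0, rule_format]
  have m: "C * norm y * invsq n \<le> C * (norm u + norm v) * invsq n" if "y = u \<or> y = v" for n y
    using C(1) invsq_nonneg[of n] that by (auto intro!: mult_right_mono mult_left_mono)
  show ?thesis unfolding fser_def
  proof (rule has_vector_derivative_infsum[OF _ _ _ _ _ invsq_majorant])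
    show "((\<lambda>t. (\<i> * of_int n) ^ k * coef u n t * cis (of_int n * x)) has_vector_derivative
        (\<i> * of_int n) ^ k * coef v n t * cis (of_int n * x)) (at t within {0..})" if "t \<in> {0..}" for n t
      using assms(1)[of t n] that
      by (intro has_vector_derivative_mult_left has_vector_derivative_mult_right) auto
    show "cmod ((\<i> * of_int n) ^ k * coef u n t * cis (of_int n * x)) \<le> C * (norm u + norm v) * invsq n" for n t
      by (rule order_trans[OF C(2) m]) simp
    show "cmod ((\<i> * of_int n) ^ k * coef v n t * cis (of_int n * x)) \<le> C * (norm u + norm v) * invsq n" for n t
      by (rule order_trans[OF C(2) m]) simp
  qed (use assms(2) in auto)
qed

text \<open>The weight is at least 20 (1 + n^2), and the sum of \<open>invsq\<close> is at most 5;
  5/20 = 1/4.\<close>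

lemma fser_le: "cmod (fser 0 y t x) \<le> norm y / 4"
proof -
  have le: "cmod ((\<i> * of_int n) ^ 0 * coef y n t * cis (of_int n * x)) \<le> norm y / 20 * invsq n" for n
  proof -
    have "cmod (coef y n t) \<le> norm y * (1 / wt n)" using coef_le[of y n t] by simp
    also have "\<dots> \<le> norm y * (invsq n / 20)" by (intro mult_left_mono inverse_wt_le) auto
    finally show ?thesis by (simp add: norm_mult)
  qed
  have "cmod (fser 0 y t x) \<le> (\<Sum>\<^sub>\<infinity>n. norm y / 20 * invsq n)"
    unfolding fser_def
    by (rule norm_infsum_le[OF has_sum_infsum[OF fser_summable] has_sum_infsum[OF invsq_majorant] le])
  also have "\<dots> = norm y / 20 * infsum invsq UNIV" by (rule infsum_cmult_right')
  also have "\<dots> \<le> norm y / 20 * 5" by (intro mult_left_mono infsum_invsq_le) auto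
  finally show ?thesis by simp
qed

lemma fser_bounded: "\<exists>B. \<forall>t x. cmod (fser k y t x) \<le> B"
proof -
  obtain C where C0: "C \<ge> 0 \<and> (\<forall>y n t x. cmod ((\<i> * of_int n) ^ k * coef y n t * cis (of_int n * x)) \<le> C * norm y * invsq n)"
    using fser_term_le[of k] ..
  note C = conjunct1[OF C0] conjunct2[OF C0, rule_format]
  have "cmod (fser k y t x) \<le> (\<Sum>\<^sub>\<infinity>n. C * norm y * invsq n)" for t x
    unfolding fser_def
    by (rule norm_infsum_le[OF has_sum_infsum[OF fser_summable] has_sum_infsum[OF invsq_majorant] C(2)])
  then show ?thesis by blast
qed

lemma fser_add: "fser k (a + b) t x = fser k a t x + fser k b t x"
  unfolding fser_def by (subst infsum_add[OF fser_summable fser_summable, symmetric]) (simp add: algebra_simps)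

lemma fser_scaleR: "fser k (c *\<^sub>R a) t x = c *\<^sub>R fser k a t x"
  unfolding fser_def scaleR_conv_of_real
  by (subst infsum_cmult_right'[symmetric]) (simp add: scaleR_conv_of_real mult_ac)

lemma fser_uminus: "fser k (- a) t x = - fser k a t x"
  using fser_scaleR[of k "-1" a t x] by simp

lemma fser_diff: "fser k (a - b) t x = fser k a t x - fser k b t x"
  using fser_add[of k a "- b" t x] by (simp add: fser_uminus)

lemma fser_periodic: "fser k y t (x + 2 * pi) = fser k y t x"
proof -
  have "cis (of_int n * (x + 2 * pi)) = cis (of_int n * x)" for n
  proof -
    have "cis (of_int n * (x + 2 * pi)) = cis (of_int n * x) * cis (2 * pi * of_int n)"
      by (simp add: cis_mult algebra_simps)
    also have "cis (2 * pi * of_int n) = 1" by (rule cis_multiple_2pi) auto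
    finally show ?thesis by simp
  qed
  then show ?thesis by (simp add: fser_def)
qed

lemma fser_real: assumes "sym y" shows "fser 0 y t x \<in> \<real>"
proof -
  have "cnj (fser 0 y t x) = (\<Sum>\<^sub>\<infinity>n. cnj (coef y n t * cis (of_int n * x)))"
    by (simp add: fser_def flip: infsum_cnj)
  also have "\<dots> = (\<Sum>\<^sub>\<infinity>n. coef y (- n) t * cis (of_int (- n) * x))"
    using assms by (simp add: sym_def cis_cnj)
  also have "\<dots> = fser 0 y t x"
    unfolding fser_def
    by (subst infsum_reindex_bij_betw[of uminus UNIV UNIV "\<lambda>n. coef y n t * cis (of_int n * x)"])
      (auto intro!: bij_betwI[where g=uminus])
  finally show ?thesis using Reals_cnj_iff by blast
qed

text \<open>This is the Cauchy product: the shear (n, k) \<mapsto> (k, n - k) turns the double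
  series of the convolution into the product of two absolutely convergent series.\<close>

lemma fser_pr: "fser 0 (pr a b) t x = fser 0 a t x * fser 0 b t x"
proof -
  define f where "f k = coef a k t * cis (of_int k * x)" for k
  define g where "g k = coef b k t * cis (of_int k * x)" for k
  have fs: "(\<lambda>k. norm (f k)) summable_on UNIV" and gs: "(\<lambda>k. norm (g k)) summable_on UNIV"
  proof -
    have *: "(\<lambda>k. norm (coef y k t * cis (of_int k * x))) summable_on UNIV" for y
      using fser_summable[of 0 y t x]
      by (simp add: summable_on_iff_abs_summable_on_complex)
    show "(\<lambda>k. norm (f k)) summable_on UNIV" "(\<lambda>k. norm (g k)) summable_on UNIV"
      unfolding f_def g_def by (rule *)+
  qed
  have prod: "(\<lambda>(k, j). f k * g j) summable_on UNIV \<times> UNIV"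
  proof -
    have "(\<lambda>z. norm (case z of (k, j) \<Rightarrow> f k * g j)) summable_on UNIV \<times> UNIV"
    proof (rule nonneg_bdd_above_summable_on)
      show "bdd_above (sum (\<lambda>z. norm (case z of (k, j) \<Rightarrow> f k * g j)) ` {F. F \<subseteq> UNIV \<times> UNIV \<and> finite F})"
      proof (rule bdd_aboveI2)
        fix F :: "(int \<times> int) set" assume "F \<in> {F. F \<subseteq> UNIV \<times> UNIV \<and> finite F}"
        then have F: "finite F" by simp
        have "sum (\<lambda>z. norm (case z of (k, j) \<Rightarrow> f k * g j)) F \<le>
            sum (\<lambda>z. norm (case z of (k, j) \<Rightarrow> f k * g j)) (fst ` F \<times> snd ` F)"
        proof (rule sum_mono2)
          show "F \<subseteq> fst ` F \<times> snd ` F" by (auto intro: rev_image_eqI)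
        qed (use F in auto)
        also have "\<dots> = (\<Sum>k\<in>fst ` F. norm (f k)) * (\<Sum>j\<in>snd ` F. norm (g j))"
          by (simp add: sum_product sum.cartesian_product norm_mult split_beta)
        also have "\<dots> \<le> (\<Sum>\<^sub>\<infinity>k. norm (f k)) * (\<Sum>\<^sub>\<infinity>j. norm (g j))"
          using F fs gs by (intro mult_mono finite_sum_le_infsum sum_nonneg infsum_nonneg) auto
        finally show "sum (\<lambda>z. norm (case z of (k, j) \<Rightarrow> f k * g j)) F \<le>
            (\<Sum>\<^sub>\<infinity>k. norm (f k)) * (\<Sum>\<^sub>\<infinity>j. norm (g j))" .
      qed
    qed simp
    then show ?thesis by (rule abs_summable_summable)
  qed
  have bij: "bij_betw (\<lambda>(n, k). (k, n - k)) (UNIV \<times> UNIV) (UNIV \<times> (UNIV :: int set))"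
    by (rule bij_betwI[where g="\<lambda>(k, j). (k + j, k)"]) auto
  have prod': "(\<lambda>(n, k). f k * g (n - k)) summable_on UNIV \<times> UNIV"
    using summable_on_reindex_bij_betw[OF bij, of "\<lambda>(k, j). f k * g j"] prod
    by (simp add: case_prod_unfold)
  have fg: "coef a k t * coef b (n - k) t * cis (of_int n * x) = f k * g (n - k)" for n k
  proof -
    have "cis (of_int n * x) = cis (of_int k * x) * cis (of_int (n - k) * x)"
      by (simp add: cis_mult algebra_simps)
    then show ?thesis by (simp add: f_def g_def)
  qed
  have "fser 0 (pr a b) t x = (\<Sum>\<^sub>\<infinity>n. \<Sum>\<^sub>\<infinity>k. f k * g (n - k))"
    unfolding fser_def coef_pr fg[symmetric] by (simp add: infsum_cmult_left')
  also have "\<dots> = infsum (\<lambda>(n, k). f k * g (n - k)) (UNIV \<times> UNIV)"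
    by (rule infsum_Sigma'_banach[OF prod'])
  also have "\<dots> = infsum (\<lambda>(k, j). f k * g j) (UNIV \<times> UNIV)"
    using infsum_reindex_bij_betw[OF bij, of "\<lambda>(k, j). f k * g j"] by (simp add: case_prod_unfold)
  also have "\<dots> = (\<Sum>\<^sub>\<infinity>k. \<Sum>\<^sub>\<infinity>j. f k * g j)"
    by (rule infsum_Sigma'_banach[OF prod, symmetric])
  also have "\<dots> = (\<Sum>\<^sub>\<infinity>k. f k) * (\<Sum>\<^sub>\<infinity>j. g j)"
    by (simp add: infsum_cmult_right' infsum_cmult_left')
  finally show ?thesis by (simp add: fser_def f_def g_def)
qed

lemma fser_opR: assumes "j \<le> 2" shows "fser 0 (opR j y) t x = fser j (opR 0 y) t x"
  unfolding fser_def by (simp add: coef_opR assms coefR_def)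

text \<open>The symbols of the identity and of the second derivative, each divided by
  \<open>lam\<close>, differ by exactly 1; in functions, z = u - u''.\<close>

lemma fser_id: "fser 0 y t x = fser 0 (opR 0 y) t x - fser 2 (opR 0 y) t x"
proof -
  have "coef (opR 0 y - opR 2 y) n t = coef y n t" for n t
  proof -
    have "coef (opR 0 y - opR 2 y) n t = (of_real (lam n) * coef y n t) / of_real (lam n)"
      by (simp add: coef_opR coefR_def power2_eq_square lam_def algebra_simps diff_divide_distrib add_divide_distrib)
    then show ?thesis using lam_pos[of n] by simp
  qed
  then have "opR 0 y - opR 2 y = y" by (intro coef_eqI) simp
  then show ?thesis using fser_diff[of 0 "opR 0 y" "opR 2 y"] fser_opR[of 2] by simp
qed

lemma fser_finite:
  assumes "finite A" "\<And>n. n \<notin> A \<Longrightarrow> coef y n t = 0"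
  shows "fser 0 y t x = (\<Sum>n\<in>A. coef y n t * cis (of_int n * x))"
proof -
  have "fser 0 y t x = infsum (\<lambda>n. coef y n t * cis (of_int n * x)) A"
    unfolding fser_def by (rule infsum_cong_neutral) (use assms in auto)
  then show ?thesis using assms(1) by simp
qed

lemma fser_s2W: "fser 0 s2W t x = of_real ((sin x)\<^sup>2)"
proof -
  have "fser 0 s2W t x = (\<Sum>n\<in>{-2, 0, 2}. coef s2W n t * cis (of_int n * x))"
    by (rule fser_finite) (auto simp: s2W c_s2_def)
  also have "\<dots> = 1/2 - (1/4) * (cis (2 * x) + cis (- (2 * x)))"
    by (simp add: s2W c_s2_def algebra_simps)
  also have "\<dots> = of_real ((sin x)\<^sup>2)"
    by (rule complex_eqI; use cos_double_sin[of x] in \<open>simp add: field_simps\<close>)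
  finally show ?thesis .
qed

lemma fser_sgW: "fser 0 sgW t x = of_real (sin (2 * x))"
proof -
  have "fser 0 sgW t x = (\<Sum>n\<in>{-2, 2}. coef sgW n t * cis (of_int n * x))"
    by (rule fser_finite) (auto simp: sgW c_sg_def)
  also have "\<dots> = (\<i>/2) * (cis (- (2 * x)) - cis (2 * x))"
    by (simp add: sgW c_sg_def algebra_simps)
  also have "\<dots> = of_real (sin (2 * x))"
    by (rule complex_eqI) simp_all
  finally show ?thesis .
qed

lemma fser_Z0: "fser 0 (opR 0 Z0) 0 x = of_real (eps * sin x)"
proof -
  have "fser 0 (opR 0 Z0) 0 x = (\<Sum>n\<in>{-1, 1}. coef (opR 0 Z0) n 0 * cis (of_int n * x))"
    by (rule fser_finite) (auto simp: coef_opR Z0)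
  also have "\<dots> = of_real eps * ((\<i>/2) * (cis (- x) - cis x))"
    by (simp add: coef_opR coefR_def Z0 lam_def algebra_simps)
  also have "\<dots> = of_real (eps * sin x)"
    by (rule complex_eqI) simp_all
  finally show ?thesis .
qed

lemma coef_Z0_derivative:
  assumes "t \<ge> 0"
  shows "(coef Z0 n has_vector_derivative (- of_real (lam n) * coef Z0 n t)) (at t within {0..})"
proof -
  define c :: complex where "c = (if n = 1 then - \<i>/2 else if n = -1 then \<i>/2 else 0)"
  have "((\<lambda>t. 2 * eps * exp (- 2 * t)) has_real_derivative (- 2 * (2 * eps * exp (- 2 * t)))) (at t within {0..})"
    by (auto intro!: derivative_eq_intros)
  then have "((\<lambda>t. of_real (2 * eps * exp (- 2 * t)) * c) has_vector_derivative
      (of_real (- 2 * (2 * eps * exp (- 2 * t))) * c)) (at t within {0..})"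
    by (intro has_vector_derivative_mult_left has_vector_derivative_of_real)
  moreover have "of_real (- 2 * (2 * eps * exp (- 2 * t))) * c = - of_real (lam n) * coef Z0 n t"
    using assms by (simp add: Z0 c_def lam_def max_def)
  ultimately have "((\<lambda>t. of_real (2 * eps * exp (- 2 * t)) * c) has_vector_derivative
      (- of_real (lam n) * coef Z0 n t)) (at t within {0..})" by (simp only:)
  then show ?thesis
    by (rule has_vector_derivative_transform[rotated 2]) (use assms in \<open>auto simp: Z0 c_def max_def\<close>)
qed

text \<open>The profile equation in the parameter \<open>\<phi>\<close> with \<open>dx = sqrt (1 + eps\<^sup>2 sin\<^sup>2 \<phi>) d\<phi>\<close>, in which the initial
  profile becomes \<open>eps * sin \<phi>\<close>. \<open>U k\<close> and \<open>V k\<close> are the \<open>k\<close>-th space derivatives of the solution and of its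
  time derivative.\<close>

theorem helix_pde_phi:
  obtains U V :: "nat \<Rightarrow> real \<times> real \<Rightarrow> real" where
    "\<And>k. continuous_on UNIV (U k)" "\<And>k. continuous_on UNIV (V k)"
    "\<And>k t x. ((\<lambda>x. U k (t, x)) has_real_derivative U (Suc k) (t, x)) (at x)"
    "\<And>k t x. ((\<lambda>x. V k (t, x)) has_real_derivative V (Suc k) (t, x)) (at x)"
    "\<And>k t x. t \<ge> 0 \<Longrightarrow> ((\<lambda>t. U k (t, x)) has_real_derivative V k (t, x)) (at t within {0..})"
    "\<And>k. \<exists>B. \<forall>z. \<bar>U k z\<bar> \<le> B"
    "\<And>z. \<bar>U 0 z\<bar> \<le> 1/10" "\<And>z. \<bar>U 1 z\<bar> \<le> 1/10"
    "\<And>k t x. U k (t, x + 2 * pi) = U k (t, x)"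
    "\<And>t x. V 0 (t, x) = (U 2 (t, x) - eps\<^sup>2 * sin x * cos x * U 1 (t, x) / (1 + eps\<^sup>2 * (sin x)\<^sup>2))
        / (1 + eps\<^sup>2 * (sin x)\<^sup>2 + (U 1 (t, x))\<^sup>2) - U 0 (t, x) / (1 + (U 0 (t, x))\<^sup>2)"
    "\<And>x. U 0 (0, x) = eps * sin x"
proof -
  obtain y where y: "norm y \<le> radius" "symst y" "step y = y" using step_fixpoint by blast
  have fp: "sz y = stepz y" "sa y = stepa y" "sb y = stepb y" "sp y = stepp y"
  proof -
    have "sz (step y) = stepz y" "sa (step y) = stepa y" "sb (step y) = stepb y" "sp (step y) = stepp y"
      by (simp_all add: step_def sz_def sa_def sb_def sp_def)
    then show "sz y = stepz y" "sa y = stepa y" "sb y = stepb y" "sp y = stepp y" by (simp_all only: y(3))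
  qed
  have s: "sym (sz y)" "sym (sa y)" "sym (sb y)" "sym (sp y)" using y(2) by (simp_all add: symst_def)
  define u where "u = opR 0 (sz y)"
  \<comment> \<open>Since z = u - u'', the equation u_t = u'' - u + N reads u_t = N - z. The time
    derivative is thus again given by an element of the algebra, which provides all its space
    derivatives.\<close>
  define v where "v = fN y - sz y"
  define U where "U k z = Re (fser k u (fst z) (snd z))" for k z
  define V where "V k z = Re (fser k v (fst z) (snd z))" for k z
  have su: "sym u" unfolding u_def by (intro sym_opR s) simp
  have su1: "sym (opR 1 (sz y))" "sym (opR 2 (sz y))" by (intro sym_opR s; simp)+
  \<comment> \<open>Each mode satisfies z_n' = l (N_n - z_n) with l = \<open>lam n\<close>; the mode
    of u is z_n / l, so its derivative is N_n - z_n.\<close>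
  have dcoef: "(coef u n has_vector_derivative coef v n t) (at t within {0..})" if t: "t \<ge> 0" for n t
  proof -
    define l :: complex where "l = of_real (lam n)"
    have l: "l \<noteq> 0" using lam_pos[of n] by (simp add: l_def)
    have z: "coef (sz y) n t = coef Z0 n t + duhamel (lam n) (coef (fN y) n) t" for t
      by (subst fp(1)) (simp add: stepz_def coef_opK)
    have "((\<lambda>t. coef Z0 n t + duhamel (lam n) (coef (fN y) n) t) has_vector_derivative
        (- l * coef Z0 n t + l * (coef (fN y) n t - duhamel (lam n) (coef (fN y) n) t))) (at t within {0..})"
      unfolding l_def
      by (intro has_vector_derivative_add coef_Z0_derivative[OF t] duhamel_derivative[OF coef_continuous t])
    then have "((\<lambda>t. coef (sz y) n t / l) has_vector_derivative
        (- l * coef Z0 n t + l * (coef (fN y) n t - duhamel (lam n) (coef (fN y) n) t)) / l) (at t within {0..})"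
      unfolding z[symmetric] by (rule has_vector_derivative_divide)
    moreover have "(- l * coef Z0 n t + l * (coef (fN y) n t - duhamel (lam n) (coef (fN y) n) t)) / l
        = coef v n t"
      using l by (simp add: v_def z field_simps)
    moreover have "coef u n = (\<lambda>t. coef (sz y) n t / l)"
      by (rule ext) (simp add: u_def coef_opR coefR_def l_def)
    ultimately show ?thesis by simp
  qed
  have Re_deriv: "((\<lambda>x. Re (f x)) has_real_derivative Re D) F" if "(f has_vector_derivative D) F" for f D F
    using bounded_linear.has_vector_derivative[OF bounded_linear_Re that] by (simp add: has_real_derivative_iff_has_vector_derivative)
  have cU: "continuous_on UNIV (U k)" for k
    unfolding U_def by (intro continuous_intros fser_continuous)
  have cV: "continuous_on UNIV (V k)" for k
    unfolding V_def by (intro continuous_intros fser_continuous)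
  have dU: "((\<lambda>x. U k (t, x)) has_real_derivative U (Suc k) (t, x)) (at x)" for k t x
    unfolding U_def fst_conv snd_conv by (rule Re_deriv[OF fser_derivative])
  have dV: "((\<lambda>x. V k (t, x)) has_real_derivative V (Suc k) (t, x)) (at x)" for k t x
    unfolding V_def fst_conv snd_conv by (rule Re_deriv[OF fser_derivative])
  have dt: "((\<lambda>t. U k (t, x)) has_real_derivative V k (t, x)) (at t within {0..})" if "t \<ge> 0" for k t x
    unfolding U_def V_def fst_conv snd_conv by (rule Re_deriv[OF fser_time_derivative[OF dcoef that]])
  have bU: "\<exists>B. \<forall>z. \<bar>U k z\<bar> \<le> B" for k
  proof -
    obtain B where "\<And>t x. cmod (fser k u t x) \<le> B" using fser_bounded by blast
    then have "\<bar>U k z\<bar> \<le> B" for z unfolding U_def using abs_Re_le_cmod order_trans by blast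
    then show ?thesis by blast
  qed
  have nz: "norm (sz y) \<le> 4/100"
    using order_trans[OF norm_components(1) y(1)] by (simp add: radius_def)
  have U1: "fser 1 u t x = fser 0 (opR 1 (sz y)) t x" and U2: "fser 2 u t x = fser 0 (opR 2 (sz y)) t x" for t x
    unfolding u_def by (simp_all add: fser_opR)
  have b0: "\<bar>U 0 z\<bar> \<le> 1/10" for z
  proof -
    have "\<bar>U 0 z\<bar> \<le> norm u / 4" unfolding U_def by (rule order_trans[OF abs_Re_le_cmod fser_le])
    also have "norm u \<le> norm (sz y)" unfolding u_def by (rule norm_opR) simp
    finally show ?thesis using nz by simp
  qed
  have b1: "\<bar>U 1 z\<bar> \<le> 1/10" for z
  proof -
    have "\<bar>U 1 z\<bar> \<le> norm (opR 1 (sz y)) / 4" unfolding U_def U1 by (rule order_trans[OF abs_Re_le_cmod fser_le])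
    also have "norm (opR 1 (sz y)) \<le> norm (sz y)" by (rule norm_opR) simp
    finally show ?thesis using nz by simp
  qed
  have per: "U k (t, x + 2 * pi) = U k (t, x)" for k t x
    unfolding U_def by (simp add: fser_periodic)
  have pde: "V 0 (t, x) = (U 2 (t, x) - eps\<^sup>2 * sin x * cos x * U 1 (t, x) / (1 + eps\<^sup>2 * (sin x)\<^sup>2))
        / (1 + eps\<^sup>2 * (sin x)\<^sup>2 + (U 1 (t, x))\<^sup>2) - U 0 (t, x) / (1 + (U 0 (t, x))\<^sup>2)" for t x
  proof -
    define R where "R w = fser 0 w t x" for w
    define u0 where "u0 = U 0 (t, x)"
    define u1 where "u1 = U 1 (t, x)"
    define u2 where "u2 = U 2 (t, x)"
    define a where "a = Re (R (sa y))"
    define b where "b = Re (R (sb y))"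
    define p where "p = Re (R (sp y))"
    define e where "e = eps\<^sup>2"
    define q where "q = (sin x)\<^sup>2"
    have real: "R w = of_real (Re (R w))" if "sym w" for w
      unfolding R_def using fser_real[OF that] by (simp add: of_real_Re)
    have R: "R (opR 0 (sz y)) = of_real u0" "R (opR 1 (sz y)) = of_real u1" "R (opR 2 (sz y)) = of_real u2"
      "R (sa y) = of_real a" "R (sb y) = of_real b" "R (sp y) = of_real p"
    proof -
      have "u0 = Re (R (opR 0 (sz y)))" by (simp only: u0_def U_def fst_conv snd_conv R_def u_def)
      then show "R (opR 0 (sz y)) = of_real u0" using real[OF su[unfolded u_def]] by (simp only:)
      have "u1 = Re (R (opR 1 (sz y)))" by (simp only: u1_def U_def fst_conv snd_conv R_def U1)
      then show "R (opR 1 (sz y)) = of_real u1" using real[OF su1(1)] by (simp only:)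
      have "u2 = Re (R (opR 2 (sz y)))" by (simp only: u2_def U_def fst_conv snd_conv R_def U2)
      then show "R (opR 2 (sz y)) = of_real u2" using real[OF su1(2)] by (simp only:)
      show "R (sa y) = of_real a" "R (sb y) = of_real b" "R (sp y) = of_real p"
        unfolding a_def b_def p_def by (rule real[OF s(2)], rule real[OF s(3)], rule real[OF s(4)])
    qed
    have ops: "R (g + h) = R g + R h" "R (- g) = - R g" "R (c *\<^sub>R g) = of_real c * R g"
      "R (pr g h) = R g * R h" "R s2W = of_real q" "R sgW = of_real (2 * sin x * cos x)" for g h c
      unfolding R_def q_def
      by (simp_all only: fser_add fser_uminus fser_scaleR fser_pr fser_s2W fser_sgW sin_double scaleR_conv_of_real)
    have A: "R (fA y) = of_real (e * q + u1\<^sup>2)"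
      unfolding fA_def ops R e_def by (simp add: power2_eq_square)
    have B: "R (fB y) = of_real (u0\<^sup>2)"
      unfolding fB_def ops R by (simp add: power2_eq_square)
    have G: "R (fG y) = of_real (2 * sin x * cos x * u1 * (1 + p))"
      unfolding fG_def ops R by (simp add: algebra_simps)
    have N: "R (fN y) = of_real (u2 * a - e / 2 * (2 * sin x * cos x * u1 * (1 + p) * (1 + a)) - u0 * b)"
      unfolding fN_def ops R G e_def by (simp add: algebra_simps)
    have "R (sa y) = - (R (fA y) + R (fA y) * R (sa y))"
      by (subst fp(2)) (simp only: stepa_def ops)
    then have "a = - ((e * q + u1\<^sup>2) + (e * q + u1\<^sup>2) * a)"
      unfolding A R by (simp only: of_real_add[symmetric] of_real_mult[symmetric] of_real_minus[symmetric] of_real_eq_iff)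
    then have a: "(1 + a) * (1 + e * q + u1\<^sup>2) = 1" by (simp add: algebra_simps)
    have "R (sb y) = - (R (fB y) + R (fB y) * R (sb y))"
      by (subst fp(3)) (simp only: stepb_def ops)
    then have "b = - (u0\<^sup>2 + u0\<^sup>2 * b)"
      unfolding B R by (simp only: of_real_add[symmetric] of_real_mult[symmetric] of_real_minus[symmetric] of_real_eq_iff)
    then have b: "(1 + b) * (1 + u0\<^sup>2) = 1" by (simp add: algebra_simps)
    have "R (sp y) = - (of_real (eps\<^sup>2) * of_real q + of_real (eps\<^sup>2) * of_real q * R (sp y))"
      by (subst fp(4)) (simp only: stepp_def ops)
    then have "p = - (e * q + e * q * p)"
      unfolding e_def[symmetric] R by (simp only: of_real_add[symmetric] of_real_mult[symmetric] of_real_minus[symmetric] of_real_eq_iff)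
    then have p: "(1 + p) * (1 + e * q) = 1" by (simp add: algebra_simps)
    have pos: "1 + e * q > 0" "1 + e * q + u1\<^sup>2 > 0" "1 + u0\<^sup>2 > 0"
      by (simp_all add: e_def q_def add_pos_nonneg)
    have inv: "1 + a = 1 / (1 + e * q + u1\<^sup>2)" "1 + b = 1 / (1 + u0\<^sup>2)" "1 + p = 1 / (1 + e * q)"
      using a b p pos by (simp_all add: nonzero_eq_divide_eq)
    have Z: "R (sz y) = of_real (u0 - u2)"
      unfolding R_def using R(1) R(3) fser_id[of "sz y" t x] U2 by (simp add: R_def u_def)
    have "V 0 (t, x) = Re (R (fN y) - R (sz y))"
      by (simp add: V_def v_def R_def fser_diff)
    also have "\<dots> = u2 * a - e / 2 * (2 * sin x * cos x * u1 * (1 + p) * (1 + a)) - u0 * b - (u0 - u2)"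
      unfolding N Z of_real_diff[symmetric] by (rule Re_complex_of_real)
    also have "\<dots> = (u2 - e * sin x * cos x * u1 * (1 + p)) * (1 + a) - u0 * (1 + b)"
      by (simp add: algebra_simps)
    also have "\<dots> = (u2 - e * sin x * cos x * u1 / (1 + e * q)) / (1 + e * q + u1\<^sup>2) - u0 / (1 + u0\<^sup>2)"
      unfolding inv by simp
    finally show ?thesis by (simp only: u0_def u1_def u2_def e_def q_def)
  qed
  have init: "U 0 (0, x) = eps * sin x" for x
  proof -
    have "coef (sz y) n 0 = coef Z0 n 0" for n
      by (subst fp(1)) (simp add: stepz_def coef_opK duhamel_0)
    then have "fser 0 u 0 x = fser 0 (opR 0 Z0) 0 x"
      by (simp add: fser_def u_def coef_opR)
    then show ?thesis by (simp add: U_def fser_Z0 del: of_real_mult)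
  qed
  show ?thesis by (rule that[OF cU cV dU dV dt bU b0 b1 per pde init])
qed

section \<open>Functions on space-time\<close>

definition ST :: "(real \<times> real) set" where "ST = {0..} \<times> UNIV"

lemma approachable_ST [simp]: "approachable ST"
  unfolding ST_def by (intro approachable_Times_UNIV) simp

definition pt :: "(real \<times> real \<Rightarrow> real) \<Rightarrow> real \<times> real \<Rightarrow> real" where
  "pt f z = frechet_derivative f (at z within ST) (1, 0)"
definition px :: "(real \<times> real \<Rightarrow> real) \<Rightarrow> real \<times> real \<Rightarrow> real" where
  "px f z = frechet_derivative f (at z within ST) (0, 1)"

lemma smooth_on_partials:
  assumes "smooth_on ST f"
  shows smooth_on_pt: "smooth_on ST (pt f)" and smooth_on_px: "smooth_on ST (px f)"
  unfolding pt_def[abs_def] px_def[abs_def]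
  by (rule smooth_on_frechet_Basis[OF assms], simp add: Basis_prod_def)+

lemma partials_has_derivative:
  assumes "smooth_on ST f" "z \<in> ST"
  shows "(f has_derivative (\<lambda>v. fst v * pt f z + snd v * px f z)) (at z within ST)"
proof -
  have d: "(f has_derivative frechet_derivative f (at z within ST)) (at z within ST)"
    by (rule smooth_on_has_derivative[OF assms])
  have l: "linear (frechet_derivative f (at z within ST))" by (rule has_derivative_linear[OF d])
  have "frechet_derivative f (at z within ST) v = fst v * pt f z + snd v * px f z" for v
  proof -
    have "frechet_derivative f (at z within ST) (fst v *\<^sub>R (1, 0) + snd v *\<^sub>R (0, 1)) =
        fst v *\<^sub>R pt f z + snd v *\<^sub>R px f z"
      by (simp only: linear_add[OF l] linear_scale[OF l] pt_def px_def)
    then show ?thesis by simp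
  qed
  then show ?thesis by (intro has_derivative_eq_rhs[OF d] ext)
qed

lemma px_derivative:
  assumes "smooth_on ST f" "t \<ge> 0"
  shows "((\<lambda>x. f (t, x)) has_real_derivative px f (t, x)) (at x)"
proof -
  have 1: "((\<lambda>x. (t, x)) has_derivative (\<lambda>v. (0, v))) (at x within UNIV)"
    by (auto intro!: derivative_eq_intros)
  have "(\<lambda>x. (t, x)) ` UNIV \<subseteq> ST" using assms(2) by (auto simp: ST_def)
  from has_derivative_in_compose2[OF partials_has_derivative[OF assms(1)] this UNIV_I 1]
  show ?thesis by (simp add: has_field_derivative_def mult_commute_abs)
qed

lemma pt_derivative:
  assumes "smooth_on ST f" "t \<ge> 0"
  shows "((\<lambda>t. f (t, x)) has_real_derivative pt f (t, x)) (at t within {0..})"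
proof -
  have 1: "((\<lambda>t. (t, x)) has_derivative (\<lambda>v. (v, 0))) (at t within {0..})"
    by (auto intro!: derivative_eq_intros)
  have "(\<lambda>t. (t, x)) ` {0..} \<subseteq> ST" "t \<in> {0..}" using assms(2) by (auto simp: ST_def)
  from has_derivative_in_compose2[OF partials_has_derivative[OF assms(1)] this 1]
  show ?thesis by (simp add: has_field_derivative_def mult_commute_abs)
qed

lemma at_within_atLeast_nontrivial: "(0::real) \<le> t \<Longrightarrow> at t within {0..} \<noteq> bot"
  unfolding at_within_atLeast_eq
  by (simp add: trivial_limit_within islimpt_Icc)

lemma px_eqI:
  assumes "smooth_on ST f" "t \<ge> 0" "((\<lambda>x. f (t, x)) has_real_derivative D) (at x)"
  shows "px f (t, x) = D"
  using DERIV_unique[OF px_derivative[OF assms(1,2)] assms(3)] .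

lemma pt_eqI:
  assumes "smooth_on ST f" "t \<ge> 0" "((\<lambda>t. f (t, x)) has_real_derivative D) (at t within {0..})"
  shows "pt f (t, x) = D"
proof -
  have "((\<lambda>t. f (t, x)) has_vector_derivative pt f (t, x)) (at t within {0..})"
    "((\<lambda>t. f (t, x)) has_vector_derivative D) (at t within {0..})"
    using pt_derivative[OF assms(1,2)] assms(3) by (simp_all add: has_real_derivative_iff_has_vector_derivative)
  then show ?thesis
    using vector_derivative_unique_within[OF at_within_atLeast_nontrivial[OF assms(2)]] by blast
qed

text \<open>Existence of the time derivative together with continuity of the space derivative
  suffices for total differentiability.\<close>

lemma has_derivative_continuous_partials:
  fixes f :: "real \<times> real \<Rightarrow> real"
  assumes "\<And>t x. t \<ge> 0 \<Longrightarrow> ((\<lambda>t. f (t, x)) has_real_derivative ft (t, x)) (at t within {0..})"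
    and "\<And>t x. t \<ge> 0 \<Longrightarrow> ((\<lambda>x. f (t, x)) has_real_derivative fx (t, x)) (at x)"
    and "continuous_on ST fx" "z \<in> ST"
  shows "(f has_derivative (\<lambda>v. fst v * ft z + snd v * fx z)) (at z within ST)"
proof -
  obtain t x where z: "z = (t, x)" "t \<ge> 0" using assms(4) by (auto simp: ST_def)
  have "((\<lambda>(t, x). f (t, x)) has_derivative
      (\<lambda>(a, b). (\<lambda>h. h * ft (t, x)) a + blinfun_apply (blinfun_mult_right (fx (t, x))) b)) (at (t, x) within {0..} \<times> UNIV)"
  proof (rule has_derivative_partialsI)
    show "((\<lambda>t. f (t, x)) has_derivative (\<lambda>h. h * ft (t, x))) (at t within {0..})"
      using assms(1)[OF z(2)] by (simp add: has_field_derivative_def mult_commute_abs)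
    show "((\<lambda>x. f (t, x)) has_derivative blinfun_apply (blinfun_mult_right (fx (t, x)))) (at x within UNIV)"
      if "t \<in> {0..}" for t x
      using assms(2)[of t x] that by (simp add: has_field_derivative_def)
    have "continuous (at (t, x) within {0..} \<times> UNIV) fx"
      using assms(3) z(2) by (auto simp: continuous_on_eq_continuous_within ST_def)
    then show "continuous (at (t, x) within {0..} \<times> UNIV) (\<lambda>(t, x). blinfun_mult_right (fx (t, x)))"
      by (auto simp: split_beta' intro!: continuous_intros)
  qed auto
  then show ?thesis
    unfolding z(1) ST_def by (rule has_derivative_eq_rhs[OF has_derivative_transform[rotated 2]])
       (use z(2) in \<open>auto simp: fun_eq_iff\<close>)
qed

section \<open>Regularity in time and a class closed under differentiation\<close>

inductive_set pcl :: "(nat \<Rightarrow> real \<times> real \<Rightarrow> real) \<Rightarrow> (real \<times> real \<Rightarrow> real) set" for U where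
  gen: "U k \<in> pcl U"
| sin: "(\<lambda>z. sin (snd z)) \<in> pcl U"
| cos: "(\<lambda>z. cos (snd z)) \<in> pcl U"
| const: "(\<lambda>z. c) \<in> pcl U"
| add: "f \<in> pcl U \<Longrightarrow> g \<in> pcl U \<Longrightarrow> (\<lambda>z. f z + g z) \<in> pcl U"
| mult: "f \<in> pcl U \<Longrightarrow> g \<in> pcl U \<Longrightarrow> (\<lambda>z. f z * g z) \<in> pcl U"
| inv: "f \<in> pcl U \<Longrightarrow> (\<And>z. f z \<ge> 1) \<Longrightarrow> (\<lambda>z. inverse (f z)) \<in> pcl U"
| rsqrt: "f \<in> pcl U \<Longrightarrow> (\<And>z. f z \<ge> 1) \<Longrightarrow> (\<lambda>z. inverse (sqrt (f z))) \<in> pcl U"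

text \<open>The curve \<open>c z\<close> passes through z at parameter \<open>\<tau> z\<close>.
  Keeping it abstract lets one induction serve both partial derivatives: the curve moves either
  space at fixed time or time, within the half-line, at fixed space.\<close>

lemma pcl_derivative:
  assumes c: "\<And>z. z \<in> Z \<Longrightarrow> c z (\<tau> z) = z"
    and gen: "\<And>k. \<exists>f'\<in>pcl U. \<forall>z\<in>Z. ((\<lambda>s. U k (c z s)) has_real_derivative f' z) (at (\<tau> z) within W)"
    and sin: "\<exists>f'\<in>pcl U. \<forall>z\<in>Z. ((\<lambda>s. sin (snd (c z s))) has_real_derivative f' z) (at (\<tau> z) within W)"
    and cos: "\<exists>f'\<in>pcl U. \<forall>z\<in>Z. ((\<lambda>s. cos (snd (c z s))) has_real_derivative f' z) (at (\<tau> z) within W)"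
    and f: "f \<in> pcl U"
  shows "\<exists>f'\<in>pcl U. \<forall>z\<in>Z. ((\<lambda>s. f (c z s)) has_real_derivative f' z) (at (\<tau> z) within W)"
  using f
proof induction
  case (gen k)
  show ?case by (rule assms(2))
next
  case sin
  show ?case by (rule assms(3))
next
  case cos
  show ?case by (rule assms(4))
next
  case (const a)
  show ?case by (rule bexI[OF _ pcl.const[of 0]]) simp
next
  case (add f g)
  then obtain f' g' where f: "f' \<in> pcl U" "\<forall>z\<in>Z. ((\<lambda>s. f (c z s)) has_real_derivative f' z) (at (\<tau> z) within W)"
    and g: "g' \<in> pcl U" "\<forall>z\<in>Z. ((\<lambda>s. g (c z s)) has_real_derivative g' z) (at (\<tau> z) within W)"
    by (elim bexE)
  show ?case
    by (rule bexI[OF _ pcl.add[OF f(1) g(1)]]) (intro ballI DERIV_add f(2)[rule_format] g(2)[rule_format])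
next
  case (mult f g)
  then obtain f' g' where f: "f' \<in> pcl U" "\<forall>z\<in>Z. ((\<lambda>s. f (c z s)) has_real_derivative f' z) (at (\<tau> z) within W)"
    and g: "g' \<in> pcl U" "\<forall>z\<in>Z. ((\<lambda>s. g (c z s)) has_real_derivative g' z) (at (\<tau> z) within W)"
    by (elim bexE)
  show ?case
  proof (rule bexI[OF _ pcl.add[OF pcl.mult[OF f(1) mult.hyps(2)] pcl.mult[OF g(1) mult.hyps(1)]]], intro ballI)
    fix z assume z: "z \<in> Z"
    show "((\<lambda>s. f (c z s) * g (c z s)) has_real_derivative f' z * g z + g' z * f z) (at (\<tau> z) within W)"
      using DERIV_mult[OF f(2)[rule_format, OF z] g(2)[rule_format, OF z]] by (simp only: c[OF z])
  qed
next
  case (inv f)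
  then obtain f' where f: "f' \<in> pcl U" "\<forall>z\<in>Z. ((\<lambda>s. f (c z s)) has_real_derivative f' z) (at (\<tau> z) within W)"
    by (elim bexE)
  note i = pcl.inv[OF inv.hyps]
  show ?case
  proof (rule bexI[OF _ pcl.mult[OF pcl.const[of "-1"] pcl.mult[OF pcl.mult[OF i f(1)] i]]], intro ballI)
    fix z assume z: "z \<in> Z"
    have "f (c z (\<tau> z)) \<noteq> 0" using inv.hyps(2)[of "c z (\<tau> z)"] by linarith
    from DERIV_inverse'[OF f(2)[rule_format, OF z] this]
    show "((\<lambda>s. inverse (f (c z s))) has_real_derivative -1 * (inverse (f z) * f' z * inverse (f z))) (at (\<tau> z) within W)"
      by (simp add: c[OF z])
  qed
next
  case (rsqrt f)
  then obtain f' where f: "f' \<in> pcl U" "\<forall>z\<in>Z. ((\<lambda>s. f (c z s)) has_real_derivative f' z) (at (\<tau> z) within W)"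
    by (elim bexE)
  note i = pcl.rsqrt[OF rsqrt.hyps]
  show ?case
  proof (rule bexI[OF _ pcl.mult[OF pcl.const[of "-1/2"] pcl.mult[OF pcl.mult[OF pcl.mult[OF i i] f(1)] i]]], intro ballI)
    fix z assume z: "z \<in> Z"
    have p: "f z > 0" using rsqrt.hyps(2)[of z] by linarith
    have "((\<lambda>s. sqrt (f (c z s))) has_real_derivative (inverse (sqrt (f z)) / 2) * f' z) (at (\<tau> z) within W)"
      by (rule DERIV_chain2[OF _ f(2)[rule_format, OF z]]) (use DERIV_real_sqrt[OF p] in \<open>simp add: c[OF z]\<close>)
    from DERIV_inverse'[OF this] p
    have "((\<lambda>s. inverse (sqrt (f (c z s)))) has_real_derivative
       - (inverse (sqrt (f z)) * ((inverse (sqrt (f z)) / 2) * f' z) * inverse (sqrt (f z)))) (at (\<tau> z) within W)"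
      by (simp add: c[OF z])
    then show "((\<lambda>s. inverse (sqrt (f (c z s)))) has_real_derivative
       -1/2 * (inverse (sqrt (f z)) * inverse (sqrt (f z)) * f' z * inverse (sqrt (f z)))) (at (\<tau> z) within W)"
      by (rule DERIV_cong) (simp add: mult_ac)
  qed
qed

lemma pcl_continuous:
  assumes "\<And>k. continuous_on UNIV (U k)" "f \<in> pcl U" shows "continuous_on UNIV f"
  using assms(2)
proof induction
  case (inv f)
  have "f z \<noteq> 0" for z using inv.hyps(2)[of z] by linarith
  then show ?case using inv by (intro continuous_on_inverse) auto
next
  case (rsqrt f)
  have "sqrt (f z) \<noteq> 0" for z using rsqrt.hyps(2)[of z] by auto
  then show ?case using rsqrt by (intro continuous_on_inverse continuous_on_real_sqrt) auto
qed (use assms(1) in \<open>auto intro!: continuous_intros\<close>)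

lemma pcl_bounded:
  assumes "\<And>k. \<exists>B. \<forall>z. \<bar>U k z\<bar> \<le> B" "f \<in> pcl U" shows "\<exists>B. \<forall>z. \<bar>f z\<bar> \<le> (B::real)"
  using assms(2)
proof induction
  case (add f g)
  then obtain B B' where "\<forall>z. \<bar>f z\<bar> \<le> B" "\<forall>z. \<bar>g z\<bar> \<le> B'" by (elim exE)
  then have "\<bar>f z\<bar> \<le> B" "\<bar>g z\<bar> \<le> B'" for z by blast+
  then have "\<bar>f z + g z\<bar> \<le> B + B'" for z by (intro order_trans[OF abs_triangle_ineq] add_mono)
  then show ?case by (intro exI allI)
next
  case (mult f g)
  then obtain B B' where "\<forall>z. \<bar>f z\<bar> \<le> B" "\<forall>z. \<bar>g z\<bar> \<le> B'" by (elim exE)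
  then have *: "\<bar>f z\<bar> \<le> B" "\<bar>g z\<bar> \<le> B'" for z by blast+
  have "B \<ge> 0" using order_trans[OF abs_ge_zero *(1)] .
  then have "\<bar>f z * g z\<bar> \<le> B * B'" for z unfolding abs_mult by (intro mult_mono * abs_ge_zero)
  then show ?case by (intro exI allI)
next
  case (inv f)
  have "\<bar>inverse (f z)\<bar> \<le> 1" for z using inv.hyps(2)[of z] by (simp add: inverse_le_1_iff)
  then show ?case by (intro exI allI)
next
  case (rsqrt f)
  have "\<bar>inverse (sqrt (f z))\<bar> \<le> 1" for z using rsqrt.hyps(2)[of z] by (simp add: inverse_le_1_iff)
  then show ?case by (intro exI allI)
next
  case (gen k)
  show ?case by (rule assms(1))
next
  case sin
  show ?case by (intro exI[of _ 1] allI) simp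
next
  case cos
  show ?case by (intro exI[of _ 1] allI) simp
next
  case (const c)
  show ?case by (intro exI[of _ "\<bar>c\<bar>"] allI) simp
qed

section \<open>Return to the original space variable\<close>

lemma DERIV_ge_1_increase:
  fixes E :: "real \<Rightarrow> real"
  assumes "\<And>x. (E has_real_derivative g x) (at x)" "\<And>x. g x \<ge> 1" "a \<le> b"
  shows "b - a \<le> E b - E a"
proof (cases "a = b")
  case False
  then obtain z where "E b - E a = (b - a) * g z" using MVT2[of a b E g] assms by auto
  moreover have "(b - a) * 1 \<le> (b - a) * g z" using assms by (intro mult_left_mono) auto
  ultimately show ?thesis by simp
qed simp

text \<open>A derivative of at least 1 makes \<open>E\<close> expanding. Hence it is injective,
  takes every value by the intermediate value theorem, and has a 1-Lipschitz inverse, whose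
  continuity is the hypothesis of the inverse function rule.\<close>

lemma increasing_inverse:
  fixes E :: "real \<Rightarrow> real"
  assumes d: "\<And>x. (E has_real_derivative g x) (at x)" and g: "\<And>x. g x \<ge> 1" and E0: "E 0 = 0"
  obtains T where "\<And>x. E (T x) = x" "\<And>x. T (E x) = x" "\<And>x. (T has_real_derivative inverse (g (T x))) (at x)"
proof -
  note inc = DERIV_ge_1_increase[of E g, OF d g]
  have cont: "continuous_on A E" for A using d DERIV_isCont continuous_at_imp_continuous_on by blast
  have "\<exists>y. E y = x" for x
  proof -
    have "E (- \<bar>x\<bar>) \<le> x" "x \<le> E \<bar>x\<bar>" using inc[of "- \<bar>x\<bar>" 0] inc[of 0 "\<bar>x\<bar>"] E0 by auto
    then show ?thesis using IVT'[of E "- \<bar>x\<bar>" x "\<bar>x\<bar>"] cont by auto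
  qed
  then obtain T where T: "\<And>x. E (T x) = x" by metis
  have inj: "a = b" if "E a = E b" for a b using inc[of a b] inc[of b a] that by linarith
  have TE: "T (E x) = x" for x using inj T by blast
  have lip: "\<bar>T a - T b\<bar> \<le> \<bar>a - b\<bar>" for a b
    using inc[of "T a" "T b"] inc[of "T b" "T a"] T by (cases "T a \<le> T b") auto
  have "isCont T x" for x
    unfolding continuous_at_eps_delta dist_real_def using lip le_less_trans by blast
  then have "(T has_real_derivative inverse (g (T x))) (at x)" for x
    using T g[of "T x"] d[of "T x"]
    by (intro DERIV_inverse_function[of E _ T x "x - 1" "x + 1"]) auto
  with T TE show ?thesis by (rule that)
qed

text \<open>The determinant of the induced metric of the helicoidal graph, that is, the square of
  its slope function.\<close>

definition Wf :: "(real \<times> real \<Rightarrow> real) \<Rightarrow> real \<times> real \<Rightarrow> real" where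
  "Wf u z = (1 + (px u z)\<^sup>2) * (1 + (u z)\<^sup>2)"

theorem helix_pde:
  obtains u :: "real \<times> real \<Rightarrow> real" and L K :: real where
    "L > 0" "smooth_on ST u"
    "\<And>t x. t \<ge> 0 \<Longrightarrow> pt u (t, x) = px (px u) (t, x) / (1 + (px u (t, x))\<^sup>2) - u (t, x) / (1 + (u (t, x))\<^sup>2)"
    "\<And>t x. t \<ge> 0 \<Longrightarrow> u (t, x + L) = u (t, x)"
    "\<And>z. z \<in> ST \<Longrightarrow> \<bar>u z\<bar> \<le> 1/2" "\<And>z. z \<in> ST \<Longrightarrow> \<bar>px u z\<bar> \<le> 1/2"
    "\<And>z. z \<in> ST \<Longrightarrow> \<bar>pt u z\<bar> \<le> K" "\<And>z. z \<in> ST \<Longrightarrow> \<bar>px (px u) z\<bar> \<le> K" "\<And>z. z \<in> ST \<Longrightarrow> \<bar>px (pt u) z\<bar> \<le> K"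
    "\<And>x y. Wf u (0, x) = Wf u (0, y)"
    "\<exists>\<delta>>0. \<forall>t. 0 < t \<and> t < \<delta> \<longrightarrow> (\<exists>x y. Wf u (t, x) \<noteq> Wf u (t, y))"
proof (rule helix_pde_phi)
  fix U V :: "nat \<Rightarrow> real \<times> real \<Rightarrow> real"
  assume cU: "\<And>k. continuous_on UNIV (U k)" and cV: "\<And>k. continuous_on UNIV (V k)"
    and dU: "\<And>k t x. ((\<lambda>x. U k (t, x)) has_real_derivative U (Suc k) (t, x)) (at x)"
    and dV: "\<And>k t x. ((\<lambda>x. V k (t, x)) has_real_derivative V (Suc k) (t, x)) (at x)"
    and dt: "\<And>k t x. t \<ge> 0 \<Longrightarrow> ((\<lambda>t. U k (t, x)) has_real_derivative V k (t, x)) (at t within {0..})"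
    and bU: "\<And>k. \<exists>B. \<forall>z. \<bar>U k z\<bar> \<le> B"
    and b01: "\<And>z. \<bar>U 0 z\<bar> \<le> 1/10" "\<And>z. \<bar>U 1 z\<bar> \<le> 1/10"
    and per: "\<And>k t x. U k (t, x + 2 * pi) = U k (t, x)"
    and pde: "\<And>t x. V 0 (t, x) = (U 2 (t, x) - eps\<^sup>2 * sin x * cos x * U 1 (t, x) / (1 + eps\<^sup>2 * (sin x)\<^sup>2))
        / (1 + eps\<^sup>2 * (sin x)\<^sup>2 + (U 1 (t, x))\<^sup>2) - U 0 (t, x) / (1 + (U 0 (t, x))\<^sup>2)"
    and init: "\<And>x. U 0 (0, x) = eps * sin x"
  define d where "d x = 1 + eps\<^sup>2 * (sin x)\<^sup>2" for x
  define d1 where "d1 x = 2 * eps\<^sup>2 * sin x * cos x" for x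
  have d_ge: "d x \<ge> 1" for x by (simp add: d_def)
  have d_pos: "d x > 0" for x using d_ge[of x] by linarith
  have d_deriv: "(d has_real_derivative d1 x) (at x)" for x
    unfolding d_def d1_def by (auto intro!: derivative_eq_intros simp: power2_eq_square)
  have d_pcl: "(\<lambda>z. d (snd z)) \<in> pcl U"
    unfolding d_def power2_eq_square by (intro pcl.add pcl.mult pcl.const pcl.sin)
  define rs where "rs z = inverse (sqrt (d (snd z)))" for z :: "real \<times> real"
  have rs_pcl: "rs \<in> pcl U" unfolding rs_def[abs_def] by (rule pcl.rsqrt[OF d_pcl d_ge])
  have Dx: "\<exists>f'\<in>pcl U. \<forall>t x. ((\<lambda>x. f (t, x)) has_real_derivative f' (t, x)) (at x)" if "f \<in> pcl U" for f
  proof -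
    have "\<exists>f'\<in>pcl U. \<forall>z\<in>UNIV. ((\<lambda>s. f (fst z, s)) has_real_derivative f' z) (at (snd z) within UNIV)"
    proof (rule pcl_derivative[OF _ _ _ _ that])
      show "\<exists>f'\<in>pcl U. \<forall>z\<in>UNIV. ((\<lambda>s. U k (fst z, s)) has_real_derivative f' z) (at (snd z) within UNIV)" for k
        by (rule bexI[OF _ pcl.gen[of U "Suc k"]]) (auto intro: dU)
      show "\<exists>f'\<in>pcl U. \<forall>z\<in>UNIV. ((\<lambda>s. sin (snd (fst z, s))) has_real_derivative f' z) (at (snd z) within UNIV)"
        by (rule bexI[OF _ pcl.cos]) (auto intro!: derivative_eq_intros)
      show "\<exists>f'\<in>pcl U. \<forall>z\<in>UNIV. ((\<lambda>s. cos (snd (fst z, s))) has_real_derivative f' z) (at (snd z) within UNIV)"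
        by (rule bexI[OF _ pcl.mult[OF pcl.const[of "-1"] pcl.sin]]) (auto intro!: derivative_eq_intros)
    qed simp
    then show ?thesis by simp
  qed
  \<comment> \<open>The equation expresses \<open>V 0\<close> by generators of the class, and
    \<open>V (Suc k)\<close> is the space derivative of \<open>V k\<close>. Hence time
    differentiation stays within the class and can be iterated, although only one time derivative is
    known from the fixed point.\<close>
  have V_pcl: "V k \<in> pcl U" for k
  proof (induction k)
    case 0
    have "(\<lambda>z. (U 2 z + -1 * (eps\<^sup>2 * (sin (snd z) * (cos (snd z) * (U 1 z * inverse (d (snd z)))))))
        * inverse (d (snd z) + U 1 z * U 1 z) + -1 * (U 0 z * inverse (1 + U 0 z * U 0 z))) \<in> pcl U"
      by (intro pcl.add pcl.mult pcl.const pcl.sin pcl.cos pcl.gen pcl.inv d_pcl d_ge)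
        (use d_ge in \<open>auto intro: add_increasing2\<close>)
    moreover have "V 0 = (\<lambda>z. (U 2 z + -1 * (eps\<^sup>2 * (sin (snd z) * (cos (snd z) * (U 1 z * inverse (d (snd z)))))))
        * inverse (d (snd z) + U 1 z * U 1 z) + -1 * (U 0 z * inverse (1 + U 0 z * U 0 z)))"
      by (rule ext) (auto simp: pde d_def divide_inverse power2_eq_square mult_ac)
    ultimately show ?case by (simp only:)
  next
    case (Suc k)
    then obtain f' where f': "f' \<in> pcl U" "\<forall>t x. ((\<lambda>x. V k (t, x)) has_real_derivative f' (t, x)) (at x)"
      using Dx by blast
    have "V (Suc k) z = f' z" for z
      using DERIV_unique[OF dV[of k "fst z" "snd z"] f'(2)[rule_format]] by simp
    then have "V (Suc k) = f'" by (rule ext)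
    then show ?case using f'(1) by (simp only:)
  qed
  have Dt: "\<exists>f'\<in>pcl U. \<forall>t x. t \<ge> 0 \<longrightarrow> ((\<lambda>t. f (t, x)) has_real_derivative f' (t, x)) (at t within {0..})"
    if "f \<in> pcl U" for f
  proof -
    have "\<exists>f'\<in>pcl U. \<forall>z\<in>ST. ((\<lambda>s. f (s, snd z)) has_real_derivative f' z) (at (fst z) within {0..})"
    proof (rule pcl_derivative[OF _ _ _ _ that])
      show "\<exists>f'\<in>pcl U. \<forall>z\<in>ST. ((\<lambda>s. U k (s, snd z)) has_real_derivative f' z) (at (fst z) within {0..})" for k
        by (rule bexI[OF _ V_pcl[of k]]) (auto intro: dt simp: ST_def)
      show "\<exists>f'\<in>pcl U. \<forall>z\<in>ST. ((\<lambda>s. sin (snd (s, snd z))) has_real_derivative f' z) (at (fst z) within {0..})"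
        by (rule bexI[OF _ pcl.const[of 0]]) simp
      show "\<exists>f'\<in>pcl U. \<forall>z\<in>ST. ((\<lambda>s. cos (snd (s, snd z))) has_real_derivative f' z) (at (fst z) within {0..})"
        by (rule bexI[OF _ pcl.const[of 0]]) simp
    qed simp
    then obtain f' where "f' \<in> pcl U" "\<forall>z\<in>ST. ((\<lambda>s. f (s, snd z)) has_real_derivative f' z) (at (fst z) within {0..})"
      by (elim bexE)
    then show ?thesis by (intro bexI[of _ f']) (auto simp: ST_def)
  qed
  define g where "g x = sqrt (d x)" for x
  have g1: "g x \<ge> 1" for x using d_ge by (simp add: g_def)
  have gc: "continuous_on UNIV g" unfolding g_def d_def by (intro continuous_intros)
  obtain E0 where E0: "\<And>x. (E0 has_real_derivative g x) (at x)"
  proof -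
    have "\<exists>F. \<forall>x::real. (-\<infinity>::ereal) < x \<longrightarrow> x < (\<infinity>::ereal) \<longrightarrow> (F has_vector_derivative g x) (at x)"
      using gc by (intro einterval_antiderivative) (auto simp: continuous_on_eq_continuous_at)
    then show ?thesis using that by (auto simp: has_real_derivative_iff_has_vector_derivative)
  qed
  define E where "E x = E0 x - E0 0" for x
  have E: "(E has_real_derivative g x) (at x)" "E 0 = 0" for x
    unfolding E_def using E0 by (auto intro!: derivative_eq_intros)
  obtain T where ET: "\<And>x. E (T x) = x" and TE: "\<And>x. T (E x) = x"
    and dT: "\<And>x. (T has_real_derivative inverse (g (T x))) (at x)"
    using increasing_inverse[OF E(1) g1 E(2)] by blast
  define L where "L = E (2 * pi)"
  have L: "L > 0" using DERIV_ge_1_increase[OF E(1) g1, of 0 "2 * pi"] E(2) pi_gt_zero unfolding L_def by linarith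
  have Eper: "E (x + 2 * pi) = E x + L" for x
  proof -
    have "((\<lambda>x. E (x + 2 * pi) - E x) has_real_derivative 0) (at x)" for x
    proof -
      have "((\<lambda>x. E (x + 2 * pi)) has_real_derivative g (x + 2 * pi) * 1) (at x)"
        by (rule DERIV_chain2[OF E(1)]) (auto intro!: derivative_eq_intros)
      then have "((\<lambda>x. E (x + 2 * pi) - E x) has_real_derivative g (x + 2 * pi) * 1 - g x) (at x)"
        by (intro DERIV_diff E(1))
      then show ?thesis by (simp add: g_def d_def)
    qed
    then have "(\<lambda>x. E (x + 2 * pi) - E x) x = (\<lambda>x. E (x + 2 * pi) - E x) 0"
      using DERIV_isconst_all[of "\<lambda>x. E (x + 2 * pi) - E x" x 0] by simp
    then show ?thesis by (simp add: L_def E(2))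
  qed
  have Tper: "T (x + L) = T x + 2 * pi" for x
    using Eper[of "T x"] TE[of "T x + 2 * pi"] by (simp add: ET)
  define lift where "lift f z = (f (fst z, T (snd z)) :: real)" for f :: "real \<times> real \<Rightarrow> real" and z :: "real \<times> real"
  have lift_cont: "continuous_on A (lift f)" if "f \<in> pcl U" for f A
  proof -
    have "continuous_on UNIV T" using dT DERIV_isCont continuous_at_imp_continuous_on by blast
    then have "continuous_on UNIV (\<lambda>z. T (snd z))" for z :: "real \<times> real"
      by (rule continuous_on_compose2) (auto intro: continuous_intros)
    then have "continuous_on A (\<lambda>z. f (fst z, T (snd z)))"
      by (intro continuous_on_compose2[OF pcl_continuous[OF cU that]] continuous_intros continuous_on_subset[of UNIV _ A]) auto
    then show ?thesis by (simp add: lift_def[abs_def])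
  qed
  have lift_dx: "((\<lambda>x. lift f (t, x)) has_real_derivative lift (\<lambda>z. f' z * rs z) (t, x)) (at x)"
    if "\<forall>t x. ((\<lambda>x. f (t, x)) has_real_derivative f' (t, x)) (at x)" for f f' t x
    unfolding lift_def fst_conv snd_conv
    using DERIV_chain2[OF that[rule_format, of t "T x"] dT[of x]] by (simp add: rs_def g_def)
  have lift_dt: "((\<lambda>t. lift f (t, x)) has_real_derivative lift f' (t, x)) (at t within {0..})"
    if "\<forall>t x. t \<ge> 0 \<longrightarrow> ((\<lambda>t. f (t, x)) has_real_derivative f' (t, x)) (at t within {0..})" "t \<ge> 0" for f f' t x
    unfolding lift_def fst_conv snd_conv using that by simp
  have smooth: "smooth_on ST (lift f)" if f: "f \<in> pcl U" for f
  proof (rule smooth_on_closed_class[where C="lift ` pcl U"])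
    fix h assume "h \<in> lift ` pcl U"
    then obtain f where f: "f \<in> pcl U" "h = lift f" by blast
    obtain fx where fx: "fx \<in> pcl U" "\<forall>t x. ((\<lambda>x. f (t, x)) has_real_derivative fx (t, x)) (at x)"
      using Dx[OF f(1)] by blast
    obtain ft where ft: "ft \<in> pcl U" "\<forall>t x. t \<ge> 0 \<longrightarrow> ((\<lambda>t. f (t, x)) has_real_derivative ft (t, x)) (at t within {0..})"
      using Dt[OF f(1)] by blast
    \<comment> \<open>The factor \<open>rs\<close> from the change of variable is itself in the
      class, so the lifted class is closed under both partial derivatives.\<close>
    have fxr: "(\<lambda>z. fx z * rs z) \<in> pcl U" by (rule pcl.mult[OF fx(1) rs_pcl])
    define D where "D z v = fst v * lift ft z + snd v * lift (\<lambda>z. fx z * rs z) z" for z v :: "real \<times> real"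
    have D: "(h has_derivative D z) (at z within ST)" if "z \<in> ST" for z
      unfolding f(2) D_def
      by (rule has_derivative_continuous_partials[OF lift_dt[OF ft(2)] lift_dx[OF fx(2)] lift_cont[OF fxr] that])
    have B: "(\<lambda>z. D z b) \<in> lift ` pcl U" if "b \<in> Basis" for b
    proof -
      have "(\<lambda>z. fst b * ft z + snd b * (fx z * rs z)) \<in> pcl U"
        by (intro pcl.add pcl.mult pcl.const ft(1) fx(1) rs_pcl)
      moreover have "(\<lambda>z. D z b) = lift (\<lambda>z. fst b * ft z + snd b * (fx z * rs z))"
        by (rule ext) (simp add: D_def lift_def)
      ultimately show ?thesis by blast
    qed
    show "\<exists>D. (\<forall>x\<in>ST. (h has_derivative D x) (at x within ST)) \<and>
        (\<forall>b\<in>Basis. \<exists>g\<in>lift ` pcl U. \<forall>x\<in>ST. g x = D x b)"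
      by (rule closed_class_witness(2)[where D=D, OF D B])
  next
    show "lift f \<in> lift ` pcl U" using f by (rule imageI)
  qed simp
  have lift_bounded: "\<exists>B. \<forall>z. \<bar>lift f z\<bar> \<le> B" if "f \<in> pcl U" for f
    using pcl_bounded[OF bU that] unfolding lift_def by blast
  define u where "u = lift (U 0)"
  have su: "smooth_on ST u" unfolding u_def by (rule smooth[OF pcl.gen])
  have U_dx: "\<forall>t x. ((\<lambda>x. U k (t, x)) has_real_derivative U (Suc k) (t, x)) (at x)" for k
    using dU by blast
  have pxu: "px u (t, x) = lift (\<lambda>z. U 1 z * rs z) (t, x)" if "t \<ge> 0" for t x
    using px_eqI[OF su that] lift_dx[OF U_dx[of 0], of t x] by (simp add: u_def)
  have ptu: "pt u (t, x) = lift (V 0) (t, x)" if "t \<ge> 0" for t x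
    using dt by (intro pt_eqI[OF su that]) (auto simp: u_def intro!: lift_dt that)
  obtain rs' where rs': "rs' \<in> pcl U" "\<forall>t x. ((\<lambda>x. rs (t, x)) has_real_derivative rs' (t, x)) (at x)"
    using Dx[OF rs_pcl] by blast
  have rs'_eq: "rs' (t, x) = - (d1 x / 2) / d x * rs (t, x)" for t x
  proof -
    have "((\<lambda>x. inverse (sqrt (d x))) has_real_derivative
        - (inverse (sqrt (d x)) * (inverse (sqrt (d x)) / 2 * d1 x) * inverse (sqrt (d x)))) (at x)"
      using d_pos[of x] by (intro DERIV_inverse' DERIV_chain2[OF DERIV_real_sqrt d_deriv]) auto
    moreover have "inverse (sqrt (d x)) * inverse (sqrt (d x)) = 1 / d x"
      using d_pos[of x] by (simp add: divide_inverse flip: inverse_mult_distrib)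
    then have "- (inverse (sqrt (d x)) * (inverse (sqrt (d x)) / 2 * d1 x) * inverse (sqrt (d x)))
        = - (d1 x / 2) / d x * rs (t, x)"
      by (simp add: rs_def algebra_simps)
    ultimately show ?thesis
      using DERIV_unique[OF rs'(2)[rule_format, of t x]] by (simp add: rs_def)
  qed
  have spx: "smooth_on ST (px u)" and spt: "smooth_on ST (pt u)"
    using smooth_on_px[OF su] smooth_on_pt[OF su] .
  have prod_dx: "\<forall>t x. ((\<lambda>x. U 1 (t, x) * rs (t, x)) has_real_derivative
      (\<lambda>z. U 2 z * rs z + rs' z * U 1 z) (t, x)) (at x)"
    using DERIV_mult[OF dU[of 1] rs'(2)[rule_format]] by (simp add: numeral_2_eq_2)
  have pxxu: "px (px u) (t, x) = lift (\<lambda>z. (U 2 z * rs z + rs' z * U 1 z) * rs z) (t, x)" if "t \<ge> 0" for t x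
  proof (rule px_eqI[OF spx that])
    have "px u (t, y) = lift (\<lambda>z. U 1 z * rs z) (t, y)" for y by (rule pxu[OF that])
    then show "((\<lambda>x. px u (t, x)) has_real_derivative lift (\<lambda>z. (U 2 z * rs z + rs' z * U 1 z) * rs z) (t, x)) (at x)"
      using lift_dx[of "\<lambda>z. U 1 z * rs z" "\<lambda>z. U 2 z * rs z + rs' z * U 1 z" t x] prod_dx by simp
  qed
  have pxptu: "px (pt u) (t, x) = lift (\<lambda>z. V 1 z * rs z) (t, x)" if "t \<ge> 0" for t x
  proof (rule px_eqI[OF spt that])
    have "pt u (t, y) = lift (V 0) (t, y)" for y by (rule ptu[OF that])
    then show "((\<lambda>x. pt u (t, x)) has_real_derivative lift (\<lambda>z. V 1 z * rs z) (t, x)) (at x)"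
      using lift_dx[of "V 0" "V 1" t x] dV[of 0] by simp
  qed
  have rs2: "rs (t, x) * rs (t, x) = 1 / d x" for t x
    using d_pos[of x] by (simp add: rs_def divide_inverse flip: inverse_mult_distrib)
  have rs_le: "\<bar>rs z\<bar> \<le> 1" for z
    using d_ge[of "snd z"] by (simp add: rs_def inverse_le_1_iff)
  have PDE: "pt u (t, x) = px (px u) (t, x) / (1 + (px u (t, x))\<^sup>2) - u (t, x) / (1 + (u (t, x))\<^sup>2)"
    if "t \<ge> 0" for t x
  proof -
    define y where "y = T x"
    define u0 where "u0 = U 0 (t, y)"
    define u1 where "u1 = U 1 (t, y)"
    define u2 where "u2 = U 2 (t, y)"
    have px2: "1 + (px u (t, x))\<^sup>2 = (d y + u1\<^sup>2) / d y"
    proof -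
      have "(px u (t, x))\<^sup>2 = u1\<^sup>2 * (rs (t, y) * rs (t, y))"
        by (simp add: pxu[OF that] lift_def y_def u1_def power2_eq_square algebra_simps)
      then show ?thesis using d_pos[of y] by (simp add: rs2 field_simps)
    qed
    have "px (px u) (t, x) = (u2 - d1 y / 2 * u1 / d y) * (rs (t, y) * rs (t, y))"
      by (simp add: pxxu[OF that] lift_def y_def[symmetric] rs'_eq u1_def u2_def algebra_simps)
    then have pxx: "px (px u) (t, x) = (u2 - d1 y / 2 * u1 / d y) / d y" by (simp add: rs2)
    have pos: "d y > 0" "d y + u1\<^sup>2 > 0" using d_pos[of y] by (auto intro: add_pos_nonneg)
    have "pt u (t, x) = V 0 (t, y)" by (simp add: ptu[OF that] lift_def y_def)
    also have "\<dots> = (u2 - d1 y / 2 * u1 / d y) / (d y + u1\<^sup>2) - u0 / (1 + u0\<^sup>2)"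
      unfolding pde by (simp add: d_def d1_def u0_def u1_def u2_def)
    also have "(u2 - d1 y / 2 * u1 / d y) / (d y + u1\<^sup>2) = px (px u) (t, x) / (1 + (px u (t, x))\<^sup>2)"
      unfolding px2 pxx using pos by simp
    also have "u0 = u (t, x)" by (simp add: u0_def u_def lift_def y_def)
    finally show ?thesis .
  qed
  have periodic: "u (t, x + L) = u (t, x)" for t x
    by (simp add: u_def lift_def Tper per)
  have bu: "\<bar>u z\<bar> \<le> 1/2" for z using b01(1)[of "(fst z, T (snd z))"] by (simp add: u_def lift_def)
  have bpx: "\<bar>px u z\<bar> \<le> 1/2" if zS: "z \<in> ST" for z
  proof -
    obtain t x where z: "z = (t, x)" "t \<ge> 0" using zS by (auto simp: ST_def)
    have "\<bar>px u z\<bar> = \<bar>U 1 (t, T x)\<bar> * \<bar>rs (t, T x)\<bar>"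
      by (simp add: z pxu[OF z(2)] lift_def abs_mult)
    also have "\<dots> \<le> (1/10) * 1" by (intro mult_mono b01 rs_le) auto
    finally show ?thesis by simp
  qed
  obtain K1 where K1: "\<forall>z. \<bar>lift (V 0) z\<bar> \<le> K1" using lift_bounded[OF V_pcl] by blast
  have "(\<lambda>z. (U 2 z * rs z + rs' z * U 1 z) * rs z) \<in> pcl U"
    by (intro pcl.add pcl.mult pcl.gen rs_pcl rs'(1))
  then obtain K2 where K2: "\<forall>z. \<bar>lift (\<lambda>z. (U 2 z * rs z + rs' z * U 1 z) * rs z) z\<bar> \<le> K2"
    using lift_bounded by blast
  have "(\<lambda>z. V 1 z * rs z) \<in> pcl U" by (intro pcl.mult V_pcl rs_pcl)
  then obtain K3 where K3: "\<forall>z. \<bar>lift (\<lambda>z. V 1 z * rs z) z\<bar> \<le> K3"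
    using lift_bounded by blast
  define K where "K = max K1 (max K2 K3)"
  have bK: "\<bar>pt u z\<bar> \<le> K" "\<bar>px (px u) z\<bar> \<le> K" "\<bar>px (pt u) z\<bar> \<le> K" if zS: "z \<in> ST" for z
  proof -
    obtain t x where z: "z = (t, x)" "t \<ge> 0" using zS by (auto simp: ST_def)
    have "\<bar>pt u z\<bar> \<le> K1" unfolding z(1) ptu[OF z(2)] using K1 by blast
    then show "\<bar>pt u z\<bar> \<le> K" by (simp add: K_def)
    have "\<bar>px (px u) z\<bar> \<le> K2" unfolding z(1) pxxu[OF z(2)] using K2 by blast
    then show "\<bar>px (px u) z\<bar> \<le> K" by (simp add: K_def)
    have "\<bar>px (pt u) z\<bar> \<le> K3" unfolding z(1) pxptu[OF z(2)] using K3 by blast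
    then show "\<bar>px (pt u) z\<bar> \<le> K" by (simp add: K_def)
  qed
  define w where "w t x = (1 + (U 1 (t, x))\<^sup>2 / d x) * (1 + (U 0 (t, x))\<^sup>2)" for t x
  have Wf: "Wf u (t, x) = w t (T x)" if "t \<ge> 0" for t x
  proof -
    have "(px u (t, x))\<^sup>2 = (U 1 (t, T x))\<^sup>2 * (rs (t, T x) * rs (t, T x))"
      by (simp add: pxu[OF that] lift_def power2_eq_square algebra_simps)
    then show ?thesis by (simp add: Wf_def w_def rs2 u_def lift_def)
  qed
  have i1: "U 1 (0, x) = eps * cos x" for x
  proof -
    have "((\<lambda>x. U 0 (0, x)) has_real_derivative eps * cos x) (at x)"
      unfolding init by (auto intro!: derivative_eq_intros)
    from DERIV_unique[OF dU this] show ?thesis by simp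
  qed
  have i2: "U 2 (0, x) = - (eps * sin x)" for x
  proof -
    have "((\<lambda>x. U 1 (0, x)) has_real_derivative - (eps * sin x)) (at x)"
      unfolding i1 by (auto intro!: derivative_eq_intros)
    from DERIV_unique[OF dU this] show ?thesis by (simp add: numeral_2_eq_2)
  qed
  have e: "eps > 0" by (simp add: eps_def)
  have sc: "eps\<^sup>2 * (sin x)\<^sup>2 + eps\<^sup>2 * (cos x)\<^sup>2 = eps\<^sup>2" for x
    by (simp only: distrib_left[symmetric] sin_cos_squared_add mult_1_right)
  \<comment> \<open>This identity is the reason for the choice of \<phi>: with dx/d\<phi> = sqrt d
    it makes \<open>W\<close> equal to 1 + eps^2 for the profile eps sin \<phi>.\<close>
  have d_cos: "d x + (eps * cos x)\<^sup>2 = 1 + eps\<^sup>2" for x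
    using sc[of x] by (simp add: d_def power_mult_distrib del: sin_cos_squared_add)
  have w0: "w 0 x = 1 + eps\<^sup>2" for x
  proof -
    have "1 + (eps * sin x)\<^sup>2 = d x" by (simp add: d_def power_mult_distrib)
    moreover have "1 + (eps * cos x)\<^sup>2 / d x = (d x + (eps * cos x)\<^sup>2) / d x"
      using d_pos[of x] by (simp add: add_divide_distrib)
    ultimately have "w 0 x = (d x + (eps * cos x)\<^sup>2) / d x * d x" unfolding w_def init i1 by (simp only:)
    also have "\<dots> = d x + (eps * cos x)\<^sup>2" using d_pos[of x] by simp
    finally show ?thesis by (simp only: d_cos)
  qed
  have W0: "Wf u (0, x) = Wf u (0, y)" for x y by (simp add: Wf w0)
  have v0: "V 0 (0, x) = - 2 * (eps * sin x) / d x" for x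
  proof -
    note 1 = d_cos[of x]
    have "- (eps * sin x) - eps\<^sup>2 * sin x * cos x * (eps * cos x) / d x
        = - (eps * sin x) * ((d x + (eps * cos x)\<^sup>2) / d x)"
      using d_pos[of x] by (simp add: field_simps power2_eq_square)
    also have "\<dots> = - (eps * sin x) / d x * (1 + eps\<^sup>2)" unfolding 1 by simp
    finally have 2: "- (eps * sin x) - eps\<^sup>2 * sin x * cos x * (eps * cos x) / d x
        = - (eps * sin x) / d x * (1 + eps\<^sup>2)" .
    have "V 0 (0, x) = (- (eps * sin x) - eps\<^sup>2 * sin x * cos x * (eps * cos x) / d x) / (d x + (eps * cos x)\<^sup>2)
        - eps * sin x / d x"
      unfolding pde init i1 i2 by (simp add: d_def power_mult_distrib)
    also have "\<dots> = - (eps * sin x) / d x - eps * sin x / d x"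
    proof -
      have "1 + eps\<^sup>2 \<noteq> 0" by (metis one_plus_sq_pos less_irrefl)
      then show ?thesis unfolding 1 2 by simp
    qed
    finally show ?thesis by (simp add: field_simps)
  qed
  have v1: "V 1 (0, x) = - 2 * ((eps * cos x) * d x - (eps * sin x) * d1 x) / (d x * d x)" for x
  proof -
    have "((\<lambda>x. - 2 * (eps * sin x) / d x) has_real_derivative
        ((- 2 * (eps * cos x)) * d x - (- 2 * (eps * sin x)) * d1 x) / (d x * d x)) (at x)"
      using d_pos[of x] by (intro DERIV_divide d_deriv) (auto intro!: derivative_eq_intros)
    then have "V (Suc 0) (0, x) = ((- 2 * (eps * cos x)) * d x - (- 2 * (eps * sin x)) * d1 x) / (d x * d x)"
      using DERIV_unique[OF dV[of 0 0 x]] by (simp add: v0)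
    then show ?thesis by (simp add: algebra_simps)
  qed
  have dw: "((\<lambda>t. w t x) has_real_derivative
      (2 * U 1 (0, x) * V 1 (0, x) / d x) * (1 + (U 0 (0, x))\<^sup>2) + (2 * U 0 (0, x) * V 0 (0, x)) * (1 + (U 1 (0, x))\<^sup>2 / d x))
      (at 0 within {0..})" for x
    unfolding w_def using dt[of 0 0 x] dt[of 0 1 x] d_pos[of x]
    by (auto intro!: derivative_eq_intros simp: field_simps power2_eq_square)
  \<comment> \<open>At t = 0 the time derivative of \<open>W\<close> is - 4 eps^2 at the zero \<phi>
    = 0 of the profile and - 4 eps^2 / (1 + eps^2) at its maximum \<phi> = pi/2; \<open>q\<close> is
    the difference.\<close>
  define q where "q = - 4 * eps\<^sup>2 + 4 * eps\<^sup>2 / (1 + eps\<^sup>2)"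
  have "((\<lambda>t. w t 0 - w t (pi/2)) has_real_derivative q) (at 0 within {0..})"
    by (rule DERIV_cong[OF DERIV_diff[OF dw dw]])
      (simp add: init i1[unfolded One_nat_def] v0 v1[unfolded One_nat_def] q_def d_def d1_def power2_eq_square)
  moreover have "q < 0"
    by (simp add: q_def eps_def power2_eq_square)
  ultimately obtain \<delta> where \<delta>: "\<delta> > 0" "\<And>h. h > 0 \<Longrightarrow> 0 + h \<in> {0..} \<Longrightarrow> h < \<delta> \<Longrightarrow>
      w 0 0 - w 0 (pi/2) > w (0 + h) 0 - w (0 + h) (pi/2)"
    using has_real_derivative_neg_dec_right[of "\<lambda>t. w t 0 - w t (pi/2)" q 0 "{0..}"] by blast
  have "\<exists>x y. Wf u (t, x) \<noteq> Wf u (t, y)" if "0 < t \<and> t < \<delta>" for t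
  proof -
    have "w t 0 < w t (pi/2)" using \<delta>(2)[of t] that by (simp add: w0)
    then have "Wf u (t, E 0) \<noteq> Wf u (t, E (pi/2))" using that by (simp add: Wf TE)
    then show ?thesis by blast
  qed
  then have nonconst: "\<exists>\<delta>>0. \<forall>t. 0 < t \<and> t < \<delta> \<longrightarrow> (\<exists>x y. Wf u (t, x) \<noteq> Wf u (t, y))" using \<delta>(1) by blast
  show ?thesis
    by (rule that[OF L su PDE periodic bu bpx bK(1) bK(2) bK(3) W0 nonconst])
qed

section \<open>Flows of time-dependent vector fields\<close>

text \<open>The substitution \<tau> = t \<theta> moves the dependence on t from the interval of
  integration into the integrand, where continuity in a parameter applies.\<close>

lemma continuous_on_integral_upper:
  fixes f :: "real \<times> real \<Rightarrow> real"
  assumes f: "continuous_on ST f"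
  shows "continuous_on ST (\<lambda>z. integral {0..fst z} (\<lambda>\<tau>. f (\<tau>, snd z)))"
proof -
  have "continuous_on (ST \<times> {0..1}) (\<lambda>w. f (fst (fst w) * snd w, snd (fst w)))"
    by (rule continuous_on_compose2[OF f]) (auto simp: ST_def intro!: continuous_intros)
  then have "continuous_on (ST \<times> cbox 0 (1::real)) (\<lambda>(z, \<theta>). f (fst z * \<theta>, snd z))"
    by (simp add: split_beta' cbox_interval)
  then have "continuous_on ST (\<lambda>z. integral (cbox 0 1) (\<lambda>\<theta>. f (fst z * \<theta>, snd z)))"
    by (rule integral_continuous_on_param)
  then have "continuous_on ST (\<lambda>z. fst z * integral {0..1} (\<lambda>\<theta>. f (fst z * \<theta>, snd z)))"
    by (intro continuous_intros) (simp add: cbox_interval)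
  moreover have "fst z * integral {0..1} (\<lambda>\<theta>. f (fst z * \<theta>, snd z)) = integral {0..fst z} (\<lambda>\<tau>. f (\<tau>, snd z))"
    if "z \<in> ST" for z
  proof (cases "fst z = 0")
    case False
    then have t: "fst z > 0" using that by (auto simp: ST_def)
    have "(\<lambda>x. x / fst z) ` {0..fst z} = {0..1}"
      using t by (simp add: image_divide_atLeastAtMost)
    then show ?thesis
      using integral_stretch_real[of "fst z" 0 "fst z" "\<lambda>\<tau>. f (\<tau>, snd z)"] t by simp
  qed simp
  ultimately show ?thesis by (simp cong: continuous_on_cong)
qed

lemma continuous_on_time_slice:
  assumes "continuous_on ST f" "A \<subseteq> {0..}" shows "continuous_on A (\<lambda>t. f (t, s))"
  by (rule continuous_on_compose2[OF assms(1)]) (use assms(2) in \<open>auto simp: ST_def intro!: continuous_intros\<close>)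

lemma has_real_derivative_integral_atLeast:
  fixes f :: "real \<Rightarrow> real"
  assumes "continuous_on {0..} f" "0 \<le> t"
  shows "((\<lambda>t. integral {0..t} f) has_real_derivative f t) (at t within {0..})"
  using integral_has_vector_derivative_atLeast[OF assms]
  by (simp add: has_real_derivative_iff_has_vector_derivative)

lemma has_derivative_zero_atLeast_constant:
  fixes f :: "real \<Rightarrow> real"
  assumes "\<And>t. t \<ge> 0 \<Longrightarrow> (f has_real_derivative 0) (at t within {0..})" "t \<ge> 0"
  shows "f t = f 0"
proof -
  have "(f has_derivative (\<lambda>h. 0)) (at x within {0..})" if "x \<in> {0..}" for x
    using assms(1)[of x] that by (simp add: has_field_derivative_def lambda_zero)
  then have "\<exists>c. \<forall>x\<in>{0..}. f x = c"
    by (intro has_derivative_zero_constant) auto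
  then show ?thesis using assms(2) by force
qed

inductive_set flow_class :: "(real \<times> real \<Rightarrow> real) \<Rightarrow> (real \<times> real \<Rightarrow> real) \<Rightarrow> (real \<times> real \<Rightarrow> real) set"
  for \<Phi> E where
  comp: "smooth_on ST a \<Longrightarrow> (\<lambda>z. a (fst z, \<Phi> z)) \<in> flow_class \<Phi> E"
| jac: "E \<in> flow_class \<Phi> E"
| int: "f \<in> flow_class \<Phi> E \<Longrightarrow> (\<lambda>z. integral {0..fst z} (\<lambda>\<tau>. f (\<tau>, snd z))) \<in> flow_class \<Phi> E"
| add: "f \<in> flow_class \<Phi> E \<Longrightarrow> g \<in> flow_class \<Phi> E \<Longrightarrow> (\<lambda>z. f z + g z) \<in> flow_class \<Phi> E"
| mult: "f \<in> flow_class \<Phi> E \<Longrightarrow> g \<in> flow_class \<Phi> E \<Longrightarrow> (\<lambda>z. f z * g z) \<in> flow_class \<Phi> E"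

lemma flow_class_continuous:
  assumes "continuous_on ST \<Phi>" "continuous_on ST E" "f \<in> flow_class \<Phi> E"
  shows "continuous_on ST f"
  using assms(3)
proof induction
  case (comp a)
  show ?case
    by (rule continuous_on_compose2[OF smooth_on_imp_continuous_on[OF comp]])
      (use assms(1) in \<open>auto simp: ST_def intro!: continuous_intros\<close>)
next
  case jac
  show ?case by (rule assms(2))
next
  case (int f)
  show ?case by (rule continuous_on_integral_upper[OF int.IH])
qed (auto intro: continuous_intros)

text \<open>The derivative of \<Phi> in the initial point is \<open>E\<close>, the exponential of a
  time integral along the trajectory. Differentiating \<open>E\<close> in the initial point brings
  down another such integral, so the class has to contain integrals over the past. These are
  differentiated under the integral sign in space, and in time by evaluating the integrand.\<close>

lemma flow_class_partials:
  assumes V: "smooth_on ST V"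
    and c\<Phi>: "continuous_on ST \<Phi>"
    and \<Phi>t: "\<And>t s. t \<ge> 0 \<Longrightarrow> ((\<lambda>t. \<Phi> (t, s)) has_real_derivative V (t, \<Phi> (t, s))) (at t within {0..})"
    and E: "\<And>z. E z = exp (integral {0..fst z} (\<lambda>\<tau>. px V (\<tau>, \<Phi> (\<tau>, snd z))))"
    and \<Phi>s: "\<And>t s. t \<ge> 0 \<Longrightarrow> ((\<lambda>s. \<Phi> (t, s)) has_real_derivative E (t, s)) (at s)"
    and cE: "continuous_on ST E"
    and f: "f \<in> flow_class \<Phi> E"
  shows "\<exists>ft\<in>flow_class \<Phi> E. \<exists>fs\<in>flow_class \<Phi> E.
    (\<forall>t s. t \<ge> 0 \<longrightarrow> ((\<lambda>t. f (t, s)) has_real_derivative ft (t, s)) (at t within {0..})) \<and>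
    (\<forall>t s. t \<ge> 0 \<longrightarrow> ((\<lambda>s. f (t, s)) has_real_derivative fs (t, s)) (at s))"
proof -
  note cont = flow_class_continuous[OF c\<Phi> cE]
  have comp_t: "((\<lambda>t. a (t, \<Phi> (t, s))) has_real_derivative pt a (t, \<Phi> (t, s)) + px a (t, \<Phi> (t, s)) * V (t, \<Phi> (t, s))) (at t within {0..})"
    if a: "smooth_on ST a" and t: "t \<ge> 0" for a t s
  proof -
    have 1: "((\<lambda>t. (t, \<Phi> (t, s))) has_derivative (\<lambda>h. (h, V (t, \<Phi> (t, s)) * h))) (at t within {0..})"
      using \<Phi>t[OF t, of s] by (auto simp: has_field_derivative_def intro!: has_derivative_Pair)
    have "(\<lambda>t. (t, \<Phi> (t, s))) ` {0..} \<subseteq> ST" "t \<in> {0..}" using t by (auto simp: ST_def)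
    from has_derivative_in_compose2[OF partials_has_derivative[OF a] this 1]
    have "((\<lambda>t. a (t, \<Phi> (t, s))) has_derivative
      (\<lambda>h. (pt a (t, \<Phi> (t, s)) + px a (t, \<Phi> (t, s)) * V (t, \<Phi> (t, s))) * h)) (at t within {0..})"
      by (rule has_derivative_eq_rhs) (auto simp: algebra_simps)
    then show ?thesis by (simp add: has_field_derivative_def)
  qed
  have comp_s: "((\<lambda>s. a (t, \<Phi> (t, s))) has_real_derivative px a (t, \<Phi> (t, s)) * E (t, s)) (at s)"
    if a: "smooth_on ST a" and t: "t \<ge> 0" for a t s
    by (rule DERIV_chain2[OF px_derivative[OF a t] \<Phi>s[OF t]])
  have int_t: "((\<lambda>t. integral {0..t} (\<lambda>\<tau>. f (\<tau>, s))) has_real_derivative f (t, s)) (at t within {0..})"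
    if "continuous_on ST f" "t \<ge> 0" for f t s
    by (rule has_real_derivative_integral_atLeast[OF continuous_on_time_slice[OF that(1)] that(2)]) simp
  have int_s: "((\<lambda>s. integral {0..t} (\<lambda>\<tau>. f (\<tau>, s))) has_real_derivative integral {0..t} (\<lambda>\<tau>. fs (\<tau>, s))) (at s)"
    if "continuous_on ST f" "continuous_on ST fs" "t \<ge> 0"
      "\<forall>t s. t \<ge> 0 \<longrightarrow> ((\<lambda>s. f (t, s)) has_real_derivative fs (t, s)) (at s)" for f fs t s
  proof -
    have "((\<lambda>s. integral (cbox 0 t) (\<lambda>\<tau>. f (\<tau>, s))) has_field_derivative integral (cbox 0 t) (\<lambda>\<tau>. fs (\<tau>, s))) (at s within UNIV)"
    proof (rule leibniz_rule_field_derivative)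
      show "((\<lambda>s. f (\<tau>, s)) has_field_derivative fs (\<tau>, s)) (at s within UNIV)" if "\<tau> \<in> cbox 0 t" for \<tau> s
        using that \<open>\<forall>t s. t \<ge> 0 \<longrightarrow> _ t s\<close> by (simp add: cbox_interval)
      show "(\<lambda>\<tau>. f (\<tau>, s)) integrable_on cbox 0 t" for s
        by (intro integrable_continuous continuous_on_time_slice[OF that(1)]) (auto simp: cbox_interval)
      show "continuous_on (UNIV \<times> cbox 0 t) (\<lambda>(s, \<tau>). fs (\<tau>, s))"
        unfolding split_beta'
        by (rule continuous_on_compose2[OF that(2)]) (auto simp: ST_def cbox_interval intro!: continuous_intros)
    qed auto
    then show ?thesis by (simp add: cbox_interval)
  qed
  have pxV: "smooth_on ST (px V)" by (rule smooth_on_px[OF V])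
  have pxxV: "smooth_on ST (px (px V))" by (rule smooth_on_px[OF pxV])
  show ?thesis using f
  proof induction
    case (comp a)
    have 1: "(\<lambda>z. pt a (fst z, \<Phi> z) + px a (fst z, \<Phi> z) * V (fst z, \<Phi> z)) \<in> flow_class \<Phi> E"
      by (intro flow_class.add flow_class.mult flow_class.comp smooth_on_pt smooth_on_px comp V)
    have 2: "(\<lambda>z. px a (fst z, \<Phi> z) * E z) \<in> flow_class \<Phi> E"
      by (intro flow_class.mult flow_class.comp flow_class.jac smooth_on_px comp)
    show ?case by (rule bexI[OF bexI[OF _ 2] 1]) (simp add: comp_t[OF comp] comp_s[OF comp])
  next
    case jac
    have 1: "(\<lambda>z. E z * px V (fst z, \<Phi> z)) \<in> flow_class \<Phi> E"
      by (intro flow_class.mult flow_class.comp flow_class.jac pxV)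
    have pE: "(\<lambda>z. px (px V) (fst z, \<Phi> z) * E z) \<in> flow_class \<Phi> E"
      by (intro flow_class.mult flow_class.comp flow_class.jac pxxV)
    have pV: "(\<lambda>z. px V (fst z, \<Phi> z)) \<in> flow_class \<Phi> E"
      by (intro flow_class.comp pxV)
    have 2: "(\<lambda>z. E z * integral {0..fst z} (\<lambda>\<tau>. (\<lambda>z. px (px V) (fst z, \<Phi> z) * E z) (\<tau>, snd z))) \<in> flow_class \<Phi> E"
      by (rule flow_class.mult[OF flow_class.jac flow_class.int[OF pE]])
    have "((\<lambda>t. E (t, s)) has_real_derivative E (t, s) * px V (t, \<Phi> (t, s))) (at t within {0..})"
      if "t \<ge> 0" for t s
      using DERIV_chain2[OF DERIV_exp int_t[OF cont[OF pV] that, of s]] by (simp add: E)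
    moreover have "((\<lambda>s. E (t, s)) has_real_derivative E (t, s) * integral {0..t} (\<lambda>\<tau>. px (px V) (\<tau>, \<Phi> (\<tau>, s)) * E (\<tau>, s))) (at s)"
      if "t \<ge> 0" for t s
    proof -
      have "\<forall>t s. t \<ge> 0 \<longrightarrow> ((\<lambda>s. (\<lambda>z. px V (fst z, \<Phi> z)) (t, s)) has_real_derivative
          (\<lambda>z. px (px V) (fst z, \<Phi> z) * E z) (t, s)) (at s)"
        using comp_s[OF pxV] by simp
      from DERIV_chain2[OF DERIV_exp int_s[OF cont[OF pV] cont[OF pE] that this, of s]]
      show ?thesis unfolding E by simp
    qed
    ultimately show ?case by (intro bexI[OF bexI[OF _ 2] 1]) simp
  next
    case (int f)
    then obtain ft fs where fs: "fs \<in> flow_class \<Phi> E"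
      "\<forall>t s. t \<ge> 0 \<longrightarrow> ((\<lambda>s. f (t, s)) has_real_derivative fs (t, s)) (at s)" by (elim bexE conjE)
    show ?case
      by (rule bexI[OF bexI[OF _ flow_class.int[OF fs(1)]] int.hyps])
        (simp add: int_t[OF cont[OF int.hyps]] int_s[OF cont[OF int.hyps] cont[OF fs(1)] _ fs(2)])
  next
    case (add f g)
    then obtain ft fs gt gs where f: "ft \<in> flow_class \<Phi> E" "fs \<in> flow_class \<Phi> E"
      "\<forall>t s. t \<ge> 0 \<longrightarrow> ((\<lambda>t. f (t, s)) has_real_derivative ft (t, s)) (at t within {0..})"
      "\<forall>t s. t \<ge> 0 \<longrightarrow> ((\<lambda>s. f (t, s)) has_real_derivative fs (t, s)) (at s)"
      and g: "gt \<in> flow_class \<Phi> E" "gs \<in> flow_class \<Phi> E"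
      "\<forall>t s. t \<ge> 0 \<longrightarrow> ((\<lambda>t. g (t, s)) has_real_derivative gt (t, s)) (at t within {0..})"
      "\<forall>t s. t \<ge> 0 \<longrightarrow> ((\<lambda>s. g (t, s)) has_real_derivative gs (t, s)) (at s)" by (elim bexE conjE)
    show ?case
      by (rule bexI[OF bexI[OF _ flow_class.add[OF f(2) g(2)]] flow_class.add[OF f(1) g(1)]])
        (intro conjI allI impI DERIV_add f(3,4)[rule_format] g(3,4)[rule_format])
  next
    case (mult f g)
    then obtain ft fs gt gs where f: "ft \<in> flow_class \<Phi> E" "fs \<in> flow_class \<Phi> E"
      "\<forall>t s. t \<ge> 0 \<longrightarrow> ((\<lambda>t. f (t, s)) has_real_derivative ft (t, s)) (at t within {0..})"
      "\<forall>t s. t \<ge> 0 \<longrightarrow> ((\<lambda>s. f (t, s)) has_real_derivative fs (t, s)) (at s)"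
      and g: "gt \<in> flow_class \<Phi> E" "gs \<in> flow_class \<Phi> E"
      "\<forall>t s. t \<ge> 0 \<longrightarrow> ((\<lambda>t. g (t, s)) has_real_derivative gt (t, s)) (at t within {0..})"
      "\<forall>t s. t \<ge> 0 \<longrightarrow> ((\<lambda>s. g (t, s)) has_real_derivative gs (t, s)) (at s)" by (elim bexE conjE)
    have 1: "(\<lambda>z. ft z * g z + gt z * f z) \<in> flow_class \<Phi> E"
      by (intro flow_class.add flow_class.mult mult.hyps f(1) g(1))
    have 2: "(\<lambda>z. fs z * g z + gs z * f z) \<in> flow_class \<Phi> E"
      by (intro flow_class.add flow_class.mult mult.hyps f(2) g(2))
    show ?case
      by (rule bexI[OF bexI[OF _ 2] 1])
        (intro conjI allI impI DERIV_mult f(3,4)[rule_format] g(3,4)[rule_format])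
  qed
qed

lemma flow_smooth:
  assumes V: "smooth_on ST V"
    and c\<Phi>: "continuous_on ST \<Phi>"
    and \<Phi>t: "\<And>t s. t \<ge> 0 \<Longrightarrow> ((\<lambda>t. \<Phi> (t, s)) has_real_derivative V (t, \<Phi> (t, s))) (at t within {0..})"
    and E: "\<And>z. E z = exp (integral {0..fst z} (\<lambda>\<tau>. px V (\<tau>, \<Phi> (\<tau>, snd z))))"
    and \<Phi>s: "\<And>t s. t \<ge> 0 \<Longrightarrow> ((\<lambda>s. \<Phi> (t, s)) has_real_derivative E (t, s)) (at s)"
  shows "smooth_on ST \<Phi>"
proof -
  have "continuous_on ST (\<lambda>z. px V (fst z, \<Phi> z))"
    by (rule continuous_on_compose2[OF smooth_on_imp_continuous_on[OF smooth_on_px[OF V]]])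
      (use c\<Phi> in \<open>auto simp: ST_def intro!: continuous_intros\<close>)
  from continuous_on_exp[OF continuous_on_integral_upper[OF this]]
  have cE: "continuous_on ST E" by (simp add: E[abs_def])
  have const: "smooth_on ST (\<lambda>_. c :: real)" for c by (rule smooth_on_const) simp
  show ?thesis
  proof (rule smooth_on_closed_class[where C="flow_class \<Phi> E"])
    fix f assume f: "f \<in> flow_class \<Phi> E"
    have "\<exists>ft\<in>flow_class \<Phi> E. \<exists>fs\<in>flow_class \<Phi> E.
      (\<forall>t s. t \<ge> 0 \<longrightarrow> ((\<lambda>t. f (t, s)) has_real_derivative ft (t, s)) (at t within {0..})) \<and>
      (\<forall>t s. t \<ge> 0 \<longrightarrow> ((\<lambda>s. f (t, s)) has_real_derivative fs (t, s)) (at s))"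
      by (rule flow_class_partials[OF V c\<Phi> \<Phi>t E \<Phi>s cE f])
    then obtain ft fs where p: "ft \<in> flow_class \<Phi> E" "fs \<in> flow_class \<Phi> E"
      "\<forall>t s. t \<ge> 0 \<longrightarrow> ((\<lambda>t. f (t, s)) has_real_derivative ft (t, s)) (at t within {0..})"
      "\<forall>t s. t \<ge> 0 \<longrightarrow> ((\<lambda>s. f (t, s)) has_real_derivative fs (t, s)) (at s)"
      by (elim bexE conjE)
    define D where "D z v = fst v * ft z + snd v * fs z" for z v :: "real \<times> real"
    have D: "(f has_derivative D z) (at z within ST)" if "z \<in> ST" for z
      unfolding D_def
      by (rule has_derivative_continuous_partials[OF _ _ flow_class_continuous[OF c\<Phi> cE p(2)] that])
        (use p(3,4) in simp_all)
    have B: "(\<lambda>z. D z b) \<in> flow_class \<Phi> E" for b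
      unfolding D_def
      by (rule flow_class.add[OF flow_class.mult[OF flow_class.comp[OF const] p(1)]
            flow_class.mult[OF flow_class.comp[OF const] p(2)]])
    show "\<exists>D. (\<forall>x\<in>ST. (f has_derivative D x) (at x within ST)) \<and>
        (\<forall>b\<in>Basis. \<exists>g\<in>flow_class \<Phi> E. \<forall>x\<in>ST. g x = D x b)"
      by (rule closed_class_witness(2)[where D=D, OF D B])
  next
    have "smooth_on ST snd" by (rule smooth_on_bounded_linear[OF _ bounded_linear_snd]) simp
    from flow_class.comp[OF this, of \<Phi> E] show "\<Phi> \<in> flow_class \<Phi> E" by simp
  qed simp
qed

section \<open>Global existence and dependence on the initial point\<close>

lemma picard:
  fixes V :: "real \<times> real \<Rightarrow> real"
  assumes cV: "continuous_on ST V" and bV: "\<And>z. z \<in> ST \<Longrightarrow> \<bar>V z\<bar> \<le> K"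
    and lip: "\<And>t a b. t \<ge> 0 \<Longrightarrow> \<bar>V (t, a) - V (t, b)\<bar> \<le> K * \<bar>a - b\<bar>" and K: "K > 0"
  shows "\<exists>\<phi>. continuous_on {0..} \<phi> \<and> (\<forall>t\<ge>0. \<phi> t = s + integral {0..t} (\<lambda>\<tau>. V (\<tau>, \<phi> \<tau>)))"
proof -
  \<comment> \<open>The unknown is \<zeta> with \<phi> = s + exp (2 K t) \<zeta>, so that an
    exponentially weighted norm of \<phi> - s becomes the plain uniform norm of \<zeta>. As K times
    the integral of exp (2 K \<tau>) over [0, t] is at most exp (2 K t) / 2, the map contracts by
    1/2 on the whole half-line at once. The \<open>max\<close> makes the value 0 for negative
    times.\<close>
  define G where "G \<zeta> t = exp (- 2 * K * max 0 t) * integral {0..max 0 t} (\<lambda>\<tau>. V (\<tau>, s + exp (2 * K * \<tau>) * \<zeta> \<tau>))"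
    for \<zeta> :: "real \<Rightarrow> real" and t
  have ic: "continuous_on {0..} (\<lambda>\<tau>. V (\<tau>, s + exp (2 * K * \<tau>) * \<zeta> \<tau>))" if "continuous_on UNIV \<zeta>" for \<zeta>
    by (rule continuous_on_compose2[OF cV])
      (auto simp: ST_def intro!: continuous_intros continuous_on_subset[OF that])
  have ii: "(\<lambda>\<tau>. V (\<tau>, s + exp (2 * K * \<tau>) * \<zeta> \<tau>)) integrable_on {0..T}" if "continuous_on UNIV \<zeta>" for \<zeta> T
    by (rule integrable_continuous_interval[OF continuous_on_subset[OF ic[OF that]]]) auto
  have Gc: "continuous_on UNIV (G \<zeta>)" if "continuous_on UNIV \<zeta>" for \<zeta>
  proof -
    have "continuous_on {0..} (\<lambda>t. integral {0..t} (\<lambda>\<tau>. V (\<tau>, s + exp (2 * K * \<tau>) * \<zeta> \<tau>)))"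
      by (rule continuous_on_vector_derivative[OF integral_has_vector_derivative_atLeast[OF ic[OF that]]]) simp
    then have "continuous_on UNIV (\<lambda>t::real. integral {0..max 0 t} (\<lambda>\<tau>. V (\<tau>, s + exp (2 * K * \<tau>) * \<zeta> \<tau>)))"
      by (rule continuous_on_compose2) (auto intro!: continuous_intros)
    then show ?thesis unfolding G_def by (intro continuous_intros)
  qed
  have Gb: "norm (G \<zeta> t) \<le> 1" if "continuous_on UNIV \<zeta>" for \<zeta> t
  proof -
    define T where "T = max 0 t"
    have "norm (integral {0..T} (\<lambda>\<tau>. V (\<tau>, s + exp (2 * K * \<tau>) * \<zeta> \<tau>))) \<le> integral {0..T} (\<lambda>\<tau>. K)"
      by (rule integral_norm_bound_integral[OF ii[OF that]]) (use bV in \<open>auto simp: ST_def\<close>)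
    then have "\<bar>integral {0..T} (\<lambda>\<tau>. V (\<tau>, s + exp (2 * K * \<tau>) * \<zeta> \<tau>))\<bar> \<le> integral {0..T} (\<lambda>\<tau>. K)"
      by simp
    also have "\<dots> = K * T" by (simp add: T_def)
    also have "\<dots> \<le> exp (2 * K * T)"
    proof -
      have "K * T \<le> 2 * K * T" using K by (simp add: T_def)
      then show ?thesis using exp_ge_add_one_self[of "2 * K * T"] by linarith
    qed
    finally have "exp (- 2 * K * T) * \<bar>integral {0..T} (\<lambda>\<tau>. V (\<tau>, s + exp (2 * K * \<tau>) * \<zeta> \<tau>))\<bar>
        \<le> exp (- 2 * K * T) * exp (2 * K * T)" by (intro mult_left_mono) auto
    also have "\<dots> = 1" by (simp flip: exp_add)
    finally show ?thesis by (simp add: G_def T_def abs_mult)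
  qed
  define A where "A \<zeta> = Bcontfun (G (apply_bcontfun \<zeta>))" for \<zeta> :: "real \<Rightarrow>\<^sub>C real"
  have A: "apply_bcontfun (A \<zeta>) = G (apply_bcontfun \<zeta>)" for \<zeta>
    unfolding A_def by (rule Bcontfun_inverse, rule bcontfun_normI[OF Gc Gb]) auto
  have contr: "dist (A \<zeta>) (A \<xi>) \<le> (1/2) * dist \<zeta> \<xi>" for \<zeta> \<xi>
  proof (rule dist_bound)
    fix t :: real
    define T where "T = max 0 t"
    have T: "T \<ge> 0" by (simp add: T_def)
    define d where "d = dist \<zeta> \<xi>"
    have cz: "continuous_on UNIV (apply_bcontfun \<zeta>)" "continuous_on UNIV (apply_bcontfun \<xi>)" by auto
    have I: "((\<lambda>\<tau>. K * d * exp (2 * K * \<tau>)) has_integral (d / 2 * exp (2 * K * T) - d / 2 * exp (2 * K * 0))) {0..T}"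
      using T K by (intro fundamental_theorem_of_calculus)
        (auto intro!: derivative_eq_intros simp: has_real_derivative_iff_has_vector_derivative[symmetric])
    have "\<bar>integral {0..T} (\<lambda>\<tau>. V (\<tau>, s + exp (2 * K * \<tau>) * \<zeta> \<tau>)) - integral {0..T} (\<lambda>\<tau>. V (\<tau>, s + exp (2 * K * \<tau>) * \<xi> \<tau>))\<bar>
        = \<bar>integral {0..T} (\<lambda>\<tau>. V (\<tau>, s + exp (2 * K * \<tau>) * \<zeta> \<tau>) - V (\<tau>, s + exp (2 * K * \<tau>) * \<xi> \<tau>))\<bar>"
      by (subst Henstock_Kurzweil_Integration.integral_diff[OF ii[OF cz(1)] ii[OF cz(2)]]) simp
    also have "\<dots> \<le> integral {0..T} (\<lambda>\<tau>. K * d * exp (2 * K * \<tau>))"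
    proof -
      have "norm (integral {0..T} (\<lambda>\<tau>. V (\<tau>, s + exp (2 * K * \<tau>) * \<zeta> \<tau>) - V (\<tau>, s + exp (2 * K * \<tau>) * \<xi> \<tau>)))
        \<le> integral {0..T} (\<lambda>\<tau>. K * d * exp (2 * K * \<tau>))"
      proof (rule integral_norm_bound_integral)
        fix \<tau> assume "\<tau> \<in> {0..T}"
        then have "norm (V (\<tau>, s + exp (2 * K * \<tau>) * \<zeta> \<tau>) - V (\<tau>, s + exp (2 * K * \<tau>) * \<xi> \<tau>))
            \<le> K * \<bar>(s + exp (2 * K * \<tau>) * \<zeta> \<tau>) - (s + exp (2 * K * \<tau>) * \<xi> \<tau>)\<bar>"
          using lip[of \<tau> "s + exp (2 * K * \<tau>) * \<zeta> \<tau>" "s + exp (2 * K * \<tau>) * \<xi> \<tau>"] by simp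
        also have "\<bar>(s + exp (2 * K * \<tau>) * \<zeta> \<tau>) - (s + exp (2 * K * \<tau>) * \<xi> \<tau>)\<bar> = exp (2 * K * \<tau>) * dist (\<zeta> \<tau>) (\<xi> \<tau>)"
          by (simp add: dist_real_def abs_mult flip: right_diff_distrib)
        also have "\<dots> \<le> exp (2 * K * \<tau>) * d"
          unfolding d_def by (intro mult_left_mono dist_bounded) auto
        finally show "norm (V (\<tau>, s + exp (2 * K * \<tau>) * \<zeta> \<tau>) - V (\<tau>, s + exp (2 * K * \<tau>) * \<xi> \<tau>)) \<le> K * d * exp (2 * K * \<tau>)"
          using K by (simp add: mult_ac)
      qed (use I ii[OF cz(1)] ii[OF cz(2)] in \<open>auto intro: integrable_diff\<close>)
      then show ?thesis by simp
    qed
    also have "\<dots> \<le> d / 2 * exp (2 * K * T)"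
      unfolding integral_unique[OF I] by (simp add: d_def)
    finally have "exp (- 2 * K * T) * \<bar>integral {0..T} (\<lambda>\<tau>. V (\<tau>, s + exp (2 * K * \<tau>) * \<zeta> \<tau>)) - integral {0..T} (\<lambda>\<tau>. V (\<tau>, s + exp (2 * K * \<tau>) * \<xi> \<tau>))\<bar>
        \<le> exp (- 2 * K * T) * (d / 2 * exp (2 * K * T))" by (intro mult_left_mono) auto
    also have "\<dots> = d / 2 * (exp (- 2 * K * T) * exp (2 * K * T))" by simp
    also have "\<dots> = d / 2" by (simp flip: exp_add)
    finally show "dist (apply_bcontfun (A \<zeta>) t) (apply_bcontfun (A \<xi>) t) \<le> (1/2) * dist \<zeta> \<xi>"
      by (simp add: A G_def T_def[symmetric] dist_real_def d_def abs_mult flip: right_diff_distrib)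
  qed
  have "\<exists>!\<zeta>. A \<zeta> = \<zeta>" by (rule banach_fix_type[of "1/2"]) (use contr in auto)
  then obtain \<zeta> where \<zeta>: "A \<zeta> = \<zeta>" by blast
  define \<phi> where "\<phi> t = s + exp (2 * K * t) * \<zeta> t" for t
  have "continuous_on {0..} \<phi>" unfolding \<phi>_def by (intro continuous_intros) auto
  moreover have "\<phi> t = s + integral {0..t} (\<lambda>\<tau>. V (\<tau>, \<phi> \<tau>))" if "t \<ge> 0" for t
  proof -
    have "\<zeta> t = G (apply_bcontfun \<zeta>) t" using A[of \<zeta>] \<zeta> by simp
    then have "\<zeta> t = exp (- (2 * K * t)) * integral {0..t} (\<lambda>\<tau>. V (\<tau>, \<phi> \<tau>))"
      using that by (simp add: G_def \<phi>_def max_def)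
    then have "exp (2 * K * t) * \<zeta> t = (exp (2 * K * t) * exp (- (2 * K * t))) * integral {0..t} (\<lambda>\<tau>. V (\<tau>, \<phi> \<tau>))"
      by simp
    then show ?thesis by (simp add: \<phi>_def flip: exp_add)
  qed
  ultimately show ?thesis by blast
qed

theorem flow_exists:
  fixes V :: "real \<times> real \<Rightarrow> real"
  assumes V: "smooth_on ST V" and bV: "\<And>z. z \<in> ST \<Longrightarrow> \<bar>V z\<bar> \<le> K" and bVx: "\<And>z. z \<in> ST \<Longrightarrow> \<bar>px V z\<bar> \<le> K"
  obtains \<Phi> :: "real \<times> real \<Rightarrow> real" where "smooth_on ST \<Phi>" "\<And>s. \<Phi> (0, s) = s"
    "\<And>t s. t \<ge> 0 \<Longrightarrow> pt \<Phi> (t, s) = V (t, \<Phi> (t, s))"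
    "\<And>t s. t \<ge> 0 \<Longrightarrow> px \<Phi> (t, s) > 0" "\<And>t. t \<ge> 0 \<Longrightarrow> surj (\<lambda>s. \<Phi> (t, s))"
proof -
  define M where "M = \<bar>K\<bar> + 1"
  have M: "M > 0" by (simp add: M_def)
  have bV': "\<bar>V z\<bar> \<le> M" and bVx': "\<bar>px V z\<bar> \<le> M" if "z \<in> ST" for z
    using bV[OF that] bVx[OF that] by (auto simp: M_def)
  have cV: "continuous_on ST V" and cVx: "continuous_on ST (px V)"
    using smooth_on_imp_continuous_on[OF V] smooth_on_imp_continuous_on[OF smooth_on_px[OF V]] .
  \<comment> \<open>An averaged derivative with V (t, b) - V (t, a) = Q (b - a), continuous also
    where a = b. It turns the equation for the difference of two trajectories into a linear one,
    solved by an exponential. When the trajectories merge, the exponential tends to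
    \<open>E\<close>, which gives differentiability in the initial point by Caratheodory's
    criterion.\<close>
  define Q where "Q t a b = integral (cbox 0 1) (\<lambda>\<theta>. px V (t, a + \<theta> * (b - a)))" for t a b
  have VQ: "V (t, b) - V (t, a) = Q t a b * (b - a)" if t: "t \<ge> 0" for t a b
  proof -
    have "((\<lambda>\<theta>. px V (t, a + \<theta> * (b - a)) * (b - a)) has_integral (V (t, a + 1 * (b - a)) - V (t, a + 0 * (b - a)))) {0..1}"
    proof (rule fundamental_theorem_of_calculus)
      fix \<theta> :: real
      have "((\<lambda>\<theta>. V (t, a + \<theta> * (b - a))) has_real_derivative px V (t, a + \<theta> * (b - a)) * (b - a)) (at \<theta> within {0..1})"
        by (rule DERIV_chain2[OF px_derivative[OF V t]]) (auto intro!: derivative_eq_intros)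
      then show "((\<lambda>\<theta>. V (t, a + \<theta> * (b - a))) has_vector_derivative px V (t, a + \<theta> * (b - a)) * (b - a)) (at \<theta> within {0..1})"
        by (simp add: has_real_derivative_iff_has_vector_derivative)
    qed simp
    from integral_unique[OF this] show ?thesis by (simp add: Q_def cbox_interval)
  qed
  have Qcont: "continuous_on A (\<lambda>x. Q (t x) (a x) (b x))"
    if c: "continuous_on A t" "continuous_on A a" "continuous_on A b" "\<And>x. x \<in> A \<Longrightarrow> t x \<ge> 0"
    for A :: "'c::topological_space set" and t a b
    unfolding Q_def
  proof (rule integral_continuous_on_param)
    show "continuous_on (A \<times> cbox 0 1) (\<lambda>(x, \<theta>). px V (t x, a x + \<theta> * (b x - a x)))"
      unfolding split_beta'
      by (rule continuous_on_compose2[OF cVx])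
       (auto simp: ST_def c(4) intro!: continuous_intros continuous_on_compose2[OF c(1)]
          continuous_on_compose2[OF c(2)] continuous_on_compose2[OF c(3)])
  qed
  have Qb: "\<bar>Q t a b\<bar> \<le> M" if "t \<ge> 0" for t a b
  proof -
    have "norm (integral (cbox 0 1) (\<lambda>\<theta>. px V (t, a + \<theta> * (b - a)))) \<le> integral (cbox 0 (1::real)) (\<lambda>\<theta>. M)"
    proof (rule integral_norm_bound_integral)
      have "continuous_on (cbox 0 1) (\<lambda>\<theta>. px V (t, a + \<theta> * (b - a)))"
        by (rule continuous_on_compose2[OF cVx]) (use that in \<open>auto simp: ST_def intro!: continuous_intros\<close>)
      then show "(\<lambda>\<theta>. px V (t, a + \<theta> * (b - a))) integrable_on cbox 0 1" by (rule integrable_continuous)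
      show "norm (px V (t, a + \<theta> * (b - a))) \<le> M" for \<theta> using bVx' that by (simp add: ST_def)
    qed auto
    then show ?thesis by (simp add: Q_def)
  qed
  have lip: "\<bar>V (t, a) - V (t, b)\<bar> \<le> M * \<bar>a - b\<bar>" if "t \<ge> 0" for t a b
    unfolding VQ[OF that] abs_mult by (intro mult_right_mono Qb that) auto
  have "\<exists>\<phi>. continuous_on {0..} \<phi> \<and> (\<forall>t\<ge>0. \<phi> t = s + integral {0..t} (\<lambda>\<tau>. V (\<tau>, \<phi> \<tau>)))" for s
    by (rule picard[OF cV bV' lip M])
  then obtain \<phi> where \<phi>0: "\<forall>s. continuous_on {0..} (\<phi> s) \<and> (\<forall>t\<ge>0. \<phi> s t = s + integral {0..t} (\<lambda>\<tau>. V (\<tau>, \<phi> s \<tau>)))"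
    using choice[of "\<lambda>s \<phi>. continuous_on {0..} \<phi> \<and> (\<forall>t\<ge>0. \<phi> t = s + integral {0..t} (\<lambda>\<tau>. V (\<tau>, \<phi> \<tau>)))"] by blast
  have \<phi>c: "continuous_on {0..} (\<phi> s)" and \<phi>i: "t \<ge> 0 \<Longrightarrow> \<phi> s t = s + integral {0..t} (\<lambda>\<tau>. V (\<tau>, \<phi> s \<tau>))" for s t
    using \<phi>0 by blast+
  have \<phi>Vc: "continuous_on {0..} (\<lambda>\<tau>. V (\<tau>, \<phi> s \<tau>))" for s
    by (rule continuous_on_compose2[OF cV]) (auto simp: ST_def intro!: continuous_intros \<phi>c)
  have \<phi>t: "((\<lambda>t. \<phi> s t) has_real_derivative V (t, \<phi> s t)) (at t within {0..})" if "t \<ge> 0" for s t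
  proof -
    have "((\<lambda>t. s + integral {0..t} (\<lambda>\<tau>. V (\<tau>, \<phi> s \<tau>))) has_real_derivative 0 + V (t, \<phi> s t)) (at t within {0..})"
      by (intro DERIV_add DERIV_const has_real_derivative_integral_atLeast[OF \<phi>Vc that])
    then have "((\<lambda>t. s + integral {0..t} (\<lambda>\<tau>. V (\<tau>, \<phi> s \<tau>))) has_real_derivative V (t, \<phi> s t)) (at t within {0..})"
      by simp
    then show ?thesis
      by (rule has_field_derivative_transform_within[where d=1]) (use that \<phi>i in simp_all)
  qed
  have \<phi>00: "\<phi> s 0 = s" for s using \<phi>i[of 0 s] by simp
  have Qc: "continuous_on {0..} (\<lambda>\<tau>. Q \<tau> (\<phi> s \<tau>) (\<phi> z \<tau>))" for s z
    by (rule Qcont) (auto intro!: \<phi>c continuous_intros)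
  have diff: "\<phi> z t - \<phi> s t = exp (integral {0..t} (\<lambda>\<tau>. Q \<tau> (\<phi> s \<tau>) (\<phi> z \<tau>))) * (z - s)" if t: "t \<ge> 0" for s z t
  proof -
    define I where "I t = integral {0..t} (\<lambda>\<tau>. Q \<tau> (\<phi> s \<tau>) (\<phi> z \<tau>))" for t
    have dI: "(I has_real_derivative Q t (\<phi> s t) (\<phi> z t)) (at t within {0..})" if "t \<ge> 0" for t
      unfolding I_def by (rule has_real_derivative_integral_atLeast[OF Qc that])
    have "((\<lambda>t. (\<phi> z t - \<phi> s t) * exp (- I t)) has_real_derivative 0) (at t within {0..})" if t: "t \<ge> 0" for t
    proof -
      have "((\<lambda>t. (\<phi> z t - \<phi> s t) * exp (- I t)) has_real_derivative
        (V (t, \<phi> z t) - V (t, \<phi> s t)) * exp (- I t) + (exp (- I t) * (- Q t (\<phi> s t) (\<phi> z t))) * (\<phi> z t - \<phi> s t)) (at t within {0..})"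
        by (intro DERIV_mult DERIV_diff \<phi>t t DERIV_chain2[OF DERIV_exp] DERIV_minus dI)
      then show ?thesis by (simp add: VQ[OF t] algebra_simps)
    qed
    from has_derivative_zero_atLeast_constant[OF this t]
    have "(\<phi> z t - \<phi> s t) * exp (- I t) = z - s" by (simp add: \<phi>00 I_def)
    then have "(\<phi> z t - \<phi> s t) * (exp (- I t) * exp (I t)) = exp (I t) * (z - s)" by (simp add: mult_ac)
    then show ?thesis by (simp add: I_def flip: exp_add)
  qed
  define \<Phi> where "\<Phi> z = \<phi> (snd z) (fst z)" for z
  have lip_s: "\<bar>\<phi> z t - \<phi> s t\<bar> \<le> exp (M * t) * \<bar>z - s\<bar>" if t: "t \<ge> 0" for s z t
  proof -
    have "integral {0..t} (\<lambda>\<tau>. Q \<tau> (\<phi> s \<tau>) (\<phi> z \<tau>)) \<le> integral {0..t} (\<lambda>\<tau>. M)"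
    proof (rule integral_le)
      show "(\<lambda>\<tau>. Q \<tau> (\<phi> s \<tau>) (\<phi> z \<tau>)) integrable_on {0..t}"
        by (rule integrable_continuous_interval[OF continuous_on_subset[OF Qc]]) auto
      show "Q \<tau> (\<phi> s \<tau>) (\<phi> z \<tau>) \<le> M" if "\<tau> \<in> {0..t}" for \<tau>
        using Qb[of \<tau> "\<phi> s \<tau>" "\<phi> z \<tau>"] that by simp
    qed auto
    then show ?thesis unfolding diff[OF t] abs_mult using t
      by (intro mult_right_mono) (auto simp: mult.commute)
  qed
  have lip_t: "\<bar>\<phi> s t' - \<phi> s t\<bar> \<le> M * \<bar>t' - t\<bar>" if "t \<ge> 0" "t' \<ge> 0" for s t t'
  proof -
    have "norm (\<phi> s t' - \<phi> s t) \<le> M * norm (t' - t)"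
      by (rule field_differentiable_bound[where S="{0..}" and f'="\<lambda>t. V (t, \<phi> s t)"])
        (use \<phi>t bV' that in \<open>auto simp: ST_def\<close>)
    then show ?thesis by simp
  qed
  have c\<Phi>: "continuous_on ST \<Phi>"
    unfolding continuous_on_def
  proof
    fix z assume z: "z \<in> ST"
    have "((\<lambda>w. exp (M * fst w) * \<bar>snd w - snd z\<bar> + M * \<bar>fst w - fst z\<bar>) \<longlongrightarrow> exp (M * fst z) * \<bar>snd z - snd z\<bar> + M * \<bar>fst z - fst z\<bar>) (at z within ST)"
      by (intro tendsto_intros)
    then have lim: "((\<lambda>w. exp (M * fst w) * \<bar>snd w - snd z\<bar> + M * \<bar>fst w - fst z\<bar>) \<longlongrightarrow> 0) (at z within ST)" by simp
    have "((\<lambda>w. \<Phi> w - \<Phi> z) \<longlongrightarrow> 0) (at z within ST)"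
    proof (rule Lim_null_comparison[OF _ lim])
      show "\<forall>\<^sub>F w in at z within ST. norm (\<Phi> w - \<Phi> z) \<le> exp (M * fst w) * \<bar>snd w - snd z\<bar> + M * \<bar>fst w - fst z\<bar>"
        unfolding eventually_at_filter
      proof (intro always_eventually allI impI)
        fix w assume "w \<in> ST"
        then have "fst w \<ge> 0" "fst z \<ge> 0" using z by (auto simp: ST_def)
        then show "norm (\<Phi> w - \<Phi> z) \<le> exp (M * fst w) * \<bar>snd w - snd z\<bar> + M * \<bar>fst w - fst z\<bar>"
          using lip_s[of "fst w" "snd w" "snd z"] lip_t[of "fst z" "fst w" "snd z"] by (simp add: \<Phi>_def)
      qed
    qed
    then show "(\<Phi> \<longlongrightarrow> \<Phi> z) (at z within ST)" by (simp add: LIM_zero_iff)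
  qed
  define E where "E z = exp (integral {0..fst z} (\<lambda>\<tau>. px V (\<tau>, \<Phi> (\<tau>, snd z))))" for z
  have \<Phi>t: "((\<lambda>t. \<Phi> (t, s)) has_real_derivative V (t, \<Phi> (t, s))) (at t within {0..})" if "t \<ge> 0" for t s
    using \<phi>t[OF that, of s] by (simp add: \<Phi>_def)
  have Qdiag: "Q t a a = px V (t, a)" for t a by (simp add: Q_def)
  have \<Phi>s: "((\<lambda>s. \<Phi> (t, s)) has_real_derivative E (t, s)) (at s)" if t: "t \<ge> 0" for t s
    unfolding CARAT_DERIV
  proof (intro exI conjI allI)
    define g where "g z = exp (integral (cbox 0 t) (\<lambda>\<tau>. Q \<tau> (\<Phi> (\<tau>, s)) (\<Phi> (\<tau>, z))))" for z
    show "\<Phi> (t, z) - \<Phi> (t, s) = g z * (z - s)" for z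
      using diff[OF t, of z s] by (simp add: \<Phi>_def g_def cbox_interval)
    have "continuous_on UNIV (\<lambda>z. integral (cbox 0 t) (\<lambda>\<tau>. Q \<tau> (\<Phi> (\<tau>, s)) (\<Phi> (\<tau>, z))))"
    proof (rule integral_continuous_on_param)
      show "continuous_on (UNIV \<times> cbox 0 t) (\<lambda>(z, \<tau>). Q \<tau> (\<Phi> (\<tau>, s)) (\<Phi> (\<tau>, z)))"
        unfolding split_beta'
        by (rule Qcont)
          (auto simp: ST_def cbox_interval intro!: continuous_intros continuous_on_compose2[OF c\<Phi>])
    qed
    then have "continuous_on UNIV g" unfolding g_def by (intro continuous_intros)
    then show "isCont g s" by (simp add: continuous_on_eq_continuous_at)
    show "g s = E (t, s)" by (simp add: g_def E_def Qdiag cbox_interval)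
  qed
  have sm: "smooth_on ST \<Phi>" by (rule flow_smooth[OF V c\<Phi> \<Phi>t E_def \<Phi>s])
  have surj: "surj (\<lambda>s. \<Phi> (t, s))" if t: "t \<ge> 0" for t
  proof -
    have close: "\<bar>\<Phi> (t, s) - s\<bar> \<le> M * t" for s
      using lip_t[of 0 t s] t by (simp add: \<Phi>_def \<phi>00)
    have "\<exists>s. \<Phi> (t, s) = y" for y
    proof -
      have c: "continuous_on {y - M * t..y + M * t} (\<lambda>s. \<Phi> (t, s))"
        by (rule continuous_on_compose2[OF c\<Phi>]) (use t in \<open>auto simp: ST_def intro!: continuous_intros\<close>)
      have "M * t \<ge> 0" using M t by simp
      then have "\<exists>x\<ge>y - M * t. x \<le> y + M * t \<and> \<Phi> (t, x) = y"
        using close[of "y - M * t"] close[of "y + M * t"] by (intro IVT' c) auto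
      then show ?thesis by blast
    qed
    then show ?thesis by (metis surjI)
  qed
  show ?thesis
  proof (rule that[OF sm _ _ _ surj])
    show "\<Phi> (0, s) = s" for s by (simp add: \<Phi>_def \<phi>00)
    show "pt \<Phi> (t, s) = V (t, \<Phi> (t, s))" if "t \<ge> 0" for t s by (rule pt_eqI[OF sm that \<Phi>t[OF that]])
    show "px \<Phi> (t, s) > 0" if "t \<ge> 0" for t s
      unfolding px_eqI[OF sm that \<Phi>s[OF that]] by (simp add: E_def)
  qed
qed

section \<open>Helicoidal surfaces\<close>

lemma smooth_on_deriv:
  fixes f :: "real \<Rightarrow> real"
  assumes "smooth_on UNIV f"
  shows smooth_DERIV: "(f has_real_derivative deriv f x) (at x)" and smooth_deriv: "smooth_on UNIV (deriv f)"
proof -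
  have d: "(f has_real_derivative frechet_derivative f (at x) 1) (at x)" for x
  proof -
    have h: "(f has_derivative frechet_derivative f (at x)) (at x)"
      using smooth_on_has_derivative[OF assms UNIV_I] .
    have "frechet_derivative f (at x) v = frechet_derivative f (at x) 1 * v" for v
      using linear.scaleR[OF has_derivative_linear[OF h], of v 1] by simp
    then have "frechet_derivative f (at x) = (*) (frechet_derivative f (at x) 1)" by (rule ext)
    from has_derivative_eq_rhs[OF h this] show ?thesis by (simp only: has_field_derivative_def)
  qed
  have e: "deriv f = (\<lambda>x. frechet_derivative f (at x) 1)" using d DERIV_imp_deriv by blast
  show "(f has_real_derivative deriv f x) (at x)" unfolding e by (rule d)
  show "smooth_on UNIV (deriv f)" unfolding e by (rule smooth_on_frechet_Basis[OF assms]) simp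
qed

lemma frechet_eq:
  fixes f :: "'a::euclidean_space \<Rightarrow> 'b::real_normed_vector"
  shows "(f has_derivative D) (at x) \<Longrightarrow> frechet_derivative f (at x) = D"
  by (rule frechet_derivative_within_eq[OF approachable_UNIV UNIV_I])

section \<open>The rotating frame of the plane\<close>

definition v2 :: "real \<Rightarrow> real \<Rightarrow> real^2" where "v2 a b = a *\<^sub>R axis 1 1 + b *\<^sub>R axis 2 1"
definition ee :: "real \<Rightarrow> real^2" where "ee \<theta> = v2 (cos \<theta>) (sin \<theta>)"
definition nn :: "real \<Rightarrow> real^2" where "nn \<theta> = v2 (- sin \<theta>) (cos \<theta>)"

lemma v2_nth [simp]: "v2 a b $ 1 = a" "v2 a b $ 2 = b"
  by (simp_all add: v2_def axis_def)

lemma vec2_eqI: "x $ 1 = y $ 1 \<Longrightarrow> x $ 2 = y $ 2 \<Longrightarrow> x = (y :: real^2)"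
  by (simp add: vec_eq_iff forall_2)

lemma v2_eta: "v2 (p $ 1) (p $ 2) = p" by (rule vec2_eqI) simp_all

lemma inner_2: "x \<bullet> y = x $ 1 * y $ 1 + x $ 2 * (y $ 2 :: real)" for x y :: "real^2"
  by (simp add: inner_vec_def sum_2)

lemma v2_simps: "v2 a b + v2 c d = v2 (a + c) (b + d)" "- v2 a b = v2 (- a) (- b)"
  "v2 a b - v2 c d = v2 (a - c) (b - d)" "k *\<^sub>R v2 a b = v2 (k * a) (k * b)" "v2 0 0 = 0"
  by (rule vec2_eqI; simp)+

lemma v2_eq_iff: "v2 a b = v2 c d \<longleftrightarrow> a = c \<and> b = d"
  by (metis v2_nth)

lemma sin_sq_cos_sq': "cos \<theta> * cos \<theta> + sin \<theta> * sin \<theta> = (1::real)"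
  using sin_cos_squared_add3[of \<theta>] .

lemma frame_inner [simp]: "ee \<theta> \<bullet> ee \<theta> = 1" "nn \<theta> \<bullet> nn \<theta> = 1" "ee \<theta> \<bullet> nn \<theta> = 0" "nn \<theta> \<bullet> ee \<theta> = 0"
  using sin_sq_cos_sq'[of \<theta>] by (simp_all add: inner_2 ee_def nn_def algebra_simps)

lemma frame_decomp: "\<beta> = (\<beta> \<bullet> ee \<theta>) *\<^sub>R ee \<theta> + (\<beta> \<bullet> nn \<theta>) *\<^sub>R nn \<theta>"
proof -
  have t: "cos \<theta> * (cos \<theta> * t) + sin \<theta> * (sin \<theta> * t) = t" for t
  proof -
    have "cos \<theta> * (cos \<theta> * t) + sin \<theta> * (sin \<theta> * t) = (cos \<theta> * cos \<theta> + sin \<theta> * sin \<theta>) * t"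
      by (simp only: distrib_right mult.assoc)
    then show ?thesis by (simp only: sin_sq_cos_sq' mult_1_left)
  qed
  show ?thesis
    by (intro vec2_eqI) (simp_all add: inner_2 ee_def nn_def algebra_simps t)
qed

lemma v2_inner [simp]: "v2 a b \<bullet> v2 c d = a * c + b * d" by (simp add: inner_2)

lemma has_derivative_nth: "((\<lambda>p. p $ i) has_derivative (\<lambda>v. v $ i)) F"
  by (rule bounded_linear_imp_has_derivative[OF bounded_linear_vec_nth])

lemma smooth_on_nth: "smooth_on UNIV (\<lambda>p::real^'n. p $ i)"
  by (rule smooth_on_bounded_linear[OF approachable_UNIV bounded_linear_vec_nth])

lemma has_derivative_comp_nth:
  fixes f :: "real \<Rightarrow> real"
  assumes "(f has_real_derivative D) (at (p $ i))"
  shows "((\<lambda>p. f (p $ i)) has_derivative (\<lambda>v. v $ i * D)) (at p)"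
  by (rule has_derivative_eq_rhs[OF has_derivative_compose[OF has_derivative_nth
        assms[unfolded has_field_derivative_def]]]) (simp add: mult.commute)

lemma smooth_on_comp_nth: "smooth_on UNIV f \<Longrightarrow> smooth_on UNIV (\<lambda>p::real^'n. f (p $ i) :: real)"
  by (rule smooth_on_compose[OF approachable_UNIV _ smooth_on_nth])

lemma has_derivative_v2:
  assumes "(a has_derivative a') F" "(b has_derivative b') F"
  shows "((\<lambda>p. v2 (a p) (b p)) has_derivative (\<lambda>v. v2 (a' v) (b' v))) F"
  unfolding v2_def by (intro has_derivative_add has_derivative_scaleR_left assms)

lemma smooth_on_v2:
  fixes a b :: "'a::euclidean_space \<Rightarrow> real"
  assumes "approachable S" "smooth_on S a" "smooth_on S b" shows "smooth_on S (\<lambda>p. v2 (a p) (b p))"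
  unfolding v2_def
  by (intro smooth_on_add smooth_on_scaleR smooth_on_const assms)

lemma smooth_on_ee: "approachable S \<Longrightarrow> smooth_on S f \<Longrightarrow> smooth_on S (\<lambda>p. ee (f p))"
  and smooth_on_nn: "approachable S \<Longrightarrow> smooth_on S f \<Longrightarrow> smooth_on S (\<lambda>p. nn (f p))"
  for f :: "'a::euclidean_space \<Rightarrow> real"
  unfolding ee_def nn_def
  by (intro smooth_on_v2 smooth_on_uminus smooth_on_compose[OF _ smooth_on_sin] smooth_on_compose[OF _ smooth_on_cos]; assumption)+

lemma has_derivative_ee: "((\<lambda>p. ee (p $ 2)) has_derivative (\<lambda>v. v $ 2 *\<^sub>R nn (p $ 2))) (at (p::real^2))"
  and has_derivative_nn: "((\<lambda>p. nn (p $ 2)) has_derivative (\<lambda>v. v $ 2 *\<^sub>R (- ee (p $ 2)))) (at (p::real^2))"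
proof -
  have s: "((\<lambda>p. sin (p $ 2)) has_derivative (\<lambda>v. v $ 2 * cos (p $ 2))) (at (p::real^2))"
    and c: "((\<lambda>p. cos (p $ 2)) has_derivative (\<lambda>v. v $ 2 * - sin (p $ 2))) (at (p::real^2))"
    using has_derivative_comp_nth[of sin "cos (p $ 2)" p 2] has_derivative_comp_nth[of cos "- sin (p $ 2)" p 2]
    by (simp_all add: DERIV_sin DERIV_cos)
  show "((\<lambda>p. ee (p $ 2)) has_derivative (\<lambda>v. v $ 2 *\<^sub>R nn (p $ 2))) (at (p::real^2))"
    unfolding ee_def by (rule has_derivative_eq_rhs[OF has_derivative_v2[OF c s]]) (auto simp: nn_def v2_simps)
  show "((\<lambda>p. nn (p $ 2)) has_derivative (\<lambda>v. v $ 2 *\<^sub>R (- ee (p $ 2)))) (at (p::real^2))"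
    unfolding nn_def by (rule has_derivative_eq_rhs[OF has_derivative_v2[OF has_derivative_minus[OF s] c]]) (auto simp: ee_def v2_simps)
qed

lemma matrix_inv_eqI:
  fixes A B :: "real^'n^'n"
  assumes "B ** A = mat 1" shows "matrix_inv A = B"
proof -
  have AB: "A ** B = mat 1" using assms matrix_left_right_inverse by blast
  have "A ** matrix_inv A = mat 1 \<and> matrix_inv A ** A = mat 1"
    unfolding matrix_inv_def by (rule someI[of _ B]) (simp add: assms AB)
  then have inv: "A ** matrix_inv A = mat 1" ..
  have "matrix_inv A = (B ** A) ** matrix_inv A" by (simp add: assms)
  also have "\<dots> = B ** (A ** matrix_inv A)" by (simp add: matrix_mul_assoc)
  also have "\<dots> = B" by (simp add: inv)
  finally show ?thesis .
qed

lemma normal_partI: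
  assumes "(F has_derivative D) (at p)" "\<And>v. z \<bullet> D v = 0" "w - z = D u"
  shows "normal_part F p w = z"
proof -
  have D: "frechet_derivative F (at p) = D" by (rule frechet_eq[OF assms(1)])
  have l: "linear D" by (rule has_derivative_linear[OF assms(1)])
  have mem: "y \<in> normal_space F p \<longleftrightarrow> (\<forall>v. y \<bullet> D v = 0)" for y
    by (auto simp: normal_space_def tangent_space_def D orthogonal_comp_def orthogonal_def inner_commute)
  show ?thesis unfolding normal_part_def
  proof (rule the_equality)
    show "z \<in> normal_space F p \<and> w - z \<in> tangent_space F p"
      using assms(2,3) by (auto simp: mem tangent_space_def D)
  next
    fix y assume y: "y \<in> normal_space F p \<and> w - y \<in> tangent_space F p"
    then obtain u' where u': "w - y = D u'" by (auto simp: tangent_space_def D)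
    have yz: "y - z = D (u - u')" by (simp add: linear_diff[OF l] flip: u' assms(3))
    have "(y - z) \<bullet> D (u - u') = 0" using y assms(2) by (simp add: mem inner_diff_left)
    then have "(y - z) \<bullet> (y - z) = 0" by (simp only: yz)
    then show "y = z" by simp
  qed
qed

text \<open>The profile curve (\<open>X\<close>, \<open>U\<close>) is parametrized because points of
  a mean curvature flow move normally and not vertically. Taking \<open>X\<close> to be the identity
  gives the graph of p \<mapsto> U (p $ 1) ee (p $ 2).\<close>

definition helix :: "(real \<Rightarrow> real) \<Rightarrow> (real \<Rightarrow> real) \<Rightarrow> real^2 \<Rightarrow> (real^2) \<times> (real^2)" where
  "helix X U p = (v2 (X (p $ 1)) (p $ 2), U (p $ 1) *\<^sub>R ee (p $ 2))"

context
  fixes X U :: "real \<Rightarrow> real"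
  assumes sX: "smooth_on UNIV X" and sU: "smooth_on UNIV U" and X0: "\<And>x. deriv X x \<noteq> 0"
begin

definition hx :: "real^2 \<Rightarrow> (real^2) \<times> (real^2)" where
  "hx p = (v2 (deriv X (p $ 1)) 0, deriv U (p $ 1) *\<^sub>R ee (p $ 2))"
definition hy :: "real^2 \<Rightarrow> (real^2) \<times> (real^2)" where
  "hy p = (v2 0 1, U (p $ 1) *\<^sub>R nn (p $ 2))"
definition g1 :: "real^2 \<Rightarrow> real" where "g1 p = (deriv X (p $ 1))\<^sup>2 + (deriv U (p $ 1))\<^sup>2"
definition g2 :: "real^2 \<Rightarrow> real" where "g2 p = 1 + (U (p $ 1))\<^sup>2"
definition \<nu>1 :: "real^2 \<Rightarrow> (real^2) \<times> (real^2)" where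
  "\<nu>1 p = inverse (sqrt (g1 p)) *\<^sub>R (v2 (- deriv U (p $ 1)) 0, deriv X (p $ 1) *\<^sub>R ee (p $ 2))"
definition \<nu>2 :: "real^2 \<Rightarrow> (real^2) \<times> (real^2)" where
  "\<nu>2 p = inverse (sqrt (g2 p)) *\<^sub>R (v2 0 (- U (p $ 1)), nn (p $ 2))"

lemma g1_pos: "g1 p > 0" and g2_pos: "g2 p > 0"
  using X0[of "p $ 1"] by (simp_all add: g1_def g2_def add_pos_nonneg)

lemma helix_has_derivative: "(helix X U has_derivative (\<lambda>v. v $ 1 *\<^sub>R hx p + v $ 2 *\<^sub>R hy p)) (at p)"
proof -
  note dX = has_derivative_comp_nth[OF smooth_DERIV[OF sX], where p=p and i=1]
  note dU = has_derivative_comp_nth[OF smooth_DERIV[OF sU], where p=p and i=1]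
  have "((\<lambda>p. (v2 (X (p $ 1)) (p $ 2), U (p $ 1) *\<^sub>R ee (p $ 2))) has_derivative
     (\<lambda>v. (v2 (v $ 1 * deriv X (p $ 1)) (v $ 2),
       U (p $ 1) *\<^sub>R (v $ 2 *\<^sub>R nn (p $ 2)) + (v $ 1 * deriv U (p $ 1)) *\<^sub>R ee (p $ 2)))) (at p)"
    by (intro has_derivative_Pair has_derivative_v2 dX has_derivative_nth has_derivative_scaleR dU has_derivative_ee)
  then show ?thesis unfolding helix_def[abs_def]
    by (rule has_derivative_eq_rhs) (auto simp: hx_def hy_def v2_simps mult_ac)
qed

lemma helix_frechet: "frechet_derivative (helix X U) (at p) v = v $ 1 *\<^sub>R hx p + v $ 2 *\<^sub>R hy p"
  using frechet_eq[OF helix_has_derivative[of p]] by simp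

lemma smooth_comps:
  "smooth_on UNIV (\<lambda>p::real^2. X (p $ 1))" "smooth_on UNIV (\<lambda>p::real^2. U (p $ 1))"
  "smooth_on UNIV (\<lambda>p::real^2. deriv X (p $ 1))" "smooth_on UNIV (\<lambda>p::real^2. deriv U (p $ 1))"
  by (intro smooth_on_comp_nth sX sU smooth_deriv)+

lemma smooth_helix: "smooth_on UNIV (helix X U)"
  unfolding helix_def[abs_def]
  by (intro smooth_on_Pair smooth_on_v2 smooth_on_scaleR smooth_on_ee smooth_comps smooth_on_nth approachable_UNIV)

lemma smooth_hx: "smooth_on UNIV hx" and smooth_hy: "smooth_on UNIV hy"
  unfolding hx_def[abs_def] hy_def[abs_def]
  by (intro smooth_on_Pair smooth_on_v2 smooth_on_scaleR smooth_on_ee smooth_on_nn smooth_comps smooth_on_nth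
      smooth_on_const approachable_UNIV)+

lemma smooth_g1: "smooth_on UNIV g1" and smooth_g2: "smooth_on UNIV g2"
  unfolding g1_def[abs_def] g2_def[abs_def]
  by (intro smooth_on_add_real smooth_on_power smooth_comps smooth_on_const approachable_UNIV)+

lemma smooth_rsqrt: "smooth_on UNIV (\<lambda>p. inverse (sqrt (g1 p)))" "smooth_on UNIV (\<lambda>p. inverse (sqrt (g2 p)))"
  by (intro smooth_on_inverse smooth_on_sqrt smooth_g1 smooth_g2 approachable_UNIV; use g1_pos g2_pos in \<open>simp add: less_imp_neq[symmetric]\<close>)+

lemma smooth_\<nu>1: "smooth_on UNIV \<nu>1" and smooth_\<nu>2: "smooth_on UNIV \<nu>2"
  unfolding \<nu>1_def[abs_def] \<nu>2_def[abs_def]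
  by (intro smooth_rsqrt smooth_on_Pair smooth_on_v2 smooth_on_scaleR smooth_on_ee smooth_on_nn smooth_comps smooth_on_nth
      smooth_on_const smooth_on_uminus approachable_UNIV)+

lemma inner_h: "hx p \<bullet> hx p = g1 p" "hy p \<bullet> hy p = g2 p" "hx p \<bullet> hy p = 0" "hy p \<bullet> hx p = 0"
  by (simp_all add: hx_def hy_def g1_def g2_def power2_eq_square)

lemma inner_\<nu>: "\<nu>1 p \<bullet> hx p = 0" "\<nu>1 p \<bullet> hy p = 0" "\<nu>2 p \<bullet> hx p = 0" "\<nu>2 p \<bullet> hy p = 0"
  "\<nu>1 p \<bullet> \<nu>1 p = 1" "\<nu>2 p \<bullet> \<nu>2 p = 1" "\<nu>1 p \<bullet> \<nu>2 p = 0" "\<nu>2 p \<bullet> \<nu>1 p = 0"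
proof -
  have s: "inverse (sqrt (g p)) * (inverse (sqrt (g p)) * g p) = 1" if "g p > 0" for g :: "real^2 \<Rightarrow> real"
  proof -
    have "sqrt (g p) * sqrt (g p) = g p" using that by simp
    then show ?thesis using that by (metis inverse_mult_distrib left_inverse less_irrefl mult.assoc)
  qed
  have a: "(v2 (- deriv U (p $ 1)) 0, deriv X (p $ 1) *\<^sub>R ee (p $ 2)) \<bullet>
      (v2 (- deriv U (p $ 1)) 0, deriv X (p $ 1) *\<^sub>R ee (p $ 2)) = g1 p"
    and b: "(v2 0 (- U (p $ 1)), nn (p $ 2)) \<bullet> (v2 0 (- U (p $ 1)), nn (p $ 2)) = g2 p"
    by (simp_all add: g1_def g2_def power2_eq_square)
  show "\<nu>1 p \<bullet> \<nu>1 p = 1" using s[of g1, OF g1_pos] by (simp only: \<nu>1_def inner_scaleR_left inner_scaleR_right a)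
  show "\<nu>2 p \<bullet> \<nu>2 p = 1" using s[of g2, OF g2_pos] by (simp only: \<nu>2_def inner_scaleR_left inner_scaleR_right b)
qed (simp_all add: hx_def hy_def \<nu>1_def \<nu>2_def)

text \<open>The four vectors form an orthogonal basis of R^4. Relative to the axes in the base and
  the rotated frame in the fibre, the space splits into two planes, one containing \<open>hx\<close>
  and \<open>\<nu>1\<close>, the other \<open>hy\<close> and \<open>\<nu>2\<close>;
  \<open>p1\<close> and \<open>p2\<close> are the expansions in these planes.\<close>

lemma decomp:
  "w = (w \<bullet> hx p / g1 p) *\<^sub>R hx p + (w \<bullet> hy p / g2 p) *\<^sub>R hy p + (w \<bullet> \<nu>1 p) *\<^sub>R \<nu>1 p + (w \<bullet> \<nu>2 p) *\<^sub>R \<nu>2 p"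
proof -
  define \<theta> where "\<theta> = p $ 2"
  define a b c d where "a = fst w $ 1" and "b = fst w $ 2" and "c = snd w \<bullet> ee \<theta>" and "d = snd w \<bullet> nn \<theta>"
  have w: "w = (v2 a b, c *\<^sub>R ee \<theta> + d *\<^sub>R nn \<theta>)"
    by (rule prod_eqI) (simp_all add: a_def b_def c_def d_def v2_eta frame_decomp[symmetric])
  define x u k where "x = deriv X (p $ 1)" and "u = deriv U (p $ 1)" and "k = U (p $ 1)"
  have g1: "g1 p = x\<^sup>2 + u\<^sup>2" and g2: "g2 p = 1 + k\<^sup>2" by (simp_all add: g1_def g2_def x_def u_def k_def)
  have sq: "inverse (sqrt (g1 p)) * inverse (sqrt (g1 p)) = 1 / g1 p" "inverse (sqrt (g2 p)) * inverse (sqrt (g2 p)) = 1 / g2 p"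
    using g1_pos[of p] g2_pos[of p] by (simp_all add: divide_inverse flip: inverse_mult_distrib)
  have i: "w \<bullet> hx p = a * x + c * u" "w \<bullet> hy p = b + d * k"
    unfolding w by (simp_all add: hx_def hy_def x_def u_def k_def \<theta>_def[symmetric] inner_add_left mult_ac)
  have j: "(w \<bullet> \<nu>1 p) *\<^sub>R \<nu>1 p = ((c * x - a * u) / g1 p) *\<^sub>R (v2 (- u) 0, x *\<^sub>R ee \<theta>)"
  proof -
    have "w \<bullet> \<nu>1 p = inverse (sqrt (g1 p)) * (c * x - a * u)"
      unfolding w by (simp add: \<nu>1_def x_def u_def \<theta>_def[symmetric] inner_add_left algebra_simps)
    then have "(w \<bullet> \<nu>1 p) *\<^sub>R \<nu>1 p = ((inverse (sqrt (g1 p)) * inverse (sqrt (g1 p))) * (c * x - a * u)) *\<^sub>R (v2 (- u) 0, x *\<^sub>R ee \<theta>)"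
      by (simp add: \<nu>1_def x_def u_def \<theta>_def mult_ac)
    then show ?thesis unfolding sq by simp
  qed
  have j2: "(w \<bullet> \<nu>2 p) *\<^sub>R \<nu>2 p = ((d - b * k) / g2 p) *\<^sub>R (v2 0 (- k), nn \<theta>)"
  proof -
    have "w \<bullet> \<nu>2 p = inverse (sqrt (g2 p)) * (d - b * k)"
      unfolding w by (simp add: \<nu>2_def k_def \<theta>_def[symmetric] inner_add_left algebra_simps)
    then have "(w \<bullet> \<nu>2 p) *\<^sub>R \<nu>2 p = ((inverse (sqrt (g2 p)) * inverse (sqrt (g2 p))) * (d - b * k)) *\<^sub>R (v2 0 (- k), nn \<theta>)"
      by (simp add: \<nu>2_def k_def \<theta>_def mult_ac)
    then show ?thesis unfolding sq by simp
  qed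
  have hh: "hx p = (v2 x 0, u *\<^sub>R ee \<theta>)" "hy p = (v2 0 1, k *\<^sub>R nn \<theta>)"
    by (simp_all add: hx_def hy_def x_def u_def k_def \<theta>_def)
  have p1: "(a * x + c * u) / g1 p * x - (c * x - a * u) / g1 p * u = a"
    "(a * x + c * u) / g1 p * u + (c * x - a * u) / g1 p * x = c"
  proof -
    have "(a * x + c * u) * x - (c * x - a * u) * u = a * g1 p"
      "(a * x + c * u) * u + (c * x - a * u) * x = c * g1 p"
      by (simp_all add: g1 power2_eq_square algebra_simps)
    then show "(a * x + c * u) / g1 p * x - (c * x - a * u) / g1 p * u = a"
      "(a * x + c * u) / g1 p * u + (c * x - a * u) / g1 p * x = c"
      using g1_pos[of p] by (simp_all add: times_divide_eq_left flip: diff_divide_distrib add_divide_distrib)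
  qed
  have p2: "(b + d * k) / g2 p - (d - b * k) / g2 p * k = b" "(b + d * k) / g2 p * k + (d - b * k) / g2 p = d"
  proof -
    have "(b + d * k) - (d - b * k) * k = b * g2 p" "(b + d * k) * k + (d - b * k) = d * g2 p"
      by (simp_all add: g2 power2_eq_square algebra_simps)
    then show "(b + d * k) / g2 p - (d - b * k) / g2 p * k = b" "(b + d * k) / g2 p * k + (d - b * k) / g2 p = d"
      using g2_pos[of p] by (simp_all add: times_divide_eq_left flip: diff_divide_distrib add_divide_distrib)
  qed
  show ?thesis
    unfolding i j j2 unfolding hh
  proof (subst w, rule prod_eqI)
    show "fst (v2 a b, c *\<^sub>R ee \<theta> + d *\<^sub>R nn \<theta>) =
      fst (((a * x + c * u) / g1 p) *\<^sub>R (v2 x 0, u *\<^sub>R ee \<theta>) + ((b + d * k) / g2 p) *\<^sub>R (v2 0 1, k *\<^sub>R nn \<theta>) +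
        ((c * x - a * u) / g1 p) *\<^sub>R (v2 (- u) 0, x *\<^sub>R ee \<theta>) + ((d - b * k) / g2 p) *\<^sub>R (v2 0 (- k), nn \<theta>))"
      using p1(1) p2(1) by (simp add: v2_simps v2_eq_iff)
    have "c *\<^sub>R ee \<theta> + d *\<^sub>R nn \<theta> = ((a * x + c * u) / g1 p * u + (c * x - a * u) / g1 p * x) *\<^sub>R ee \<theta> +
        ((b + d * k) / g2 p * k + (d - b * k) / g2 p) *\<^sub>R nn \<theta>" unfolding p1 p2 ..
    then show "snd (v2 a b, c *\<^sub>R ee \<theta> + d *\<^sub>R nn \<theta>) =
      snd (((a * x + c * u) / g1 p) *\<^sub>R (v2 x 0, u *\<^sub>R ee \<theta>) + ((b + d * k) / g2 p) *\<^sub>R (v2 0 1, k *\<^sub>R nn \<theta>) +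
        ((c * x - a * u) / g1 p) *\<^sub>R (v2 (- u) 0, x *\<^sub>R ee \<theta>) + ((d - b * k) / g2 p) *\<^sub>R (v2 0 (- k), nn \<theta>))"
      by (simp add: scaleR_add_left)
  qed
qed

lemma helix_normal_part: "normal_part (helix X U) p w = (w \<bullet> \<nu>1 p) *\<^sub>R \<nu>1 p + (w \<bullet> \<nu>2 p) *\<^sub>R \<nu>2 p"
proof (rule normal_partI[OF helix_has_derivative])
  show "((w \<bullet> \<nu>1 p) *\<^sub>R \<nu>1 p + (w \<bullet> \<nu>2 p) *\<^sub>R \<nu>2 p) \<bullet> (v $ 1 *\<^sub>R hx p + v $ 2 *\<^sub>R hy p) = 0" for v :: "real^2"
    by (simp add: inner_add_left inner_add_right inner_\<nu>)
  show "w - ((w \<bullet> \<nu>1 p) *\<^sub>R \<nu>1 p + (w \<bullet> \<nu>2 p) *\<^sub>R \<nu>2 p) =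
      v2 (w \<bullet> hx p / g1 p) (w \<bullet> hy p / g2 p) $ 1 *\<^sub>R hx p + v2 (w \<bullet> hx p / g1 p) (w \<bullet> hy p / g2 p) $ 2 *\<^sub>R hy p"
    unfolding v2_nth using decomp[of w p] by (simp add: algebra_simps)
qed

lemma helix_inj: "inj (frechet_derivative (helix X U) (at p))"
proof (rule injI)
  fix v w assume "frechet_derivative (helix X U) (at p) v = frechet_derivative (helix X U) (at p) w"
  then have "fst (v $ 1 *\<^sub>R hx p + v $ 2 *\<^sub>R hy p) = fst (w $ 1 *\<^sub>R hx p + w $ 2 *\<^sub>R hy p)"
    unfolding helix_frechet by simp
  then show "v = w" using X0[of "p $ 1"] by (intro vec2_eqI) (auto simp: hx_def hy_def v2_simps v2_eq_iff)
qed

lemma helix_immersion: "immersion (helix X U)"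
  unfolding immersion_def using smooth_helix helix_inj by blast

lemma helix_levi_civita:
  "levi_civita (helix X U) Y Z p =
     v2 (euclidean_connection Y (pushforward (helix X U) Z) p \<bullet> hx p / g1 p)
        (euclidean_connection Y (pushforward (helix X U) Z) p \<bullet> hy p / g2 p)"
proof -
  define w where "w = euclidean_connection Y (pushforward (helix X U) Z) p"
  have eq: "frechet_derivative (helix X U) (at p) (v2 (w \<bullet> hx p / g1 p) (w \<bullet> hy p / g2 p)) =
      w - second_fundamental_form (helix X U) Y Z p"
    unfolding helix_frechet second_fundamental_form_def w_def[symmetric] helix_normal_part v2_nth
    using decomp[of w p] by (simp add: algebra_simps)
  show ?thesis
    unfolding levi_civita_def w_def[symmetric]
  proof (rule the_equality)
    show "frechet_derivative (helix X U) (at p) (v2 (w \<bullet> hx p / g1 p) (w \<bullet> hy p / g2 p)) =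
      w - second_fundamental_form (helix X U) Y Z p" by (rule eq)
    show "v = v2 (w \<bullet> hx p / g1 p) (w \<bullet> hy p / g2 p)"
      if "frechet_derivative (helix X U) (at p) v = w - second_fundamental_form (helix X U) Y Z p" for v
      by (rule injD[OF helix_inj[of p]]) (simp only: that eq)
  qed
qed

lemma helix_matrix_inv:
  "matrix_inv (induced_metric (helix X U) p) =
     (\<chi> i j. if i = j then (if i = 1 then 1 / g1 p else 1 / g2 p) else 0)" (is "_ = ?B")
proof (rule matrix_inv_eqI)
  have f: "frechet_derivative (helix X U) (at p) (axis 1 1) = hx p" "frechet_derivative (helix X U) (at p) (axis 2 1) = hy p"
    unfolding helix_frechet by (simp_all add: axis_def)
  have "induced_metric (helix X U) p $ 1 $ 1 = g1 p" "induced_metric (helix X U) p $ 2 $ 2 = g2 p"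
    "induced_metric (helix X U) p $ 1 $ 2 = 0" "induced_metric (helix X U) p $ 2 $ 1 = 0"
    unfolding induced_metric_def by (simp_all add: f inner_h)
  then show "?B ** induced_metric (helix X U) p = mat 1"
    using g1_pos[of p] g2_pos[of p] by (simp add: vec_eq_iff forall_2 matrix_matrix_mult_def sum_2 mat_def)
qed

lemma pushforward_axis:
  "pushforward (helix X U) (\<lambda>_. axis 1 1) = hx" "pushforward (helix X U) (\<lambda>_. axis 2 1) = hy"
  by (rule ext, simp add: pushforward_def helix_frechet axis_def)+

text \<open>If U = u o X, the chain rule makes \<open>a\<close> and \<open>b\<close> the values of
  u' and u'' at X. Both diagonal values of the second fundamental form are multiples of the single
  normal vector (- a, ee), so the mean curvature reduces to a scalar expression in u, u' and
  u''.\<close>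

lemma helix_mean_curvature:
  assumes pos: "deriv X (p $ 1) > 0"
    and U1: "deriv U (p $ 1) = a * deriv X (p $ 1)"
    and U2: "deriv (deriv U) (p $ 1) = b * (deriv X (p $ 1))\<^sup>2 + a * deriv (deriv X) (p $ 1)"
  shows "mean_curvature (helix X U) p =
    ((b / (1 + a\<^sup>2) - U (p $ 1) / (1 + (U (p $ 1))\<^sup>2)) / (1 + a\<^sup>2)) *\<^sub>R (v2 (- a) 0, ee (p $ 2))"
proof -
  define x where "x = deriv X (p $ 1)"
  define k where "k = U (p $ 1)"
  define \<theta> where "\<theta> = p $ 2"
  have x: "x > 0" using pos by (simp add: x_def)
  have A: "1 + a\<^sup>2 > 0" by (simp add: add_pos_nonneg)
  have "(hx has_derivative (\<lambda>v. (v2 (v $ 1 * deriv (deriv X) (p $ 1)) 0,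
      deriv U (p $ 1) *\<^sub>R (v $ 2 *\<^sub>R nn (p $ 2)) + (v $ 1 * deriv (deriv U) (p $ 1)) *\<^sub>R ee (p $ 2)))) (at p)"
    unfolding hx_def[abs_def]
    by (intro has_derivative_Pair has_derivative_v2 has_derivative_const has_derivative_scaleR has_derivative_ee
        has_derivative_comp_nth smooth_DERIV smooth_deriv sX sU)
  from frechet_eq[OF this]
  have hxx: "frechet_derivative hx (at p) (axis 1 1) = (v2 (deriv (deriv X) (p $ 1)) 0, deriv (deriv U) (p $ 1) *\<^sub>R ee \<theta>)"
    by (simp add: axis_def \<theta>_def)
  have "(hy has_derivative (\<lambda>v. (0, U (p $ 1) *\<^sub>R (v $ 2 *\<^sub>R (- ee (p $ 2))) + (v $ 1 * deriv U (p $ 1)) *\<^sub>R nn (p $ 2)))) (at p)"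
    unfolding hy_def[abs_def]
    by (intro has_derivative_Pair has_derivative_const has_derivative_scaleR has_derivative_nn
        has_derivative_comp_nth smooth_DERIV sU)
  from frechet_eq[OF this]
  have hyy: "frechet_derivative hy (at p) (axis 2 1) = (0, - k *\<^sub>R ee \<theta>)"
    by (simp add: axis_def k_def \<theta>_def)
  have g1: "g1 p = x\<^sup>2 * (1 + a\<^sup>2)" and g2: "g2 p = 1 + k\<^sup>2"
    by (simp_all add: g1_def g2_def U1 x_def k_def power_mult_distrib algebra_simps)
  have sg: "inverse (sqrt (g1 p)) * inverse (sqrt (g1 p)) = 1 / (x\<^sup>2 * (1 + a\<^sup>2))"
    using g1_pos[of p] by (simp add: divide_inverse g1 flip: inverse_mult_distrib)
  \<comment> \<open>The powers of x = X' coming from the parametrization cancel, so the mean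
    curvature depends only on the surface.\<close>
  have q: "1 / (x\<^sup>2 * A) * c * x = c / x / A" if "A > 0" for A c
    using x that by (simp add: field_simps power2_eq_square)
  have np1: "normal_part (helix X U) p (v2 (deriv (deriv X) (p $ 1)) 0, deriv (deriv U) (p $ 1) *\<^sub>R ee \<theta>) =
      (b * x\<^sup>2 / (1 + a\<^sup>2)) *\<^sub>R (v2 (- a) 0, ee \<theta>)"
  proof -
    have "normal_part (helix X U) p (v2 (deriv (deriv X) (p $ 1)) 0, deriv (deriv U) (p $ 1) *\<^sub>R ee \<theta>) =
      ((inverse (sqrt (g1 p)) * inverse (sqrt (g1 p))) * (x * deriv (deriv U) (p $ 1) - a * x * deriv (deriv X) (p $ 1)))
        *\<^sub>R (x *\<^sub>R (v2 (- a) 0, ee \<theta>))"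
      unfolding helix_normal_part
      by (simp add: \<nu>1_def \<nu>2_def U1 x_def[symmetric] \<theta>_def[symmetric] v2_simps algebra_simps)
    also have "x * deriv (deriv U) (p $ 1) - a * x * deriv (deriv X) (p $ 1) = b * x\<^sup>2 * x"
      unfolding U2 x_def[symmetric] by (simp add: algebra_simps)
    also have "(inverse (sqrt (g1 p)) * inverse (sqrt (g1 p)) * (b * x\<^sup>2 * x)) *\<^sub>R (x *\<^sub>R (v2 (- a) 0, ee \<theta>)) =
        (1 / (x\<^sup>2 * (1 + a\<^sup>2)) * (b * x\<^sup>2 * x) * x) *\<^sub>R (v2 (- a) 0, ee \<theta>)"
      unfolding sg scaleR_scaleR ..
    also have "1 / (x\<^sup>2 * (1 + a\<^sup>2)) * (b * x\<^sup>2 * x) * x = b * x\<^sup>2 / (1 + a\<^sup>2)"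
      using q[OF A, of "b * x\<^sup>2 * x"] x by (simp add: power2_eq_square)
    finally show ?thesis .
  qed
  have np2: "normal_part (helix X U) p (0, - k *\<^sub>R ee \<theta>) = (- k / (1 + a\<^sup>2)) *\<^sub>R (v2 (- a) 0, ee \<theta>)"
  proof -
    have "normal_part (helix X U) p (0, - k *\<^sub>R ee \<theta>) =
      ((inverse (sqrt (g1 p)) * inverse (sqrt (g1 p))) * (- k * x)) *\<^sub>R (x *\<^sub>R (v2 (- a) 0, ee \<theta>))"
      unfolding helix_normal_part
      by (simp add: \<nu>1_def \<nu>2_def U1 x_def[symmetric] \<theta>_def[symmetric] v2_simps algebra_simps)
    also have "\<dots> = (1 / (x\<^sup>2 * (1 + a\<^sup>2)) * (- k * x) * x) *\<^sub>R (v2 (- a) 0, ee \<theta>)"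
      unfolding sg scaleR_scaleR ..
    also have "1 / (x\<^sup>2 * (1 + a\<^sup>2)) * (- k * x) * x = - k / (1 + a\<^sup>2)"
      using q[OF A, of "- k * x"] x by simp
    finally show ?thesis .
  qed
  have "mean_curvature (helix X U) p =
      (1 / g1 p) *\<^sub>R normal_part (helix X U) p (frechet_derivative hx (at p) (axis 1 1)) +
      (1 / g2 p) *\<^sub>R normal_part (helix X U) p (frechet_derivative hy (at p) (axis 2 1))"
    unfolding mean_curvature_def second_fundamental_form_def euclidean_connection_def helix_matrix_inv
    by (simp add: sum_2 pushforward_axis)
  also have "\<dots> = (1 / g1 p * (b * x\<^sup>2 / (1 + a\<^sup>2)) + 1 / g2 p * (- k / (1 + a\<^sup>2))) *\<^sub>R (v2 (- a) 0, ee \<theta>)"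
    unfolding hxx hyy np1 np2 by (simp add: scaleR_left_distrib scaleR_left_diff_distrib del: scaleR_Pair)
  also have "1 / g1 p * (b * x\<^sup>2 / (1 + a\<^sup>2)) + 1 / g2 p * (- k / (1 + a\<^sup>2)) = (b / (1 + a\<^sup>2) - k / (1 + k\<^sup>2)) / (1 + a\<^sup>2)"
    unfolding g1 g2 using x A by (simp add: diff_divide_distrib)
  finally show ?thesis by (simp only: k_def \<theta>_def)
qed

end

section \<open>Normal curvature of a helicoidal graph\<close>

text \<open>Integrating the y-derivative recovers g up to a term independent of the upper limit. The
  x-derivative passes under this integral, and the fundamental theorem at the lower endpoint then
  identifies the y-derivative of \<open>ga\<close>. The comparison uses one-sided derivatives on
  [y, y + 1].\<close>

lemma mixed_partials:
  fixes g :: "real \<Rightarrow> real \<Rightarrow> real"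
  assumes ga: "\<And>x y. ((\<lambda>x. g x y) has_real_derivative ga x y) (at x)"
    and gb: "\<And>x y. ((\<lambda>y. g x y) has_real_derivative gb x y) (at y)"
    and gab: "\<And>x y. ((\<lambda>y. ga x y) has_real_derivative gab x y) (at y)"
    and gba: "\<And>x y. ((\<lambda>x. gb x y) has_real_derivative gba x y) (at x)"
    and c2: "\<And>x. continuous_on UNIV (gb x)"
    and c21: "continuous_on UNIV (\<lambda>(x, y). gba x y)"
  shows "gab x y = gba x y"
proof -
  have I: "integral {y..s} (gb x) = g x s - g x y" if "y \<le> s" for x s
  proof (rule integral_unique, rule fundamental_theorem_of_calculus[OF that])
    fix r show "((\<lambda>y. g x y) has_vector_derivative gb x r) (at r within {y..s})"
      using gb[of x r] has_field_derivative_at_within has_real_derivative_iff_has_vector_derivative by blast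
  qed
  have J: "ga x s - ga x y = integral {y..s} (gba x)" if "y \<le> s" for s
  proof -
    have "((\<lambda>x. integral (cbox y s) (gb x)) has_field_derivative integral (cbox y s) (gba x)) (at x within UNIV)"
    proof (rule leibniz_rule_field_derivative)
      show "((\<lambda>x. gb x r) has_field_derivative gba x r) (at x within UNIV)" for x r using gba by simp
      show "gb x integrable_on cbox y s" for x
        by (intro integrable_continuous continuous_on_subset[OF c2]) simp
      show "continuous_on (UNIV \<times> cbox y s) (\<lambda>(x, t). gba x t)"
        by (rule continuous_on_subset[OF c21]) simp
    qed auto
    then have "((\<lambda>x. g x s - g x y) has_real_derivative integral {y..s} (gba x)) (at x)"
      by (simp add: I[OF that] cbox_interval)
    moreover have "((\<lambda>x. g x s - g x y) has_real_derivative ga x s - ga x y) (at x)"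
      by (intro DERIV_diff ga)
    ultimately show ?thesis using DERIV_unique by blast
  qed
  have c21x: "continuous_on A (gba x)" for A
  proof -
    have "continuous_on A (\<lambda>s. (\<lambda>(x, y). gba x y) (x, s))"
      by (rule continuous_on_compose2[OF c21]) (auto intro!: continuous_intros)
    then show ?thesis by simp
  qed
  have "((\<lambda>s. integral {y..s} (gba x)) has_vector_derivative gba x y) (at y within {y..y+1})"
    by (rule integral_has_vector_derivative[OF c21x]) simp
  then have "((\<lambda>s. ga x s - ga x y) has_vector_derivative gba x y) (at y within {y..y+1})"
    by (rule has_vector_derivative_transform[rotated 2]) (auto simp: J)
  moreover have "((\<lambda>s. ga x s - ga x y) has_vector_derivative gab x y) (at y within {y..y+1})"
  proof -
    have "((\<lambda>s. ga x s - ga x y) has_real_derivative gab x y - 0) (at y within {y..y+1})"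
      by (intro DERIV_diff DERIV_const has_field_derivative_at_within[OF gab])
    then show ?thesis by (simp add: has_real_derivative_iff_has_vector_derivative)
  qed
  ultimately show ?thesis
    using vector_derivative_unique_within[of y "{y..y+1}"]
    by (metis (no_types, lifting) at_within_Icc_at_right less_add_one trivial_limit_at_right_real)
qed

definition pd :: "2 \<Rightarrow> (real^2 \<Rightarrow> real) \<Rightarrow> real^2 \<Rightarrow> real" where
  "pd i f p = frechet_derivative f (at p) (axis i 1)"

lemma smooth_pd: assumes "smooth_on UNIV f" shows "smooth_on UNIV (pd i f)"
  unfolding pd_def[abs_def] by (rule smooth_on_frechet_Basis[OF assms]) (simp add: axis_in_Basis_iff)

lemma frechet_pd:
  fixes f :: "real^2 \<Rightarrow> real"
  assumes "smooth_on UNIV f"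
  shows "frechet_derivative f (at p) v = v $ 1 * pd 1 f p + v $ 2 * pd 2 f p"
proof -
  have l: "linear (frechet_derivative f (at p))"
    using has_derivative_linear[OF smooth_on_has_derivative[OF assms UNIV_I]] .
  have "v = v $ 1 *\<^sub>R axis 1 1 + v $ 2 *\<^sub>R axis 2 1" by (rule vec2_eqI) (simp_all add: axis_def)
  then have "frechet_derivative f (at p) v = frechet_derivative f (at p) (v $ 1 *\<^sub>R axis 1 1 + v $ 2 *\<^sub>R axis 2 1)" by simp
  then show ?thesis by (simp add: linear_add[OF l] linear_scale[OF l] pd_def)
qed

lemma pd_DERIV:
  assumes "smooth_on UNIV f"
  shows "((\<lambda>x. f (v2 x y)) has_real_derivative pd 1 f (v2 x y)) (at x)"
    and "((\<lambda>y. f (v2 x y)) has_real_derivative pd 2 f (v2 x y)) (at y)"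
proof -
  have f: "(f has_derivative frechet_derivative f (at p)) (at p)" for p
    using smooth_on_has_derivative[OF assms UNIV_I] .
  have 1: "((\<lambda>x. v2 x y) has_derivative (\<lambda>h. v2 h 0)) (at x)"
    by (rule has_derivative_v2) (auto intro!: derivative_eq_intros)
  have 2: "((\<lambda>y. v2 x y) has_derivative (\<lambda>h. v2 0 h)) (at y)"
    by (rule has_derivative_v2) (auto intro!: derivative_eq_intros)
  show "((\<lambda>x. f (v2 x y)) has_real_derivative pd 1 f (v2 x y)) (at x)"
    using has_derivative_compose[OF 1 f] by (simp add: has_field_derivative_def frechet_pd[OF assms] mult_commute_abs)
  show "((\<lambda>y. f (v2 x y)) has_real_derivative pd 2 f (v2 x y)) (at y)"
    using has_derivative_compose[OF 2 f] by (simp add: has_field_derivative_def frechet_pd[OF assms] mult_commute_abs)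
qed

lemma pd_commute:
  assumes f: "smooth_on UNIV f" shows "pd 2 (pd 1 f) p = pd 1 (pd 2 f) p"
proof -
  have "continuous_on UNIV (pd 1 (pd 2 f))"
    by (rule smooth_on_imp_continuous_on[OF smooth_pd[OF smooth_pd[OF f]]])
  moreover have v: "continuous_on UNIV (\<lambda>z. v2 (fst z) (snd z))" unfolding v2_def by (intro continuous_intros)
  ultimately have c: "continuous_on UNIV (\<lambda>(x, y). pd 1 (pd 2 f) (v2 x y))"
    unfolding split_beta' by (rule continuous_on_compose2) simp
  have c2: "continuous_on UNIV (\<lambda>y. pd 2 f (v2 x y))" for x
    using DERIV_isCont[OF pd_DERIV(2)[OF smooth_pd[OF f]]] continuous_at_imp_continuous_on by blast
  have "pd 2 (pd 1 f) (v2 (p $ 1) (p $ 2)) = pd 1 (pd 2 f) (v2 (p $ 1) (p $ 2))"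
    by (rule mixed_partials[where g="\<lambda>x y. f (v2 x y)" and gab="\<lambda>x y. pd 2 (pd 1 f) (v2 x y)"
        and gba="\<lambda>x y. pd 1 (pd 2 f) (v2 x y)", OF pd_DERIV[OF f] pd_DERIV(2)[OF smooth_pd[OF f]]
          pd_DERIV(1)[OF smooth_pd[OF f]] c2 c])
  then show ?thesis by (simp add: v2_eta)
qed

lemma frechet_nth:
  fixes Y :: "real^2 \<Rightarrow> real^2"
  assumes "smooth_on UNIV Y"
  shows "((\<lambda>p. Y p $ i) has_derivative (\<lambda>v. frechet_derivative Y (at p) v $ i)) (at p)"
  by (rule bounded_linear.has_derivative[OF bounded_linear_vec_nth smooth_on_has_derivative[OF assms UNIV_I]])

text \<open>Second derivatives of f cancel by symmetry of the mixed partials; what remains are the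
  derivatives of the coefficients of the two fields.\<close>

lemma lie_bracket_derivative:
  fixes f :: "real^2 \<Rightarrow> real" and X Y :: "real^2 \<Rightarrow> real^2"
  assumes f: "smooth_on UNIV f" and X: "smooth_on UNIV X" and Y: "smooth_on UNIV Y"
  shows "frechet_derivative (\<lambda>p. frechet_derivative f (at p) (Y p)) (at p) (X p)
    - frechet_derivative (\<lambda>p. frechet_derivative f (at p) (X p)) (at p) (Y p)
    = frechet_derivative f (at p) (lie_bracket X Y p)"
proof -
  have d: "frechet_derivative (\<lambda>p. frechet_derivative f (at p) (Z p)) (at p) v =
      Z p $ 1 * frechet_derivative (pd 1 f) (at p) v + frechet_derivative Z (at p) v $ 1 * pd 1 f p +
      (Z p $ 2 * frechet_derivative (pd 2 f) (at p) v + frechet_derivative Z (at p) v $ 2 * pd 2 f p)"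
    if Z: "smooth_on UNIV Z" for Z v
  proof -
    have "((\<lambda>p. Z p $ 1 * pd 1 f p + Z p $ 2 * pd 2 f p) has_derivative (\<lambda>v.
      Z p $ 1 * frechet_derivative (pd 1 f) (at p) v + frechet_derivative Z (at p) v $ 1 * pd 1 f p +
      (Z p $ 2 * frechet_derivative (pd 2 f) (at p) v + frechet_derivative Z (at p) v $ 2 * pd 2 f p))) (at p)"
      by (intro has_derivative_add has_derivative_mult frechet_nth[OF Z]
          smooth_on_has_derivative[OF smooth_pd[OF f] UNIV_I])
    then have "((\<lambda>p. frechet_derivative f (at p) (Z p)) has_derivative (\<lambda>v.
      Z p $ 1 * frechet_derivative (pd 1 f) (at p) v + frechet_derivative Z (at p) v $ 1 * pd 1 f p +
      (Z p $ 2 * frechet_derivative (pd 2 f) (at p) v + frechet_derivative Z (at p) v $ 2 * pd 2 f p))) (at p)"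
      by (simp only: frechet_pd[OF f])
    from fun_cong[OF frechet_eq[OF this], of v] show ?thesis .
  qed
  show ?thesis
    unfolding d[OF X] d[OF Y] unfolding frechet_pd[OF smooth_pd[OF f]] frechet_pd[OF f] lie_bracket_def euclidean_connection_def
    by (simp add: pd_commute[OF f] algebra_simps)
qed

context
  fixes U :: "real \<Rightarrow> real"
  assumes sU: "smooth_on UNIV U"
begin

abbreviation "surf \<equiv> helix (\<lambda>x. x) U"
abbreviation "nrm1 \<equiv> \<nu>1 (\<lambda>x. x) U"
abbreviation "nrm2 \<equiv> \<nu>2 U"
abbreviation "tan1 \<equiv> hx (\<lambda>x. x) U"
abbreviation "tan2 \<equiv> hy U"

lemma sI: "smooth_on UNIV (\<lambda>x::real. x)" and dI: "deriv (\<lambda>x::real. x) x \<noteq> 0"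
  by (simp_all add: smooth_on_ident)

lemmas G_normal_part = helix_normal_part[OF sI sU dI]
lemmas G_inner = inner_\<nu>[OF sI sU dI]
lemmas G_smooth = smooth_\<nu>1[OF sI sU dI] smooth_\<nu>2[OF sI sU dI] smooth_hx[OF sI sU dI] smooth_hy[OF sI sU dI]

definition W :: "real \<Rightarrow> real" where "W x = (1 + (deriv U x)\<^sup>2) * (1 + (U x)\<^sup>2)"

definition \<omega> :: "real^2 \<Rightarrow> real" where "\<omega> p = inverse (sqrt (W (p $ 1)))"

lemma W_pos: "W x > 0" by (simp add: W_def add_pos_nonneg mult_pos_pos)

lemma smooth_\<omega>: "smooth_on UNIV \<omega>"
proof -
  have "smooth_on UNIV (\<lambda>p::real^2. W (p $ 1))"
    unfolding W_def
    by (intro smooth_on_mult smooth_on_add_real smooth_on_power smooth_on_comp_nth smooth_on_const sU smooth_deriv approachable_UNIV)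
  then show ?thesis unfolding \<omega>_def[abs_def]
    by (intro smooth_on_inverse smooth_on_sqrt approachable_UNIV) (use W_pos in \<open>auto simp: less_imp_neq[symmetric]\<close>)
qed

text \<open>Among the terms of the derivative of \<open>nrm1\<close> only the turning of
  \<open>ee\<close> into \<open>nn\<close> has a component along \<open>nrm2\<close>; the change of
  length and the second derivative of U are orthogonal to it. The two normalizing factors multiply
  to \<open>\<omega>\<close>.\<close>

lemma N1_derivative_inner: "frechet_derivative nrm1 (at p) v \<bullet> nrm2 p = v $ 2 * \<omega> p"
proof -
  define r where "r p = inverse (sqrt (g1 (\<lambda>x. x) U p))" for p
  define A where "A p = (v2 (- deriv U (p $ 1)) 0, ee (p $ 2))" for p :: "real^2"
  have nrm1: "nrm1 = (\<lambda>p. r p *\<^sub>R A p)" by (rule ext) (simp add: \<nu>1_def[OF sI sU dI] r_def A_def)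
  have r: "smooth_on UNIV r" unfolding r_def by (rule smooth_rsqrt(1)[OF sI sU dI])
  have A: "(A has_derivative (\<lambda>v. (v2 (- (v $ 1 * deriv (deriv U) (p $ 1))) 0, v $ 2 *\<^sub>R nn (p $ 2)))) (at p)"
    unfolding A_def[abs_def]
    by (intro has_derivative_Pair has_derivative_v2 has_derivative_minus has_derivative_const has_derivative_ee
        has_derivative_comp_nth smooth_DERIV smooth_deriv sU)
  have "(nrm1 has_derivative (\<lambda>v. r p *\<^sub>R (v2 (- (v $ 1 * deriv (deriv U) (p $ 1))) 0, v $ 2 *\<^sub>R nn (p $ 2))
      + frechet_derivative r (at p) v *\<^sub>R A p)) (at p)"
    unfolding nrm1 by (rule has_derivative_scaleR[OF smooth_on_has_derivative[OF r UNIV_I] A])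
  from frechet_eq[OF this]
  have "frechet_derivative nrm1 (at p) v \<bullet> nrm2 p = r p * (inverse (sqrt (g2 U p)) * v $ 2)"
    by (simp add: \<nu>2_def[OF sI sU dI] A_def inner_add_left)
  also have "\<dots> = v $ 2 * (r p * inverse (sqrt (g2 U p)))" by simp
  also have "r p * inverse (sqrt (g2 U p)) = \<omega> p"
    by (simp add: r_def \<omega>_def W_def g1_def[OF sI sU dI] g2_def[OF sI sU dI] real_sqrt_mult)
  finally show ?thesis .
qed

lemma inner_const_derivative:
  fixes A B :: "real^2 \<Rightarrow> (real^2) \<times> (real^2)"
  assumes "smooth_on UNIV A" "smooth_on UNIV B" "\<And>p. A p \<bullet> B p = c"
  shows "A p \<bullet> frechet_derivative B (at p) v + frechet_derivative A (at p) v \<bullet> B p = 0"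
proof -
  have "((\<lambda>p. A p \<bullet> B p) has_derivative (\<lambda>v. A p \<bullet> frechet_derivative B (at p) v + frechet_derivative A (at p) v \<bullet> B p)) (at p)"
    by (intro has_derivative_inner smooth_on_has_derivative[OF assms(1) UNIV_I] smooth_on_has_derivative[OF assms(2) UNIV_I])
  moreover have "((\<lambda>p. A p \<bullet> B p) has_derivative (\<lambda>v. 0)) (at p)" by (simp add: assms(3))
  ultimately have "(\<lambda>v. A p \<bullet> frechet_derivative B (at p) v + frechet_derivative A (at p) v \<bullet> B p) = (\<lambda>v. 0)"
    by (rule has_derivative_unique)
  then show ?thesis by (rule fun_cong)
qed

lemma frame_derivative_inner:
  "frechet_derivative nrm1 (at p) v \<bullet> nrm1 p = 0" "frechet_derivative nrm2 (at p) v \<bullet> nrm2 p = 0"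
  "frechet_derivative nrm2 (at p) v \<bullet> nrm1 p = - (v $ 2 * \<omega> p)"
proof -
  have 11: "nrm1 p \<bullet> frechet_derivative nrm1 (at p) v + frechet_derivative nrm1 (at p) v \<bullet> nrm1 p = 0"
    by (rule inner_const_derivative[OF G_smooth(1,1) G_inner(5)])
  have 22: "nrm2 p \<bullet> frechet_derivative nrm2 (at p) v + frechet_derivative nrm2 (at p) v \<bullet> nrm2 p = 0"
    by (rule inner_const_derivative[OF G_smooth(2,2) G_inner(6)])
  have 12: "nrm1 p \<bullet> frechet_derivative nrm2 (at p) v + frechet_derivative nrm1 (at p) v \<bullet> nrm2 p = 0"
    by (rule inner_const_derivative[OF G_smooth(1,2) G_inner(7)])
  show "frechet_derivative nrm1 (at p) v \<bullet> nrm1 p = 0" "frechet_derivative nrm2 (at p) v \<bullet> nrm2 p = 0"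
    using 11 22 by (simp_all add: inner_commute)
  show "frechet_derivative nrm2 (at p) v \<bullet> nrm1 p = - (v $ 2 * \<omega> p)"
    using 12 N1_derivative_inner[of p v] by (simp add: inner_commute)
qed

text \<open>In the orthonormal frame the connection is the flat one plus the one-form
  \<open>\<omega>\<close> dy times the quarter turn. Planar rotations commute, so the curvature is
  the exterior derivative of this form alone.\<close>

lemma normal_connection_frame:
  assumes a: "smooth_on UNIV a" and b: "smooth_on UNIV b"
  shows "normal_connection surf V (\<lambda>p. a p *\<^sub>R nrm1 p + b p *\<^sub>R nrm2 p) p =
    (frechet_derivative a (at p) (V p) - \<omega> p * V p $ 2 * b p) *\<^sub>R nrm1 p +
    (frechet_derivative b (at p) (V p) + \<omega> p * V p $ 2 * a p) *\<^sub>R nrm2 p"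
proof -
  define D where "D v = (a p *\<^sub>R frechet_derivative nrm1 (at p) v + frechet_derivative a (at p) v *\<^sub>R nrm1 p) +
      (b p *\<^sub>R frechet_derivative nrm2 (at p) v + frechet_derivative b (at p) v *\<^sub>R nrm2 p)" for v
  have "((\<lambda>p. a p *\<^sub>R nrm1 p + b p *\<^sub>R nrm2 p) has_derivative D) (at p)"
    unfolding D_def
    by (intro has_derivative_add has_derivative_scaleR smooth_on_has_derivative[OF _ UNIV_I] a b G_smooth)
  then have D: "euclidean_connection V (\<lambda>p. a p *\<^sub>R nrm1 p + b p *\<^sub>R nrm2 p) p = D (V p)"
    unfolding euclidean_connection_def by (simp only: frechet_eq)
  have "D (V p) \<bullet> nrm1 p = frechet_derivative a (at p) (V p) - \<omega> p * V p $ 2 * b p"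
    "D (V p) \<bullet> nrm2 p = frechet_derivative b (at p) (V p) + \<omega> p * V p $ 2 * a p"
    unfolding D_def by (simp_all add: inner_add_left frame_derivative_inner N1_derivative_inner G_inner)
  then show ?thesis unfolding normal_connection_def D G_normal_part by (simp only:)
qed

lemma normal_field_frame:
  assumes "\<And>p. \<nu> p \<in> normal_space surf p"
  shows "\<nu> = (\<lambda>p. (\<nu> p \<bullet> nrm1 p) *\<^sub>R nrm1 p + (\<nu> p \<bullet> nrm2 p) *\<^sub>R nrm2 p)"
proof (rule ext)
  fix p
  have o: "\<nu> p \<bullet> frechet_derivative surf (at p) v = 0" for v
    using assms[of p] by (auto simp: normal_space_def tangent_space_def orthogonal_comp_def orthogonal_def inner_commute)
  have "\<nu> p \<bullet> tan1 p = 0" "\<nu> p \<bullet> tan2 p = 0"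
    using o[of "axis 1 1"] o[of "axis 2 1"] by (simp_all add: helix_frechet[OF sI sU dI] axis_def)
  then show "\<nu> p = (\<nu> p \<bullet> nrm1 p) *\<^sub>R nrm1 p + (\<nu> p \<bullet> nrm2 p) *\<^sub>R nrm2 p"
    using decomp[OF sI sU dI, of "\<nu> p" p] by simp
qed

text \<open>With \<open>\<omega>\<close> equal to a constant c the form c dy is closed. In the
  components of the curvature the terms quadratic in c cancel by commutativity, the others against
  the Lie bracket term.\<close>

lemma flat_if_W_constant:
  assumes W: "\<And>x y. W x = W y"
  shows "flat_normal_bundle surf"
  unfolding flat_normal_bundle_def
proof (intro allI impI)
  fix X Y :: "real^2 \<Rightarrow> real^2" and \<nu> p
  assume X: "smooth_on UNIV X" and Y: "smooth_on UNIV Y" and \<nu>: "smooth_on UNIV \<nu>"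
    and n: "\<forall>p. \<nu> p \<in> normal_space surf p"
  define c where "c = inverse (sqrt (W 0))"
  have \<omega>: "\<omega> p = c" for p unfolding \<omega>_def c_def using W by metis
  define a where "a p = \<nu> p \<bullet> nrm1 p" for p
  define b where "b p = \<nu> p \<bullet> nrm2 p" for p
  have a: "smooth_on UNIV a" and b: "smooth_on UNIV b"
    unfolding a_def b_def by (intro smooth_on_inner \<nu> G_smooth approachable_UNIV)+
  have \<nu>_eq: "\<nu> = (\<lambda>p. a p *\<^sub>R nrm1 p + b p *\<^sub>R nrm2 p)"
    unfolding a_def b_def by (rule normal_field_frame) (use n in blast)
  define aa where "aa Z p = frechet_derivative a (at p) (Z p) - c * Z p $ 2 * b p" for Z p
  define bb where "bb Z p = frechet_derivative b (at p) (Z p) + c * Z p $ 2 * a p" for Z p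
  have nc: "normal_connection surf Z \<nu> = (\<lambda>p. aa Z p *\<^sub>R nrm1 p + bb Z p *\<^sub>R nrm2 p)" for Z
    unfolding aa_def bb_def by (rule ext, subst \<nu>_eq) (simp only: normal_connection_frame[OF a b] \<omega>)
  have sn: "smooth_on UNIV (\<lambda>p. Z p $ i)" if "smooth_on UNIV Z" for Z :: "real^2 \<Rightarrow> real^2" and i
    by (rule smooth_on_linear_image[OF approachable_UNIV bounded_linear_vec_nth that])
  have da: "smooth_on UNIV (\<lambda>p. frechet_derivative a (at p) (Z p))"
    and db: "smooth_on UNIV (\<lambda>p. frechet_derivative b (at p) (Z p))" if "smooth_on UNIV Z" for Z
    using smooth_on_derivative_along[OF approachable_UNIV a that] smooth_on_derivative_along[OF approachable_UNIV b that] .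
  have saa: "smooth_on UNIV (aa Z)" and sbb: "smooth_on UNIV (bb Z)" if "smooth_on UNIV Z" for Z
    unfolding aa_def[abs_def] bb_def[abs_def]
    by (intro smooth_on_diff smooth_on_add_real smooth_on_mult smooth_on_const da db sn that a b approachable_UNIV)+
  have daa: "frechet_derivative (aa Z) (at p) v = frechet_derivative (\<lambda>p. frechet_derivative a (at p) (Z p)) (at p) v
      - (c * Z p $ 2 * frechet_derivative b (at p) v + c * frechet_derivative Z (at p) v $ 2 * b p)"
    and dbb: "frechet_derivative (bb Z) (at p) v = frechet_derivative (\<lambda>p. frechet_derivative b (at p) (Z p)) (at p) v
      + (c * Z p $ 2 * frechet_derivative a (at p) v + c * frechet_derivative Z (at p) v $ 2 * a p)"
    if Z: "smooth_on UNIV Z" for Z v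
  proof -
    have cz: "((\<lambda>p. c * Z p $ 2) has_derivative (\<lambda>v. c * frechet_derivative Z (at p) v $ 2)) (at p)"
      by (rule has_derivative_mult_right[OF frechet_nth[OF Z]])
    have "(aa Z has_derivative (\<lambda>v. frechet_derivative (\<lambda>p. frechet_derivative a (at p) (Z p)) (at p) v
      - (c * Z p $ 2 * frechet_derivative b (at p) v + c * frechet_derivative Z (at p) v $ 2 * b p))) (at p)"
      unfolding aa_def[abs_def]
      by (intro has_derivative_diff has_derivative_mult[OF cz] smooth_on_has_derivative[OF _ UNIV_I] da[OF Z] b)
    from frechet_eq[OF this] show "frechet_derivative (aa Z) (at p) v = frechet_derivative (\<lambda>p. frechet_derivative a (at p) (Z p)) (at p) v
      - (c * Z p $ 2 * frechet_derivative b (at p) v + c * frechet_derivative Z (at p) v $ 2 * b p)" by simp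
    have "(bb Z has_derivative (\<lambda>v. frechet_derivative (\<lambda>p. frechet_derivative b (at p) (Z p)) (at p) v
      + (c * Z p $ 2 * frechet_derivative a (at p) v + c * frechet_derivative Z (at p) v $ 2 * a p))) (at p)"
      unfolding bb_def[abs_def]
      by (intro has_derivative_add has_derivative_mult[OF cz] smooth_on_has_derivative[OF _ UNIV_I] db[OF Z] a)
    from frechet_eq[OF this] show "frechet_derivative (bb Z) (at p) v = frechet_derivative (\<lambda>p. frechet_derivative b (at p) (Z p)) (at p) v
      + (c * Z p $ 2 * frechet_derivative a (at p) v + c * frechet_derivative Z (at p) v $ 2 * a p)" by simp
  qed
  have nn2: "normal_connection surf V (normal_connection surf Z \<nu>) p =
      (frechet_derivative (aa Z) (at p) (V p) - c * V p $ 2 * bb Z p) *\<^sub>R nrm1 p +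
      (frechet_derivative (bb Z) (at p) (V p) + c * V p $ 2 * aa Z p) *\<^sub>R nrm2 p" if "smooth_on UNIV Z" for V Z
    unfolding nc by (simp only: normal_connection_frame[OF saa[OF that] sbb[OF that]] \<omega>)
  define L where "L = lie_bracket X Y p"
  have L2: "L $ 2 = frechet_derivative Y (at p) (X p) $ 2 - frechet_derivative X (at p) (Y p) $ 2"
    by (simp add: L_def lie_bracket_def euclidean_connection_def)
  have la: "frechet_derivative a (at p) L = frechet_derivative (\<lambda>p. frechet_derivative a (at p) (Y p)) (at p) (X p)
    - frechet_derivative (\<lambda>p. frechet_derivative a (at p) (X p)) (at p) (Y p)"
    and lb: "frechet_derivative b (at p) L = frechet_derivative (\<lambda>p. frechet_derivative b (at p) (Y p)) (at p) (X p)
    - frechet_derivative (\<lambda>p. frechet_derivative b (at p) (X p)) (at p) (Y p)"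
    unfolding L_def using lie_bracket_derivative[OF a X Y] lie_bracket_derivative[OF b X Y] by simp_all
  have A: "(frechet_derivative (aa Y) (at p) (X p) - c * X p $ 2 * bb Y p)
      - (frechet_derivative (aa X) (at p) (Y p) - c * Y p $ 2 * bb X p) - aa (lie_bracket X Y) p = 0"
    unfolding daa[OF X] daa[OF Y]
    by (simp add: aa_def bb_def L_def[symmetric] la L2 algebra_simps)
  have B: "(frechet_derivative (bb Y) (at p) (X p) + c * X p $ 2 * aa Y p)
      - (frechet_derivative (bb X) (at p) (Y p) + c * Y p $ 2 * aa X p) - bb (lie_bracket X Y) p = 0"
    unfolding dbb[OF X] dbb[OF Y]
    by (simp add: aa_def bb_def L_def[symmetric] lb L2 algebra_simps)
  have "normal_curvature surf X Y \<nu> p =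
     ((frechet_derivative (aa Y) (at p) (X p) - c * X p $ 2 * bb Y p)
      - (frechet_derivative (aa X) (at p) (Y p) - c * Y p $ 2 * bb X p) - aa (lie_bracket X Y) p) *\<^sub>R nrm1 p +
     ((frechet_derivative (bb Y) (at p) (X p) + c * X p $ 2 * aa Y p)
      - (frechet_derivative (bb X) (at p) (Y p) + c * Y p $ 2 * aa X p) - bb (lie_bracket X Y) p) *\<^sub>R nrm2 p"
    unfolding normal_curvature_def nn2[OF X] nn2[OF Y] unfolding nc by (simp only: scaleR_left_diff_distrib) simp
  then show "normal_curvature surf X Y \<nu> p = 0" unfolding A B by simp
qed

text \<open>For the commuting coordinate fields the curvature applied to \<open>nrm1\<close> is the
  x-derivative of \<open>\<omega>\<close> times \<open>nrm2\<close>, so flatness forces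
  \<open>\<omega>\<close>, a function of x alone, to be constant.\<close>

lemma W_constant_if_flat:
  assumes flat: "flat_normal_bundle surf" shows "W x = W y"
proof -
  define X :: "real^2 \<Rightarrow> real^2" where "X = (\<lambda>_. axis 1 1)"
  define Y :: "real^2 \<Rightarrow> real^2" where "Y = (\<lambda>_. axis 2 1)"
  have XY: "X p $ 1 = 1" "X p $ 2 = 0" "Y p $ 1 = 0" "Y p $ 2 = 1" for p by (simp_all add: X_def Y_def axis_def)
  have s1: "smooth_on UNIV (\<lambda>_::real^2. 1::real)" and s0: "smooth_on UNIV (\<lambda>_::real^2. 0::real)"
    by (rule smooth_on_const[OF approachable_UNIV])+
  have d0: "frechet_derivative (\<lambda>_::real^2. k::real) (at p) v = 0" for k p v by simp
  have nrm1: "nrm1 = (\<lambda>p. 1 *\<^sub>R nrm1 p + 0 *\<^sub>R nrm2 p)" by simp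
  have ncX: "normal_connection surf X nrm1 = (\<lambda>p. 0 *\<^sub>R nrm1 p + 0 *\<^sub>R nrm2 p)"
    by (rule ext, subst nrm1) (simp only: normal_connection_frame[OF s1 s0] XY d0, simp)
  have ncY: "normal_connection surf Y nrm1 = (\<lambda>p. 0 *\<^sub>R nrm1 p + \<omega> p *\<^sub>R nrm2 p)"
    by (rule ext, subst nrm1) (simp only: normal_connection_frame[OF s1 s0] XY d0, simp)
  have lie: "lie_bracket X Y p = 0" for p
    by (simp add: lie_bracket_def euclidean_connection_def X_def Y_def)
  have "frechet_derivative \<omega> (at p) (axis 1 1) = 0" for p
  proof -
    have "nrm1 p \<in> normal_space surf p" for p
      by (auto simp: normal_space_def tangent_space_def orthogonal_comp_def orthogonal_def
          helix_frechet[OF sI sU dI] inner_add_left inner_commute[of _ "nrm1 p"] inner_add_right G_inner)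
    then have "normal_curvature surf X Y nrm1 p = 0"
      using flat G_smooth(1) smooth_on_const[OF approachable_UNIV] unfolding flat_normal_bundle_def X_def Y_def by blast
    moreover have "normal_curvature surf X Y nrm1 p = frechet_derivative \<omega> (at p) (axis 1 1) *\<^sub>R nrm2 p"
    proof -
      have 1: "normal_connection surf X (\<lambda>p. 0 *\<^sub>R nrm1 p + \<omega> p *\<^sub>R nrm2 p) p = frechet_derivative \<omega> (at p) (axis 1 1) *\<^sub>R nrm2 p"
        unfolding normal_connection_frame[OF s0 smooth_\<omega>] by (simp add: X_def axis_def)
      have 2: "normal_connection surf Y (\<lambda>p. 0 *\<^sub>R nrm1 p + 0 *\<^sub>R nrm2 p) p = 0"
        unfolding normal_connection_frame[OF s0 s0] by simp
      have 3: "normal_connection surf (lie_bracket X Y) nrm1 p = 0"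
        by (subst nrm1) (simp only: normal_connection_frame[OF s1 s0] lie d0, simp)
      show ?thesis unfolding normal_curvature_def 3 ncX ncY 1 2 by simp
    qed
    ultimately have "frechet_derivative \<omega> (at p) (axis 1 1) *\<^sub>R (nrm2 p \<bullet> nrm2 p) = 0"
      by (metis inner_scaleR_left inner_zero_left real_scaleR_def)
    then show ?thesis by (simp add: G_inner)
  qed
  then have "((\<lambda>x. \<omega> (v2 x 0)) has_real_derivative 0) (at x)" for x
    using pd_DERIV(1)[OF smooth_\<omega>, of 0 x] by (simp add: pd_def)
  then have "\<omega> (v2 x 0) = \<omega> (v2 y 0)" using DERIV_isconst_all[of "\<lambda>x. \<omega> (v2 x 0)" x y] by simp
  then show ?thesis by (simp add: \<omega>_def)
qed

end

section \<open>Bounded geometry of a periodic helicoidal graph\<close>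

text \<open>Smooth maps on the torus with periods L and 2 pi; all tensor components of the graph
  belong to this class. Smoothness is included so that the class is closed under
  differentiation.\<close>

definition per :: "real \<Rightarrow> (real^2 \<Rightarrow> 'b::euclidean_space) \<Rightarrow> bool" where
  "per L f \<longleftrightarrow> smooth_on UNIV f \<and> (\<forall>p. f (p + v2 L 0) = f p) \<and> (\<forall>p. f (p + v2 0 (2 * pi)) = f p)"

lemma perI:
  assumes "smooth_on UNIV f" "\<And>p. f (p + v2 L 0) = f p" "\<And>p. f (p + v2 0 (2 * pi)) = f p"
  shows "per L f"
  using assms by (simp add: per_def)

lemma perD:
  assumes "per L f"
  shows "smooth_on UNIV f" "f (p + v2 L 0) = f p" "f (p + v2 0 (2 * pi)) = f p"
  using assms by (simp_all add: per_def)

lemma per_const: "per L (\<lambda>_. c)"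
  by (rule perI) (simp_all add: smooth_on_const)

lemma per_add: "per L f \<Longrightarrow> per L g \<Longrightarrow> per L (\<lambda>p. f p + g p)"
  by (rule perI, rule smooth_on_add) (simp_all add: perD)

lemma per_diff: "per L f \<Longrightarrow> per L g \<Longrightarrow> per L (\<lambda>p. f p - g p)"
  by (rule perI, rule smooth_on_diff) (simp_all add: perD)

lemma per_sum:
  assumes f: "\<And>i. i \<in> I \<Longrightarrow> per L (f i)" shows "per L (\<lambda>p. \<Sum>i\<in>I. f i p)"
proof (rule perI)
  show "smooth_on UNIV (\<lambda>p. \<Sum>i\<in>I. f i p)" by (rule smooth_on_sum[OF approachable_UNIV perD(1)[OF f]])
  show "(\<Sum>i\<in>I. f i (p + v2 L 0)) = (\<Sum>i\<in>I. f i p)" for p by (rule sum.cong[OF refl perD(2)[OF f]])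
  show "(\<Sum>i\<in>I. f i (p + v2 0 (2 * pi))) = (\<Sum>i\<in>I. f i p)" for p by (rule sum.cong[OF refl perD(3)[OF f]])
qed

lemma per_scaleR: "per L f \<Longrightarrow> per L g \<Longrightarrow> per L (\<lambda>p. f p *\<^sub>R g p)"
  by (rule perI, rule smooth_on_scaleR) (simp_all add: perD)

lemma per_mult: "per L f \<Longrightarrow> per L g \<Longrightarrow> per L (\<lambda>p. f p * g p :: real)"
  by (rule perI, rule smooth_on_mult) (simp_all add: perD)

lemma per_inner: "per L f \<Longrightarrow> per L g \<Longrightarrow> per L (\<lambda>p. f p \<bullet> g p)"
  by (rule perI, rule smooth_on_inner) (simp_all add: perD)

lemma per_v2: "per L f \<Longrightarrow> per L g \<Longrightarrow> per L (\<lambda>p. v2 (f p) (g p))"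
  by (rule perI, rule smooth_on_v2) (simp_all add: perD)

lemma per_nth: "per L Y \<Longrightarrow> per L (\<lambda>p. Y p $ i)" for Y :: "real^2 \<Rightarrow> real^2"
  by (rule perI, rule smooth_on_linear_image[OF approachable_UNIV bounded_linear_vec_nth]) (simp_all add: perD)

lemma frechet_shift:
  fixes f :: "'a::euclidean_space \<Rightarrow> 'b::euclidean_space"
  assumes f: "smooth_on UNIV f" and s: "\<And>p. f (p + s) = f p"
  shows "frechet_derivative f (at (p + s)) = frechet_derivative f (at p)"
proof -
  have t: "((\<lambda>p. p + s) has_derivative (\<lambda>v. v)) (at p)" by (auto intro!: derivative_eq_intros)
  have "((\<lambda>p. f (p + s)) has_derivative frechet_derivative f (at (p + s))) (at p)"
    by (rule has_derivative_compose[OF t smooth_on_has_derivative[OF f UNIV_I]])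
  then have "(f has_derivative frechet_derivative f (at (p + s))) (at p)" by (simp add: s)
  then show ?thesis by (rule frechet_eq[symmetric])
qed

lemma per_frechet:
  assumes "per L f" "per L X" shows "per L (\<lambda>p. frechet_derivative f (at p) (X p))"
  by (rule perI, rule smooth_on_derivative_along[OF approachable_UNIV perD(1)[OF assms(1)] perD(1)[OF assms(2)]])
    (simp_all add: frechet_shift[OF perD(1)[OF assms(1)] perD(2)[OF assms(1)]]
      frechet_shift[OF perD(1)[OF assms(1)] perD(3)[OF assms(1)]] perD(2,3)[OF assms(2)])

lemma shift_int:
  fixes f :: "'a::real_vector \<Rightarrow> 'b"
  assumes s: "\<And>p. f (p + s) = f p"
  shows "f (p + of_int k *\<^sub>R s) = f p"
proof -
  have n: "f (p + of_nat n *\<^sub>R s) = f p" for n :: nat and p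
  proof (induction n arbitrary: p)
    case (Suc n)
    have "p + of_nat (Suc n) *\<^sub>R s = (p + of_nat n *\<^sub>R s) + s" by (simp add: algebra_simps)
    then show ?case by (simp only: s Suc)
  qed simp
  show ?thesis
  proof (cases "k \<ge> 0")
    case True
    then show ?thesis using n[of p "nat k"] by simp
  next
    case False
    have "p = (p + of_int k *\<^sub>R s) + of_nat (nat (- k)) *\<^sub>R s" using False by simp
    then show ?thesis using n[of "p + of_int k *\<^sub>R s" "nat (- k)"] by metis
  qed
qed

text \<open>Integer multiples of the periods move every point into a compact fundamental cell, on
  which the continuous function is bounded.\<close>

lemma per_bounded:
  assumes L: "L > 0" and f: "per L f" shows "\<exists>B. \<forall>p. norm (f p) \<le> B"
proof -
  have "compact (f ` cbox (v2 0 0) (v2 L (2 * pi)))"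
    by (intro compact_continuous_image compact_cbox continuous_on_subset[OF smooth_on_imp_continuous_on[OF perD(1)[OF f]]]) simp
  then obtain B where B: "\<And>x. x \<in> f ` cbox (v2 0 0) (v2 L (2 * pi)) \<Longrightarrow> norm x \<le> B"
    using compact_imp_bounded bounded_iff by metis
  have fl: "0 \<le> x - of_int \<lfloor>x / l\<rfloor> * l \<and> x - of_int \<lfloor>x / l\<rfloor> * l \<le> l" if "l > 0" for x l :: real
  proof -
    have "of_int \<lfloor>x / l\<rfloor> * l \<le> x / l * l" "x / l * l \<le> (of_int \<lfloor>x / l\<rfloor> + 1) * l"
      by (intro mult_right_mono; use that in linarith)+
    then have "of_int \<lfloor>x / l\<rfloor> * l \<le> x" "x \<le> (of_int \<lfloor>x / l\<rfloor> + 1) * l"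
      using that by simp_all
    then show ?thesis by (simp add: algebra_simps)
  qed
  have "norm (f p) \<le> B" for p
  proof -
    define k where "k = \<lfloor>p $ 1 / L\<rfloor>"
    define j where "j = \<lfloor>p $ 2 / (2 * pi)\<rfloor>"
    define q where "q = v2 (p $ 1 - of_int k * L) (p $ 2 - of_int j * (2 * pi))"
    have "q \<in> cbox (v2 0 0) (v2 L (2 * pi))"
      using fl[of L "p $ 1"] fl[of "2 * pi" "p $ 2"] L by (simp add: mem_box_cart forall_2 q_def k_def j_def)
    then have "norm (f q) \<le> B" using B by blast
    moreover have "p = (q + of_int k *\<^sub>R v2 L 0) + of_int j *\<^sub>R v2 0 (2 * pi)"
      by (rule vec2_eqI) (simp_all add: q_def)
    then have "f p = f q"
      using shift_int[of f "v2 0 (2 * pi)", OF perD(3)[OF f]] shift_int[of f "v2 L 0", OF perD(2)[OF f]] by simp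
    ultimately show ?thesis by simp
  qed
  then show ?thesis by blast
qed

lemma graph_helix: "graph_immersion (\<lambda>p. U (p $ 1) *\<^sub>R ee (p $ 2)) = helix (\<lambda>x. x) U"
  by (rule ext) (simp add: graph_immersion_def helix_def v2_eta)

context
  fixes U :: "real \<Rightarrow> real" and L :: real
  assumes sU: "smooth_on UNIV U" and L: "L > 0" and U_per: "\<And>x. U (x + L) = U x"
begin

lemma dI': "deriv (\<lambda>x::real. x) x \<noteq> 0" by simp

lemma deriv_per: "deriv U (x + L) = deriv U x"
proof -
  have "((\<lambda>x. U (x + L)) has_real_derivative deriv U (x + L) * 1) (at x)"
    by (rule DERIV_chain2[OF smooth_DERIV[OF sU]]) (auto intro!: derivative_eq_intros)
  then have "(U has_real_derivative deriv U (x + L)) (at x)" by (simp add: U_per)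
  then show ?thesis using DERIV_imp_deriv by metis
qed

lemma ee_per: "ee (x + 2 * pi) = ee x" "nn (x + 2 * pi) = nn x"
  by (simp_all add: ee_def nn_def)

lemmas sII = smooth_on_ident[OF approachable_UNIV]

lemma per_frame: "per L (nrm1 U)" "per L (nrm2 U)" "per L (tan1 U)" "per L (tan2 U)"
  by (rule perI, rule smooth_\<nu>1[OF sII sU dI'] smooth_\<nu>2[OF sII sU dI'] smooth_hx[OF sII sU dI'] smooth_hy[OF sII sU dI'],
     simp_all add: \<nu>1_def[OF sII sU dI'] \<nu>2_def[OF sII sU dI'] hx_def[OF sII sU dI'] hy_def[OF sII sU dI']
        g1_def[OF sII sU dI'] g2_def[OF sII sU dI'] deriv_per U_per ee_per)+

lemma per_inverse_g: "per L (\<lambda>p. 1 / g1 (\<lambda>x. x) U p)" "per L (\<lambda>p. 1 / g2 U p)"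
proof -
  have "smooth_on UNIV (\<lambda>p. 1 / g1 (\<lambda>x. x) U p)" "smooth_on UNIV (\<lambda>p. 1 / g2 U p)"
    using g1_pos[OF sII sU dI'] g2_pos[OF sII sU dI'] smooth_g1[OF sII sU dI'] smooth_g2[OF sII sU dI']
    by (auto intro!: smooth_on_divide smooth_on_const simp: less_imp_neq[symmetric])
  then show "per L (\<lambda>p. 1 / g1 (\<lambda>x. x) U p)" "per L (\<lambda>p. 1 / g2 U p)"
    by (intro perI; simp add: g1_def[OF sII sU dI'] g2_def[OF sII sU dI'] deriv_per U_per)+
qed

lemma per_normal_part: assumes "per L w" shows "per L (\<lambda>p. normal_part (surf U) p (w p))"
  unfolding helix_normal_part[OF sII sU dI']
  by (intro per_add per_scaleR per_inner assms per_frame)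

lemma per_pushforward: assumes "per L Y" shows "per L (pushforward (surf U) Y)"
  unfolding pushforward_def[abs_def] helix_frechet[OF sII sU dI']
  by (intro per_add per_scaleR per_nth assms per_frame)

lemma per_euclidean: assumes "per L X" "per L Y" shows "per L (euclidean_connection X (pushforward (surf U) Y))"
  unfolding euclidean_connection_def[abs_def] by (rule per_frechet[OF per_pushforward[OF assms(2)] assms(1)])

lemma per_sff: assumes "per L X" "per L Y" shows "per L (second_fundamental_form (surf U) X Y)"
  unfolding second_fundamental_form_def[abs_def] by (rule per_normal_part[OF per_euclidean[OF assms]])

lemma per_levi_civita: assumes "per L X" "per L Y" shows "per L (levi_civita (surf U) X Y)"
proof -
  have "per L (\<lambda>p. v2 ((euclidean_connection X (pushforward (surf U) Y) p \<bullet> (tan1 U) p) * (1 / g1 (\<lambda>x. x) U p))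
     ((euclidean_connection X (pushforward (surf U) Y) p \<bullet> (tan2 U) p) * (1 / g2 U p)))"
    by (intro per_v2 per_mult per_inner per_euclidean assms per_frame per_inverse_g)
  moreover have "levi_civita (surf U) X Y = (\<lambda>p. v2 ((euclidean_connection X (pushforward (surf U) Y) p \<bullet> (tan1 U) p) * (1 / g1 (\<lambda>x. x) U p))
     ((euclidean_connection X (pushforward (surf U) Y) p \<bullet> (tan2 U) p) * (1 / g2 U p)))"
    by (rule ext) (simp add: helix_levi_civita[OF sII sU dI'])
  ultimately show ?thesis by (simp only:)
qed

lemma per_normal_connection: assumes "per L X" "per L V" shows "per L (normal_connection (surf U) X V)"
  unfolding normal_connection_def[abs_def] euclidean_connection_def
  by (rule per_normal_part[OF per_frechet[OF assms(2,1)]])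

text \<open>The induction ranges over all periodic fields, not just coordinate fields, because the
  covariant derivative of order l + 1 evaluates the tensor of order l on the nonconstant fields
  given by \<open>levi_civita\<close>.\<close>

lemma per_nabla_A: "length Xs = l + 2 \<Longrightarrow> \<forall>X\<in>set Xs. per L X \<Longrightarrow> per L (nabla_A (surf U) l Xs)"
proof (induction l arbitrary: Xs)
  case 0
  then show ?case by (simp add: nabla_A_def) (intro per_sff; simp)
next
  case (Suc l)
  have eq: "nabla_A (surf U) (Suc l) = covariant_derivative (surf U) (nabla_A (surf U) l)" by (simp add: nabla_A_def)
  obtain X Ys where Xs: "Xs = X # Ys" using Suc.prems(1) by (cases Xs) auto
  have len: "length Ys = l + 2" and pX: "per L X" and pY: "\<forall>Y\<in>set Ys. per L Y" using Suc.prems by (auto simp: Xs)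
  have "per L (\<lambda>p. normal_connection (surf U) X (nabla_A (surf U) l Ys) p
        - (\<Sum>i<length Ys. nabla_A (surf U) l (Ys[i := levi_civita (surf U) X (Ys ! i)]) p))"
  proof (intro per_diff per_sum)
    show "per L (\<lambda>p. normal_connection (surf U) X (nabla_A (surf U) l Ys) p)"
      by (rule per_normal_connection[OF pX Suc.IH[OF len pY]])
    show "per L (\<lambda>p. nabla_A (surf U) l (Ys[i := levi_civita (surf U) X (Ys ! i)]) p)" if "i \<in> {..<length Ys}" for i
    proof (rule Suc.IH)
      show "length (Ys[i := levi_civita (surf U) X (Ys ! i)]) = l + 2" using len by simp
      have "per L (Ys ! i)" using pY that by simp
      then show "\<forall>X\<in>set (Ys[i := levi_civita (surf U) X (Ys ! i)]). per L X"
        using pY per_levi_civita[OF pX] set_update_subset_insert[of Ys i "levi_civita (surf U) X (Ys ! i)"] by blast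
    qed
  qed
  then show ?case by (simp add: eq Xs covariant_derivative_def[abs_def] Let_def)
qed

lemma helix_bounded_geometry: "bounded_geometry (surf U)"
  unfolding bounded_geometry_def
proof
  fix l
  define T where "T I = nabla_A (surf U) l (map (\<lambda>i _. axis i 1) I)" for I :: "2 list"
  have "\<exists>B. \<forall>p. norm (T I p) \<le> B" if "length I = l + 2" for I
    unfolding T_def by (rule per_bounded[OF L per_nabla_A]) (use that in \<open>auto intro: per_const\<close>)
  then have "\<forall>I. \<exists>B. length I = l + 2 \<longrightarrow> (\<forall>p. norm (T I p) \<le> B)" by blast
  then obtain B where B: "\<And>I p. length I = l + 2 \<Longrightarrow> norm (T I p) \<le> B I" using choice by metis
  define S where "S = {I :: 2 list. length I = l + 2}"
  \<comment> \<open>The metric of a graph dominates the Euclidean one, so the entries of the inverse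
    metric do not exceed 1 and raising indices is harmless.\<close>
  have mi: "\<bar>matrix_inv (induced_metric (surf U) p) $ i $ j\<bar> \<le> 1" for p i j
    using g1_pos[OF sII sU dI', of p] g2_pos[OF sII sU dI', of p]
    by (simp add: helix_matrix_inv[OF sII sU dI'] g1_def[OF sII sU dI'] g2_def[OF sII sU dI'])
  have "tensor_norm (surf U) (l + 2) (nabla_A (surf U) l) p \<le> sqrt (\<Sum>I\<in>S. \<Sum>J\<in>S. B I * B J)" for p
  proof -
    have "(\<Prod>r<l + 2. matrix_inv (induced_metric (surf U) p) $ (I ! r) $ (J ! r)) * (T I p \<bullet> T J p) \<le> B I * B J"
      if "I \<in> S" "J \<in> S" for I J
    proof -
      have "\<bar>\<Prod>r<l + 2. matrix_inv (induced_metric (surf U) p) $ (I ! r) $ (J ! r)\<bar> \<le> 1"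
        unfolding abs_prod by (rule prod_le_1) (simp add: mi)
      moreover have "\<bar>T I p \<bullet> T J p\<bar> \<le> B I * B J"
      proof -
        have IJ: "norm (T I p) \<le> B I" "norm (T J p) \<le> B J" using B that by (simp_all add: S_def)
        have "norm (T I p) * norm (T J p) \<le> B I * B J"
          using IJ by (intro mult_mono) (auto intro: order_trans[OF norm_ge_zero])
        then show ?thesis by (rule order_trans[OF Cauchy_Schwarz_ineq2])
      qed
      ultimately have "\<bar>\<Prod>r<l + 2. matrix_inv (induced_metric (surf U) p) $ (I ! r) $ (J ! r)\<bar> * \<bar>T I p \<bullet> T J p\<bar> \<le> 1 * (B I * B J)"
        by (intro mult_mono) auto
      then show ?thesis unfolding abs_mult[symmetric] by linarith
    qed
    then show ?thesis unfolding tensor_norm_def T_def[symmetric] S_def[symmetric]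
      by (intro real_sqrt_le_mono sum_mono)
  qed
  then show "bdd_above (range (tensor_norm (surf U) (l + 2) (nabla_A (surf U) l)))"
    by (intro bdd_aboveI2)
qed

end

section \<open>Slope and singular values\<close>

lemma helix_gram:
  fixes U :: "real \<Rightarrow> real"
  assumes sU: "smooth_on UNIV U"
  defines "f \<equiv> \<lambda>p. U (p $ 1) *\<^sub>R ee (p $ 2)"
  shows "transpose (differential_matrix f p) ** differential_matrix f p =
    (\<chi> i j. if i = j then (if i = 1 then (deriv U (p $ 1))\<^sup>2 else (U (p $ 1))\<^sup>2) else 0)"
proof -
  have "(f has_derivative (\<lambda>v. U (p $ 1) *\<^sub>R (v $ 2 *\<^sub>R nn (p $ 2)) + (v $ 1 * deriv U (p $ 1)) *\<^sub>R ee (p $ 2))) (at p)"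
    unfolding f_def by (intro has_derivative_scaleR has_derivative_ee has_derivative_comp_nth smooth_DERIV sU)
  from frechet_eq[OF this]
  have c: "differential_matrix f p $ k $ 1 = deriv U (p $ 1) * ee (p $ 2) $ k"
    "differential_matrix f p $ k $ 2 = U (p $ 1) * nn (p $ 2) $ k" for k
    by (simp_all add: differential_matrix_def matrix_def axis_def)
  have n: "a * (b * (a * b)) + a * (c * (a * c)) = a\<^sup>2 * (b * b + c * c)"
    "a * (b * (d * e)) + a * (c * (d * g)) = a * d * (b * e + c * g)" for a b c d e g :: real
    by (simp_all add: power2_eq_square algebra_simps)
  have i: "ee x $ 1 * ee x $ 1 + ee x $ 2 * ee x $ 2 = 1" "nn x $ 1 * nn x $ 1 + nn x $ 2 * nn x $ 2 = 1"
    "ee x $ 1 * nn x $ 1 + ee x $ 2 * nn x $ 2 = 0" "nn x $ 1 * ee x $ 1 + nn x $ 2 * ee x $ 2 = 0" for x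
    unfolding inner_2[symmetric] by simp_all
  show ?thesis
    by (simp add: vec_eq_iff forall_2 matrix_matrix_mult_def transpose_def sum_2 c mult.assoc n(1) i)
      (simp add: n(2) i)
qed

text \<open>The singular values are the absolute values of U' and U. With squares at most 1/4 the
  slope is at most 5/4, and the area quantity at least (15/16) / (25/16) = 3/5, which exceeds the
  1/2 that is proved.\<close>

lemma helix_slope:
  fixes U :: "real \<Rightarrow> real"
  assumes sU: "smooth_on UNIV U" and b: "\<And>x. \<bar>U x\<bar> \<le> 1/2" "\<And>x. \<bar>deriv U x\<bar> \<le> 1/2"
  shows "bounded_slope (\<lambda>p. U (p $ 1) *\<^sub>R ee (p $ 2))"
    and "uniformly_area_decreasing (\<lambda>p. U (p $ 1) *\<^sub>R ee (p $ 2))"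
proof -
  define f where "f = (\<lambda>p::real^2. U (p $ 1) *\<^sub>R ee (p $ 2))"
  note gram = helix_gram[OF sU, folded f_def]
  have sq: "(U x)\<^sup>2 \<le> 1/4" "(deriv U x)\<^sup>2 \<le> 1/4" for x
    using power_mono[OF b(1)[of x], of 2] power_mono[OF b(2)[of x], of 2] by (simp_all add: power2_eq_square)
  have "slope f p \<le> sqrt ((5/4) * (5/4))" for p
  proof -
    have "det (mat 1 + transpose (differential_matrix f p) ** differential_matrix f p) =
       (1 + (deriv U (p $ 1))\<^sup>2) * (1 + (U (p $ 1))\<^sup>2)"
      unfolding gram by (simp add: det_2 mat_def)
    also have "\<dots> \<le> (5/4) * (5/4)" using sq[of "p $ 1"] by (intro mult_mono) auto
    finally show ?thesis unfolding slope_def by (rule real_sqrt_le_mono)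
  qed
  then show "bounded_slope (\<lambda>p. U (p $ 1) *\<^sub>R ee (p $ 2))"
    unfolding bounded_slope_def f_def[symmetric] by (intro bdd_aboveI2)
  have "\<exists>a c. singular_values (differential_matrix f p) a c \<and> (1 - a\<^sup>2 * c\<^sup>2) / ((1 + a\<^sup>2) * (1 + c\<^sup>2)) \<ge> 1/2" for p
  proof (intro exI conjI)
    define a where "a = \<bar>deriv U (p $ 1)\<bar>"
    define c where "c = \<bar>U (p $ 1)\<bar>"
    show "singular_values (differential_matrix f p) a c"
      unfolding singular_values_def gram by (simp add: det_2 mat_def a_def c_def)
    have q: "a\<^sup>2 \<le> 1/4" "c\<^sup>2 \<le> 1/4" using sq[of "p $ 1"] by (simp_all add: a_def c_def)
    have "a\<^sup>2 * c\<^sup>2 \<le> (1/4) * (1/4)" using q by (intro mult_mono) auto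
    moreover have "(1 + a\<^sup>2) * (1 + c\<^sup>2) \<le> (5/4) * (5/4)" using q by (intro mult_mono) auto
    moreover have "(1 + a\<^sup>2) * (1 + c\<^sup>2) > 0" by (intro mult_pos_pos one_plus_sq_pos)
    ultimately show "(1 - a\<^sup>2 * c\<^sup>2) / ((1 + a\<^sup>2) * (1 + c\<^sup>2)) \<ge> 1/2" by (simp add: le_divide_eq)
  qed
  then show "uniformly_area_decreasing (\<lambda>p. U (p $ 1) *\<^sub>R ee (p $ 2))"
    unfolding uniformly_area_decreasing_def f_def[symmetric] by (intro exI[of _ "1/2"]) simp
qed

section \<open>Uniqueness of the flow\<close>

text \<open>For nonnegative g and h let Y be the matrix with rows (a_i sqrt g, b_i sqrt h). The two
  sides are the squared Frobenius norms of Y^T Y - I and of Y Y^T - I, which agree because the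
  traces of Y^T Y and of its square do not depend on the order of the factors. Stated without square
  roots, the identity is polynomial.\<close>

lemma gram_identity:
  fixes a1 a2 b1 b2 g h :: real
  shows "((a1\<^sup>2 + a2\<^sup>2) * g - 1)\<^sup>2 + 2 * ((a1 * b1 + a2 * b2)\<^sup>2 * g * h) + ((b1\<^sup>2 + b2\<^sup>2) * h - 1)\<^sup>2 =
    (a1\<^sup>2 * g + b1\<^sup>2 * h - 1)\<^sup>2 + 2 * (a1 * a2 * g + b1 * b2 * h)\<^sup>2 + (a2\<^sup>2 * g + b2\<^sup>2 * h - 1)\<^sup>2"
  by (simp add: power2_eq_square algebra_simps)

lemma young: "(x::real) * y \<le> x\<^sup>2 / 8 + 2 * y\<^sup>2"
proof -
  have "0 \<le> (x - 4 * y)\<^sup>2" by simp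
  then show ?thesis by (simp add: power2_eq_square algebra_simps)
qed

text \<open>The trace of the Hessian of the comparison graph over a 2-plane with orthonormal basis
  \<open>\<epsilon>1\<close>, \<open>\<epsilon>2\<close> differs from its trace over the tangent plane of the comparison graph by an amount
  controlled by the slopes \<open>P \<epsilon>1\<close>, \<open>P \<epsilon>2\<close> of the plane relative to that graph.\<close>

lemma trace_comparison:
  fixes \<epsilon>1 \<epsilon>2 :: "(real^2) \<times> (real^2)" and w :: "real^2" and u u1 u2 ut K \<theta> :: real
  assumes on: "\<epsilon>1 \<bullet> \<epsilon>1 = 1" "\<epsilon>2 \<bullet> \<epsilon>2 = 1" "\<epsilon>1 \<bullet> \<epsilon>2 = 0"
    and u: "\<bar>u\<bar> \<le> 1/2" "\<bar>u1\<bar> \<le> 1/2" "\<bar>u2\<bar> \<le> K"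
    and ut: "ut = u2 / (1 + u1\<^sup>2) - u / (1 + u\<^sup>2)"
  defines "P \<equiv> \<lambda>v. snd v - ((u1 * fst v $ 1) *\<^sub>R ee \<theta> + (u * fst v $ 2) *\<^sub>R nn \<theta>)"
    and "B \<equiv> \<lambda>v. (u2 * (fst v $ 1)\<^sup>2) *\<^sub>R ee \<theta> + (2 * u1 * (fst v $ 1 * fst v $ 2)) *\<^sub>R nn \<theta> - (u * (fst v $ 2)\<^sup>2) *\<^sub>R ee \<theta>"
    and "\<psi> \<equiv> sqrt (1 + w \<bullet> w)"
  shows "w \<bullet> (B \<epsilon>1 + B \<epsilon>2 - ut *\<^sub>R ee \<theta>) / \<psi> \<le> 384 * (K + 2)\<^sup>2 * (\<psi> - 1) +
    ((P \<epsilon>1 \<bullet> P \<epsilon>1) / \<psi> - (w \<bullet> P \<epsilon>1)\<^sup>2 / \<psi> ^ 3) + ((P \<epsilon>2 \<bullet> P \<epsilon>2) / \<psi> - (w \<bullet> P \<epsilon>2)\<^sup>2 / \<psi> ^ 3)"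
proof -
  have K: "K \<ge> 0" using u(3) abs_ge_zero order_trans by blast
  define a1 b1 a2 b2 where "a1 = fst \<epsilon>1 $ 1" and "b1 = fst \<epsilon>1 $ 2" and "a2 = fst \<epsilon>2 $ 1" and "b2 = fst \<epsilon>2 $ 2"
  define q1 where "q1 = (u1 * a1) *\<^sub>R ee \<theta> + (u * b1) *\<^sub>R nn \<theta>"
  define q2 where "q2 = (u1 * a2) *\<^sub>R ee \<theta> + (u * b2) *\<^sub>R nn \<theta>"
  define P1 where "P1 = P \<epsilon>1"
  define P2 where "P2 = P \<epsilon>2"
  have s1: "snd \<epsilon>1 = q1 + P1" and s2: "snd \<epsilon>2 = q2 + P2"
    by (simp_all add: P1_def P2_def P_def q1_def q2_def a1_def b1_def a2_def b2_def)
  define \<sigma> where "\<sigma> = sqrt (P1 \<bullet> P1 + P2 \<bullet> P2)"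
  have \<sigma>: "\<sigma> \<ge> 0" "\<sigma>\<^sup>2 = P1 \<bullet> P1 + P2 \<bullet> P2" by (simp_all add: \<sigma>_def)
  have nP: "norm P1 \<le> \<sigma>" "norm P2 \<le> \<sigma>" unfolding \<sigma>_def norm_eq_sqrt_inner by simp_all
  have e: "\<epsilon> \<bullet> \<epsilon>' = fst \<epsilon> $ 1 * fst \<epsilon>' $ 1 + fst \<epsilon> $ 2 * fst \<epsilon>' $ 2 + snd \<epsilon> \<bullet> snd \<epsilon>'" for \<epsilon> \<epsilon>' :: "(real^2) \<times> (real^2)"
    by (simp add: inner_prod_def inner_2)
  have n1: "a1\<^sup>2 + b1\<^sup>2 + (norm (snd \<epsilon>1))\<^sup>2 = 1" and n2: "a2\<^sup>2 + b2\<^sup>2 + (norm (snd \<epsilon>2))\<^sup>2 = 1"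
    using on(1,2) unfolding e a1_def b1_def a2_def b2_def by (simp_all add: power2_eq_square dot_square_norm)
  have sq: "a1\<^sup>2 \<le> 1" "b1\<^sup>2 \<le> 1" "a2\<^sup>2 \<le> 1" "b2\<^sup>2 \<le> 1" "(norm (snd \<epsilon>1))\<^sup>2 \<le> 1" "(norm (snd \<epsilon>2))\<^sup>2 \<le> 1"
    using n1 n2 zero_le_power2[of a1] zero_le_power2[of b1] zero_le_power2[of a2] zero_le_power2[of b2]
      zero_le_power2[of "norm (snd \<epsilon>1)"] zero_le_power2[of "norm (snd \<epsilon>2)"] by linarith+
  have ab: "\<bar>a1\<bar> \<le> 1" "\<bar>b1\<bar> \<le> 1" "\<bar>a2\<bar> \<le> 1" "\<bar>b2\<bar> \<le> 1"
    using sq(1-4) by (simp_all add: abs_square_le_1)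
  have ns: "norm (snd \<epsilon>1) \<le> 1" "norm (snd \<epsilon>2) \<le> 1"
    using sq(5,6) by (simp_all add: abs_square_le_1)
  have nf: "norm (ee x) = 1" "norm (nn x) = 1" for x by (simp_all add: norm_eq_sqrt_inner)
  have nq: "norm ((u1 * a) *\<^sub>R ee \<theta> + (u * b) *\<^sub>R nn \<theta>) \<le> 1" if "\<bar>a\<bar> \<le> 1" "\<bar>b\<bar> \<le> 1" for a b
  proof -
    have "norm ((u1 * a) *\<^sub>R ee \<theta> + (u * b) *\<^sub>R nn \<theta>) \<le> \<bar>u1\<bar> * \<bar>a\<bar> + \<bar>u\<bar> * \<bar>b\<bar>"
      by (rule order_trans[OF norm_triangle_ineq]) (simp add: nf abs_mult)
    also have "\<dots> \<le> (1/2) * 1 + (1/2) * 1" using u that by (intro add_mono mult_mono) auto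
    finally show ?thesis by simp
  qed
  have q: "norm q1 \<le> 1" "norm q2 \<le> 1" unfolding q1_def q2_def using nq ab by blast+
  have P2b: "norm P1 \<le> 2" "norm P2 \<le> 2"
  proof -
    have "P1 = snd \<epsilon>1 - q1" "P2 = snd \<epsilon>2 - q2" using s1 s2 by simp_all
    then show "norm P1 \<le> 2" "norm P2 \<le> 2"
      using norm_triangle_ineq4[of "snd \<epsilon>1" q1] norm_triangle_ineq4[of "snd \<epsilon>2" q2] ns q by simp_all
  qed
  define g where "g = 1 + u1\<^sup>2"
  define h where "h = 1 + u\<^sup>2"
  have gh: "g \<ge> 1" "h \<ge> 1" by (simp_all add: g_def h_def)
  have qq: "((u1 * a) *\<^sub>R ee \<theta> + (u * b) *\<^sub>R nn \<theta>) \<bullet> ((u1 * a') *\<^sub>R ee \<theta> + (u * b') *\<^sub>R nn \<theta>) = u1\<^sup>2 * (a * a') + u\<^sup>2 * (b * b')"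
    for a b a' b' by (simp add: inner_add_left inner_add_right power2_eq_square)
  define R where "R x p y p' = x \<bullet> p' + p \<bullet> y + p \<bullet> p'" for x p y p' :: "real^2"
  have Rb: "\<bar>R x p y p'\<bar> \<le> 4 * \<sigma>" if "norm x \<le> 1" "norm y \<le> 1" "norm p \<le> \<sigma>" "norm p' \<le> \<sigma>" "norm p \<le> 2" for x p y p'
  proof -
    have "\<bar>x \<bullet> p'\<bar> \<le> 1 * \<sigma>" by (rule order_trans[OF Cauchy_Schwarz_ineq2]) (intro mult_mono; use that in simp)
    moreover have "\<bar>p \<bullet> y\<bar> \<le> \<sigma> * 1" by (rule order_trans[OF Cauchy_Schwarz_ineq2]) (intro mult_mono; use that \<sigma>(1) in simp)
    moreover have "\<bar>p \<bullet> p'\<bar> \<le> 2 * \<sigma>" by (rule order_trans[OF Cauchy_Schwarz_ineq2]) (use that in \<open>auto intro!: mult_mono\<close>)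
    ultimately show ?thesis unfolding R_def by linarith
  qed
  have sp: "(x + p) \<bullet> (y + p') = x \<bullet> y + R x p y p'" for x p y p' :: "real^2"
    by (simp add: R_def inner_add_left inner_add_right)
  \<comment> \<open>Orthonormality of the two vectors, written in their horizontal parts: up to
    errors of order \<sigma>, the rows (a_i sqrt g, b_i sqrt h) are orthonormal.\<close>
  have r11: "a1\<^sup>2 * g + b1\<^sup>2 * h - 1 = - R q1 P1 q1 P1"
    using on(1) unfolding e a1_def[symmetric] b1_def[symmetric] s1 sp
    by (simp add: q1_def qq g_def h_def power2_eq_square algebra_simps)
  have r22: "a2\<^sup>2 * g + b2\<^sup>2 * h - 1 = - R q2 P2 q2 P2"
    using on(2) unfolding e a2_def[symmetric] b2_def[symmetric] s2 sp
    by (simp add: q2_def qq g_def h_def power2_eq_square algebra_simps)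
  have r12: "a1 * a2 * g + b1 * b2 * h = - R q1 P1 q2 P2"
    using on(3) unfolding e a1_def[symmetric] b1_def[symmetric] a2_def[symmetric] b2_def[symmetric] s1 s2 sp
    by (simp add: q1_def q2_def qq g_def h_def power2_eq_square algebra_simps)
  have R2: "(R x p y p')\<^sup>2 \<le> 16 * \<sigma>\<^sup>2" if "norm x \<le> 1" "norm y \<le> 1" "norm p \<le> \<sigma>" "norm p' \<le> \<sigma>" "norm p \<le> 2" for x p y p'
    using power_mono[OF Rb[OF that] abs_ge_zero, of 2] by (simp add: power_mult_distrib)
  define A where "A = a1\<^sup>2 + a2\<^sup>2"
  define M where "M = a1 * b1 + a2 * b2"
  define N where "N = b1\<^sup>2 + b2\<^sup>2"
  \<comment> \<open>Near orthonormality passes from rows to columns by \<open>gram_identity\<close>.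
    This compares A, N and M with 1/g, 1/h and 0, the coefficients of the trace over the tangent
    plane of the comparison graph. The constant is 16 + 2 * 16 + 16.\<close>
  have tot: "(A * g - 1)\<^sup>2 + 2 * (M\<^sup>2 * g * h) + (N * h - 1)\<^sup>2 \<le> 64 * \<sigma>\<^sup>2"
    unfolding A_def M_def N_def gram_identity r11 r22 r12
    using R2[OF q(1) q(1) nP(1) nP(1) P2b(1)] R2[OF q(2) q(2) nP(2) nP(2) P2b(2)] R2[OF q(1) q(2) nP(1) nP(2) P2b(1)]
    by simp
  have Mgh: "M\<^sup>2 \<le> M\<^sup>2 * g * h"
  proof -
    have "1 * 1 \<le> g * h" using gh by (intro mult_mono) auto
    then have "M\<^sup>2 * 1 \<le> M\<^sup>2 * (g * h)" by (intro mult_left_mono) auto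
    then show ?thesis by (simp add: mult.assoc)
  qed
  have le8: "\<bar>x\<bar> \<le> 8 * \<sigma>" if "x\<^sup>2 \<le> 64 * \<sigma>\<^sup>2" for x
  proof -
    have "x\<^sup>2 \<le> (8 * \<sigma>)\<^sup>2" using that by (simp add: power_mult_distrib)
    then show ?thesis using abs_le_square_iff[of x "8 * \<sigma>"] \<sigma>(1) by simp
  qed
  have pos: "(A * g - 1)\<^sup>2 \<ge> 0" "(N * h - 1)\<^sup>2 \<ge> 0" "M\<^sup>2 \<ge> 0" by simp_all
  have "\<bar>A * g - 1\<bar> \<le> 8 * \<sigma>" "\<bar>N * h - 1\<bar> \<le> 8 * \<sigma>" "\<bar>M\<bar> \<le> 8 * \<sigma>"
    by (rule le8; use tot Mgh pos in linarith)+
  moreover have "\<bar>A - 1 / g\<bar> \<le> \<bar>A * g - 1\<bar>" "\<bar>N - 1 / h\<bar> \<le> \<bar>N * h - 1\<bar>"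
  proof -
    have *: "\<bar>x - 1 / c\<bar> \<le> \<bar>x * c - 1\<bar>" if "c \<ge> 1" for x c :: real
    proof -
      have "\<bar>x - 1 / c\<bar> * 1 \<le> \<bar>x - 1 / c\<bar> * c" using that by (intro mult_left_mono) auto
      also have "\<dots> = \<bar>(x - 1 / c) * c\<bar>" using that by (simp add: abs_mult)
      also have "(x - 1 / c) * c = x * c - 1" using that by (simp add: field_simps)
      finally show ?thesis by simp
    qed
    show "\<bar>A - 1 / g\<bar> \<le> \<bar>A * g - 1\<bar>" "\<bar>N - 1 / h\<bar> \<le> \<bar>N * h - 1\<bar>" using * gh by blast+
  qed
  ultimately have fine: "\<bar>A - 1 / g\<bar> \<le> 8 * \<sigma>" "\<bar>N - 1 / h\<bar> \<le> 8 * \<sigma>" "\<bar>M\<bar> \<le> 8 * \<sigma>" by linarith+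
  \<comment> \<open>A bound independent of \<sigma>, for points far from the comparison graph, where
    the Hessian term is too weak to absorb \<sigma>.\<close>
  have crude: "\<bar>A - 1 / g\<bar> \<le> 2" "\<bar>N - 1 / h\<bar> \<le> 2" "\<bar>M\<bar> \<le> 2"
  proof -
    have "0 \<le> 1 / g" "1 / g \<le> 1" "0 \<le> 1 / h" "1 / h \<le> 1" using gh by simp_all
    moreover have "0 \<le> A" "A \<le> 2" "0 \<le> N" "N \<le> 2" using sq by (simp_all add: A_def N_def)
    ultimately show "\<bar>A - 1 / g\<bar> \<le> 2" "\<bar>N - 1 / h\<bar> \<le> 2" by linarith+
    have "\<bar>a1 * b1\<bar> \<le> 1 * 1" "\<bar>a2 * b2\<bar> \<le> 1 * 1" unfolding abs_mult using ab by (intro mult_mono; simp)+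
    then show "\<bar>M\<bar> \<le> 2" unfolding M_def by linarith
  qed
  define D where "D = B \<epsilon>1 + B \<epsilon>2 - ut *\<^sub>R ee \<theta>"
  have D: "D = (u2 * (A - 1 / g) - u * (N - 1 / h)) *\<^sub>R ee \<theta> + (2 * u1 * M) *\<^sub>R nn \<theta>"
    unfolding D_def B_def ut A_def N_def M_def g_def h_def a1_def b1_def a2_def b2_def
    by (simp add: algebra_simps)
  have nD: "norm D \<le> (K + 2) * c" if c: "\<bar>A - 1 / g\<bar> \<le> c" "\<bar>N - 1 / h\<bar> \<le> c" "\<bar>M\<bar> \<le> c" for c
  proof -
    have "c \<ge> 0" using c(1) abs_ge_zero order_trans by blast
    have "norm D \<le> \<bar>u2 * (A - 1 / g) - u * (N - 1 / h)\<bar> + \<bar>2 * u1 * M\<bar>"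
      unfolding D by (rule order_trans[OF norm_triangle_ineq]) (simp add: nf)
    also have "\<dots> \<le> \<bar>u2\<bar> * \<bar>A - 1 / g\<bar> + \<bar>u\<bar> * \<bar>N - 1 / h\<bar> + 2 * \<bar>u1\<bar> * \<bar>M\<bar>"
      using abs_triangle_ineq4[of "u2 * (A - 1 / g)" "u * (N - 1 / h)"] by (simp add: abs_mult)
    also have "\<dots> \<le> K * c + (1/2) * c + 2 * (1/2) * c"
      using u c K \<open>c \<ge> 0\<close> by (intro add_mono mult_mono) auto
    also have "\<dots> \<le> (K + 2) * c" using \<open>c \<ge> 0\<close> by (simp add: algebra_simps)
    finally show ?thesis .
  qed
  have ww: "w \<bullet> w \<ge> 0" by simp
  have \<psi>1: "\<psi> \<ge> 1" and \<psi>2: "\<psi>\<^sup>2 = 1 + w \<bullet> w" by (simp_all add: \<psi>_def)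
  have nw: "(norm w)\<^sup>2 = \<psi>\<^sup>2 - 1" by (simp add: \<psi>2 dot_square_norm)
  have nw_le: "norm w \<le> \<psi>"
  proof -
    have "(norm w)\<^sup>2 \<le> \<psi>\<^sup>2" using nw by simp
    then show ?thesis using \<psi>1 by (intro power2_le_imp_le[of "norm w" \<psi>]) auto
  qed
  \<comment> \<open>The right-hand side is the Hessian of sqrt (1 + |w|^2) in the direction v; it is
    positive definite, with constant degenerating like \<psi>^-3.\<close>
  have low: "(v \<bullet> v) / \<psi> ^ 3 \<le> (v \<bullet> v) / \<psi> - (w \<bullet> v)\<^sup>2 / \<psi> ^ 3" for v
  proof -
    have "(w \<bullet> v)\<^sup>2 \<le> (\<psi>\<^sup>2 - 1) * (v \<bullet> v)"
      using Cauchy_Schwarz_ineq[of w v] \<psi>2 by simp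
    then have "(v \<bullet> v) + (w \<bullet> v)\<^sup>2 \<le> \<psi>\<^sup>2 * (v \<bullet> v)" by (simp add: algebra_simps)
    then have "((v \<bullet> v) + (w \<bullet> v)\<^sup>2) / \<psi> ^ 3 \<le> \<psi>\<^sup>2 * (v \<bullet> v) / \<psi> ^ 3"
      using \<psi>1 by (intro divide_right_mono) auto
    also have "\<psi>\<^sup>2 * (v \<bullet> v) / \<psi> ^ 3 = (v \<bullet> v) / \<psi>" using \<psi>1 by (simp add: power2_eq_square power3_eq_cube)
    finally show ?thesis by (simp add: add_divide_distrib)
  qed
  have low0: "0 \<le> (v \<bullet> v) / \<psi> ^ 3" for v :: "real^2" using \<psi>1 by simp
  have lhs: "w \<bullet> D / \<psi> \<le> norm w * norm D / \<psi>"
    using \<psi>1 norm_cauchy_schwarz[of w D] by (intro divide_right_mono) auto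
  \<comment> \<open>For \<psi> \<ge> 2 the crude bound is absorbed by \<psi> - 1 \<ge> 1. For \<psi>
    < 2 one has \<psi>^3 < 8, which is why the coefficient 1/8 is chosen in \<open>young\<close>;
    the term left over is 128 (K + 2)^2 (\<psi>^2 - 1), and \<psi> + 1 \<le> 3 gives 384 = 3 *
    128.\<close>
  have main: "norm w * norm D / \<psi> \<le> 384 * (K + 2)\<^sup>2 * (\<psi> - 1) + (P1 \<bullet> P1) / \<psi> ^ 3 + (P2 \<bullet> P2) / \<psi> ^ 3"
  proof (cases "\<psi> \<ge> 2")
    case True
    have "norm w * norm D / \<psi> \<le> \<psi> * ((K + 2) * 2) / \<psi>"
      using nw_le nD[OF crude] \<psi>1 by (intro divide_right_mono mult_mono) auto
    also have "\<dots> = 2 * (K + 2) * 1" using \<psi>1 by simp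
    also have "\<dots> \<le> 384 * (K + 2)\<^sup>2 * (\<psi> - 1)"
    proof (rule mult_mono)
      have "(K + 2) * 1 \<le> (K + 2) * (K + 2)" using K by (intro mult_left_mono) auto
      moreover have "0 \<le> (K + 2) * (K + 2)" by simp
      ultimately show "2 * (K + 2) \<le> 384 * (K + 2)\<^sup>2" unfolding power2_eq_square using K by linarith
    qed (use True in auto)
    finally show ?thesis using low0[of P1] low0[of P2] by linarith
  next
    case False
    have "norm w * norm D / \<psi> \<le> norm w * norm D"
      using \<psi>1 divide_left_mono[of 1 \<psi> "norm w * norm D"] by simp
    also have "\<dots> \<le> norm w * ((K + 2) * (8 * \<sigma>))" by (intro mult_left_mono nD[OF fine]) auto
    also have "\<dots> = \<sigma> * (8 * (K + 2) * norm w)" by simp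
    also have "\<dots> \<le> \<sigma>\<^sup>2 / 8 + 2 * (8 * (K + 2) * norm w)\<^sup>2" by (rule young)
    also have "2 * (8 * (K + 2) * norm w)\<^sup>2 = 128 * (K + 2)\<^sup>2 * (\<psi>\<^sup>2 - 1)"
      unfolding power_mult_distrib nw by simp
    also have "\<psi>\<^sup>2 - 1 = (\<psi> + 1) * (\<psi> - 1)" by (simp add: power2_eq_square algebra_simps)
    also have "128 * (K + 2)\<^sup>2 * ((\<psi> + 1) * (\<psi> - 1)) \<le> 128 * (K + 2)\<^sup>2 * (3 * (\<psi> - 1))"
      using False \<psi>1 by (intro mult_left_mono mult_right_mono) auto
    also have "\<sigma>\<^sup>2 / 8 \<le> \<sigma>\<^sup>2 / \<psi> ^ 3"
    proof (rule divide_left_mono)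
      have "\<psi> ^ 3 \<le> 2 ^ 3" using False \<psi>1 by (intro power_mono) auto
      then show "\<psi> ^ 3 \<le> 8" by simp
    qed (use \<psi>1 in auto)
    also have "\<sigma>\<^sup>2 / \<psi> ^ 3 = (P1 \<bullet> P1) / \<psi> ^ 3 + (P2 \<bullet> P2) / \<psi> ^ 3" by (simp add: \<sigma>(2) add_divide_distrib)
    finally show ?thesis by (simp add: algebra_simps)
  qed
  show ?thesis
    unfolding D_def[symmetric] P1_def[symmetric] P2_def[symmetric]
    using lhs main low[of P1] low[of P2] by linarith
qed

section \<open>Second derivatives along lines and orthonormal frames\<close>

lemma local_max_second_derivative:
  fixes f :: "real \<Rightarrow> real"
  assumes d: "\<And>s. (f has_real_derivative f' s) (at s)" and d2: "(f' has_real_derivative c) (at 0)"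
    and m: "\<And>s. f s \<le> f 0"
  shows "f' 0 = 0" "c \<le> 0"
proof -
  show f0: "f' 0 = 0" by (rule DERIV_local_max[OF d, of 1]) (use m in auto)
  show "c \<le> 0"
  proof (rule ccontr)
    assume "\<not> c \<le> 0"
    then obtain e where e: "e > 0" "\<And>h. 0 < h \<Longrightarrow> h < e \<Longrightarrow> f' 0 < f' (0 + h)"
      using DERIV_pos_inc_right[OF d2] by force
    obtain z where z: "0 < z" "z < e / 2" "f (e / 2) - f 0 = (e / 2 - 0) * f' z"
      using MVT2[of 0 "e / 2" f f'] d e(1) by auto
    have "f' z > 0" using e(2)[of z] z f0 by simp
    then have "(e / 2 - 0) * f' z > 0" using e(1) by simp
    then show False using z(3) m[of "e / 2"] by linarith
  qed
qed

text \<open>Gram-Schmidt applied to the images of the coordinate vectors. In terms of the parameter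
  vectors the inverse metric is b1 b1^T + b2 b2^T, so contraction with it becomes a sum over b1 and
  b2.\<close>

lemma orthonormal_frame:
  fixes F :: "real^2 \<Rightarrow> 'b::euclidean_space" and p :: "real^2"
  assumes F: "immersion F"
  defines "D \<equiv> frechet_derivative F (at p)"
  obtains b1 b2 where "D b1 \<bullet> D b1 = 1" "D b2 \<bullet> D b2 = 1" "D b1 \<bullet> D b2 = 0"
    "\<And>i j. matrix_inv (induced_metric F p) $ i $ j = b1 $ i * b1 $ j + b2 $ i * b2 $ j"
    "\<And>w. \<exists>v. normal_part F p w = w - D v"
proof -
  have dF: "(F has_derivative D) (at p)"
    unfolding D_def using F smooth_on_has_derivative[OF _ UNIV_I, of F p] by (simp add: immersion_def)
  have l: "linear D" by (rule has_derivative_linear[OF dF])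
  have inj: "D v = 0 \<Longrightarrow> v = 0" for v
    using F linear_0[OF l] unfolding immersion_def D_def[symmetric] by (metis D_def injD)
  define e1 where "e1 = D (axis 1 1)"
  have e1: "e1 \<noteq> 0" using inj[of "axis 1 1"] by (auto simp: e1_def axis_eq_0_iff)
  define c where "c = (D (axis 2 1) \<bullet> e1) / (e1 \<bullet> e1)"
  define x where "x = axis 2 1 - c *\<^sub>R (axis 1 1 :: real^2)"
  define w where "w = D x"
  have "x $ 2 = 1" by (simp add: x_def axis_def)
  then have "x \<noteq> 0" by auto
  then have w0: "w \<noteq> 0" using inj[of x] by (auto simp: w_def)
  have we: "w \<bullet> e1 = 0"
    using e1 by (simp add: w_def x_def linear_diff[OF l] linear_scale[OF l] e1_def[symmetric] inner_diff_left c_def)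
  define b1 where "b1 = (1 / norm e1) *\<^sub>R (axis 1 1 :: real^2)"
  define b2 where "b2 = (1 / norm w) *\<^sub>R x"
  have D1: "D b1 = (1 / norm e1) *\<^sub>R e1" and D2: "D b2 = (1 / norm w) *\<^sub>R w"
    by (simp_all add: b1_def b2_def linear_scale[OF l] e1_def w_def)
  have o: "D b1 \<bullet> D b1 = 1" "D b2 \<bullet> D b2 = 1" "D b1 \<bullet> D b2 = 0" "D b2 \<bullet> D b1 = 0"
    using e1 w0 we by (simp_all add: D1 D2 dot_square_norm power2_eq_square inner_commute)
  have ax: "axis k 1 = (D b1 \<bullet> D (axis k 1)) *\<^sub>R b1 + (D b2 \<bullet> D (axis k 1)) *\<^sub>R b2" for k :: 2
  proof -
    have "\<exists>\<alpha> \<beta>. axis k 1 = \<alpha> *\<^sub>R b1 + \<beta> *\<^sub>R b2"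
    proof -
      have "axis 1 1 = norm e1 *\<^sub>R b1 + 0 *\<^sub>R b2" using e1 by (simp add: b1_def)
      moreover have "axis 2 1 = (c * norm e1) *\<^sub>R b1 + norm w *\<^sub>R b2" using e1 w0 by (simp add: b1_def b2_def x_def)
      ultimately show ?thesis using exhaust_2[of k] by metis
    qed
    then obtain \<alpha> \<beta> where k: "axis k 1 = \<alpha> *\<^sub>R b1 + \<beta> *\<^sub>R b2" by blast
    then have "D (axis k 1) = \<alpha> *\<^sub>R D b1 + \<beta> *\<^sub>R D b2" by (simp add: linear_add[OF l] linear_scale[OF l])
    then have "D b1 \<bullet> D (axis k 1) = \<alpha>" "D b2 \<bullet> D (axis k 1) = \<beta>" by (simp_all add: inner_add_right o)
    then show ?thesis using k by simp
  qed
  define Q :: "real^2^2" where "Q = (\<chi> i j. b1 $ i * b1 $ j + b2 $ i * b2 $ j)"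
  have Db: "D v = v $ 1 *\<^sub>R D (axis 1 1) + v $ 2 *\<^sub>R D (axis 2 1)" for v
  proof -
    have "v = v $ 1 *\<^sub>R axis 1 1 + v $ 2 *\<^sub>R axis 2 1" by (rule vec2_eqI) (simp_all add: axis_def)
    then show ?thesis by (metis linear_add[OF l] linear_scale[OF l])
  qed
  have inv: "matrix_inv (induced_metric F p) = Q"
  proof (rule matrix_inv_eqI)
    have "(Q ** induced_metric F p) $ i $ k = (mat 1 :: real^2^2) $ i $ k" for i k
    proof -
      have "(Q ** induced_metric F p) $ i $ k =
        b1 $ i * (D b1 \<bullet> D (axis k 1)) + b2 $ i * (D b2 \<bullet> D (axis k 1))"
        unfolding Db[of b1] Db[of b2]
        by (simp add: Q_def matrix_matrix_mult_def sum_2 induced_metric_def D_def[symmetric] inner_add_left algebra_simps)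
      also have "\<dots> = ((D b1 \<bullet> D (axis k 1)) *\<^sub>R b1 + (D b2 \<bullet> D (axis k 1)) *\<^sub>R b2) $ i" by (simp add: mult.commute)
      also have "\<dots> = axis k 1 $ i" by (simp only: ax[symmetric])
      finally show ?thesis by (simp add: axis_def mat_def)
    qed
    then show "Q ** induced_metric F p = mat 1" by (simp add: vec_eq_iff)
  qed
  have np: "\<exists>v. normal_part F p w = w - D v" for w
  proof -
    define v where "v = (w \<bullet> D b1) *\<^sub>R b1 + (w \<bullet> D b2) *\<^sub>R b2"
    have Dv: "D v = (w \<bullet> D b1) *\<^sub>R D b1 + (w \<bullet> D b2) *\<^sub>R D b2"
      by (simp add: v_def linear_add[OF l] linear_scale[OF l])
    have z: "(w - D v) \<bullet> D (axis k 1) = 0" for k :: 2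
      by (subst ax) (simp add: linear_add[OF l] linear_scale[OF l] inner_add_right inner_diff_left Dv inner_add_left o)
    have "normal_part F p w = w - D v"
    proof (rule normal_partI[OF dF])
      show "(w - D v) \<bullet> D y = 0" for y by (subst Db) (simp add: inner_add_right z)
      show "w - (w - D v) = D v" by simp
    qed
    then show ?thesis ..
  qed
  show ?thesis by (rule that[OF o(1-3) _ np]) (simp add: inv Q_def)
qed

text \<open>The second derivative of s \<mapsto> F (p + s b) at 0, written as the double sum that
  occurs in \<open>mean_curvature\<close>.\<close>

definition line2 :: "(real^2 \<Rightarrow> 'b::euclidean_space) \<Rightarrow> real^2 \<Rightarrow> real^2 \<Rightarrow> 'b" where
  "line2 F p b = (\<Sum>i\<in>UNIV. \<Sum>j\<in>UNIV. (b $ i * b $ j) *\<^sub>R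
     frechet_derivative (\<lambda>q. frechet_derivative F (at q) (axis j 1)) (at p) (axis i 1))"

lemma line_derivatives:
  fixes F :: "real^2 \<Rightarrow> 'b::euclidean_space"
  assumes F: "smooth_on UNIV F"
  shows "((\<lambda>s. F (p + s *\<^sub>R b)) has_vector_derivative frechet_derivative F (at (p + s *\<^sub>R b)) b) (at s)"
    and "((\<lambda>s. frechet_derivative F (at (p + s *\<^sub>R b)) b) has_vector_derivative line2 F p b) (at 0)"
proof -
  have line: "((\<lambda>s. p + s *\<^sub>R b) has_derivative (\<lambda>h. h *\<^sub>R b)) (at s)" for s
    by (auto intro!: derivative_eq_intros)
  have chain: "((\<lambda>s. H (p + s *\<^sub>R b)) has_vector_derivative frechet_derivative H (at (p + s *\<^sub>R b)) b) (at s)"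
    if H: "smooth_on UNIV H" for H :: "real^2 \<Rightarrow> 'b" and s
  proof -
    have h: "(H has_derivative frechet_derivative H (at q)) (at q)" for q
      using smooth_on_has_derivative[OF H UNIV_I] .
    show ?thesis
      using has_derivative_compose[OF line h, of s] linear_scale[OF has_derivative_linear[OF h]]
      by (simp add: has_vector_derivative_def)
  qed
  show "((\<lambda>s. F (p + s *\<^sub>R b)) has_vector_derivative frechet_derivative F (at (p + s *\<^sub>R b)) b) (at s)"
    by (rule chain[OF F])
  define Fj where "Fj j q = frechet_derivative F (at q) (axis j 1)" for j :: 2 and q
  have Fj: "smooth_on UNIV (Fj j)" for j
    unfolding Fj_def by (rule smooth_on_frechet_Basis[OF F]) (simp add: axis_in_Basis_iff)
  have split: "frechet_derivative H (at q) v = v $ 1 *\<^sub>R frechet_derivative H (at q) (axis 1 1) + v $ 2 *\<^sub>R frechet_derivative H (at q) (axis 2 1)"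
    if H: "smooth_on UNIV H" for H :: "real^2 \<Rightarrow> 'b" and q v
  proof -
    have l: "linear (frechet_derivative H (at q))"
      using has_derivative_linear[OF smooth_on_has_derivative[OF H UNIV_I]] .
    have "v = v $ 1 *\<^sub>R axis 1 1 + v $ 2 *\<^sub>R axis 2 1" by (rule vec2_eqI) (simp_all add: axis_def)
    then show ?thesis by (metis linear_add[OF l] linear_scale[OF l])
  qed
  have "((\<lambda>s. b $ 1 *\<^sub>R Fj 1 (p + s *\<^sub>R b) + b $ 2 *\<^sub>R Fj 2 (p + s *\<^sub>R b)) has_vector_derivative
     (b $ 1 *\<^sub>R frechet_derivative (Fj 1) (at (p + 0 *\<^sub>R b)) b + b $ 2 *\<^sub>R frechet_derivative (Fj 2) (at (p + 0 *\<^sub>R b)) b)) (at 0)"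
    by (intro has_vector_derivative_add bounded_linear.has_vector_derivative[OF bounded_linear_scaleR_right] chain[OF Fj])
  moreover have "b $ 1 *\<^sub>R frechet_derivative (Fj 1) (at (p + 0 *\<^sub>R b)) b + b $ 2 *\<^sub>R frechet_derivative (Fj 2) (at (p + 0 *\<^sub>R b)) b = line2 F p b"
    unfolding split[OF Fj, of _ _ b] line2_def Fj_def[symmetric]
    by (simp add: sum_2 algebra_simps)
  moreover have "(\<lambda>s. b $ 1 *\<^sub>R Fj 1 (p + s *\<^sub>R b) + b $ 2 *\<^sub>R Fj 2 (p + s *\<^sub>R b)) = (\<lambda>s. frechet_derivative F (at (p + s *\<^sub>R b)) b)"
    unfolding Fj_def by (rule ext) (rule split[OF F, symmetric])
  ultimately show "((\<lambda>s. frechet_derivative F (at (p + s *\<^sub>R b)) b) has_vector_derivative line2 F p b) (at 0)"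
    by simp
qed

text \<open>Normal projection only subtracts a tangent vector. Leaving that vector unspecified is
  enough for the maximum principle, as the differential of the test function vanishes on tangent
  vectors at a maximum.\<close>

lemma mean_curvature_frame:
  fixes F :: "real^2 \<Rightarrow> 'b::euclidean_space" and p :: "real^2"
  assumes F: "immersion F"
  defines "D \<equiv> frechet_derivative F (at p)"
  obtains b1 b2 v where "D b1 \<bullet> D b1 = 1" "D b2 \<bullet> D b2 = 1" "D b1 \<bullet> D b2 = 0"
    "mean_curvature F p = line2 F p b1 + line2 F p b2 - D v"
proof -
  have l: "linear D"
    unfolding D_def using F has_derivative_linear[OF smooth_on_has_derivative[OF _ UNIV_I, of F p]] by (simp add: immersion_def)
  show ?thesis
  proof (rule orthonormal_frame[OF F, of p], fold D_def)
    fix b1 b2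
    assume o: "D b1 \<bullet> D b1 = 1" "D b2 \<bullet> D b2 = 1" "D b1 \<bullet> D b2 = 0"
      and inv: "\<And>i j. matrix_inv (induced_metric F p) $ i $ j = b1 $ i * b1 $ j + b2 $ i * b2 $ j"
      and np: "\<And>w. \<exists>v. normal_part F p w = w - D v"
    define F2 where "F2 i j = frechet_derivative (\<lambda>q. frechet_derivative F (at q) (axis j 1)) (at p) (axis i 1)" for i j :: 2
    obtain V where V: "\<And>w. normal_part F p w = w - D (V w)" using np by metis
    define m where "m i j = b1 $ i * b1 $ j + b2 $ i * b2 $ j" for i j
    have "mean_curvature F p = (\<Sum>i\<in>UNIV. \<Sum>j\<in>UNIV. m i j *\<^sub>R (F2 i j - D (V (F2 i j))))"
      unfolding mean_curvature_def second_fundamental_form_def euclidean_connection_def pushforward_def inv V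
      by (simp add: F2_def m_def)
    also have "\<dots> = line2 F p b1 + line2 F p b2 - D (\<Sum>i\<in>UNIV. \<Sum>j\<in>UNIV. m i j *\<^sub>R V (F2 i j))"
      unfolding line2_def F2_def[symmetric] linear_sum[OF l] linear_scale[OF l]
      by (simp add: sum_2 m_def algebra_simps)
    finally show ?thesis by (rule that[OF o])
  qed
qed

text \<open>This replaces the inverse function theorem with parameters: Brouwer's theorem is applied to the
  Newton map of \<open>a t\<close> with the derivative frozen at \<open>(t0, p0)\<close>.\<close>

lemma local_surjection:
  fixes a :: "real \<Rightarrow> 'a::euclidean_space \<Rightarrow> 'a"
  assumes I: "compact I" "t0 \<in> I" and c: "continuous_on (I \<times> UNIV) (\<lambda>(t, p). a t p)"
    and d: "(a t0 has_derivative A) (at p0)" and inj: "inj A" and r0: "r0 > 0"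
  obtains \<delta> where "\<delta> > 0"
    "\<And>t x. t \<in> I \<Longrightarrow> \<bar>t - t0\<bar> < \<delta> \<Longrightarrow> norm (x - a t0 p0) \<le> \<delta> \<Longrightarrow> \<exists>q\<in>cball p0 r0. a t q = x"
proof -
  have lA: "linear A" by (rule has_derivative_linear[OF d])
  obtain B where B: "linear B" "\<And>x. B (A x) = x" "\<And>x. A (B x) = x"
    using linear_injective_isomorphism[OF lA inj] by blast
  obtain c where c0: "c > 0" and cb: "\<And>v. norm (B v) \<le> c * norm v" using linear_bounded_pos[OF B(1)] by blast
  have "\<exists>d>0. \<forall>q. norm (q - p0) < d \<longrightarrow> norm (a t0 q - a t0 p0 - A (q - p0)) \<le> 1 / (4 * c) * norm (q - p0)"
    using conjunct2[OF d[unfolded has_derivative_at_alt], THEN spec, of "1 / (4 * c)"] c0 by simp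
  then obtain d where d0: "d > 0" and dd: "\<And>q. norm (q - p0) < d \<Longrightarrow> norm (a t0 q - a t0 p0 - A (q - p0)) \<le> 1 / (4 * c) * norm (q - p0)"
    by blast
  define r where "r = min r0 (d / 2)"
  have r: "r > 0" "r \<le> r0" "r < d" using r0 d0 by (auto simp: r_def)
  \<comment> \<open>The Newton map has three errors, each at most m: the change of t, the
    nonlinearity at t0 and the shift of the target. After applying B they amount to at most 3 c m =
    3 r / 4, so the ball is mapped into itself.\<close>
  define m where "m = r / (4 * c)"
  have m: "m > 0" "c * m = r / 4" using r c0 by (simp_all add: m_def)
  have near: "norm (a t0 q - a t0 p0 - A (q - p0)) \<le> m" if "q \<in> cball p0 r" for q
  proof -
    have q: "norm (q - p0) \<le> r" using that by (simp add: dist_norm norm_minus_commute)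
    have "norm (a t0 q - a t0 p0 - A (q - p0)) \<le> 1 / (4 * c) * norm (q - p0)" using dd q r(3) by simp
    also have "\<dots> \<le> 1 / (4 * c) * r" using q c0 by (intro mult_left_mono) auto
    finally show ?thesis by (simp add: m_def)
  qed
  have "uniformly_continuous_on (I \<times> cball p0 r) (\<lambda>(t, p). a t p)"
    by (rule compact_uniformly_continuous[OF continuous_on_subset[OF c]]) (auto intro!: compact_Times I)
  then obtain e where e: "e > 0" and ee: "\<And>z z'. z \<in> I \<times> cball p0 r \<Longrightarrow> z' \<in> I \<times> cball p0 r \<Longrightarrow> dist z' z < e \<Longrightarrow>
      dist (case z' of (t, p) \<Rightarrow> a t p) (case z of (t, p) \<Rightarrow> a t p) < m"
    using m(1) unfolding uniformly_continuous_on_def by blast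
  show ?thesis
  proof (rule that[of "min e m"])
    show "min e m > 0" using e m by simp
    fix t x assume t: "t \<in> I" "\<bar>t - t0\<bar> < min e m" and x: "norm (x - a t0 p0) \<le> min e m"
    define \<phi> where "\<phi> q = q - B (a t q - x)" for q
    have "continuous_on (cball p0 r) (\<lambda>q. a t q)"
      using continuous_on_compose2[OF c, of "cball p0 r" "\<lambda>q. (t, q)"] t(1) by (force intro!: continuous_intros)
    then have "continuous_on (cball p0 r) \<phi>"
      unfolding \<phi>_def by (intro continuous_intros linear_continuous_on_compose[OF _ B(1)])
    moreover have "\<phi> q \<in> cball p0 r" if q: "q \<in> cball p0 r" for q
    proof -
      have "dist (a t q) (a t0 q) < m" using ee[of "(t0, q)" "(t, q)"] t I(2) q by (simp add: dist_Pair_Pair dist_real_def)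
      then have 1: "norm (a t q - a t0 q) \<le> m" by (simp add: dist_norm)
      have eq: "\<phi> q - p0 = - B ((a t q - a t0 q) + (a t0 q - a t0 p0 - A (q - p0)) - (x - a t0 p0))"
        unfolding \<phi>_def using B(2)[of "q - p0"] by (simp add: linear_diff[OF B(1)] linear_add[OF B(1)])
      have "norm ((a t q - a t0 q) + (a t0 q - a t0 p0 - A (q - p0)) - (x - a t0 p0)) \<le> m + m + m"
        using 1 near[OF q] x norm_triangle_ineq[of "a t q - a t0 q" "a t0 q - a t0 p0 - A (q - p0)"]
          norm_triangle_ineq4[of "(a t q - a t0 q) + (a t0 q - a t0 p0 - A (q - p0))" "x - a t0 p0"] by linarith
      then have "norm (\<phi> q - p0) \<le> c * (m + m + m)"
        unfolding eq norm_minus_cancel by (rule order_trans[OF cb mult_left_mono]) (use c0 in simp)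
      also have "\<dots> \<le> r" using m r by (simp add: algebra_simps)
      finally show ?thesis by (simp add: dist_norm norm_minus_commute)
    qed
    ultimately obtain q where q: "q \<in> cball p0 r" "\<phi> q = q" using brouwer_ball[OF r(1), of p0 \<phi>] by blast
    then have "A (B (a t q - x)) = A 0" by (simp add: \<phi>_def)
    then have "a t q = x" by (simp add: B(3) linear_0[OF lA])
    moreover have "q \<in> cball p0 r0" using q(1) r(2) by simp
    ultimately show "\<exists>q\<in>cball p0 r0. a t q = x" by blast
  qed
qed

section \<open>Entire graphs and the vertical distance to the comparison graph\<close>

lemma entire_graph_rangeD:
  assumes "range F = entire_graph h"
  shows "F p = (fst (F p), h (fst (F p)))" "\<exists>p. F p = (x, h x)"
proof -
  have "F p \<in> entire_graph h" unfolding assms[symmetric] by (rule rangeI)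
  then obtain q where "F p = (q, h q)" unfolding entire_graph_def by blast
  then show "F p = (fst (F p), h (fst (F p)))" by simp
  have "(x, h x) \<in> range F" unfolding assms entire_graph_def by blast
  then obtain q where "(x, h x) = F q" by (rule rangeE)
  then show "\<exists>p. F p = (x, h x)" by (intro exI[of _ q]) (rule sym)
qed

text \<open>On the surface the second component is \<open>h\<close> of the first, so its
  differential is determined by that of the first component; two tangent vectors with equal
  horizontal part therefore coincide.\<close>

lemma graph_fst_derivative_inj:
  fixes F :: "real^2 \<Rightarrow> (real^2) \<times> (real^2)"
  assumes F: "immersion F" and h: "smooth_on UNIV h" and r: "range F = entire_graph h"
  shows "inj (\<lambda>v. fst (frechet_derivative F (at p) v))"
proof -
  have dF: "(F has_derivative frechet_derivative F (at p)) (at p)"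
    using F smooth_on_has_derivative[OF _ UNIV_I, of F p] by (simp add: immersion_def)
  define D where "D = frechet_derivative F (at p)"
  have dF: "(F has_derivative D) (at p)" using dF by (simp add: D_def)
  have iD: "inj D" using F unfolding immersion_def D_def by blast
  have dh: "(h has_derivative frechet_derivative h (at (fst (F p)))) (at (fst (F p)))"
    by (rule smooth_on_has_derivative[OF h UNIV_I])
  have "((\<lambda>q. snd (F q)) has_derivative (\<lambda>v. frechet_derivative h (at (fst (F p))) (fst (D v)))) (at p)"
  proof -
    have "snd (F q) = h (fst (F q))" for q using arg_cong[OF entire_graph_rangeD(1)[OF r, of q], of snd] by simp
    then show ?thesis using has_derivative_compose[OF has_derivative_fst[OF dF] dh] by simp
  qed
  then have sn: "(\<lambda>v. snd (D v)) = (\<lambda>v. frechet_derivative h (at (fst (F p))) (fst (D v)))"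
    by (rule has_derivative_unique[OF has_derivative_snd[OF dF]])
  have "v = w" if "fst (D v) = fst (D w)" for v w
  proof -
    have "snd (D v) = snd (D w)" using fun_cong[OF sn, of v] fun_cong[OF sn, of w] that by simp
    then have "D v = D w" using that by (rule prod_eqI[rotated])
    then show ?thesis by (rule injD[OF iD])
  qed
  then show ?thesis unfolding D_def[symmetric] by (rule injI)
qed

text \<open>The vertical distance \<open>wf\<close> to the comparison graph, its differential \<open>Pf\<close>, and the Hessian \<open>Bf\<close> of the
  comparison graph.\<close>

definition wf :: "(real \<times> real \<Rightarrow> real) \<Rightarrow> real \<Rightarrow> (real^2) \<times> (real^2) \<Rightarrow> real^2" where
  "wf u t X = snd X - u (t, fst X $ 1) *\<^sub>R ee (fst X $ 2)"
definition Pf :: "(real \<times> real \<Rightarrow> real) \<Rightarrow> real \<Rightarrow> (real^2) \<times> (real^2) \<Rightarrow> (real^2) \<times> (real^2) \<Rightarrow> real^2" where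
  "Pf u t X v = snd v - ((px u (t, fst X $ 1) * fst v $ 1) *\<^sub>R ee (fst X $ 2) + (u (t, fst X $ 1) * fst v $ 2) *\<^sub>R nn (fst X $ 2))"
definition Bf :: "(real \<times> real \<Rightarrow> real) \<Rightarrow> real \<Rightarrow> (real^2) \<times> (real^2) \<Rightarrow> (real^2) \<times> (real^2) \<Rightarrow> real^2" where
  "Bf u t X v = (px (px u) (t, fst X $ 1) * (fst v $ 1)\<^sup>2) *\<^sub>R ee (fst X $ 2) +
     (2 * px u (t, fst X $ 1) * (fst v $ 1 * fst v $ 2)) *\<^sub>R nn (fst X $ 2) - (u (t, fst X $ 1) * (fst v $ 2)\<^sup>2) *\<^sub>R ee (fst X $ 2)"

lemma has_vector_derivative_ee:
  assumes "(\<theta> has_real_derivative \<theta>') (at s within S)"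
  shows "((\<lambda>s. ee (\<theta> s)) has_vector_derivative \<theta>' *\<^sub>R nn (\<theta> s)) (at s within S)"
    and "((\<lambda>s. nn (\<theta> s)) has_vector_derivative - (\<theta>' *\<^sub>R ee (\<theta> s))) (at s within S)"
proof -
  have c: "((\<lambda>s. cos (\<theta> s)) has_real_derivative - (sin (\<theta> s) * \<theta>')) (at s within S)"
    and n: "((\<lambda>s. sin (\<theta> s)) has_real_derivative cos (\<theta> s) * \<theta>') (at s within S)"
    and m: "((\<lambda>s. - sin (\<theta> s)) has_real_derivative - (cos (\<theta> s) * \<theta>')) (at s within S)"
    using assms by (auto intro!: derivative_eq_intros)
  have g: "((\<lambda>s. v2 (f s) (g s)) has_vector_derivative v2 f' g') (at s within S)"
    if "(f has_real_derivative f') (at s within S)" "(g has_real_derivative g') (at s within S)" for f g f' g'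
  proof -
    have "((\<lambda>s. f s *\<^sub>R axis 1 1 + g s *\<^sub>R axis 2 1) has_vector_derivative
        (f s *\<^sub>R 0 + f' *\<^sub>R axis 1 1) + (g s *\<^sub>R 0 + g' *\<^sub>R axis 2 1 :: real^2)) (at s within S)"
      by (intro has_vector_derivative_add has_vector_derivative_scaleR has_vector_derivative_const that)
    then show ?thesis by (simp add: v2_def)
  qed
  show "((\<lambda>s. ee (\<theta> s)) has_vector_derivative \<theta>' *\<^sub>R nn (\<theta> s)) (at s within S)"
    using g[OF c n] unfolding ee_def nn_def by (simp add: v2_simps mult.commute)
  show "((\<lambda>s. nn (\<theta> s)) has_vector_derivative - (\<theta>' *\<^sub>R ee (\<theta> s))) (at s within S)"
    using g[OF m c] unfolding ee_def nn_def by (simp add: v2_simps mult.commute)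
qed

lemma has_vector_derivative_fst_nth:
  fixes X :: "real \<Rightarrow> (real^2) \<times> (real^2)"
  assumes "(X has_vector_derivative X') (at s within S)"
  shows "((\<lambda>s. fst (X s) $ i) has_real_derivative fst X' $ i) (at s within S)"
    and "((\<lambda>s. snd (X s)) has_vector_derivative snd X') (at s within S)"
proof -
  have b: "bounded_linear (\<lambda>z::(real^2) \<times> (real^2). fst z $ i)"
    by (rule bounded_linear_compose[OF bounded_linear_vec_nth bounded_linear_fst])
  show "((\<lambda>s. fst (X s) $ i) has_real_derivative fst X' $ i) (at s within S)"
    using bounded_linear.has_vector_derivative[OF b assms] by (simp add: has_real_derivative_iff_has_vector_derivative)
  show "((\<lambda>s. snd (X s)) has_vector_derivative snd X') (at s within S)"
    by (rule bounded_linear.has_vector_derivative[OF bounded_linear_snd assms])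
qed

lemma along_curve:
  assumes f: "smooth_on ST f" and c: "(c has_real_derivative c') (at s within S)" "\<And>s. s \<in> S \<Longrightarrow> c s \<ge> 0"
    and x: "(x has_real_derivative x') (at s within S)" and s: "s \<in> S"
  shows "((\<lambda>s. f (c s, x s)) has_real_derivative c' * pt f (c s, x s) + x' * px f (c s, x s)) (at s within S)"
proof -
  have 1: "((\<lambda>s. (c s, x s)) has_derivative (\<lambda>h. (c' * h, x' * h))) (at s within S)"
    using c(1) x unfolding has_field_derivative_def by (rule has_derivative_Pair)
  have "(\<lambda>s. (c s, x s)) ` S \<subseteq> ST" using c(2) by (auto simp: ST_def)
  from has_derivative_in_compose2[OF partials_has_derivative[OF f] this s 1]
  show ?thesis unfolding has_field_derivative_def
    by (rule has_derivative_eq_rhs) ((rule ext)?, simp add: algebra_simps)+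
qed

lemma wf_derivative:
  assumes u: "smooth_on ST u" and c: "(c has_real_derivative c') (at s within S)" "\<And>s. s \<in> S \<Longrightarrow> c s \<ge> 0"
    and X: "(X has_vector_derivative X') (at s within S)" and s: "s \<in> S"
  shows "((\<lambda>s. wf u (c s) (X s)) has_vector_derivative
    Pf u (c s) (X s) X' - (c' * pt u (c s, fst (X s) $ 1)) *\<^sub>R ee (fst (X s) $ 2)) (at s within S)"
proof -
  have "((\<lambda>s. snd (X s) - u (c s, fst (X s) $ 1) *\<^sub>R ee (fst (X s) $ 2)) has_vector_derivative
      snd X' - (u (c s, fst (X s) $ 1) *\<^sub>R (fst X' $ 2 *\<^sub>R nn (fst (X s) $ 2)) +
        (c' * pt u (c s, fst (X s) $ 1) + fst X' $ 1 * px u (c s, fst (X s) $ 1)) *\<^sub>R ee (fst (X s) $ 2))) (at s within S)"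
    by (rule has_vector_derivative_diff[OF has_vector_derivative_fst_nth(2)[OF X]
        has_vector_derivative_scaleR[OF along_curve[OF u c has_vector_derivative_fst_nth(1)[OF X] s]
          has_vector_derivative_ee(1)[OF has_vector_derivative_fst_nth(1)[OF X]]]])
  then show ?thesis by (simp add: wf_def Pf_def algebra_simps)
qed

lemma Pf_derivative:
  assumes u: "smooth_on ST u" and t: "t \<ge> 0"
    and X: "(X has_vector_derivative X' s) (at s)" and X': "(X' has_vector_derivative X2) (at s)"
  shows "((\<lambda>s. Pf u t (X s) (X' s)) has_vector_derivative Pf u t (X s) X2 - Bf u t (X s) (X' s)) (at s)"
proof -
  note x1 = has_vector_derivative_fst_nth(1)[OF X] and x2 = has_vector_derivative_fst_nth(1)[OF X']
  have f: "((\<lambda>s. f (t, fst (X s) $ 1)) has_real_derivative 0 * pt f (t, fst (X s) $ 1) + fst (X' s) $ 1 * px f (t, fst (X s) $ 1)) (at s)"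
    if "smooth_on ST f" for f
    by (rule along_curve[OF that DERIV_const t x1 UNIV_I])
  have "((\<lambda>s. snd (X' s) - ((px u (t, fst (X s) $ 1) * fst (X' s) $ 1) *\<^sub>R ee (fst (X s) $ 2) +
        (u (t, fst (X s) $ 1) * fst (X' s) $ 2) *\<^sub>R nn (fst (X s) $ 2))) has_vector_derivative
      snd X2 - (((px u (t, fst (X s) $ 1) * fst (X' s) $ 1) *\<^sub>R (fst (X' s) $ 2 *\<^sub>R nn (fst (X s) $ 2)) +
        ((0 * pt (px u) (t, fst (X s) $ 1) + fst (X' s) $ 1 * px (px u) (t, fst (X s) $ 1)) * fst (X' s) $ 1 +
          fst X2 $ 1 * px u (t, fst (X s) $ 1)) *\<^sub>R ee (fst (X s) $ 2)) +
        ((u (t, fst (X s) $ 1) * fst (X' s) $ 2) *\<^sub>R (- (fst (X' s) $ 2 *\<^sub>R ee (fst (X s) $ 2))) +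
        ((0 * pt u (t, fst (X s) $ 1) + fst (X' s) $ 1 * px u (t, fst (X s) $ 1)) * fst (X' s) $ 2 +
          fst X2 $ 2 * u (t, fst (X s) $ 1)) *\<^sub>R nn (fst (X s) $ 2)))) (at s)"
    by (rule has_vector_derivative_diff[OF has_vector_derivative_fst_nth(2)[OF X'] has_vector_derivative_add[OF
          has_vector_derivative_scaleR[OF DERIV_mult[OF f[OF smooth_on_px[OF u]] x2] has_vector_derivative_ee(1)[OF x1]]
          has_vector_derivative_scaleR[OF DERIV_mult[OF f[OF u] x2] has_vector_derivative_ee(2)[OF x1]]]])
  then show ?thesis unfolding Pf_def by (rule has_vector_derivative_eq_rhs) (rule vec2_eqI; simp add: Bf_def algebra_simps power2_eq_square)
qed

lemma has_real_derivative_inner: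
  fixes f g :: "real \<Rightarrow> 'b::real_inner"
  assumes "(f has_vector_derivative f') (at s within S)" "(g has_vector_derivative g') (at s within S)"
  shows "((\<lambda>s. f s \<bullet> g s) has_real_derivative f s \<bullet> g' + f' \<bullet> g s) (at s within S)"
  using has_derivative_inner[OF assms[unfolded has_vector_derivative_def]]
  unfolding has_field_derivative_def by (rule has_derivative_eq_rhs) (simp add: fun_eq_iff algebra_simps)

lemma has_real_derivative_length:
  fixes w :: "real \<Rightarrow> 'b::real_inner"
  assumes "(w has_vector_derivative w') (at s within S)"
  shows "((\<lambda>s. sqrt (1 + w s \<bullet> w s)) has_real_derivative (w s \<bullet> w') / sqrt (1 + w s \<bullet> w s)) (at s within S)"
proof -
  have p: "1 + w s \<bullet> w s > 0" by (simp add: add_pos_nonneg)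
  have "((\<lambda>s. 1 + w s \<bullet> w s) has_real_derivative 0 + (w s \<bullet> w' + w' \<bullet> w s)) (at s within S)"
    by (rule DERIV_add[OF DERIV_const has_real_derivative_inner[OF assms assms]])
  from DERIV_chain2[where f=sqrt and g="\<lambda>s. 1 + w s \<bullet> w s" and x=s, OF DERIV_real_sqrt[OF p] this] show ?thesis
  proof (rule DERIV_cong)
    have "w' \<bullet> w s = w s \<bullet> w'" by (rule inner_commute)
    then show "inverse (sqrt (1 + w s \<bullet> w s)) / 2 * (0 + (w s \<bullet> w' + w' \<bullet> w s)) = (w s \<bullet> w') / sqrt (1 + w s \<bullet> w s)"
      by (simp only: divide_inverse) simp
  qed
qed

text \<open>The second term forces a maximum on the noncompact surface and makes the inequality at the maximum
  strict: along the flow \<open>1 + \<bar>X\<bar>\<^sup>2 + 4 t\<close> would solve the heat equation.\<close>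

definition barrier :: "(real \<times> real \<Rightarrow> real) \<Rightarrow> real \<Rightarrow> real \<Rightarrow> real \<Rightarrow> (real^2) \<times> (real^2) \<Rightarrow> real" where
  "barrier u \<kappa> \<epsilon> t X = exp (- (\<kappa> * t)) * (sqrt (1 + wf u t X \<bullet> wf u t X) - 1) - \<epsilon> * (1 + X \<bullet> X + 5 * t)"

lemma barrier_derivative:
  assumes u: "smooth_on ST u" and c: "(c has_real_derivative c') (at s within S)" "\<And>s. s \<in> S \<Longrightarrow> c s \<ge> 0"
    and X: "(X has_vector_derivative X') (at s within S)" and s: "s \<in> S"
  defines "w \<equiv> wf u (c s) (X s)"
  shows "((\<lambda>s. barrier u \<kappa> \<epsilon> (c s) (X s)) has_real_derivative
    - (\<kappa> * c') * exp (- (\<kappa> * c s)) * (sqrt (1 + w \<bullet> w) - 1) +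
    exp (- (\<kappa> * c s)) * ((w \<bullet> (Pf u (c s) (X s) X' - (c' * pt u (c s, fst (X s) $ 1)) *\<^sub>R ee (fst (X s) $ 2))) / sqrt (1 + w \<bullet> w))
    - \<epsilon> * (2 * (X s \<bullet> X') + 5 * c')) (at s within S)"
proof -
  note l = has_real_derivative_length[OF wf_derivative[OF u c X s]]
  have e: "((\<lambda>s. exp (- (\<kappa> * c s))) has_real_derivative exp (- (\<kappa> * c s)) * - (\<kappa> * c')) (at s within S)"
    by (auto intro!: derivative_eq_intros c(1))
  have n: "((\<lambda>s. \<epsilon> * (1 + X s \<bullet> X s + 5 * c s)) has_real_derivative \<epsilon> * (0 + (X s \<bullet> X' + X' \<bullet> X s) + 5 * c')) (at s within S)"
    by (rule DERIV_cmult[OF DERIV_add[OF DERIV_add[OF DERIV_const has_real_derivative_inner[OF X X]] DERIV_cmult[OF c(1)]]])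
  have "((\<lambda>s. exp (- (\<kappa> * c s)) * (sqrt (1 + wf u (c s) (X s) \<bullet> wf u (c s) (X s)) - 1) - \<epsilon> * (1 + X s \<bullet> X s + 5 * c s)) has_real_derivative
      (exp (- (\<kappa> * c s)) * - (\<kappa> * c') * (sqrt (1 + w \<bullet> w) - 1) +
       ((w \<bullet> (Pf u (c s) (X s) X' - (c' * pt u (c s, fst (X s) $ 1)) *\<^sub>R ee (fst (X s) $ 2))) / sqrt (1 + w \<bullet> w) - 0) * exp (- (\<kappa> * c s))) -
      \<epsilon> * (0 + (X s \<bullet> X' + X' \<bullet> X s) + 5 * c')) (at s within S)"
    unfolding w_def by (rule DERIV_diff[OF DERIV_mult[OF e DERIV_diff[OF l DERIV_const]] n])
  then show ?thesis unfolding barrier_def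
    by (rule DERIV_cong) (simp add: inner_commute[of X'] algebra_simps)
qed

text \<open>First and second order conditions at a maximum along a curve. Besides the Hessian of
  sqrt (1 + |w|^2), the Hessian \<open>B\<close> of the comparison graph and the quadratic term of
  the barrier, the acceleration \<open>X2\<close> enters through the same linear form as the
  velocity in the first condition.\<close>

lemma barrier_second_derivative:
  assumes u: "smooth_on ST u" and t: "t \<ge> 0"
    and X: "\<And>s. (X has_vector_derivative X' s) (at s)" and X': "(X' has_vector_derivative X2) (at 0)"
    and m: "\<And>s. barrier u \<kappa> \<epsilon> t (X s) \<le> barrier u \<kappa> \<epsilon> t (X 0)"
  defines "w \<equiv> wf u t (X 0)" and "P \<equiv> Pf u t (X 0)" and "B \<equiv> Bf u t (X 0)"
  defines "\<psi> \<equiv> sqrt (1 + w \<bullet> w)" and "E \<equiv> exp (- (\<kappa> * t))"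
  shows "E * ((w \<bullet> P (X' 0)) / \<psi>) - \<epsilon> * (2 * (X 0 \<bullet> X' 0)) = 0"
    and "E * ((w \<bullet> P X2) / \<psi>) - \<epsilon> * (2 * (X 0 \<bullet> X2)) + E * ((P (X' 0) \<bullet> P (X' 0)) / \<psi> - (w \<bullet> P (X' 0))\<^sup>2 / \<psi> ^ 3)
      - E * ((w \<bullet> B (X' 0)) / \<psi>) - 2 * \<epsilon> * (X' 0 \<bullet> X' 0) \<le> 0"
proof -
  define f' where "f' s = E * ((wf u t (X s) \<bullet> Pf u t (X s) (X' s)) / sqrt (1 + wf u t (X s) \<bullet> wf u t (X s))) - \<epsilon> * (2 * (X s \<bullet> X' s))" for s
  have d: "((\<lambda>s. barrier u \<kappa> \<epsilon> t (X s)) has_real_derivative f' s) (at s)" for s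
    using barrier_derivative[OF u DERIV_const t X UNIV_I, of \<kappa> \<epsilon> s] by (simp add: f'_def E_def)
  have \<psi>: "\<psi> > 0" by (simp add: \<psi>_def add_pos_nonneg)
  have w: "((\<lambda>s. wf u t (X s)) has_vector_derivative P (X' 0)) (at 0)"
    using wf_derivative[OF u DERIV_const t X UNIV_I, of 0] by (simp add: P_def)
  have l: "((\<lambda>s. sqrt (1 + wf u t (X s) \<bullet> wf u t (X s))) has_real_derivative (w \<bullet> P (X' 0)) / \<psi>) (at 0)"
    unfolding \<psi>_def w_def by (rule has_real_derivative_length[OF w])
  have p: "((\<lambda>s. Pf u t (X s) (X' s)) has_vector_derivative P X2 - B (X' 0)) (at 0)"
    unfolding P_def B_def by (rule Pf_derivative[OF u t X X'])
  have "(f' has_real_derivative E * (((w \<bullet> (P X2 - B (X' 0)) + P (X' 0) \<bullet> P (X' 0)) * \<psi> - (w \<bullet> P (X' 0)) * ((w \<bullet> P (X' 0)) / \<psi>)) / (\<psi> * \<psi>))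
      - \<epsilon> * (2 * (X 0 \<bullet> X2 + X' 0 \<bullet> X' 0))) (at 0)"
  proof -
    have n0: "sqrt (1 + wf u t (X 0) \<bullet> wf u t (X 0)) \<noteq> 0" using \<psi> unfolding \<psi>_def w_def by simp
    show ?thesis
      unfolding f'_def[abs_def] \<psi>_def w_def P_def
      by (rule DERIV_diff[OF DERIV_cmult[OF DERIV_divide[OF has_real_derivative_inner[OF w p] l n0, unfolded \<psi>_def w_def P_def]]
          DERIV_cmult[OF DERIV_cmult[OF has_real_derivative_inner[OF X X']]]])
  qed
  note c = local_max_second_derivative[OF d this m]
  show "E * ((w \<bullet> P (X' 0)) / \<psi>) - \<epsilon> * (2 * (X 0 \<bullet> X' 0)) = 0"
    using c(1) unfolding f'_def w_def \<psi>_def P_def .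
  have "((w \<bullet> (P X2 - B (X' 0)) + P (X' 0) \<bullet> P (X' 0)) * \<psi> - (w \<bullet> P (X' 0)) * ((w \<bullet> P (X' 0)) / \<psi>)) / (\<psi> * \<psi>) =
      (w \<bullet> P X2) / \<psi> + ((P (X' 0) \<bullet> P (X' 0)) / \<psi> - (w \<bullet> P (X' 0))\<^sup>2 / \<psi> ^ 3) - (w \<bullet> B (X' 0)) / \<psi>"
    using \<psi> by (simp add: inner_diff_right diff_divide_distrib add_divide_distrib power2_eq_square power3_eq_cube distrib_right left_diff_distrib)
  with c(2) show "E * ((w \<bullet> P X2) / \<psi>) - \<epsilon> * (2 * (X 0 \<bullet> X2)) + E * ((P (X' 0) \<bullet> P (X' 0)) / \<psi> - (w \<bullet> P (X' 0))\<^sup>2 / \<psi> ^ 3)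
      - E * ((w \<bullet> B (X' 0)) / \<psi>) - 2 * \<epsilon> * (X' 0 \<bullet> X' 0) \<le> 0"
    by (simp only:) (simp add: algebra_simps)
qed

lemma Pf_linear: "Pf u t X (v + w) = Pf u t X v + Pf u t X w" "Pf u t X (v - w) = Pf u t X v - Pf u t X w"
  by (simp_all add: Pf_def algebra_simps)

text \<open>The second order conditions are summed over an orthonormal frame and combined with the
  sign of the time derivative. \<open>trace_comparison\<close> and the choice of \<kappa> cancel
  everything except the contributions of the quadratic barrier, which leave \<epsilon> \<le>
  0.\<close>

lemma no_positive_maximum:
  fixes u :: "real \<times> real \<Rightarrow> real" and G :: "real \<Rightarrow> real^2 \<Rightarrow> (real^2) \<times> (real^2)"
  assumes u: "smooth_on ST u"
    and pde: "\<And>t x. t \<ge> 0 \<Longrightarrow> pt u (t, x) = px (px u) (t, x) / (1 + (px u (t, x))\<^sup>2) - u (t, x) / (1 + (u (t, x))\<^sup>2)"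
    and bd: "\<And>z. z \<in> ST \<Longrightarrow> \<bar>u z\<bar> \<le> 1/2" "\<And>z. z \<in> ST \<Longrightarrow> \<bar>px u z\<bar> \<le> 1/2" "\<And>z. z \<in> ST \<Longrightarrow> \<bar>px (px u) z\<bar> \<le> K"
    and t0: "0 < t0" "t0 < T" and im: "immersion (G t0)"
    and flow: "((\<lambda>s. G s p0) has_vector_derivative mean_curvature (G t0) p0) (at t0 within {0..<T})"
    and \<epsilon>: "\<epsilon> > 0" and \<kappa>: "\<kappa> = 384 * (K + 2)\<^sup>2"
    and mx: "\<And>t p. 0 \<le> t \<Longrightarrow> t \<le> t0 \<Longrightarrow> barrier u \<kappa> \<epsilon> t (G t p) \<le> barrier u \<kappa> \<epsilon> t0 (G t0 p0)"
  shows False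
proof -
  define X0 where "X0 = G t0 p0"
  define w where "w = wf u t0 X0"
  define P where "P = Pf u t0 X0"
  define B where "B = Bf u t0 X0"
  define \<psi> where "\<psi> = sqrt (1 + w \<bullet> w)"
  define E where "E = exp (- (\<kappa> * t0))"
  \<comment> \<open>The differential of the barrier in the ambient position at the maximum. It
    vanishes on tangent vectors, so the unspecified tangent vector in
    \<open>mean_curvature_frame\<close> drops out.\<close>
  define lf where "lf v = E * ((w \<bullet> P v) / \<psi>) - \<epsilon> * (2 * (X0 \<bullet> v))" for v
  define ut where "ut = pt u (t0, fst X0 $ 1)"
  define \<theta> where "\<theta> = fst X0 $ 2"
  define H where "H = mean_curvature (G t0) p0"
  have lf_add: "lf (v + w) = lf v + lf w" "lf (v - w) = lf v - lf w" for v w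
    by (simp_all add: lf_def P_def Pf_linear inner_add_right inner_diff_right add_divide_distrib diff_divide_distrib algebra_simps)
  have E: "E > 0" by (simp add: E_def)
  have s: "smooth_on UNIV (G t0)" using im by (simp add: immersion_def)
  have sec: "lf (D b) = 0"
    "lf (line2 (G t0) p0 b) + E * ((P (D b) \<bullet> P (D b)) / \<psi> - (w \<bullet> P (D b))\<^sup>2 / \<psi> ^ 3)
      - E * ((w \<bullet> B (D b)) / \<psi>) - 2 * \<epsilon> * (D b \<bullet> D b) \<le> 0" if D: "D = frechet_derivative (G t0) (at p0)" for b D
  proof -
    have "barrier u \<kappa> \<epsilon> t0 (G t0 (p0 + s *\<^sub>R b)) \<le> barrier u \<kappa> \<epsilon> t0 (G t0 (p0 + 0 *\<^sub>R b))" for s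
      using mx[of t0 "p0 + s *\<^sub>R b"] t0 by simp
    note * = barrier_second_derivative[where X="\<lambda>s. G t0 (p0 + s *\<^sub>R b)", OF u less_imp_le[OF t0(1)] line_derivatives[OF s] this]
    show "lf (D b) = 0" using *(1) by (simp add: lf_def E_def \<psi>_def w_def P_def X0_def D)
    show "lf (line2 (G t0) p0 b) + E * ((P (D b) \<bullet> P (D b)) / \<psi> - (w \<bullet> P (D b))\<^sup>2 / \<psi> ^ 3)
      - E * ((w \<bullet> B (D b)) / \<psi>) - 2 * \<epsilon> * (D b \<bullet> D b) \<le> 0"
      using *(2) by (simp add: lf_def E_def \<psi>_def w_def P_def B_def X0_def D)
  qed
  have int: "at t0 within {0..<T} = at t0"
    by (rule at_within_interior) (use t0 in \<open>simp add: interior_atLeastLessThan\<close>)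
  have "((\<lambda>t. barrier u \<kappa> \<epsilon> t (G t p0)) has_real_derivative
      - (\<kappa> * 1) * E * (\<psi> - 1) + E * ((w \<bullet> (P H - (1 * ut) *\<^sub>R ee \<theta>)) / \<psi>) - \<epsilon> * (2 * (X0 \<bullet> H) + 5 * 1)) (at t0 within {0..<T})"
    unfolding E_def \<psi>_def w_def P_def ut_def \<theta>_def H_def X0_def
    by (rule barrier_derivative[OF u DERIV_ident _ flow]) (use t0 in auto)
  then have td: "((\<lambda>t. barrier u \<kappa> \<epsilon> t (G t p0)) has_real_derivative
      - \<kappa> * E * (\<psi> - 1) + E * ((w \<bullet> (P H - ut *\<^sub>R ee \<theta>)) / \<psi>) - \<epsilon> * (2 * (X0 \<bullet> H) + 5)) (at t0)"
    unfolding int by simp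
  \<comment> \<open>Only earlier times are compared, so the time derivative at the maximum is
    nonnegative but need not vanish.\<close>
  have tpos: "- \<kappa> * E * (\<psi> - 1) + E * ((w \<bullet> (P H - ut *\<^sub>R ee \<theta>)) / \<psi>) - \<epsilon> * (2 * (X0 \<bullet> H) + 5) \<ge> 0"
  proof (rule ccontr)
    assume "\<not> ?thesis"
    then obtain d where d: "d > 0" "\<And>h. h > 0 \<Longrightarrow> h < d \<Longrightarrow> barrier u \<kappa> \<epsilon> t0 (G t0 p0) < barrier u \<kappa> \<epsilon> (t0 - h) (G (t0 - h) p0)"
      using DERIV_neg_dec_left[OF td] by force
    define h where "h = min (d / 2) t0"
    have "h > 0" "h < d" "h \<le> t0" using d(1) t0 by (auto simp: h_def)
    then show False using d(2)[of h] mx[of "t0 - h" p0] by simp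
  qed
  have "E * ((w \<bullet> (P H - ut *\<^sub>R ee \<theta>)) / \<psi>) = E * ((w \<bullet> P H) / \<psi>) - E * (ut * (w \<bullet> ee \<theta>) / \<psi>)"
    by (simp add: inner_diff_right diff_divide_distrib right_diff_distrib)
  then have time: "lf H - \<kappa> * (E * (\<psi> - 1)) - E * (ut * (w \<bullet> ee \<theta>) / \<psi>) - 5 * \<epsilon> \<ge> 0"
    using tpos by (simp add: lf_def algebra_simps)
  show False
  proof (rule mean_curvature_frame[OF im, of p0])
    fix b1 b2 v
    define D where "D = frechet_derivative (G t0) (at p0)"
    assume o: "frechet_derivative (G t0) (at p0) b1 \<bullet> frechet_derivative (G t0) (at p0) b1 = 1"
      "frechet_derivative (G t0) (at p0) b2 \<bullet> frechet_derivative (G t0) (at p0) b2 = 1"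
      "frechet_derivative (G t0) (at p0) b1 \<bullet> frechet_derivative (G t0) (at p0) b2 = 0"
      and mc: "mean_curvature (G t0) p0 = line2 (G t0) p0 b1 + line2 (G t0) p0 b2 - frechet_derivative (G t0) (at p0) v"
    note o = o[folded D_def]
    have lfH: "lf H = lf (line2 (G t0) p0 b1) + lf (line2 (G t0) p0 b2)"
      unfolding H_def mc lf_add sec(1)[OF refl] by simp
    have z: "(t0, fst X0 $ 1) \<in> ST" using t0 by (simp add: ST_def)
    have tr: "w \<bullet> (B (D b1) + B (D b2) - ut *\<^sub>R ee \<theta>) / \<psi> \<le> 384 * (K + 2)\<^sup>2 * (\<psi> - 1) +
      ((P (D b1) \<bullet> P (D b1)) / \<psi> - (w \<bullet> P (D b1))\<^sup>2 / \<psi> ^ 3) + ((P (D b2) \<bullet> P (D b2)) / \<psi> - (w \<bullet> P (D b2))\<^sup>2 / \<psi> ^ 3)"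
      unfolding P_def B_def Pf_def Bf_def \<psi>_def ut_def \<theta>_def
      by (rule trace_comparison[OF o bd(1)[OF z] bd(2)[OF z] bd(3)[OF z] pde[OF less_imp_le[OF t0(1)]]])
    have sp: "w \<bullet> (B (D b1) + B (D b2) - ut *\<^sub>R ee \<theta>) / \<psi> = (w \<bullet> B (D b1)) / \<psi> + (w \<bullet> B (D b2)) / \<psi> - ut * (w \<bullet> ee \<theta>) / \<psi>"
      by (simp add: inner_diff_right inner_add_right add_divide_distrib diff_divide_distrib)
    from mult_left_mono[OF tr[unfolded sp, folded \<kappa>] less_imp_le[OF E]]
    have "E * ((w \<bullet> B (D b1)) / \<psi>) + E * ((w \<bullet> B (D b2)) / \<psi>) - E * (ut * (w \<bullet> ee \<theta>) / \<psi>) \<le> \<kappa> * (E * (\<psi> - 1)) +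
      E * ((P (D b1) \<bullet> P (D b1)) / \<psi> - (w \<bullet> P (D b1))\<^sup>2 / \<psi> ^ 3) + E * ((P (D b2) \<bullet> P (D b2)) / \<psi> - (w \<bullet> P (D b2))\<^sup>2 / \<psi> ^ 3)"
      by (simp only: distrib_left right_diff_distrib mult.left_commute mult.assoc)
    \<comment> \<open>The frame contributes 2 \<epsilon> for each of its two unit vectors and the
      time derivative 5 \<epsilon>; the excess \<epsilon> gives the contradiction.\<close>
    then show False using time sec(2)[OF D_def, of b1, unfolded o(1)] sec(2)[OF D_def, of b2, unfolded o(2)] lfH \<epsilon> by linarith
  qed
qed

text \<open>Smoothness of each \<open>h t\<close> says nothing about its dependence on t. By
  \<open>local_surjection\<close> every (t, x) near (t0, x0) is the base point of
  \<open>G t q\<close> with q near p0, so continuity of G transfers to the graph functions.\<close>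

lemma graph_function_continuous:
  fixes G :: "real \<Rightarrow> real^2 \<Rightarrow> (real^2) \<times> (real^2)"
  assumes c: "continuous_on ({0..t1} \<times> UNIV) (\<lambda>(t, p). G t p)"
    and im: "\<And>t. t \<in> {0..t1} \<Longrightarrow> immersion (G t)" and h: "\<And>t. t \<in> {0..t1} \<Longrightarrow> smooth_on UNIV (h t)"
    and r: "\<And>t. t \<in> {0..t1} \<Longrightarrow> range (G t) = entire_graph (h t)"
  shows "continuous_on ({0..t1} \<times> UNIV) (\<lambda>(t, x). h t x)"
  unfolding continuous_on_iff
proof (intro ballI allI impI)
  fix z :: "real \<times> (real^2)" and e :: real assume z: "z \<in> {0..t1} \<times> UNIV" and e: "e > 0"
  obtain t0 x0 where z0: "z = (t0, x0)" and t0: "t0 \<in> {0..t1}" using z by (cases z) auto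
  obtain p0 where p0: "G t0 p0 = (x0, h t0 x0)" using entire_graph_rangeD(2)[OF r[OF t0]] by blast
  have "\<exists>d>0. \<forall>z'\<in>{0..t1} \<times> UNIV. dist z' (t0, p0) < d \<longrightarrow> dist (case z' of (t, p) \<Rightarrow> G t p) (case (t0, p0) of (t, p) \<Rightarrow> G t p) < e"
    using c[unfolded continuous_on_iff, rule_format, of "(t0, p0)" e] t0 e by blast
  then obtain d where d: "d > 0" and dd: "\<And>t p. t \<in> {0..t1} \<Longrightarrow> dist (t, p) (t0, p0) < d \<Longrightarrow> dist (G t p) (G t0 p0) < e"
    by force
  have dG: "(G t0 has_derivative frechet_derivative (G t0) (at p0)) (at p0)"
    using im[OF t0] smooth_on_has_derivative[OF _ UNIV_I, of "G t0" p0] by (simp add: immersion_def)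
  have ca: "continuous_on ({0..t1} \<times> UNIV) (\<lambda>(t, p). fst (G t p))"
    using continuous_on_fst[OF c] by (simp add: split_beta')
  show "\<exists>d>0. \<forall>z'\<in>{0..t1} \<times> UNIV. dist z' z < d \<longrightarrow> dist (case z' of (t, x) \<Rightarrow> h t x) (case z of (t, x) \<Rightarrow> h t x) < e"
  proof (rule local_surjection[where a="\<lambda>t p. fst (G t p)", OF compact_Icc t0 ca has_derivative_fst[OF dG]
        graph_fst_derivative_inj[OF im[OF t0] h[OF t0] r[OF t0]] half_gt_zero[OF d]])
    fix \<delta> :: real
    assume \<delta>: "\<delta> > 0" and q: "\<And>t x. t \<in> {0..t1} \<Longrightarrow> \<bar>t - t0\<bar> < \<delta> \<Longrightarrow> norm (x - fst (G t0 p0)) \<le> \<delta> \<Longrightarrow> \<exists>q\<in>cball p0 (d / 2). fst (G t q) = x"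
    have "dist (h t x) (h t0 x0) < e" if t: "t \<in> {0..t1}" and dz: "dist (t, x) (t0, x0) < min \<delta> (d / 2)" for t x
    proof -
      have 1: "\<bar>t - t0\<bar> < min \<delta> (d / 2)" using dist_fst_le[of "(t, x)" "(t0, x0)"] dz by (simp add: dist_real_def)
      have 2: "norm (x - x0) < min \<delta> (d / 2)" using dist_snd_le[of "(t, x)" "(t0, x0)"] dz by (simp add: dist_norm)
      obtain q where q: "q \<in> cball p0 (d / 2)" "fst (G t q) = x" using q[of t x] t 1 2 p0 by auto
      have "dist (t, q) (t0, p0) \<le> \<bar>t - t0\<bar> + dist q p0"
        unfolding dist_Pair_Pair dist_real_def using sqrt_sum_squares_le_sum[of "\<bar>t - t0\<bar>" "dist q p0"] by simp
      also have "\<dots> < d" using 1 q(1) by (simp add: dist_commute)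
      finally have "dist (G t q) (G t0 p0) < e" by (rule dd[OF t])
      then have "dist (snd (G t q)) (snd (G t0 p0)) < e" using dist_snd_le[of "G t q" "G t0 p0"] by linarith
      moreover have "snd (G t q) = h t x" using arg_cong[OF entire_graph_rangeD(1)[OF r[OF t], of q], of snd] q(2) by simp
      ultimately show ?thesis by (simp add: p0)
    qed
    then show ?thesis using \<delta> d unfolding z0 by (intro exI[of _ "min \<delta> (d / 2)"]) auto
  qed
qed

lemma norm_ee [simp]: "norm (ee \<theta>) = 1" by (simp add: norm_eq_sqrt_inner)

text \<open>The root grows at most linearly in |y|, and completing the square bounds |y| by
  \<epsilon> |y|^2 + 1 / (4 \<epsilon>). The quadratic barrier thus handles y by itself, and the
  radius beyond which the function is negative can be stated in x alone, uniformly in y and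
  t.\<close>

lemma barrier_coercive:
  assumes "\<And>z. z \<in> ST \<Longrightarrow> \<bar>u z\<bar> \<le> 1/2" "t \<ge> 0" "\<epsilon> > 0" "\<kappa> \<ge> 0" "norm x > 1 + (1 / (4 * \<epsilon>) + 1 / 2) / \<epsilon>"
  shows "barrier u \<kappa> \<epsilon> t (x, y) < 0"
proof -
  define w where "w = wf u t (x, y)"
  have "norm w \<le> norm y + norm (u (t, x $ 1) *\<^sub>R ee (x $ 2))" unfolding w_def wf_def fst_conv snd_conv by (rule norm_triangle_ineq4)
  also have "\<dots> \<le> norm y + 1 / 2" using assms(1)[of "(t, x $ 1)"] assms(2) by (simp add: ST_def)
  finally have nw: "norm w \<le> norm y + 1 / 2" .
  have "sqrt (1 + w \<bullet> w) \<le> 1 + norm w"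
    by (rule real_le_lsqrt) (simp_all add: dot_square_norm power2_sum)
  then have 1: "sqrt (1 + w \<bullet> w) - 1 \<le> norm y + 1 / 2" using nw by simp
  have "exp (- (\<kappa> * t)) * (sqrt (1 + w \<bullet> w) - 1) \<le> 1 * (norm y + 1 / 2)"
    using 1 assms(2,4) by (intro mult_mono) auto
  then have "exp (- (\<kappa> * t)) * (sqrt (1 + w \<bullet> w) - 1) \<le> norm y + 1 / 2" by (simp only: mult_1)
  moreover have "norm y \<le> \<epsilon> * (norm y)\<^sup>2 + 1 / (4 * \<epsilon>)"
  proof -
    have "0 \<le> (2 * \<epsilon> * norm y - 1)\<^sup>2 / (4 * \<epsilon>)" using assms(3) by simp
    also have "\<dots> = \<epsilon> * (norm y)\<^sup>2 + 1 / (4 * \<epsilon>) - norm y" using assms(3) by (simp add: field_simps power2_eq_square)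
    finally show ?thesis by simp
  qed
  moreover have "1 / (4 * \<epsilon>) + 1 / 2 < \<epsilon> * (norm x)\<^sup>2"
  proof -
    define Q where "Q = (1 / (4 * \<epsilon>) + 1 / 2) / \<epsilon>"
    have Q: "Q \<ge> 0" "norm x > 1 + Q" using assms(3,5) by (simp_all add: Q_def)
    have "Q < norm x * 1" using Q by simp
    also have "\<dots> \<le> norm x * norm x" using Q by (intro mult_left_mono) auto
    finally have "\<epsilon> * Q < \<epsilon> * (norm x)\<^sup>2" using assms(3) by (simp add: power2_eq_square)
    then show ?thesis using assms(3) by (simp add: Q_def)
  qed
  moreover have eq: "\<epsilon> * (1 + (x, y) \<bullet> (x, y) + 5 * t) = \<epsilon> + \<epsilon> * (norm x)\<^sup>2 + \<epsilon> * (norm y)\<^sup>2 + 5 * (\<epsilon> * t)"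
    unfolding inner_Pair by (simp add: dot_square_norm algebra_simps)
  moreover have "0 \<le> \<epsilon> * t" using assms by simp
  moreover have "A - (\<epsilon> + b + c + 5 * d) < 0" if "A \<le> n + 1 / 2" "n \<le> c + q" "q + 1 / 2 < b" "0 \<le> d" for A b c d n q :: real
    using that assms(3) by linarith
  ultimately show ?thesis unfolding barrier_def w_def[symmetric] eq by blast
qed

text \<open>Over base points the search for a positive maximum is confined to the compact set
  [0, t1] x \<open>cball 0 R\<close>; in the parameters of G there is no such confinement at hand.
  The maximum found there is then transported to a parameter p0, where the flow equation
  applies.\<close>

lemma barrier_nonpositive:
  fixes u :: "real \<times> real \<Rightarrow> real" and G :: "real \<Rightarrow> real^2 \<Rightarrow> (real^2) \<times> (real^2)"
  assumes u: "smooth_on ST u"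
    and pde: "\<And>t x. t \<ge> 0 \<Longrightarrow> pt u (t, x) = px (px u) (t, x) / (1 + (px u (t, x))\<^sup>2) - u (t, x) / (1 + (u (t, x))\<^sup>2)"
    and bd: "\<And>z. z \<in> ST \<Longrightarrow> \<bar>u z\<bar> \<le> 1/2" "\<And>z. z \<in> ST \<Longrightarrow> \<bar>px u z\<bar> \<le> 1/2" "\<And>z. z \<in> ST \<Longrightarrow> \<bar>px (px u) z\<bar> \<le> K"
    and G: "mean_curvature_flow {0..<T} G"
    and h: "\<And>t. t \<in> {0..<T} \<Longrightarrow> smooth_on UNIV (h t) \<and> range (G t) = entire_graph (h t)"
    and h0: "\<And>x. h 0 x = u (0, x $ 1) *\<^sub>R ee (x $ 2)"
    and t1: "t1 \<in> {0..<T}" and \<epsilon>: "\<epsilon> > 0" and \<kappa>: "\<kappa> = 384 * (K + 2)\<^sup>2"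
  shows "barrier u \<kappa> \<epsilon> t1 (x1, h t1 x1) \<le> 0"
proof (rule ccontr)
  assume "\<not> ?thesis"
  then have pos: "barrier u \<kappa> \<epsilon> t1 (x1, h t1 x1) > 0" by simp
  have \<kappa>0: "\<kappa> \<ge> 0" by (simp add: \<kappa>)
  have sub: "{0..t1} \<subseteq> {0..<T}" using t1 by auto
  define R where "R = 1 + (1 / (4 * \<epsilon>) + 1 / 2) / \<epsilon>"
  have far: "norm x > R \<Longrightarrow> t \<ge> 0 \<Longrightarrow> barrier u \<kappa> \<epsilon> t (x, h t x) < 0" for t x
    unfolding R_def by (rule barrier_coercive[OF bd(1) _ \<epsilon> \<kappa>0])
  have G1: "smooth_on ({0..<T} \<times> UNIV) (\<lambda>(t, p). G t p)" and G2: "\<And>t. t \<in> {0..<T} \<Longrightarrow> immersion (G t)"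
    and G3: "\<And>t p. t \<in> {0..<T} \<Longrightarrow> ((\<lambda>s. G s p) has_vector_derivative mean_curvature (G t) p) (at t within {0..<T})"
    using G unfolding mean_curvature_flow_def by blast+
  have "continuous_on ({0..t1} \<times> UNIV) (\<lambda>(t, x). h t x)"
  proof (rule graph_function_continuous)
    show "continuous_on ({0..t1} \<times> UNIV) (\<lambda>(t, p). G t p)"
      by (rule continuous_on_subset[OF smooth_on_imp_continuous_on[OF G1]]) (use sub in auto)
    fix t assume "t \<in> {0..t1}"
    then have t: "t \<in> {0..<T}" using sub by blast
    show "immersion (G t)" by (rule G2[OF t])
    show "smooth_on UNIV (h t)" "range (G t) = entire_graph (h t)" using h[OF t] by blast+
  qed
  then have hc: "continuous_on ({0..t1} \<times> cball 0 R) (\<lambda>z. h (fst z) (snd z))"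
    unfolding split_beta' by (rule continuous_on_subset) auto
  have uc: "continuous_on ({0..t1} \<times> cball 0 R) (\<lambda>z::real \<times> (real^2). u (fst z, snd z $ 1))"
    by (rule continuous_on_compose2[OF smooth_on_imp_continuous_on[OF u]]) (auto simp: ST_def intro!: continuous_intros)
  have ec: "continuous_on ({0..t1} \<times> cball 0 R) (\<lambda>z::real \<times> (real^2). ee (snd z $ 2))"
    unfolding ee_def v2_def by (intro continuous_intros)
  have bc: "continuous_on ({0..t1} \<times> cball 0 R) (\<lambda>z. barrier u \<kappa> \<epsilon> (fst z) (snd z, h (fst z) (snd z)))"
    unfolding barrier_def wf_def fst_conv snd_conv by (intro continuous_intros hc uc ec)
  have in1: "(t1, x1) \<in> {0..t1} \<times> cball 0 R"
    using far[of x1 t1] pos t1 by force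
  obtain z where z: "z \<in> {0..t1} \<times> cball 0 R" and zm: "\<And>y. y \<in> {0..t1} \<times> cball 0 R \<Longrightarrow>
      barrier u \<kappa> \<epsilon> (fst y) (snd y, h (fst y) (snd y)) \<le> barrier u \<kappa> \<epsilon> (fst z) (snd z, h (fst z) (snd z))"
    using continuous_attains_sup[OF compact_Times[OF compact_Icc compact_cball] _ bc] in1 by blast
  define t0 where "t0 = fst z"
  define x0 where "x0 = snd z"
  have t0: "0 \<le> t0" "t0 \<le> t1" "t0 \<in> {0..<T}" using z sub by (auto simp: t0_def)
  have M: "barrier u \<kappa> \<epsilon> t0 (x0, h t0 x0) > 0" using zm[OF in1] pos by (simp add: t0_def x0_def)
  have mx: "barrier u \<kappa> \<epsilon> t (x, h t x) \<le> barrier u \<kappa> \<epsilon> t0 (x0, h t0 x0)" if "0 \<le> t" "t \<le> t1" for t x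
  proof (cases "norm x \<le> R")
    case True
    then show ?thesis using zm[of "(t, x)"] that by (simp add: t0_def x0_def)
  next
    case False
    then show ?thesis using far[of x t] that M by simp
  qed
  \<comment> \<open>At time 0 the two graphs coincide, so the barrier reduces to its negative
    quadratic part.\<close>
  have "t0 \<noteq> 0"
  proof
    assume "t0 = 0"
    have "\<epsilon> * (1 + (x0, h 0 x0) \<bullet> (x0, h 0 x0)) \<ge> 0"
      using \<epsilon> by (intro mult_nonneg_nonneg add_nonneg_nonneg inner_ge_zero) auto
    then have "barrier u \<kappa> \<epsilon> 0 (x0, h 0 x0) \<le> 0" by (simp add: barrier_def wf_def h0)
    then show False using M \<open>t0 = 0\<close> by simp
  qed
  then have t0p: "0 < t0" "t0 < T" using t0 by auto
  obtain p0 where p0: "G t0 p0 = (x0, h t0 x0)" using entire_graph_rangeD(2) h[OF t0(3)] by blast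
  show False
  proof (rule no_positive_maximum[OF u pde bd t0p G2[OF t0(3)] G3[OF t0(3)] \<epsilon> \<kappa>])
    fix t p assume t: "0 \<le> t" "t \<le> t0"
    then have tT: "t \<in> {0..<T}" using t0p by auto
    have "barrier u \<kappa> \<epsilon> t (fst (G t p), h t (fst (G t p))) \<le> barrier u \<kappa> \<epsilon> t0 (x0, h t0 x0)"
      by (rule mx) (use t t0 in auto)
    then show "barrier u \<kappa> \<epsilon> t (G t p) \<le> barrier u \<kappa> \<epsilon> t0 (G t0 p0)"
      by (simp only: p0 entire_graph_rangeD(1)[OF conjunct2[OF h[OF tT]], symmetric])
  qed
qed

theorem helix_flow_unique:
  fixes u :: "real \<times> real \<Rightarrow> real" and G :: "real \<Rightarrow> real^2 \<Rightarrow> (real^2) \<times> (real^2)"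
  assumes u: "smooth_on ST u"
    and pde: "\<And>t x. t \<ge> 0 \<Longrightarrow> pt u (t, x) = px (px u) (t, x) / (1 + (px u (t, x))\<^sup>2) - u (t, x) / (1 + (u (t, x))\<^sup>2)"
    and bd: "\<And>z. z \<in> ST \<Longrightarrow> \<bar>u z\<bar> \<le> 1/2" "\<And>z. z \<in> ST \<Longrightarrow> \<bar>px u z\<bar> \<le> 1/2" "\<And>z. z \<in> ST \<Longrightarrow> \<bar>px (px u) z\<bar> \<le> K"
    and G: "graphical_mean_curvature_flow {0..<T} G"
    and G0: "range (G 0) = entire_graph (\<lambda>p. u (0, p $ 1) *\<^sub>R ee (p $ 2))"
    and t: "t \<in> {0..<T}"
  shows "range (G t) = entire_graph (\<lambda>p. u (t, p $ 1) *\<^sub>R ee (p $ 2))"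
proof -
  have fl: "mean_curvature_flow {0..<T} G" using G by (simp add: graphical_mean_curvature_flow_def)
  have "\<forall>t\<in>{0..<T}. \<exists>h. smooth_on UNIV h \<and> range (G t) = entire_graph h"
    using G by (simp add: graphical_mean_curvature_flow_def)
  then obtain h where h: "\<And>t. t \<in> {0..<T} \<Longrightarrow> smooth_on UNIV (h t) \<and> range (G t) = entire_graph (h t)"
    using bchoice[of "{0..<T}" "\<lambda>t h. smooth_on UNIV h \<and> range (G t) = entire_graph h"] by blast
  have h0: "h 0 x = u (0, x $ 1) *\<^sub>R ee (x $ 2)" for x
  proof -
    have "0 \<in> {0..<T}" using t by auto
    then have "entire_graph (h 0) = entire_graph (\<lambda>p. u (0, p $ 1) *\<^sub>R ee (p $ 2))" using h G0 by metis
    moreover have "(x, h 0 x) \<in> entire_graph (h 0)" unfolding entire_graph_def by blast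
    ultimately show ?thesis unfolding entire_graph_def by blast
  qed
  have "wf u t (x, h t x) = 0" for x
  proof (rule ccontr)
    assume "wf u t (x, h t x) \<noteq> 0"
    define w where "w = wf u t (x, h t x)"
    define C where "C = 1 + (x, h t x) \<bullet> (x, h t x) + 5 * t"
    define A where "A = exp (- (384 * (K + 2)\<^sup>2 * t)) * (sqrt (1 + w \<bullet> w) - 1)"
    have "w \<bullet> w > 0" using \<open>wf u t (x, h t x) \<noteq> 0\<close> by (simp add: w_def)
    then have A: "A > 0" by (simp add: A_def)
    have C: "C > 0" unfolding C_def by (intro add_pos_nonneg inner_ge_zero) (use t in auto)
    \<comment> \<open>The value A / (2 C) of \<epsilon> leaves half of the first term: the barrier
      would be A / 2 > 0. This takes the place of letting \<epsilon> tend to 0.\<close>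
    have "barrier u (384 * (K + 2)\<^sup>2) (A / (2 * C)) t (x, h t x) \<le> 0"
      by (rule barrier_nonpositive[OF u pde bd fl h h0 t _ refl]) (use A C in auto)
    moreover have "barrier u (384 * (K + 2)\<^sup>2) (A / (2 * C)) t (x, h t x) = A - A / (2 * C) * C"
      unfolding barrier_def A_def C_def w_def ..
    ultimately show False using A C by simp
  qed
  then have "h t = (\<lambda>p. u (t, p $ 1) *\<^sub>R ee (p $ 2))" by (simp add: wf_def fun_eq_iff)
  then show ?thesis using h[OF t] by simp
qed

section \<open>Existence of the flow\<close>

lemma smooth_on_slice:
  fixes f :: "real \<times> real \<Rightarrow> real"
  assumes "smooth_on ST f" "t \<ge> 0" "smooth_on UNIV X"
  shows "smooth_on UNIV (\<lambda>s::real. f (t, X s))"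
  by (rule smooth_on_compose2[OF approachable_UNIV assms(1)[unfolded ST_def] smooth_on_const[OF approachable_UNIV] assms(3)])
    (use assms(2) in simp)

lemma deriv_slice:
  assumes "smooth_on ST f" "t \<ge> 0" shows "deriv (\<lambda>x. f (t, x)) = (\<lambda>x. px f (t, x))"
  by (rule ext) (rule DERIV_imp_deriv[OF px_derivative[OF assms]])

lemma smooth_helix_graph:
  assumes "smooth_on UNIV U" shows "smooth_on UNIV (\<lambda>p::real^2. U (p $ 1) *\<^sub>R ee (p $ 2))"
  by (intro smooth_on_scaleR smooth_on_ee smooth_on_nth smooth_on_comp_nth[OF assms] approachable_UNIV)

text \<open>The graph of the solution moves with vertical velocity \<open>u\<^sub>t\<close>; the reparametrization \<open>\<Phi>\<close> removes the
  tangential part.\<close>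

context
  fixes u \<Phi> :: "real \<times> real \<Rightarrow> real"
  assumes u: "smooth_on ST u"
    and pde: "\<And>t x. t \<ge> 0 \<Longrightarrow> pt u (t, x) = px (px u) (t, x) / (1 + (px u (t, x))\<^sup>2) - u (t, x) / (1 + (u (t, x))\<^sup>2)"
    and \<Phi>: "smooth_on ST \<Phi>" and \<Phi>_t: "\<And>t s. t \<ge> 0 \<Longrightarrow> pt \<Phi> (t, s) =
      - (pt u (t, \<Phi> (t, s)) * px u (t, \<Phi> (t, s)) / (1 + (px u (t, \<Phi> (t, s)))\<^sup>2))"
    and \<Phi>_s: "\<And>t s. t \<ge> 0 \<Longrightarrow> px \<Phi> (t, s) > 0" and \<Phi>_surj: "\<And>t. t \<ge> 0 \<Longrightarrow> surj (\<lambda>s. \<Phi> (t, s))"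
begin

definition helix_flow :: "real \<Rightarrow> real^2 \<Rightarrow> (real^2) \<times> (real^2)" where
  "helix_flow t = helix (\<lambda>s. \<Phi> (t, s)) (\<lambda>s. u (t, \<Phi> (t, s)))"

lemma helix_flow_smooth: "smooth_on ({0..} \<times> UNIV) (\<lambda>(t, p). helix_flow t p)"
proof -
  have S: "approachable ({0::real..} \<times> (UNIV :: (real^2) set))" by (intro approachable_Times_UNIV) simp
  have t: "smooth_on ({0..} \<times> UNIV) (\<lambda>z::real \<times> (real^2). fst z)"
    by (rule smooth_on_bounded_linear[OF S bounded_linear_fst])
  have p: "smooth_on ({0..} \<times> UNIV) (\<lambda>z::real \<times> (real^2). snd z $ i)" for i
    by (rule smooth_on_bounded_linear[OF S bounded_linear_compose[OF bounded_linear_vec_nth bounded_linear_snd]])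
  have X: "smooth_on ({0..} \<times> UNIV) (\<lambda>z::real \<times> (real^2). \<Phi> (fst z, snd z $ 1))"
    by (rule smooth_on_compose2[OF S \<Phi>[unfolded ST_def] t p]) auto
  have U: "smooth_on ({0..} \<times> UNIV) (\<lambda>z::real \<times> (real^2). u (fst z, \<Phi> (fst z, snd z $ 1)))"
    by (rule smooth_on_compose2[OF S u[unfolded ST_def] t X]) auto
  have c: "smooth_on ({0..} \<times> UNIV) (\<lambda>z::real \<times> (real^2). cos (snd z $ 2))"
    and s: "smooth_on ({0..} \<times> UNIV) (\<lambda>z::real \<times> (real^2). sin (snd z $ 2))"
    by (rule smooth_on_compose[OF S smooth_on_cos p], rule smooth_on_compose[OF S smooth_on_sin p])
  show ?thesis
    unfolding helix_flow_def helix_def split_beta' ee_def v2_def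
    by (intro smooth_on_Pair smooth_on_add smooth_on_scaleR smooth_on_const X U p c s S)
qed

context
  fixes t :: real assumes t: "t \<ge> 0"
begin

lemma X_smooth: "smooth_on UNIV (\<lambda>s. \<Phi> (t, s))" and U_smooth: "smooth_on UNIV (\<lambda>s. u (t, \<Phi> (t, s)))"
  using smooth_on_slice[OF \<Phi> t smooth_on_ident[OF approachable_UNIV]] smooth_on_slice[OF u t] by blast+

lemma X_deriv: "deriv (\<lambda>s. \<Phi> (t, s)) = (\<lambda>s. px \<Phi> (t, s))"
  by (rule deriv_slice[OF \<Phi> t])

lemma X_deriv_nonzero: "deriv (\<lambda>s. \<Phi> (t, s)) x \<noteq> 0"
  using \<Phi>_s[OF t, of x] by (simp add: X_deriv)

lemma U_deriv: "deriv (\<lambda>s. u (t, \<Phi> (t, s))) = (\<lambda>s. px u (t, \<Phi> (t, s)) * px \<Phi> (t, s))"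
  by (rule ext) (rule DERIV_imp_deriv[OF DERIV_chain2[OF px_derivative[OF u t] px_derivative[OF \<Phi> t]]])

lemma U_deriv2: "deriv (deriv (\<lambda>s. u (t, \<Phi> (t, s)))) s =
  px (px u) (t, \<Phi> (t, s)) * (px \<Phi> (t, s))\<^sup>2 + px u (t, \<Phi> (t, s)) * px (px \<Phi>) (t, s)"
proof -
  have "((\<lambda>s. px u (t, \<Phi> (t, s)) * px \<Phi> (t, s)) has_real_derivative
      px (px u) (t, \<Phi> (t, s)) * px \<Phi> (t, s) * px \<Phi> (t, s) + px (px \<Phi>) (t, s) * px u (t, \<Phi> (t, s))) (at s)"
    by (rule DERIV_mult[OF DERIV_chain2[OF px_derivative[OF smooth_on_px[OF u] t] px_derivative[OF \<Phi> t]]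
        px_derivative[OF smooth_on_px[OF \<Phi>] t]])
  from DERIV_imp_deriv[OF this] show ?thesis unfolding U_deriv by (simp add: power2_eq_square)
qed

lemma helix_flow_immersion: "immersion (helix_flow t)"
  unfolding helix_flow_def by (rule helix_immersion[OF X_smooth U_smooth X_deriv_nonzero])

text \<open>The vertical velocity \<tau> (0, ee) splits into its normal part \<tau> / (1 + a^2) (-
  a, ee), which is the mean curvature, and the tangential part \<tau> a / (1 + a^2) (1, a ee). The
  equation for \<Phi> moves the base point with the horizontal part of the former.\<close>

lemma helix_flow_mean_curvature:
  "((\<lambda>s. helix_flow s p) has_vector_derivative mean_curvature (helix_flow t) p) (at t within {0..})"
proof -
  define x where "x = \<Phi> (t, p $ 1)"
  define a where "a = px u (t, x)"
  define \<tau> where "\<tau> = pt u (t, x)"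
  have mc: "mean_curvature (helix_flow t) p = (\<tau> / (1 + a\<^sup>2)) *\<^sub>R (v2 (- a) 0, ee (p $ 2))"
  proof -
    have "mean_curvature (helix_flow t) p =
      ((px (px u) (t, x) / (1 + a\<^sup>2) - u (t, \<Phi> (t, p $ 1)) / (1 + (u (t, \<Phi> (t, p $ 1)))\<^sup>2)) / (1 + a\<^sup>2)) *\<^sub>R (v2 (- a) 0, ee (p $ 2))"
      unfolding helix_flow_def
    proof (rule helix_mean_curvature[OF X_smooth U_smooth X_deriv_nonzero])
      show "deriv (\<lambda>s. \<Phi> (t, s)) (p $ 1) > 0" using \<Phi>_s[OF t] by (simp add: X_deriv)
      show "deriv (\<lambda>s. u (t, \<Phi> (t, s))) (p $ 1) = a * deriv (\<lambda>s. \<Phi> (t, s)) (p $ 1)"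
        by (simp add: X_deriv U_deriv a_def x_def)
      show "deriv (deriv (\<lambda>s. u (t, \<Phi> (t, s)))) (p $ 1) =
          px (px u) (t, x) * (deriv (\<lambda>s. \<Phi> (t, s)) (p $ 1))\<^sup>2 + a * deriv (deriv (\<lambda>s. \<Phi> (t, s))) (p $ 1)"
        unfolding U_deriv2 X_deriv deriv_slice[OF smooth_on_px[OF \<Phi>] t] by (simp add: a_def x_def)
    qed
    then show ?thesis by (simp add: \<tau>_def pde[OF t] a_def x_def)
  qed
  have A: "1 + a\<^sup>2 > 0" by (simp add: add_pos_nonneg)
  have dx: "((\<lambda>t. \<Phi> (t, p $ 1)) has_real_derivative - (\<tau> * a / (1 + a\<^sup>2))) (at t within {0..})"
    using pt_derivative[OF \<Phi> t, of "p $ 1"] by (simp add: \<Phi>_t[OF t] \<tau>_def a_def x_def)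
  have du: "((\<lambda>t. u (t, \<Phi> (t, p $ 1))) has_real_derivative \<tau> / (1 + a\<^sup>2)) (at t within {0..})"
  proof (rule DERIV_cong)
    show "((\<lambda>t. u (t, \<Phi> (t, p $ 1))) has_real_derivative 1 * pt u (t, \<Phi> (t, p $ 1)) + - (\<tau> * a / (1 + a\<^sup>2)) * px u (t, \<Phi> (t, p $ 1))) (at t within {0..})"
      by (rule along_curve[OF u DERIV_ident _ dx]) (use t in auto)
    show "1 * pt u (t, \<Phi> (t, p $ 1)) + - (\<tau> * a / (1 + a\<^sup>2)) * px u (t, \<Phi> (t, p $ 1)) = \<tau> / (1 + a\<^sup>2)"
      unfolding x_def[symmetric] a_def[symmetric] \<tau>_def[symmetric] using A by (simp add: field_simps power2_eq_square)
  qed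
  have "((\<lambda>s. (\<Phi> (s, p $ 1) *\<^sub>R axis 1 1 + p $ 2 *\<^sub>R axis 2 1 :: real^2, u (s, \<Phi> (s, p $ 1)) *\<^sub>R ee (p $ 2))) has_vector_derivative
      ((\<Phi> (t, p $ 1) *\<^sub>R 0 + - (\<tau> * a / (1 + a\<^sup>2)) *\<^sub>R axis 1 1) + 0,
        u (t, \<Phi> (t, p $ 1)) *\<^sub>R 0 + (\<tau> / (1 + a\<^sup>2)) *\<^sub>R ee (p $ 2))) (at t within {0..})"
    by (rule has_vector_derivative_Pair[OF has_vector_derivative_add[OF has_vector_derivative_scaleR[OF dx has_vector_derivative_const]
        has_vector_derivative_const] has_vector_derivative_scaleR[OF du has_vector_derivative_const]])
  then show ?thesis
    unfolding mc unfolding helix_flow_def helix_def by (simp add: v2_def)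
qed

lemma helix_flow_range: "range (helix_flow t) = entire_graph (\<lambda>p. u (t, p $ 1) *\<^sub>R ee (p $ 2))"
proof (rule set_eqI, rule iffI)
  fix z assume "z \<in> range (helix_flow t)"
  then obtain p where z: "z = helix_flow t p" by blast
  have "z = (v2 (\<Phi> (t, p $ 1)) (p $ 2), u (t, v2 (\<Phi> (t, p $ 1)) (p $ 2) $ 1) *\<^sub>R ee (v2 (\<Phi> (t, p $ 1)) (p $ 2) $ 2))"
    by (simp add: z helix_flow_def helix_def)
  then show "z \<in> entire_graph (\<lambda>p. u (t, p $ 1) *\<^sub>R ee (p $ 2))" unfolding entire_graph_def by blast
next
  fix z assume "z \<in> entire_graph (\<lambda>p. u (t, p $ 1) *\<^sub>R ee (p $ 2))"
  then obtain q where z: "z = (q, u (t, q $ 1) *\<^sub>R ee (q $ 2))" unfolding entire_graph_def by blast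
  obtain s where s: "q $ 1 = \<Phi> (t, s)" using surjD[OF \<Phi>_surj[OF t]] by blast
  have "helix_flow t (v2 s (q $ 2)) = (v2 (q $ 1) (q $ 2), u (t, q $ 1) *\<^sub>R ee (q $ 2))"
    by (simp add: helix_flow_def helix_def s)
  then have "z = helix_flow t (v2 s (q $ 2))" by (simp add: z v2_eta)
  then show "z \<in> range (helix_flow t)" by (rule range_eqI)
qed

end

lemma helix_flow_graphical: "graphical_mean_curvature_flow {0..} helix_flow"
  unfolding graphical_mean_curvature_flow_def mean_curvature_flow_def
proof (intro conjI ballI allI helix_flow_smooth)
  fix t :: real assume "t \<in> {0..}"
  then have t: "t \<ge> 0" by simp
  show "immersion (helix_flow t)" by (rule helix_flow_immersion[OF t])
  show "((\<lambda>s. helix_flow s p) has_vector_derivative mean_curvature (helix_flow t) p) (at t within {0..})" for p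
    by (rule helix_flow_mean_curvature[OF t])
  show "\<exists>h. smooth_on UNIV h \<and> range (helix_flow t) = entire_graph h"
    using smooth_helix_graph[OF smooth_on_slice[OF u t smooth_on_ident[OF approachable_UNIV]]] helix_flow_range[OF t] by blast
qed

end

lemma helix_flow_exists:
  assumes u: "smooth_on ST u"
    and pde: "\<And>t x. t \<ge> 0 \<Longrightarrow> pt u (t, x) = px (px u) (t, x) / (1 + (px u (t, x))\<^sup>2) - u (t, x) / (1 + (u (t, x))\<^sup>2)"
    and ux: "\<And>z. z \<in> ST \<Longrightarrow> \<bar>px u z\<bar> \<le> 1/2" and ut: "\<And>z. z \<in> ST \<Longrightarrow> \<bar>pt u z\<bar> \<le> K"
    and uxx: "\<And>z. z \<in> ST \<Longrightarrow> \<bar>px (px u) z\<bar> \<le> K" and utx: "\<And>z. z \<in> ST \<Longrightarrow> \<bar>px (pt u) z\<bar> \<le> K"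
  shows "\<exists>F. graphical_mean_curvature_flow {0..} F \<and> (\<forall>t\<ge>0. range (F t) = entire_graph (\<lambda>p. u (t, p $ 1) *\<^sub>R ee (p $ 2)))"
proof -
  \<comment> \<open>The horizontal velocity of a point moving normally. The bounds on u_x, u_t, u_xx
    and u_tx bound V and its space derivative, which makes its flow exist for all time.\<close>
  define V where "V z = - (pt u z * px u z / (1 + (px u z)\<^sup>2))" for z
  have pos: "1 + (px u z)\<^sup>2 > 0" for z by (simp add: add_pos_nonneg)
  have sV: "smooth_on ST V"
    unfolding V_def[abs_def]
    by (intro smooth_on_uminus smooth_on_divide smooth_on_mult smooth_on_add_real smooth_on_power smooth_on_const
        smooth_on_px smooth_on_pt u approachable_ST) (rule less_imp_neq[OF pos, symmetric])
  have K: "K \<ge> 0" using ut[of "(0, 0)"] by (simp add: ST_def)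
  have frac: "\<bar>y / (1 + (px u z)\<^sup>2)\<bar> \<le> \<bar>y\<bar>" for y z
  proof -
    have "\<bar>y\<bar> / (1 + (px u z)\<^sup>2) \<le> \<bar>y\<bar> / 1" by (rule divide_left_mono) (use pos[of z] in simp_all)
    then show ?thesis using pos[of z] by simp
  qed
  have m: "\<bar>x * y\<bar> \<le> A * B" if "\<bar>x\<bar> \<le> A" "\<bar>y\<bar> \<le> B" for x y A B :: real
    unfolding abs_mult by (rule mult_mono) (use that in auto)
  have V1: "\<bar>V z\<bar> \<le> K + 2 * K\<^sup>2" if "z \<in> ST" for z
  proof -
    have "\<bar>V z\<bar> \<le> \<bar>pt u z * px u z\<bar>" unfolding V_def abs_minus_cancel by (rule frac)
    also have "\<dots> \<le> K * (1/2)" by (rule m[OF ut[OF that] ux[OF that]])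
    finally show ?thesis using K zero_le_power2[of K] by linarith
  qed
  have V2: "\<bar>px V z\<bar> \<le> K + 2 * K\<^sup>2" if z: "z \<in> ST" for z
  proof -
    obtain t x where tx: "z = (t, x)" and t: "t \<ge> 0" using z by (auto simp: ST_def)
    define \<tau> \<tau>' a b where "\<tau> = pt u z" and "\<tau>' = px (pt u) z" and "a = px u z" and "b = px (px u) z"
    have a: "\<bar>a\<bar> \<le> 1/2" and \<tau>: "\<bar>\<tau>\<bar> \<le> K" and \<tau>': "\<bar>\<tau>'\<bar> \<le> K" and b: "\<bar>b\<bar> \<le> K"
      using ux[OF z] ut[OF z] utx[OF z] uxx[OF z] by (simp_all add: a_def b_def \<tau>_def \<tau>'_def)
    have pa: "1 + a\<^sup>2 > 0" using pos by (simp add: a_def)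
    have da: "((\<lambda>x. px u (t, x)) has_real_derivative b) (at x)"
      and d\<tau>: "((\<lambda>x. pt u (t, x)) has_real_derivative \<tau>') (at x)"
      using px_derivative[OF smooth_on_px[OF u] t, of x] px_derivative[OF smooth_on_pt[OF u] t, of x]
      by (simp_all add: b_def \<tau>'_def tx)
    have dd: "((\<lambda>x. 1 + (px u (t, x))\<^sup>2) has_real_derivative 2 * (a * b)) (at x)"
      using da by (auto intro!: derivative_eq_intros simp: a_def tx)
    have "((\<lambda>x. - (pt u (t, x) * px u (t, x) / (1 + (px u (t, x))\<^sup>2))) has_real_derivative
        - (((\<tau>' * px u (t, x) + b * pt u (t, x)) * (1 + (px u (t, x))\<^sup>2) - pt u (t, x) * px u (t, x) * (2 * (a * b))) /
          ((1 + (px u (t, x))\<^sup>2) * (1 + (px u (t, x))\<^sup>2)))) (at x)"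
      by (rule DERIV_minus[OF DERIV_divide[OF DERIV_mult[OF d\<tau> da] dd]]) (use pos[of "(t, x)"] in simp)
    then have "px V (t, x) = - (((\<tau>' * a + b * \<tau>) * (1 + a\<^sup>2) - \<tau> * a * (2 * (a * b))) / ((1 + a\<^sup>2) * (1 + a\<^sup>2)))"
      using px_eqI[OF sV t] by (simp add: V_def a_def \<tau>_def tx)
    also have "\<dots> = (\<tau> * a * (2 * (a * b)) / (1 + a\<^sup>2)) / (1 + a\<^sup>2) - (\<tau>' * a + b * \<tau>) / (1 + a\<^sup>2)"
      using pa by (simp add: diff_divide_distrib)
    finally have e: "px V z = (\<tau> * a * (2 * (a * b)) / (1 + a\<^sup>2)) / (1 + a\<^sup>2) - (\<tau>' * a + b * \<tau>) / (1 + a\<^sup>2)"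
      by (simp only: tx)
    have fr: "\<bar>y / (1 + a\<^sup>2)\<bar> \<le> \<bar>y\<bar>" for y using frac[of y z] by (simp add: a_def)
    have "\<bar>\<tau> * a * (2 * (a * b))\<bar> \<le> K * (1/2) * (2 * (1/2 * K))"
      by (intro m \<tau> a b) simp
    then have 1: "\<bar>(\<tau> * a * (2 * (a * b)) / (1 + a\<^sup>2)) / (1 + a\<^sup>2)\<bar> \<le> K\<^sup>2"
      using fr[of "\<tau> * a * (2 * (a * b)) / (1 + a\<^sup>2)"] fr[of "\<tau> * a * (2 * (a * b))"] zero_le_power2[of K]
      by (simp add: power2_eq_square)
    have "\<bar>\<tau>' * a\<bar> \<le> K * (1/2)" "\<bar>b * \<tau>\<bar> \<le> K * K" by (intro m \<tau> \<tau>' a b)+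
    then have 2: "\<bar>(\<tau>' * a + b * \<tau>) / (1 + a\<^sup>2)\<bar> \<le> K + K\<^sup>2"
      using fr[of "\<tau>' * a + b * \<tau>"] abs_triangle_ineq[of "\<tau>' * a" "b * \<tau>"] K by (simp add: power2_eq_square)
    have "\<bar>p - q\<bar> \<le> K + 2 * K\<^sup>2" if "\<bar>p\<bar> \<le> K\<^sup>2" "\<bar>q\<bar> \<le> K + K\<^sup>2" for p q using that by linarith
    from this[OF 1 2] show ?thesis unfolding e .
  qed
  show ?thesis
  proof (rule flow_exists[OF sV V1 V2])
    fix \<Phi> assume \<Phi>: "smooth_on ST \<Phi>" "\<And>t s. t \<ge> 0 \<Longrightarrow> pt \<Phi> (t, s) = V (t, \<Phi> (t, s))"
      "\<And>t s. t \<ge> 0 \<Longrightarrow> px \<Phi> (t, s) > 0" "\<And>t. t \<ge> 0 \<Longrightarrow> surj (\<lambda>s. \<Phi> (t, s))"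
    have "graphical_mean_curvature_flow {0..} (helix_flow u \<Phi>)"
      by (rule helix_flow_graphical[OF u pde \<Phi>(1) \<Phi>(2)[unfolded V_def] \<Phi>(3,4)])
    moreover have "range (helix_flow u \<Phi> t) = entire_graph (\<lambda>p. u (t, p $ 1) *\<^sub>R ee (p $ 2))" if "t \<ge> 0" for t
      by (rule helix_flow_range[OF u pde \<Phi>(1) \<Phi>(2)[unfolded V_def] \<Phi>(3,4) that])
    ultimately show ?thesis by blast
  qed
qed

theorem theorem1p2:
  shows "\<exists>f :: real^2 \<Rightarrow> real^2.
    smooth_on UNIV f \<and>
    flat_normal_bundle (graph_immersion f) \<and>
    bounded_slope f \<and>
    bounded_geometry (graph_immersion f) \<and>
    uniformly_area_decreasing f \<and>
    (\<exists>F :: real \<Rightarrow> real^2 \<Rightarrow> (real^2) \<times> (real^2). \<exists>g :: real \<Rightarrow> real^2 \<Rightarrow> real^2.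
      graphical_mean_curvature_flow {0..} F \<and>
      range (F 0) = entire_graph f \<and>
      (\<forall>T>0. \<forall>G :: real \<Rightarrow> real^2 \<Rightarrow> (real^2) \<times> (real^2).
         graphical_mean_curvature_flow {0..<T} G \<and> range (G 0) = entire_graph f \<longrightarrow>
         (\<forall>t\<in>{0..<T}. range (G t) = range (F t))) \<and>
      (\<forall>t\<ge>0. smooth_on UNIV (g t) \<and> range (F t) = entire_graph (g t) \<and>
         bounded_slope (g t) \<and>
         bounded_geometry (graph_immersion (g t)) \<and>
         uniformly_area_decreasing (g t)) \<and>
      (\<exists>\<delta>>0. \<forall>t. 0 < t \<and> t < \<delta> \<longrightarrow> \<not> flat_normal_bundle (graph_immersion (g t))))"
proof (rule helix_pde)
  fix u :: "real \<times> real \<Rightarrow> real" and L K :: real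
  assume L: "L > 0" and u: "smooth_on ST u"
    and pde: "\<And>t x. t \<ge> 0 \<Longrightarrow> pt u (t, x) = px (px u) (t, x) / (1 + (px u (t, x))\<^sup>2) - u (t, x) / (1 + (u (t, x))\<^sup>2)"
    and periodic: "\<And>t x. t \<ge> 0 \<Longrightarrow> u (t, x + L) = u (t, x)"
    and u0: "\<And>z. z \<in> ST \<Longrightarrow> \<bar>u z\<bar> \<le> 1/2" and ux: "\<And>z. z \<in> ST \<Longrightarrow> \<bar>px u z\<bar> \<le> 1/2"
    and ut: "\<And>z. z \<in> ST \<Longrightarrow> \<bar>pt u z\<bar> \<le> K" and uxx: "\<And>z. z \<in> ST \<Longrightarrow> \<bar>px (px u) z\<bar> \<le> K"
    and utx: "\<And>z. z \<in> ST \<Longrightarrow> \<bar>px (pt u) z\<bar> \<le> K"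
    and W0: "\<And>x y. Wf u (0, x) = Wf u (0, y)"
    and Wt: "\<exists>\<delta>>0. \<forall>t. 0 < t \<and> t < \<delta> \<longrightarrow> (\<exists>x y. Wf u (t, x) \<noteq> Wf u (t, y))"
  define g :: "real \<Rightarrow> real^2 \<Rightarrow> real^2" where "g t p = u (t, p $ 1) *\<^sub>R ee (p $ 2)" for t p
  have g: "g t = (\<lambda>p. u (t, p $ 1) *\<^sub>R ee (p $ 2))" for t by (rule ext) (simp add: g_def)
  have sl: "smooth_on UNIV (\<lambda>x. u (t, x))" if "t \<ge> 0" for t
    by (rule smooth_on_slice[OF u that smooth_on_ident[OF approachable_UNIV]])
  have ST: "(t, x) \<in> ST" if "t \<ge> 0" for t x using that by (simp add: ST_def)
  have WW: "W (\<lambda>x. u (t, x)) x = Wf u (t, x)" if "t \<ge> 0" for t x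
    by (simp add: W_def[OF sl[OF that]] Wf_def deriv_slice[OF u that])
  have gi: "graph_immersion (g t) = helix (\<lambda>x. x) (\<lambda>x. u (t, x))" for t
    unfolding g by (rule graph_helix)
  have props: "smooth_on UNIV (g t)" "bounded_slope (g t)" "bounded_geometry (graph_immersion (g t))" "uniformly_area_decreasing (g t)"
    if t: "t \<ge> 0" for t
  proof -
    show "smooth_on UNIV (g t)" unfolding g by (rule smooth_helix_graph[OF sl[OF t]])
    have "\<bar>u (t, x)\<bar> \<le> 1/2" "\<bar>deriv (\<lambda>x. u (t, x)) x\<bar> \<le> 1/2" for x
      using u0[OF ST[OF t]] ux[OF ST[OF t]] by (simp_all add: deriv_slice[OF u t])
    note s = helix_slope[OF sl[OF t] this]
    show "bounded_slope (g t)" "uniformly_area_decreasing (g t)" unfolding g by (rule s)+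
    show "bounded_geometry (graph_immersion (g t))"
      unfolding gi by (rule helix_bounded_geometry[OF sl[OF t] L periodic[OF t]])
  qed
  obtain F where F: "graphical_mean_curvature_flow {0..} F" "\<And>t. t \<ge> 0 \<Longrightarrow> range (F t) = entire_graph (g t)"
    using helix_flow_exists[OF u pde ux ut uxx utx] unfolding g by blast
  have flat: "flat_normal_bundle (graph_immersion (g 0))"
    unfolding gi
  proof (rule flat_if_W_constant[OF sl])
    show "W (\<lambda>x. u (0, x)) x = W (\<lambda>x. u (0, x)) y" for x y by (simp only: WW[OF order_refl] W0[of x y])
  qed simp
  \<comment> \<open>Surfaces are compared as sets: a competing flow may be parametrized differently,
    since precomposing with a fixed diffeomorphism of the parameter plane does not change the
    images.\<close>
  have unique: "range (G t) = range (F t)"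
    if "graphical_mean_curvature_flow {0..<T} G" "range (G 0) = entire_graph (g 0)" "t \<in> {0..<T}" for T G t
    using helix_flow_unique[OF u pde u0 ux uxx that(1) that(2)[unfolded g] that(3)] F(2)[of t] that(3) by (simp add: g)
  obtain \<delta> where \<delta>: "\<delta> > 0" "\<And>t. 0 < t \<Longrightarrow> t < \<delta> \<Longrightarrow> \<exists>x y. Wf u (t, x) \<noteq> Wf u (t, y)" using Wt by blast
  have "\<not> flat_normal_bundle (graph_immersion (g t))" if t: "0 < t" "t < \<delta>" for t
  proof
    assume "flat_normal_bundle (graph_immersion (g t))"
    then have "W (\<lambda>x. u (t, x)) x = W (\<lambda>x. u (t, x)) y" for x y
      unfolding gi by (rule W_constant_if_flat[OF sl[OF less_imp_le[OF t(1)]]])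
    then show False using \<delta>(2)[OF t] by (simp add: WW[OF less_imp_le[OF t(1)]])
  qed
  then have nonflat: "\<exists>\<delta>>0. \<forall>t. 0 < t \<and> t < \<delta> \<longrightarrow> \<not> flat_normal_bundle (graph_immersion (g t))"
    using \<delta>(1) by blast
  show ?thesis
    by (rule exI[of _ "g 0"], intro conjI props flat order_refl, rule exI[of _ F], rule exI[of _ g])
      (intro conjI F nonflat allI impI ballI order_refl props; use unique F(2) in blast)
qed

end
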